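(* For $n\in\mathbb{Z}$, let $\mathfrak{g}_n=\mathrm{Lie}(\mathrm{Aut}(S^2\hat{\mathbb{C}}(n)))$ be the Lie superalgebra of infinitesimal automorphisms of $S^2\hat{\mathbb{C}}(n)$. Then each $\mathfrak{g}_n$ is a subalgebra of the N=2 Neveu-Schwarz algebra, and these subalgebras are given as follows: $$\mathfrak{g}_0=\mathrm{span}_{\mathbb{C}}\{L_{-1},L_0,L_1,J_0,G^+_{-1/2},G^+_{1/2},G^-_{-1/2},G^-_{1/2}\},$$ $$\mathfrak{g}_1=\mathrm{span}_{\mathbb{C}}\{L_{-1},L_0-\tfrac12J_0,L_1-J_1,J_0,G^+_{-1/2},G^-_{-1/2},G^-_{1/2},G^-_{3/2}\},$$ $$\mathfrak{g}_{-1}=\mathrm{span}_{\mathbb{C}}\{L_{-1},L_0+\tfrac12J_0,L_1+J_1,J_0,G^+_{-1/2},G^+_{1/2},G^+_{3/2},G^-_{-1/2}\},$$ for $n\ge2$, $$\mathfrak{g}_n=\mathrm{span}_{\mathbb{C}}\{L_{-1},L_0-\tfrac n2J_0,L_1-nJ_1,J_0,G^-_{-1/2},G^-_{1/2},\dots,G^-_{n-1/2},G^-_{n+1/2}\},$$ and for $n\le-2$, $$\mathfrak{g}_n=\mathrm{span}_{\mathbb{C}}\{L_{-1},L_0-\tfrac n2J_0,L_1-nJ_1,J_0,G^+_{-1/2},G^+_{1/2},\dots,G^+_{-n-1/2},G^+_{-n+1/2}\}.$$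
   Context: Grassmann algebras. $\bigwedge_L$ is the exterior algebra over $\mathbb{C}$ on generators $\zeta_1,\dots,\zeta_L$; $\bigwedge_\infty$ is the direct limit of the $\bigwedge_L\subset\bigwedge_{L+1}$. Each is $\mathbb{Z}_2$-graded, $\bigwedge_*=\bigwedge_*^0\oplus\bigwedge_*^1$. Fix $\bigwedge_{*>1}$, either $\bigwedge_L$ with $L\ge2$ or $\bigwedge_\infty$; then $\bigwedge_{*-2}$ denotes $\bigwedge_{L-2}$ or $\bigwedge_\infty$. Each $a=a_B+a_S$ has body $a_B\in\mathbb{C}$ and nilpotent soul $a_S$, and is invertible iff $a_B\ne0$. N=2 superconformal functions. For $f$ complex analytic near $z_B$ put $f(z)=\sum_{l\ge0}\frac{z_S^l}{l!}f^{(l)}(z_B)$, $z\in\bigwedge^0_{*>1}$. A superanalytic $(1,2)$-superfunction in an even variable $z$ and odd variables $\theta^\pm$ is $f_0(z)+\theta^+f_1(z)+\theta^-f_2(z)+\theta^+\theta^-f_3(z)$, each $f_i$ being a combination of such analytic functions with $\zeta$-monomial coefficients in $\bigwedge_{*-2}$, on a domain which is the preimage of an open subset of $\mathbb{C}$ under $(z,\theta^+,\theta^-)\mapsto z_B$ (DeWitt open). With $D^\pm=\frac{\partial}{\partial\theta^\pm}+\theta^\mp\frac{\partial}{\partial z}$, a superanalytic map $(z,\theta^+,\theta^-)\mapsto(\tilde z,\tilde\theta^+,\tilde\theta^-)$ (first component even, others odd) is N=2 superconformal if $D^\pm\tilde\theta^\mp=0$, $D^\pm\tilde z-\tilde\theta^\mp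 D^\pm\tilde\theta^\pm=0$ and $D^\pm\tilde\theta^\pm\not\equiv0$. Spheres. For $n\in\mathbb{Z}$, $S^2\hat{\mathbb{C}}(n)$ is the N=2 superconformal super-Riemann surface (a space with charts to DeWitt open subsets of $\bigwedge^0_{*>1}\oplus(\bigwedge^1_{*>1})^2$ and N=2 superconformal transition functions) covered by two charts $(U_{\Delta_n},\Delta_n)$, $(U_{\Upsilon_n},\Upsilon_n)$, each a homeomorphism onto $\bigwedge^0_{*>1}\oplus(\bigwedge^1_{*>1})^2$, with transition function $\Delta_n\circ\Upsilon_n^{-1}(z,\theta^+,\theta^-)=\left(\frac1z,\frac{i\theta^+z^n}{z},\frac{i\theta^-z^{-n}}{z}\right)$ on $(\bigwedge^0_{*>1})^\times\oplus(\bigwedge^1_{*>1})^2$. $\mathrm{Aut}(S^2\hat{\mathbb{C}}(n))$ is its group of N=2 superconformal automorphisms (automorphisms that are N=2 superconformal in all charts); this is a Lie supergroup over $\bigwedge_{*-2}$. The N=2 Neveu-Schwarz algebra is the complex Lie superalgebra with basis the central element $d$, even elements $L_m,J_m$ and odd elements $G^\pm_{m+1/2}$ ($m\in\mathbb{Z}$), and relations, for $m,k\in\mathbb{Z}$, $[L_m,L_k]=(m-k)L_{m+k}+\frac1{12}(m^3-m)\delta_{m+k,0}d$; $[J_m,J_k]=\frac13m\delta_{m+k,0}d$; $[L_m,J_k]=-kJ_{m+k}$; $[L_m,G^\pm_{k+1/2}]=(\frac m2-k-\frac12)G^\pm_{m+k+1/2}$; $[J_m,G^\pm_{k+1/2}]=\pm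 G^\pm_{m+k+1/2}$; $[G^\pm_{m+1/2},G^\pm_{k+1/2}]=0$; $[G^+_{m+1/2},G^-_{k-1/2}]=2L_{m+k}+(m-k+1)J_{m+k}+\frac13(m^2+m)\delta_{m+k,0}d$. Infinitesimal N=2 superconformal transformations are represented by the superderivations (in an even variable $x$ and odd variables $\varphi^\pm$) $$L_m=-\left(x^{m+1}\frac{\partial}{\partial x}+\frac{m+1}{2}x^m\Bigl(\varphi^+\frac{\partial}{\partial\varphi^+}+\varphi^-\frac{\partial}{\partial\varphi^-}\Bigr)\right),\qquad J_m=-x^m\left(\varphi^+\frac{\partial}{\partial\varphi^+}-\varphi^-\frac{\partial}{\partial\varphi^-}\right),$$ $$G^\pm_{m-1/2}=-\left(x^m\Bigl(\frac{\partial}{\partial\varphi^\pm}-\varphi^\mp\frac{\partial}{\partial x}\Bigr)\pm mx^{m-1}\varphi^+\varphi^-\frac{\partial}{\partial\varphi^\pm}\right),$$ which form a representation of the N=2 Neveu-Schwarz algebra with $d=0$. $\mathrm{Lie}(\mathrm{Aut}(S^2\hat{\mathbb{C}}(n)))$ is the complex Lie superalgebra of the Lie supergroup $\mathrm{Aut}(S^2\hat{\mathbb{C}}(n))$: its elements are the infinitesimal N=2 superconformal transformations $X$, written in the coordinates $(x,\varphi^+,\varphi^-)$ of the chart $\Delta_n$, whose flows $e^{-yX}\cdot(x,\varphi^+,\varphi^-)$ ($X$ even, $y$ an even parameter), respectively $e^{-\xi X}\cdot(x,\varphi^+,\varphi^-)$ ($X$ odd, $\xi$ an odd parameter), are of the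 form $\Delta_n\circ T\circ\Delta_n^{-1}$ with $T\in\mathrm{Aut}(S^2\hat{\mathbb{C}}(n))$. *)

theory Defs
  imports
    "HOL-Complex_Analysis.Complex_Analysis"
    "HOL-Library.Extended_Nat"
    "HOL-Library.Poly_Mapping"
    "HOL-Library.Function_Algebras"
begin

section \<open>Grassmann algebras\<close>

text \<open>The type \<open>grassmann\<close> is the direct limit of all finitely generated Grassmann algebras: a
  finite combination of the monomials \<open>\<zeta>\<^sub>s\<close>, where \<open>s\<close> is a finite set of generators and
  \<open>\<zeta>\<^sub>s\<close> is the product in increasing order. The generators are numbered from 0, and the
  subalgebras with \<open>N\<close> generators, \<open>N \<le> \<infinity>\<close>, are the sets \<open>galg N\<close>.\<close>

typedef grassmann =
  "{f :: nat set \<Rightarrow> complex. finite {s. f s \<noteq> 0} \<and> (\<forall>s. f s \<noteq> 0 \<longrightarrow> finite s)}"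
  morphisms gcoeff Abs_grassmann
  by (intro exI[of _ "\<lambda>_. 0"]) auto

setup_lifting type_definition_grassmann

lemma grassmann_eqI: "(\<And>s. gcoeff a s = gcoeff b s) \<Longrightarrow> a = b"
  by (simp add: gcoeff_inject[symmetric] ext)

lemma gcoeff_infinite: "infinite s \<Longrightarrow> gcoeff a s = 0"
  using gcoeff[of a] by auto

lemma finite_gcoeff: "finite {s. gcoeff a s \<noteq> 0}"
  using gcoeff[of a] by auto

text \<open>For disjoint \<open>t\<close>, \<open>u\<close> one has \<open>\<zeta>\<^sub>t \<zeta>\<^sub>u = gsign t u \<zeta>\<^bsub>t \<union> u\<^esub>\<close>.\<close>

definition gsign :: "nat set \<Rightarrow> nat set \<Rightarrow> complex" where
  "gsign t u = (- 1) ^ card {(i, j). i \<in> t \<and> j \<in> u \<and> j < i}"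

lemma gsign_union_left:
  assumes "finite t" "finite t'" "finite u" "t \<inter> t' = {}"
  shows "gsign (t \<union> t') u = gsign t u * gsign t' u"
proof -
  have eq: "{(i, j). i \<in> t \<union> t' \<and> j \<in> u \<and> j < i}
      = {(i, j). i \<in> t \<and> j \<in> u \<and> j < i} \<union> {(i, j). i \<in> t' \<and> j \<in> u \<and> j < i}" by auto
  have "finite {(i, j). i \<in> t \<and> j \<in> u \<and> j < i}"
    by (rule finite_subset[of _ "t \<times> u"]) (use assms in auto)
  moreover have "finite {(i, j). i \<in> t' \<and> j \<in> u \<and> j < i}"
    by (rule finite_subset[of _ "t' \<times> u"]) (use assms in auto)
  ultimately show ?thesis
    unfolding gsign_def eq using assms(4)
    by (subst card_Un_disjoint) (auto simp: power_add)
qed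

lemma gsign_union_right:
  assumes "finite t" "finite u" "finite u'" "u \<inter> u' = {}"
  shows "gsign t (u \<union> u') = gsign t u * gsign t u'"
proof -
  have eq: "{(i, j). i \<in> t \<and> j \<in> u \<union> u' \<and> j < i}
      = {(i, j). i \<in> t \<and> j \<in> u \<and> j < i} \<union> {(i, j). i \<in> t \<and> j \<in> u' \<and> j < i}" by auto
  have "finite {(i, j). i \<in> t \<and> j \<in> u \<and> j < i}"
    by (rule finite_subset[of _ "t \<times> u"]) (use assms in auto)
  moreover have "finite {(i, j). i \<in> t \<and> j \<in> u' \<and> j < i}"
    by (rule finite_subset[of _ "t \<times> u'"]) (use assms in auto)
  ultimately show ?thesis
    unfolding gsign_def eq using assms(4)
    by (subst card_Un_disjoint) (auto simp: power_add)
qed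

lemma gsign_empty [simp]: "gsign {} u = 1" "gsign t {} = 1"
  by (simp_all add: gsign_def)

instantiation grassmann :: ring_1
begin

lift_definition zero_grassmann :: grassmann is "\<lambda>_. 0" by auto

lift_definition one_grassmann :: grassmann is "\<lambda>s. if s = {} then 1 else 0" by auto

lift_definition plus_grassmann :: "grassmann \<Rightarrow> grassmann \<Rightarrow> grassmann" is "\<lambda>f g s. f s + g s"
proof -
  fix f g :: "nat set \<Rightarrow> complex"
  assume a: "finite {s. f s \<noteq> 0} \<and> (\<forall>s. f s \<noteq> 0 \<longrightarrow> finite s)"
    "finite {s. g s \<noteq> 0} \<and> (\<forall>s. g s \<noteq> 0 \<longrightarrow> finite s)"
  then have "finite {s. f s + g s \<noteq> 0}"
    by - (rule finite_subset[of _ "{s. f s \<noteq> 0} \<union> {s. g s \<noteq> 0}"], auto)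
  then show "finite {s. f s + g s \<noteq> 0} \<and> (\<forall>s. f s + g s \<noteq> 0 \<longrightarrow> finite s)"
    using a by (auto, metis add.right_neutral)
qed

lift_definition uminus_grassmann :: "grassmann \<Rightarrow> grassmann" is "\<lambda>f s. - f s" by auto

definition minus_grassmann :: "grassmann \<Rightarrow> grassmann \<Rightarrow> grassmann" where
  "minus_grassmann a b = a + - b"

lift_definition times_grassmann :: "grassmann \<Rightarrow> grassmann \<Rightarrow> grassmann"
  is "\<lambda>f g s. \<Sum>t\<in>Pow s. gsign t (s - t) * f t * g (s - t)"
proof -
  fix f g :: "nat set \<Rightarrow> complex"
  assume a: "finite {s. f s \<noteq> 0} \<and> (\<forall>s. f s \<noteq> 0 \<longrightarrow> finite s)"
    "finite {s. g s \<noteq> 0} \<and> (\<forall>s. g s \<noteq> 0 \<longrightarrow> finite s)"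
  let ?h = "\<lambda>s. \<Sum>t\<in>Pow s. gsign t (s - t) * f t * g (s - t)"
  have "{s. ?h s \<noteq> 0} \<subseteq> (\<lambda>(t, u). t \<union> u) ` ({s. f s \<noteq> 0} \<times> {s. g s \<noteq> 0})"
  proof
    fix s assume "s \<in> {s. ?h s \<noteq> 0}"
    then have "?h s \<noteq> 0" by simp
    then obtain t where t: "t \<in> Pow s" "gsign t (s - t) * f t * g (s - t) \<noteq> 0"
      by (rule sum.not_neutral_contains_not_neutral)
    then have "(t, s - t) \<in> {s. f s \<noteq> 0} \<times> {s. g s \<noteq> 0}" "t \<union> (s - t) = s" by auto
    then show "s \<in> (\<lambda>(t, u). t \<union> u) ` ({s. f s \<noteq> 0} \<times> {s. g s \<noteq> 0})"
      by (intro rev_image_eqI[of "(t, s - t)"]) simp_all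
  qed
  moreover have "finite ((\<lambda>(t, u). t \<union> u) ` ({s. f s \<noteq> 0} \<times> {s. g s \<noteq> 0}))"
    using a by (intro finite_imageI finite_cartesian_product) auto
  ultimately have "finite {s. ?h s \<noteq> 0}" by (rule finite_subset)
  moreover have "finite s" if "?h s \<noteq> 0" for s
    using that by (rule contrapos_np) simp
  ultimately show "finite {s. ?h s \<noteq> 0} \<and> (\<forall>s. ?h s \<noteq> 0 \<longrightarrow> finite s)" by blast
qed

instance
proof
  fix a b c :: grassmann
  show "a + b + c = a + (b + c)" "a + b = b + a" "0 + a = a" "- a + a = 0"
    by (auto intro!: grassmann_eqI simp: plus_grassmann.rep_eq zero_grassmann.rep_eq uminus_grassmann.rep_eq)
  show "a - b = a + - b" by (rule minus_grassmann_def)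
  have "gcoeff 0 {} \<noteq> gcoeff 1 {}" by (simp add: zero_grassmann.rep_eq one_grassmann.rep_eq)
  then show "(0::grassmann) \<noteq> 1" by metis
  show "(a + b) * c = a * c + b * c" "a * (b + c) = a * b + a * c"
    by (auto intro!: grassmann_eqI
        simp: plus_grassmann.rep_eq times_grassmann.rep_eq ring_distribs sum.distrib)
  show "1 * a = a"
  proof (rule grassmann_eqI)
    fix s show "gcoeff (1 * a) s = gcoeff a s"
    proof (cases "finite s")
      case True
      have "gcoeff (1 * a) s = (\<Sum>t\<in>Pow s. if t = {} then gcoeff a s else 0)"
        unfolding times_grassmann.rep_eq one_grassmann.rep_eq by (rule sum.cong) auto
      then show ?thesis using True by simp
    qed (simp add: gcoeff_infinite)
  qed
  show "a * 1 = a"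
  proof (rule grassmann_eqI)
    fix s show "gcoeff (a * 1) s = gcoeff a s"
    proof (cases "finite s")
      case True
      have "gcoeff (a * 1) s = (\<Sum>t\<in>Pow s. if t = s then gcoeff a s else 0)"
        unfolding times_grassmann.rep_eq one_grassmann.rep_eq by (rule sum.cong) auto
      then show ?thesis using True by simp
    qed (simp add: gcoeff_infinite)
  qed
  show "a * b * c = a * (b * c)"
  proof (rule grassmann_eqI)
    fix s show "gcoeff (a * b * c) s = gcoeff (a * (b * c)) s"
    proof (cases "finite s")
      case True
      let ?L = "\<lambda>(t, v). gsign t (s - t) * (gsign v (t - v) * gcoeff a v * gcoeff b (t - v)) * gcoeff c (s - t)"
      let ?R = "\<lambda>(v, w). gsign v (s - v) * gcoeff a v *
                   (gsign w (s - v - w) * gcoeff b w * gcoeff c (s - v - w))"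
      have fin1: "finite (Pow s)" "\<forall>t\<in>Pow s. finite (Pow t)" "\<forall>v\<in>Pow s. finite (Pow (s - v))"
        using True finite_subset[OF _ True] by auto
      have "gcoeff (a * b * c) s = (\<Sum>t\<in>Pow s. \<Sum>v\<in>Pow t. ?L (t, v))"
        by (simp only: times_grassmann.rep_eq sum_distrib_left sum_distrib_right prod.case)
      also have "\<dots> = sum ?L (Sigma (Pow s) Pow)"
        by (subst sum.Sigma[OF fin1(1,2)]) (simp only: case_prod_eta)
      also have "\<dots> = sum ?R (SIGMA v:Pow s. Pow (s - v))"
      proof (rule sum.reindex_bij_witness[of _ "\<lambda>(v, w). (v \<union> w, v)" "\<lambda>(t, v). (v, t - v)"])
        fix x assume x: "x \<in> Sigma (Pow s) Pow"
        obtain t v where [simp]: "x = (t, v)" by (cases x)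
        have tv: "t \<subseteq> s" "v \<subseteq> t" using x by auto
        define w r where wr: "w = t - v" "r = s - t"
        have t: "t = v \<union> w" "s - v = w \<union> r" "s - v - w = r" using tv wr by auto
        have fin: "finite v" "finite w" "finite r"
          using True tv wr by (auto intro: finite_subset)
        have "v \<inter> w = {}" "w \<inter> r = {}" using tv wr by auto
        then have sg: "gsign t r = gsign v r * gsign w r" "gsign v (s - v) = gsign v w * gsign v r"
          unfolding t using fin by (auto intro!: gsign_union_left gsign_union_right)
        have "?R (v, w) = ?L (t, v)"
          by (simp only: prod.case sg wr[symmetric] t(3)) (simp only: mult_ac)
        then show "?R ((\<lambda>(t, v). (v, t - v)) x) = ?L x"
          by (simp add: wr(1))
      qed auto
      also have "\<dots> = (\<Sum>v\<in>Pow s. \<Sum>w\<in>Pow (s - v). ?R (v, w))"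
        by (subst sum.Sigma[OF fin1(1,3)]) (simp only: case_prod_eta)
      also have "\<dots> = gcoeff (a * (b * c)) s"
        by (simp only: times_grassmann.rep_eq sum_distrib_left sum_distrib_right prod.case)
      finally show ?thesis .
    qed (simp add: gcoeff_infinite)
  qed
qed

end

text \<open>Only the multiplicative inverse of invertible elements is of interest;
  non-invertible elements are assigned 0.\<close>

instantiation grassmann :: inverse
begin

definition inverse_grassmann :: "grassmann \<Rightarrow> grassmann" where
  "inverse (a::grassmann) = (if \<exists>b. a * b = 1 \<and> b * a = 1 then (THE b. a * b = 1 \<and> b * a = 1) else 0)"

definition divide_grassmann :: "grassmann \<Rightarrow> grassmann \<Rightarrow> grassmann" where
  "(a::grassmann) div b = a * inverse b"

instance ..

end

lift_definition gmono :: "nat set \<Rightarrow> grassmann"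
  is "\<lambda>t s. if finite t \<and> s = t then 1 else 0"
  by auto

lift_definition gconst :: "complex \<Rightarrow> grassmann" is "\<lambda>c s. if s = {} then c else 0"
  by auto

definition body :: "grassmann \<Rightarrow> complex" where
  "body a = gcoeff a {}"

definition soul :: "grassmann \<Rightarrow> grassmann" where
  "soul a = a - gconst (body a)"

definition galg :: "enat \<Rightarrow> grassmann set" where
  "galg N = {a. \<forall>s. gcoeff a s \<noteq> 0 \<longrightarrow> (\<forall>i\<in>s. enat i < N)}"

definition galg_even :: "enat \<Rightarrow> grassmann set" where
  "galg_even N = {a \<in> galg N. \<forall>s. gcoeff a s \<noteq> 0 \<longrightarrow> even (card s)}"

definition galg_odd :: "enat \<Rightarrow> grassmann set" where
  "galg_odd N = {a \<in> galg N. \<forall>s. gcoeff a s \<noteq> 0 \<longrightarrow> odd (card s)}"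

lemma soul_nilpotent: "\<exists>k. soul a ^ k = 0"
proof -
  define V where "V = \<Union>{s. gcoeff (soul a) s \<noteq> 0}"
  have V: "finite V"
    unfolding V_def
  proof (rule finite_Union[OF finite_gcoeff])
    show "finite s" if "s \<in> {s. gcoeff (soul a) s \<noteq> 0}" for s
      using that gcoeff_infinite[of s "soul a"] by auto
  qed
  have empty: "gcoeff (soul a) {} = 0"
    unfolding soul_def minus_grassmann_def
    by (simp only: plus_grassmann.rep_eq uminus_grassmann.rep_eq gconst.rep_eq body_def) simp
  have *: "gcoeff (soul a ^ k) s \<noteq> 0 \<Longrightarrow> s \<subseteq> V \<and> k \<le> card s" for k s
  proof (induction k arbitrary: s)
    case 0
    then show ?case by (auto simp: one_grassmann.rep_eq split: if_splits)
  next
    case (Suc k)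
    from Suc.prems have "(\<Sum>t\<in>Pow s. gsign t (s - t) * gcoeff (soul a) t * gcoeff (soul a ^ k) (s - t)) \<noteq> 0"
      by (simp add: times_grassmann.rep_eq)
    then obtain t where "t \<in> Pow s"
        "gsign t (s - t) * gcoeff (soul a) t * gcoeff (soul a ^ k) (s - t) \<noteq> 0"
      by (rule sum.not_neutral_contains_not_neutral)
    then have t: "t \<subseteq> s" "gcoeff (soul a) t \<noteq> 0" "gcoeff (soul a ^ k) (s - t) \<noteq> 0"
      by auto
    have tV: "t \<subseteq> V" "t \<noteq> {}" using t(2) empty by (auto simp: V_def)
    have st: "s - t \<subseteq> V" "k \<le> card (s - t)" using Suc.IH[OF t(3)] by auto
    have sV: "s \<subseteq> V" using tV st by auto
    have fin: "finite s" "finite t"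
      using finite_subset[OF sV V] finite_subset[OF tV(1) V] .
    have "card (s - t) = card s - card t" "card t \<le> card s" "0 < card t"
      using fin t(1) tV(2) by (simp_all add: card_Diff_subset card_mono card_gt_0_iff)
    then show ?case using st sV by linarith
  qed
  have "soul a ^ Suc (card V) = 0"
  proof (rule grassmann_eqI, rule ccontr)
    fix s assume "gcoeff (soul a ^ Suc (card V)) s \<noteq> gcoeff 0 s"
    with * [of "Suc (card V)" s] have "s \<subseteq> V" "Suc (card V) \<le> card s"
      by (simp_all add: zero_grassmann.rep_eq)
    with card_mono[OF V, of s] show False by simp
  qed
  then show ?thesis ..
qed

lemma finite_soul_powers: "finite {l. soul a ^ l \<noteq> 0}"
proof -
  obtain k where k: "soul a ^ k = 0" using soul_nilpotent by blast
  have "soul a ^ l = 0" if "k \<le> l" for l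
    using that k by (metis le_add_diff_inverse mult_zero_left power_add)
  then have "{l. soul a ^ l \<noteq> 0} \<subseteq> {..<k}" by (force simp: not_le)
  then show ?thesis using finite_subset by blast
qed


section \<open>Superfunctions in one even and two odd variables\<close>

text \<open>The extension of a complex analytic function to even Grassmann arguments; the sum is
  finite by the lemma \<open>finite_soul_powers\<close>.\<close>

definition gext :: "(complex \<Rightarrow> complex) \<Rightarrow> grassmann \<Rightarrow> grassmann" where
  "gext f z = (\<Sum>l | soul z ^ l \<noteq> 0. gconst ((deriv ^^ l) f (body z) / fact l) * soul z ^ l)"

text \<open>\<open>SF f\<^sub>0 f\<^sub>1 f\<^sub>2 f\<^sub>3\<close> stands for \<open>f\<^sub>0 + \<theta>\<^sup>+ f\<^sub>1 + \<theta>\<^sup>- f\<^sub>2 + \<theta>\<^sup>+\<theta>\<^sup>- f\<^sub>3\<close>. The type \<open>'f\<close> of functions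
  of the even variable is \<open>gfun\<close> for superanalytic functions, and \<open>pfun\<close> (below) for the
  coefficients of complex superderivations.\<close>

datatype 'f superfun = SF (sf0: 'f) (sfp: 'f) (sfm: 'f) (sfpm: 'f)

definition dtp :: "'f::{zero,uminus} superfun \<Rightarrow> 'f superfun" where
  "dtp F = SF (sfp F) 0 (sfpm F) 0"

definition dtm :: "'f::{zero,uminus} superfun \<Rightarrow> 'f superfun" where
  "dtm F = SF (sfm F) (- sfpm F) 0 0"

text \<open>An element of \<open>gfun\<close> is the family of the coefficient functions of the monomials
  \<open>\<zeta>\<^sub>s\<close>.\<close>

type_synonym gfun = "nat set \<Rightarrow> complex \<Rightarrow> complex"

definition gfun_on :: "enat \<Rightarrow> complex set \<Rightarrow> gfun \<Rightarrow> bool" where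
  "gfun_on N U f \<longleftrightarrow> finite {s. f s \<noteq> 0} \<and> (\<forall>s. f s \<noteq> 0 \<longrightarrow> finite s \<and> (\<forall>i\<in>s. enat i < N))
     \<and> (\<forall>s. f s holomorphic_on U)"

definition gfun_eval :: "gfun \<Rightarrow> grassmann \<Rightarrow> grassmann" where
  "gfun_eval f z = (\<Sum>s | f s \<noteq> 0. gext (f s) z * gmono s)"

type_synonym superpoint = "grassmann \<times> grassmann \<times> grassmann"

definition superspace :: "enat \<Rightarrow> superpoint set" where
  "superspace N = galg_even N \<times> galg_odd N \<times> galg_odd N"

fun sf_eval :: "gfun superfun \<Rightarrow> superpoint \<Rightarrow> grassmann" where
  "sf_eval F (z, p, m) = gfun_eval (sf0 F) z + p * gfun_eval (sfp F) z + m * gfun_eval (sfm F) z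
     + p * m * gfun_eval (sfpm F) z"

definition superanalytic :: "enat \<Rightarrow> complex set \<Rightarrow> gfun superfun \<Rightarrow> bool" where
  "superanalytic N U F \<longleftrightarrow> (\<forall>f\<in>set_superfun F. gfun_on N U f)"

definition sf_dz :: "gfun superfun \<Rightarrow> gfun superfun" where
  "sf_dz = map_superfun (\<lambda>f s. deriv (f s))"

fun Dp :: "gfun superfun \<Rightarrow> superpoint \<Rightarrow> grassmann" where
  "Dp F (z, p, m) = sf_eval (dtp F) (z, p, m) + m * sf_eval (sf_dz F) (z, p, m)"

fun Dm :: "gfun superfun \<Rightarrow> superpoint \<Rightarrow> grassmann" where
  "Dm F (z, p, m) = sf_eval (dtm F) (z, p, m) + p * sf_eval (sf_dz F) (z, p, m)"

text \<open>Over \<open>N\<close> generators, with \<open>N \<ge> 2\<close>, coefficients of superanalytic functions involve only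
  \<open>N - 2\<close> of them, so that the coefficient functions on \<open>U\<close> are determined by the values of the map.\<close>

definition superconformal_on :: "enat \<Rightarrow> superpoint set \<Rightarrow> (superpoint \<Rightarrow> superpoint) \<Rightarrow> bool" where
  "superconformal_on N D H \<longleftrightarrow>
     (\<exists>U Z P M. open U \<and> D = {q \<in> superspace N. body (fst q) \<in> U} \<and>
        superanalytic (N - 2) U Z \<and> superanalytic (N - 2) U P \<and> superanalytic (N - 2) U M \<and>
        (\<forall>q\<in>D. H q = (sf_eval Z q, sf_eval P q, sf_eval M q) \<and> H q \<in> superspace N \<and>
           Dp M q = 0 \<and> Dm P q = 0 \<and>
           Dp Z q - sf_eval M q * Dp P q = 0 \<and> Dm Z q - sf_eval P q * Dm M q = 0) \<and>
        (\<exists>q\<in>D. Dp P q \<noteq> 0) \<and> (\<exists>q\<in>D. Dm M q \<noteq> 0))"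

definition dewitt :: "enat \<Rightarrow> superpoint topology" where
  "dewitt N = pullback_topology (superspace N) (\<lambda>q. body (fst q)) euclidean"


section \<open>Superconformal automorphisms and the spheres\<close>

text \<open>A super-Riemann surface is given by its topology and its atlas, a set of pairs of a chart
  domain and a chart.\<close>

type_synonym 'a atlas = "('a set \<times> ('a \<Rightarrow> superpoint)) set"

definition superconformal_map :: "enat \<Rightarrow> 'a atlas \<Rightarrow> ('a \<Rightarrow> 'a) \<Rightarrow> bool" where
  "superconformal_map N A T \<longleftrightarrow> (\<forall>(U, c)\<in>A. \<forall>(V, d)\<in>A. {q \<in> U. T q \<in> V} \<noteq> {} \<longrightarrow>
     superconformal_on N (c ` {q \<in> U. T q \<in> V}) (d \<circ> T \<circ> inv_into U c))"

definition superconformal_auts :: "enat \<Rightarrow> 'a topology \<Rightarrow> 'a atlas \<Rightarrow> ('a \<Rightarrow> 'a) set" where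
  "superconformal_auts N X A = {T. \<exists>T'. homeomorphic_maps X X T T' \<and>
     superconformal_map N A T \<and> superconformal_map N A T'}"

fun transition :: "int \<Rightarrow> superpoint \<Rightarrow> superpoint" where
  "transition n (z, p, m) =
     (1 / z, gconst \<i> * p * (z powi n) / z, gconst \<i> * m * (z powi (- n)) / z)"

text \<open>The sphere is the quotient of two copies of the superspace, of which the left one becomes
  the domain of the chart \<open>\<Delta>\<^sub>n\<close> and the right one the domain of \<open>\<Upsilon>\<^sub>n\<close>.\<close>

type_synonym sphere_point = "(superpoint + superpoint) set"

definition glue :: "enat \<Rightarrow> int \<Rightarrow> (superpoint + superpoint) rel" where
  "glue N n = Id_on (superspace N <+> superspace N)
     \<union> {(Inl (transition n q), Inr q) | q. q \<in> superspace N \<and> body (fst q) \<noteq> 0}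
     \<union> {(Inr q, Inl (transition n q)) | q. q \<in> superspace N \<and> body (fst q) \<noteq> 0}"

definition sphere :: "enat \<Rightarrow> int \<Rightarrow> sphere_point set" where
  "sphere N n = (superspace N <+> superspace N) // glue N n"

definition sphere_top :: "enat \<Rightarrow> int \<Rightarrow> sphere_point topology" where
  "sphere_top N n = topology (\<lambda>W. W \<subseteq> sphere N n \<and>
     openin (dewitt N) {q \<in> superspace N. glue N n `` {Inl q} \<in> W} \<and>
     openin (dewitt N) {q \<in> superspace N. glue N n `` {Inr q} \<in> W})"

lemma openin_sphere_top:
  "openin (sphere_top N n) W \<longleftrightarrow> W \<subseteq> sphere N n \<and>
     openin (dewitt N) {q \<in> superspace N. glue N n `` {Inl q} \<in> W} \<and>
     openin (dewitt N) {q \<in> superspace N. glue N n `` {Inr q} \<in> W}"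
proof -
  have int: "{q \<in> superspace N. f q \<in> S \<inter> T} = {q \<in> superspace N. f q \<in> S} \<inter> {q \<in> superspace N. f q \<in> T}"
    and un: "{q \<in> superspace N. f q \<in> \<Union>K} = (\<Union>S\<in>K. {q \<in> superspace N. f q \<in> S})"
    for f :: "superpoint \<Rightarrow> sphere_point" and S T K
    by auto
  have "istopology (\<lambda>W. W \<subseteq> sphere N n \<and>
     openin (dewitt N) {q \<in> superspace N. glue N n `` {Inl q} \<in> W} \<and>
     openin (dewitt N) {q \<in> superspace N. glue N n `` {Inr q} \<in> W})"
    unfolding istopology_def int un by (auto)
  then show ?thesis
    unfolding sphere_top_def by (simp only: topology_inverse')
qed

definition Delta_dom :: "enat \<Rightarrow> int \<Rightarrow> sphere_point set" where
  "Delta_dom N n = {P \<in> sphere N n. \<exists>q. Inl q \<in> P}"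

definition Upsilon_dom :: "enat \<Rightarrow> int \<Rightarrow> sphere_point set" where
  "Upsilon_dom N n = {P \<in> sphere N n. \<exists>q. Inr q \<in> P}"

definition Delta :: "sphere_point \<Rightarrow> superpoint" where
  "Delta P = (THE q. Inl q \<in> P)"

definition Upsilon :: "sphere_point \<Rightarrow> superpoint" where
  "Upsilon P = (THE q. Inr q \<in> P)"

definition sphere_atlas :: "enat \<Rightarrow> int \<Rightarrow> sphere_point atlas" where
  "sphere_atlas N n = {(Delta_dom N n, Delta), (Upsilon_dom N n, Upsilon)}"

definition sphere_auts :: "enat \<Rightarrow> int \<Rightarrow> (sphere_point \<Rightarrow> sphere_point) set" where
  "sphere_auts N n = superconformal_auts N (sphere_top N n) (sphere_atlas N n)"


section \<open>Complex superderivations\<close>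

text \<open>Coefficients are complex analytic functions on the punctured plane, which is where all of
  the derivations \<open>L\<^sub>m, J\<^sub>m, G\<^bsub>m-1/2\<^esub>\<close> live. They are represented by total functions with value 0
  at the origin, so that equality of representatives is equality on the punctured plane.\<close>

typedef pfun = "{f :: complex \<Rightarrow> complex. f holomorphic_on (- {0}) \<and> f 0 = 0}"
  morphisms papp Abs_pfun
  by (intro exI[of _ "\<lambda>_. 0"]) auto

setup_lifting type_definition_pfun

instantiation pfun :: comm_ring_1
begin

lift_definition zero_pfun :: pfun is "\<lambda>_. 0" by auto

lift_definition one_pfun :: pfun is "\<lambda>x. if x = 0 then 0 else 1"
  using holomorphic_transform[OF holomorphic_on_const[of 1], of "- {0}" "\<lambda>x. if x = 0 then 0 else 1"]
  by simp

lift_definition plus_pfun :: "pfun \<Rightarrow> pfun \<Rightarrow> pfun" is "\<lambda>f g x. f x + g x"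
  by (auto intro!: holomorphic_intros)

lift_definition minus_pfun :: "pfun \<Rightarrow> pfun \<Rightarrow> pfun" is "\<lambda>f g x. f x - g x"
  by (auto intro!: holomorphic_intros)

lift_definition uminus_pfun :: "pfun \<Rightarrow> pfun" is "\<lambda>f x. - f x"
  by (auto intro!: holomorphic_intros)

lift_definition times_pfun :: "pfun \<Rightarrow> pfun \<Rightarrow> pfun" is "\<lambda>f g x. f x * g x"
  by (auto intro!: holomorphic_intros)

lemma papp_eqI: "(\<And>x. papp f x = papp g x) \<Longrightarrow> f = g"
  by (simp add: papp_inject[symmetric] ext)

lemma papp_0: "papp f 0 = 0"
  using papp[of f] by auto

instance
proof
  fix a b c :: pfun
  note d = zero_pfun.rep_eq one_pfun.rep_eq plus_pfun.rep_eq minus_pfun.rep_eq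
    uminus_pfun.rep_eq times_pfun.rep_eq
  show "a + b + c = a + (b + c)" "a + b = b + a" "0 + a = a" "- a + a = 0" "a - b = a + - b"
    "a * b * c = a * (b * c)" "a * b = b * a" "(a + b) * c = a * c + b * c"
    by (rule papp_eqI; simp add: d algebra_simps)+
  show "1 * a = a" by (rule papp_eqI) (simp add: d papp_0)
  have "papp 0 1 \<noteq> papp 1 1" by (simp add: d)
  then show "(0::pfun) \<noteq> 1" by metis
qed

end

lift_definition pderivative :: "pfun \<Rightarrow> pfun" is "\<lambda>f x. if x = 0 then 0 else deriv f x"
proof -
  fix f :: "complex \<Rightarrow> complex" assume "f holomorphic_on (- {0}) \<and> f 0 = 0"
  then have "deriv f holomorphic_on (- {0})" by (auto intro!: holomorphic_deriv)
  then have "(\<lambda>x. if x = 0 then 0 else deriv f x) holomorphic_on (- {0})"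
    by (rule holomorphic_transform) auto
  then show "(\<lambda>x. if x = 0 then 0 else deriv f x) holomorphic_on (- {0}) \<and>
      (if (0::complex) = 0 then 0 else deriv f 0) = 0" by simp
qed

lift_definition pmonom :: "complex \<Rightarrow> int \<Rightarrow> pfun" is "\<lambda>c m x. if x = 0 then 0 else c * x powi m"
proof -
  fix c :: complex and m :: int
  have "(\<lambda>x. c * x powi m) holomorphic_on (- {0})"
    by (intro holomorphic_intros) auto
  then have "(\<lambda>x. if x = 0 then 0 else c * x powi m) holomorphic_on (- {0})"
    by (rule holomorphic_transform) auto
  then show "(\<lambda>x. if x = 0 then 0 else c * x powi m) holomorphic_on (- {0}) \<and>
      (if (0::complex) = 0 then 0 else c * 0 powi m) = 0" by simp
qed

instantiation superfun :: (comm_ring_1) ring_1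
begin

definition "0 = SF 0 0 0 (0::'a)"

definition "1 = SF 1 0 0 (0::'a)"

definition "F + G = SF (sf0 F + sf0 G) (sfp F + sfp G) (sfm F + sfm G) (sfpm F + sfpm G)"

definition "F - G = SF (sf0 F - sf0 G) (sfp F - sfp G) (sfm F - sfm G) (sfpm F - sfpm G)"

definition "- F = SF (- sf0 F) (- sfp F) (- sfm F) (- sfpm F)"

definition "F * G = SF (sf0 F * sf0 G) (sf0 F * sfp G + sfp F * sf0 G)
   (sf0 F * sfm G + sfm F * sf0 G)
   (sf0 F * sfpm G + sfpm F * sf0 G + sfp F * sfm G - sfm F * sfp G)"

instance
proof
  fix a b c :: "'a superfun"
  note d = zero_superfun_def one_superfun_def plus_superfun_def minus_superfun_def
      uminus_superfun_def times_superfun_def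
  show "a + b + c = a + (b + c)" "a + b = b + a" "0 + a = a" "- a + a = 0" "(0::'a superfun) \<noteq> 1"
    "a - b = a + - b"
    by (simp_all add: d add_ac)
  show "1 * a = a" "a * 1 = a" by (simp_all add: d)
  show "(a + b) * c = a * c + b * c" "a * (b + c) = a * b + a * c" by (simp_all add: d algebra_simps)
  show "a * b * c = a * (b * c)" by (simp add: d algebra_simps)
qed

end

definition xmonom :: "complex \<Rightarrow> int \<Rightarrow> pfun superfun" where
  "xmonom c m = SF (pmonom c m) 0 0 0"

definition phip :: "pfun superfun" where
  "phip = SF 0 1 0 0"

definition phim :: "pfun superfun" where
  "phim = SF 0 0 1 0"

definition dx :: "pfun superfun \<Rightarrow> pfun superfun" where
  "dx = map_superfun pderivative"

definition sf_even :: "pfun superfun \<Rightarrow> pfun superfun" where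
  "sf_even F = SF (sf0 F) 0 0 (sfpm F)"

definition sf_odd :: "pfun superfun \<Rightarrow> pfun superfun" where
  "sf_odd F = SF 0 (sfp F) (sfm F) 0"

definition psf_eval :: "pfun superfun \<Rightarrow> superpoint \<Rightarrow> grassmann" where
  "psf_eval F = sf_eval (map_superfun (\<lambda>f s. if s = {} then papp f else 0) F)"

text \<open>\<open>(a, b, c)\<close> stands for \<open>a \<partial>/\<partial>x + b \<partial>/\<partial>\<phi>\<^sup>+ + c \<partial>/\<partial>\<phi>\<^sup>-\<close>.\<close>

type_synonym sder = "pfun superfun \<times> pfun superfun \<times> pfun superfun"

fun sder_app :: "sder \<Rightarrow> pfun superfun \<Rightarrow> pfun superfun" where
  "sder_app (a, b, c) F = a * dx F + b * dtp F + c * dtm F"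

fun sder_lmult :: "pfun superfun \<Rightarrow> sder \<Rightarrow> sder" where
  "sder_lmult F (a, b, c) = (F * a, F * b, F * c)"

fun sder_even :: "sder \<Rightarrow> sder" where
  "sder_even (a, b, c) = (sf_even a, sf_odd b, sf_odd c)"

fun sder_odd :: "sder \<Rightarrow> sder" where
  "sder_odd (a, b, c) = (sf_odd a, sf_even b, sf_even c)"

text \<open>The supercommutator, \<open>XY - (-1)\<^bsup>|X||Y|\<^esup> YX\<close> on homogeneous arguments. A derivation is
  determined by its values on \<open>x\<close>, \<open>\<phi>\<^sup>+\<close>, \<open>\<phi>\<^sup>-\<close>.\<close>

definition sder_bracket_app :: "sder \<Rightarrow> sder \<Rightarrow> pfun superfun \<Rightarrow> pfun superfun" where
  "sder_bracket_app X Y F = sder_app X (sder_app Y F)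
     - sder_app (sder_even Y) (sder_app X F)
     - sder_app (sder_odd Y) (sder_app (sder_even X) F)
     + sder_app (sder_odd Y) (sder_app (sder_odd X) F)"

definition sder_bracket :: "sder \<Rightarrow> sder \<Rightarrow> sder" where
  "sder_bracket X Y = (sder_bracket_app X Y (xmonom 1 1), sder_bracket_app X Y phip,
     sder_bracket_app X Y phim)"

definition sder_Dp :: sder where
  "sder_Dp = (phim, 1, 0)"

definition sder_Dm :: sder where
  "sder_Dm = (phip, 0, 1)"

definition infinitesimal_superconformal :: "sder \<Rightarrow> bool" where
  "infinitesimal_superconformal X \<longleftrightarrow>
     (\<exists>F. sder_bracket X sder_Dp = sder_lmult F sder_Dp) \<and>
     (\<exists>F. sder_bracket X sder_Dm = sder_lmult F sder_Dm)"


section \<open>The Lie superalgebra of infinitesimal automorphisms\<close>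

fun psf_eval3 :: "pfun superfun \<times> pfun superfun \<times> pfun superfun \<Rightarrow> superpoint \<Rightarrow> superpoint" where
  "psf_eval3 (F, G, H) q = (psf_eval F q, psf_eval G q, psf_eval H q)"

definition gsums :: "(nat \<Rightarrow> grassmann) \<Rightarrow> grassmann \<Rightarrow> bool" where
  "gsums f a \<longleftrightarrow> (\<forall>s. (\<lambda>k. gcoeff (f k) s) sums gcoeff a s)"

text \<open>\<open>q' = e\<^bsup>-yX\<^esup> \<cdot> (x, \<phi>\<^sup>+, \<phi>\<^sup>-)\<close> at \<open>(x, \<phi>\<^sup>+, \<phi>\<^sup>-) = q\<close>, for even \<open>X\<close> and even \<open>y\<close>.\<close>

definition even_flow :: "sder \<Rightarrow> grassmann \<Rightarrow> superpoint \<Rightarrow> superpoint \<Rightarrow> bool" where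
  "even_flow X y q q' \<longleftrightarrow> (\<forall>(F, a) \<in> {(xmonom 1 1, fst q'), (phip, fst (snd q')), (phim, snd (snd q'))}.
     gsums (\<lambda>k. gconst (1 / fact k) * (- y) ^ k * psf_eval ((sder_app X ^^ k) F) q) a)"

text \<open>For odd \<open>X\<close> and odd \<open>\<xi>\<close> one has \<open>(\<xi>X)\<^sup>2 = 0\<close>, so \<open>e\<^bsup>-\<xi>X\<^esup> = 1 - \<xi>X\<close>.\<close>

definition odd_flow :: "sder \<Rightarrow> grassmann \<Rightarrow> superpoint \<Rightarrow> superpoint \<Rightarrow> bool" where
  "odd_flow X \<xi> q q' \<longleftrightarrow> (\<forall>(F, a) \<in> {(xmonom 1 1, fst q'), (phip, fst (snd q')), (phim, snd (snd q'))}.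
     a = psf_eval F q - \<xi> * psf_eval (sder_app X F) q)"

definition in_Delta_coordinates ::
    "enat \<Rightarrow> int \<Rightarrow> (sphere_point \<Rightarrow> sphere_point) \<Rightarrow> superpoint \<Rightarrow> superpoint \<Rightarrow> bool" where
  "in_Delta_coordinates M n T q q' \<longleftrightarrow> (let P = inv_into (Delta_dom M n) Delta q
     in T P \<in> Delta_dom M n \<and> Delta (T P) = q')"

text \<open>The parameters of the flows are taken from the algebra of coefficients, and this algebra may be
  enlarged by adjoining further generators: otherwise, over two generators, where the algebra of
  coefficients is \<open>\<complex>\<close>, there would be no odd parameters at all. The flow of an even \<open>X\<close> is a local
  flow: the exponential series represents the automorphism \<open>T y\<close> for \<open>(y, x)\<close> with body in some
  neighbourhood of \<open>{0} \<times> (\<complex> - {0})\<close>.\<close>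

definition lie_aut_even :: "enat \<Rightarrow> int \<Rightarrow> sder set" where
  "lie_aut_even N n = {X. sder_even X = X \<and> infinitesimal_superconformal X \<and>
     (\<forall>M\<ge>N. \<exists>T W. (\<forall>y\<in>galg_even (M - 2). T y \<in> sphere_auts M n) \<and>
        open W \<and> {0} \<times> (- {0}) \<subseteq> W \<and>
        (\<forall>y\<in>galg_even (M - 2). \<forall>q\<in>superspace M. body (fst q) \<noteq> 0 \<and> (body y, body (fst q)) \<in> W \<longrightarrow>
           (\<exists>q'. even_flow X y q q' \<and> in_Delta_coordinates M n (T y) q q')))}"

definition lie_aut_odd :: "enat \<Rightarrow> int \<Rightarrow> sder set" where
  "lie_aut_odd N n = {X. sder_odd X = X \<and> infinitesimal_superconformal X \<and>
     (\<forall>M\<ge>N. \<forall>\<xi>\<in>galg_odd (M - 2). \<exists>T\<in>sphere_auts M n.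
        \<forall>q\<in>superspace M. body (fst q) \<noteq> 0 \<longrightarrow>
           (\<exists>q'. odd_flow X \<xi> q q' \<and> in_Delta_coordinates M n T q q'))}"

definition lie_aut :: "enat \<Rightarrow> int \<Rightarrow> sder set" where
  "lie_aut N n = {X + Y | X Y. X \<in> lie_aut_even N n \<and> Y \<in> lie_aut_odd N n}"


section \<open>The N=2 Neveu-Schwarz algebra\<close>

text \<open>\<open>BGp m\<close> and \<open>BGm m\<close> index \<open>G\<^sup>\<plusminus>\<^bsub>m+1/2\<^esub>\<close>.\<close>

datatype ns_index = BD | BL int | BJ int | BGp int | BGm int

type_synonym ns = "ns_index \<Rightarrow>\<^sub>0 complex"

definition ns_scale :: "complex \<Rightarrow> ns \<Rightarrow> ns" where
  "ns_scale c = Poly_Mapping.map ((*) c)"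

lemma lookup_ns_scale [simp]: "Poly_Mapping.lookup (ns_scale c u) b = c * Poly_Mapping.lookup u b"
  by (simp add: ns_scale_def map.rep_eq when_def)

interpretation ns: vector_space ns_scale
  by standard (auto intro!: poly_mapping_eqI simp: lookup_add algebra_simps)

abbreviation nsD :: ns where "nsD \<equiv> Poly_Mapping.single BD 1"
abbreviation nsL :: "int \<Rightarrow> ns" where "nsL m \<equiv> Poly_Mapping.single (BL m) 1"
abbreviation nsJ :: "int \<Rightarrow> ns" where "nsJ m \<equiv> Poly_Mapping.single (BJ m) 1"
abbreviation nsGp :: "int \<Rightarrow> ns" where "nsGp m \<equiv> Poly_Mapping.single (BGp m) 1"
abbreviation nsGm :: "int \<Rightarrow> ns" where "nsGm m \<equiv> Poly_Mapping.single (BGm m) 1"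

text \<open>In the equation for \<open>BGp m\<close> and \<open>BGm k\<close>, \<open>G\<^sup>-\<^bsub>k+1/2\<^esub>\<close> is \<open>G\<^sup>-\<^bsub>(k+1)-1/2\<^esub>\<close>.\<close>

fun ns_basis_bracket :: "ns_index \<Rightarrow> ns_index \<Rightarrow> ns" where
  "ns_basis_bracket (BL m) (BL k) = ns_scale (of_int (m - k)) (nsL (m + k))
     + ns_scale (if m + k = 0 then of_int (m ^ 3 - m) / 12 else 0) nsD"
| "ns_basis_bracket (BJ m) (BJ k) = ns_scale (if m + k = 0 then of_int m / 3 else 0) nsD"
| "ns_basis_bracket (BL m) (BJ k) = ns_scale (- of_int k) (nsJ (m + k))"
| "ns_basis_bracket (BJ k) (BL m) = ns_scale (of_int k) (nsJ (m + k))"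
| "ns_basis_bracket (BL m) (BGp k) = ns_scale (of_int m / 2 - of_int k - 1 / 2) (nsGp (m + k))"
| "ns_basis_bracket (BGp k) (BL m) = ns_scale (- (of_int m / 2 - of_int k - 1 / 2)) (nsGp (m + k))"
| "ns_basis_bracket (BL m) (BGm k) = ns_scale (of_int m / 2 - of_int k - 1 / 2) (nsGm (m + k))"
| "ns_basis_bracket (BGm k) (BL m) = ns_scale (- (of_int m / 2 - of_int k - 1 / 2)) (nsGm (m + k))"
| "ns_basis_bracket (BJ m) (BGp k) = nsGp (m + k)"
| "ns_basis_bracket (BGp k) (BJ m) = - nsGp (m + k)"
| "ns_basis_bracket (BJ m) (BGm k) = - nsGm (m + k)"
| "ns_basis_bracket (BGm k) (BJ m) = nsGm (m + k)"
| "ns_basis_bracket (BGp m) (BGm k) = ns_scale 2 (nsL (m + k + 1))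
     + ns_scale (of_int (m - k)) (nsJ (m + k + 1))
     + ns_scale (if m + k + 1 = 0 then of_int (m ^ 2 + m) / 3 else 0) nsD"
| "ns_basis_bracket (BGm k) (BGp m) = ns_scale 2 (nsL (m + k + 1))
     + ns_scale (of_int (m - k)) (nsJ (m + k + 1))
     + ns_scale (if m + k + 1 = 0 then of_int (m ^ 2 + m) / 3 else 0) nsD"
| "ns_basis_bracket (BGp m) (BGp k) = 0"
| "ns_basis_bracket (BGm m) (BGm k) = 0"
| "ns_basis_bracket BD b = 0"
| "ns_basis_bracket b BD = 0"

definition ns_bracket :: "ns \<Rightarrow> ns \<Rightarrow> ns" where
  "ns_bracket u v = (\<Sum>a\<in>Poly_Mapping.keys u. \<Sum>b\<in>Poly_Mapping.keys v.
     ns_scale (Poly_Mapping.lookup u a * Poly_Mapping.lookup v b) (ns_basis_bracket a b))"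

definition ns_even :: "ns \<Rightarrow> ns" where
  "ns_even u = (\<Sum>b\<in>Poly_Mapping.keys u - range BGp - range BGm. Poly_Mapping.single b (Poly_Mapping.lookup u b))"

definition ns_odd :: "ns \<Rightarrow> ns" where
  "ns_odd u = (\<Sum>b\<in>Poly_Mapping.keys u \<inter> (range BGp \<union> range BGm). Poly_Mapping.single b (Poly_Mapping.lookup u b))"

definition ns_subalgebra :: "ns set \<Rightarrow> bool" where
  "ns_subalgebra h \<longleftrightarrow> ns.subspace h \<and> (\<forall>u\<in>h. ns_even u \<in> h \<and> ns_odd u \<in> h)
     \<and> (\<forall>u\<in>h. \<forall>v\<in>h. ns_bracket u v \<in> h)"

text \<open>The representation by superderivations. Below, \<open>G\<^sup>\<plusminus>\<^bsub>m+1/2\<^esub>\<close> is \<open>G\<^sup>\<plusminus>\<^bsub>k-1/2\<^esub>\<close> for \<open>k = m + 1\<close>.\<close>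

fun ns_basis_rep :: "ns_index \<Rightarrow> sder" where
  "ns_basis_rep BD = 0"
| "ns_basis_rep (BL m) = - (xmonom 1 (m + 1), xmonom ((of_int m + 1) / 2) m * phip,
     xmonom ((of_int m + 1) / 2) m * phim)"
| "ns_basis_rep (BJ m) = - (0, xmonom 1 m * phip, - (xmonom 1 m * phim))"
| "ns_basis_rep (BGp m) = (let k = m + 1 in
     - (- (xmonom 1 k * phim), xmonom 1 k + xmonom (of_int k) (k - 1) * phip * phim, 0))"
| "ns_basis_rep (BGm m) = (let k = m + 1 in
     - (- (xmonom 1 k * phip), 0, xmonom 1 k - xmonom (of_int k) (k - 1) * phip * phim))"

definition ns_rep :: "ns \<Rightarrow> sder" where
  "ns_rep u = (\<Sum>b\<in>Poly_Mapping.keys u. sder_lmult (xmonom (Poly_Mapping.lookup u b) 0) (ns_basis_rep b))"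

text \<open>The representation identifies the subset \<open>h\<close> of the N=2 Neveu-Schwarz algebra with the set
  \<open>g\<close> of superderivations, as Lie superalgebras.\<close>

definition ns_identified :: "ns set \<Rightarrow> sder set \<Rightarrow> bool" where
  "ns_identified h g \<longleftrightarrow> inj_on ns_rep h \<and> ns_rep ` h = g \<and>
     (\<forall>u\<in>h. ns_rep (ns_even u) = sder_even (ns_rep u) \<and> ns_rep (ns_odd u) = sder_odd (ns_rep u)) \<and>
     (\<forall>u\<in>h. \<forall>v\<in>h. ns_rep (ns_bracket u v) = sder_bracket (ns_rep u) (ns_rep v))"

end

theory Submission
  imports Defs
begin

text \<open>The Lie superalgebra of infinitesimal automorphisms is computed exactly, uniformly in \<open>n\<close>: an even
  infinitesimal automorphism is a vector field \<open>\<alpha> + \<beta> x + \<gamma> x\<^sup>2\<close> on the Riemann sphere, lifted to the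
  odd coordinates, plus a multiple \<open>\<delta>\<close> of the infinitesimal rotation \<open>J\<^sub>0\<close>; an odd one is a pair of global sections
  of the line bundles of degrees \<open>1 - n\<close> and \<open>1 + n\<close>, that is, of polynomials of at most these degrees.
  The five cases of the theorem only list the monomials that such degree bounds leave.

  All these derivations have flows. The quadratic vector fields exponentiate to matrices, and a
  matrix in \<open>SL\<^sub>2\<close> over the even part of the Grassmann algebra, with a multiplier rotating the odd
  coordinates oppositely, acts on the sphere in homogeneous coordinates (\<open>mob_aut_in_auts\<close>,
  \<open>quadratic_sder_flows\<close>). For a pair of polynomials and an odd parameter \<open>\<xi>\<close> the flow is the explicit map
  \<open>1 - \<xi>X\<close>, and the degree bounds are what makes it regular at infinity (\<open>odd_aut_in_auts\<close>,
  \<open>odd_sder_flows\<close>).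

  There are no others. For the even ones, the lowest-order part of an automorphism is a bijective
  holomorphic map \<open>h\<close> of the Riemann sphere with multipliers \<open>A\<close>, \<open>B\<close> of the odd coordinates such that
  \<open>h' = A B\<close>. By Liouville's theorem \<open>h\<close> is a Moebius transformation and the multipliers are determined
  up to constants. This is expressed by two identities between values at two points,
  \<open>(x - y)\<^sup>2 h'(x) h'(y) = (h(x) - h(y))\<^sup>2\<close> and the constancy of \<open>A\<^sup>2 h'\<^bsup>n-1\<^esup>\<close>
  (\<open>automorphism_jet_identities\<close>). Unlike a parametrisation by matrices, identities can be differentiated along a
  flow that is given only as a power series for each argument; at time 0 they become linear
  equations, and their solutions are the fields above (\<open>even_flow_identities\<close>, \<open>lie_aut_even_eq\<close>).
  For the odd ones the superconformal condition leaves two coefficient functions \<open>u\<close>, \<open>w\<close> on the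
  punctured plane. The automorphism with the parameter \<open>\<xi> = \<zeta>\<^sub>0\<close> exhibits them as coefficients of a
  superanalytic map in both charts, hence as global sections (\<open>lie_aut_odd_eq\<close>).

  The rest is algebra: the representation by superderivations is linear and compatible with brackets
  (\<open>ns_rep_bracket\<close>), it is injective on the span of the generators because a polynomial is determined by its values, and
  the span is closed under brackets (\<open>sphere_gens_bracket\<close>).\<close>

section \<open>Arithmetic in Grassmann algebras\<close>

lemma gcoeff_0 [simp]: "gcoeff 0 s = 0"
  by (simp add: zero_grassmann.rep_eq)

lemma gcoeff_1: "gcoeff 1 s = (if s = {} then 1 else 0)"
  by (simp add: one_grassmann.rep_eq)

lemma gcoeff_add [simp]: "gcoeff (a + b) s = gcoeff a s + gcoeff b s"
  by (simp add: plus_grassmann.rep_eq)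

lemma gcoeff_uminus [simp]: "gcoeff (- a) s = - gcoeff a s"
  by (simp add: uminus_grassmann.rep_eq)

lemma gcoeff_diff [simp]: "gcoeff (a - b) s = gcoeff a s - gcoeff b s"
  by (simp only: minus_grassmann_def gcoeff_add gcoeff_uminus diff_conv_add_uminus)

lemma gcoeff_sum [simp]: "gcoeff (sum f A) s = (\<Sum>x\<in>A. gcoeff (f x) s)"
  by (induction A rule: infinite_finite_induct) auto

lemma gcoeff_mult: "gcoeff (a * b) s = (\<Sum>t\<in>Pow s. gsign t (s - t) * gcoeff a t * gcoeff b (s - t))"
  by (simp add: times_grassmann.rep_eq)

lemma gcoeff_gconst: "gcoeff (gconst c) s = (if s = {} then c else 0)"
  by (simp add: gconst.rep_eq)

lemma gcoeff_gmono: "gcoeff (gmono t) s = (if finite t \<and> s = t then 1 else 0)"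
  by (simp add: gmono.rep_eq)

lemma gcoeff_gconst_mult [simp]: "gcoeff (gconst c * a) s = c * gcoeff a s"
proof (cases "finite s")
  case True
  have "gcoeff (gconst c * a) s = (\<Sum>t\<in>Pow s. if t = {} then c * gcoeff a s else 0)"
    unfolding gcoeff_mult gcoeff_gconst by (rule sum.cong) auto
  then show ?thesis using True by simp
qed (simp add: gcoeff_infinite)

lemma gcoeff_mult_gconst [simp]: "gcoeff (a * gconst c) s = c * gcoeff a s"
proof (cases "finite s")
  case True
  have "gcoeff (a * gconst c) s = (\<Sum>t\<in>Pow s. if t = s then c * gcoeff a s else 0)"
    unfolding gcoeff_mult gcoeff_gconst by (rule sum.cong) auto
  then show ?thesis using True by simp
qed (simp add: gcoeff_infinite)

lemma gconst_commute: "a * gconst c = gconst c * a"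
  by (rule grassmann_eqI) simp

lemma gconst_left_commute: "a * (gconst c * b) = gconst c * (a * b)"
  by (metis gconst_commute mult.assoc)

lemma gconst_0 [simp]: "gconst 0 = 0"
  and gconst_1 [simp]: "gconst 1 = 1"
  and gconst_add: "gconst (c + d) = gconst c + gconst d"
  and gconst_diff: "gconst (c - d) = gconst c - gconst d"
  and gconst_uminus: "gconst (- c) = - gconst c"
  by (rule grassmann_eqI; simp add: gcoeff_gconst gcoeff_1)+

lemma gconst_mult: "gconst (c * d) = gconst c * gconst d"
  by (rule grassmann_eqI) (simp add: gcoeff_gconst)

lemma gconst_power: "gconst (c ^ k) = gconst c ^ k"
  by (induction k) (auto simp: gconst_mult)

lemma gconst_eq_iff [simp]: "gconst c = gconst d \<longleftrightarrow> c = d"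
proof
  assume "gconst c = gconst d"
  then have "gcoeff (gconst c) {} = gcoeff (gconst d) {}" by simp
  then show "c = d" by (simp add: gcoeff_gconst)
qed simp

lemma body_0 [simp]: "body 0 = 0"
  and body_1 [simp]: "body 1 = 1"
  and body_add [simp]: "body (a + b) = body a + body b"
  and body_diff [simp]: "body (a - b) = body a - body b"
  and body_uminus [simp]: "body (- a) = - body a"
  and body_gconst [simp]: "body (gconst c) = c"
  by (simp_all add: body_def gcoeff_1 gcoeff_gconst)

lemma body_mult [simp]: "body (a * b) = body a * body b"
  by (simp add: body_def gcoeff_mult)

lemma body_sum [simp]: "body (sum f A) = (\<Sum>x\<in>A. body (f x))"
  by (simp add: body_def)

lemma body_power [simp]: "body (a ^ k) = body a ^ k"
  by (induction k) auto

lemma body_soul [simp]: "body (soul a) = 0"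
  by (simp add: soul_def)

lemma gcoeff_soul: "gcoeff (soul a) s = (if s = {} then 0 else gcoeff a s)"
  by (simp add: soul_def gcoeff_gconst body_def)

lemma body_plus_soul: "gconst (body a) + soul a = a"
  by (simp add: soul_def)

lemma gcoeff_mult_nonzero:
  assumes "gcoeff (a * b) s \<noteq> 0"
  obtains t where "t \<subseteq> s" "finite s" "gcoeff a t \<noteq> 0" "gcoeff b (s - t) \<noteq> 0"
proof -
  have "finite s" using assms gcoeff_infinite by blast
  moreover have "(\<Sum>t\<in>Pow s. gsign t (s - t) * gcoeff a t * gcoeff b (s - t)) \<noteq> 0"
    using assms by (simp add: gcoeff_mult)
  then obtain t where "t \<in> Pow s" "gsign t (s - t) * gcoeff a t * gcoeff b (s - t) \<noteq> 0"
    by (rule sum.not_neutral_contains_not_neutral)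
  ultimately show ?thesis using that by auto
qed

subsection \<open>Parity and supercommutativity\<close>

definition geven :: "grassmann \<Rightarrow> bool" where
  "geven a \<longleftrightarrow> (\<forall>s. gcoeff a s \<noteq> 0 \<longrightarrow> even (card s))"

definition godd :: "grassmann \<Rightarrow> bool" where
  "godd a \<longleftrightarrow> (\<forall>s. gcoeff a s \<noteq> 0 \<longrightarrow> odd (card s))"

lemma galg_even_iff: "a \<in> galg_even N \<longleftrightarrow> a \<in> galg N \<and> geven a"
  and galg_odd_iff: "a \<in> galg_odd N \<longleftrightarrow> a \<in> galg N \<and> godd a"
  by (auto simp: galg_even_def galg_odd_def geven_def godd_def)

lemma galg_intros [intro, simp]:
  shows galg_0: "0 \<in> galg N"
    and galg_1: "1 \<in> galg N"
    and galg_gconst: "gconst c \<in> galg N"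
    and galg_add: "a \<in> galg N \<Longrightarrow> b \<in> galg N \<Longrightarrow> a + b \<in> galg N"
    and galg_uminus: "a \<in> galg N \<Longrightarrow> - a \<in> galg N"
    and galg_diff: "a \<in> galg N \<Longrightarrow> b \<in> galg N \<Longrightarrow> a - b \<in> galg N"
  unfolding galg_def
  by (auto simp: gcoeff_1 gcoeff_gconst split: if_splits) (metis add.right_neutral diff_zero)+

lemma galg_mult [intro, simp]: "a \<in> galg N \<Longrightarrow> b \<in> galg N \<Longrightarrow> a * b \<in> galg N"
  unfolding galg_def by (auto elim!: gcoeff_mult_nonzero)

lemma galg_sum [intro]: "(\<And>x. x \<in> A \<Longrightarrow> f x \<in> galg N) \<Longrightarrow> sum f A \<in> galg N"
  by (induction A rule: infinite_finite_induct) auto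

lemma galg_power [intro, simp]: "a \<in> galg N \<Longrightarrow> a ^ k \<in> galg N"
  by (induction k) auto

lemma galg_gmono: "gmono s \<in> galg N \<longleftrightarrow> (finite s \<longrightarrow> (\<forall>i\<in>s. enat i < N))"
  by (auto simp: galg_def gcoeff_gmono split: if_splits)

lemma galg_infinity [simp]: "a \<in> galg \<infinity>"
  by (simp add: galg_def)

lemma galg_mono: "a \<in> galg N \<Longrightarrow> N \<le> M \<Longrightarrow> a \<in> galg M"
  by (auto simp: galg_def intro: less_le_trans)

lemma galg_soul [intro, simp]: "a \<in> galg N \<Longrightarrow> soul a \<in> galg N"
  by (simp add: soul_def)

lemma geven_intros [intro, simp]:
  shows geven_0: "geven 0"
    and geven_1: "geven 1"
    and geven_gconst: "geven (gconst c)"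
    and geven_add: "geven a \<Longrightarrow> geven b \<Longrightarrow> geven (a + b)"
    and geven_uminus: "geven a \<Longrightarrow> geven (- a)"
    and geven_diff: "geven a \<Longrightarrow> geven b \<Longrightarrow> geven (a - b)"
  unfolding geven_def
  by (auto simp: gcoeff_1 gcoeff_gconst split: if_splits) (metis add.right_neutral diff_zero)+

lemma godd_intros [intro, simp]:
  shows godd_0: "godd 0"
    and godd_add: "godd a \<Longrightarrow> godd b \<Longrightarrow> godd (a + b)"
    and godd_uminus: "godd a \<Longrightarrow> godd (- a)"
    and godd_diff: "godd a \<Longrightarrow> godd b \<Longrightarrow> godd (a - b)"
  unfolding godd_def by (auto) (metis add.right_neutral diff_zero)+

lemma card_split: "t \<subseteq> s \<Longrightarrow> finite s \<Longrightarrow> card s = card t + card (s - t)"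
  by (metis card_Diff_subset card_mono finite_subset le_add_diff_inverse)

lemma gparity_mult [intro, simp]:
  shows geven_mult: "geven a \<Longrightarrow> geven b \<Longrightarrow> geven (a * b)"
    and geven_godd_mult: "geven a \<Longrightarrow> godd b \<Longrightarrow> godd (a * b)"
    and godd_geven_mult: "godd a \<Longrightarrow> geven b \<Longrightarrow> godd (a * b)"
    and godd_mult: "godd a \<Longrightarrow> godd b \<Longrightarrow> geven (a * b)"
  unfolding geven_def godd_def by (auto elim!: gcoeff_mult_nonzero simp: card_split)

lemma geven_power [intro, simp]: "geven a \<Longrightarrow> geven (a ^ k)"
  by (induction k) auto

lemma geven_sum [intro]: "(\<And>x. x \<in> A \<Longrightarrow> geven (f x)) \<Longrightarrow> geven (sum f A)"
  by (induction A rule: infinite_finite_induct) auto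

lemma geven_soul [intro, simp]: "geven a \<Longrightarrow> geven (soul a)"
  by (simp add: soul_def)

lemma godd_body [simp]: "godd a \<Longrightarrow> body a = 0"
  by (auto simp: godd_def body_def)

lemma geven_gmono: "geven (gmono s) \<longleftrightarrow> (finite s \<longrightarrow> even (card s))"
  and godd_gmono: "godd (gmono s) \<longleftrightarrow> (finite s \<longrightarrow> odd (card s))"
  by (auto simp: geven_def godd_def gcoeff_gmono split: if_splits)

text \<open>Exchanging the factors of \<open>\<zeta>\<^sub>t \<zeta>\<^sub>u\<close> passes each of the \<open>card t\<close> generators over each of the
  \<open>card u\<close> others; every pair is an inversion in exactly one of the two orders.\<close>

lemma gsign_swap:
  assumes "finite t" "finite u" "t \<inter> u = {}"
  shows "gsign u t = (- 1) ^ (card t * card u) * gsign t u"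
proof -
  let ?A = "{(i, j). i \<in> t \<and> j \<in> u \<and> j < i}" and ?B = "{(i, j). i \<in> u \<and> j \<in> t \<and> j < i}"
  have "finite ?A" by (rule finite_subset[of _ "t \<times> u"]) (use assms in auto)
  moreover have "finite ?B" by (rule finite_subset[of _ "u \<times> t"]) (use assms in auto)
  ultimately have fin: "finite ?A" "finite ?B" .
  have un: "t \<times> u = ?A \<union> prod.swap ` ?B" using assms(3)
    by (fastforce simp: image_iff not_less_iff_gr_or_eq disjoint_iff)
  have "card (prod.swap ` ?B) = card ?B" by (intro card_image) auto
  moreover have "card (t \<times> u) = card ?A + card (prod.swap ` ?B)"
    unfolding un by (rule card_Un_disjoint) (use fin in auto)
  ultimately have "card t * card u = card ?A + card ?B" by (simp add: card_cartesian_product)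
  then have "(- 1) ^ (card t * card u) * gsign t u = (- 1) ^ (2 * card ?A) * gsign u t"
    unfolding gsign_def by (simp add: power_add mult_2)
  then show ?thesis by simp
qed

lemma gcoeff_mult_swapped:
  "gcoeff (b * a) s = (\<Sum>t\<in>Pow s. (- 1) ^ (card t * card (s - t)) * gsign t (s - t) * gcoeff a t * gcoeff b (s - t))"
proof (cases "finite s")
  case True
  have "gcoeff (b * a) s = (\<Sum>t\<in>Pow s. gsign (s - t) t * gcoeff b (s - t) * gcoeff a t)"
    unfolding gcoeff_mult
    by (rule sum.reindex_bij_witness[of _ "\<lambda>t. s - t" "\<lambda>t. s - t"]) (auto simp: double_diff)
  also have "\<dots> = (\<Sum>t\<in>Pow s. (- 1) ^ (card t * card (s - t)) * gsign t (s - t) * gcoeff a t * gcoeff b (s - t))"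
  proof (rule sum.cong)
    fix t assume "t \<in> Pow s"
    then have "finite t" "finite (s - t)" using True finite_subset by auto
    then show "gsign (s - t) t * gcoeff b (s - t) * gcoeff a t =
        (- 1) ^ (card t * card (s - t)) * gsign t (s - t) * gcoeff a t * gcoeff b (s - t)"
      by (subst gsign_swap[of t "s - t"]) auto
  qed simp
  finally show ?thesis .
qed (simp add: gcoeff_infinite)

lemma geven_commute:
  assumes "geven a"
  shows "a * b = b * a"
proof (rule grassmann_eqI)
  fix s
  have "gsign t (s - t) * gcoeff a t * gcoeff b (s - t) =
      (- 1) ^ (card t * card (s - t)) * gsign t (s - t) * gcoeff a t * gcoeff b (s - t)" for t
    using assms by (cases "gcoeff a t = 0 \<or> gcoeff b (s - t) = 0") (auto simp: geven_def)
  then show "gcoeff (a * b) s = gcoeff (b * a) s"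
    by (subst gcoeff_mult_swapped, subst gcoeff_mult) (intro sum.cong refl)
qed

lemma godd_anticommute:
  assumes "godd a" "godd b"
  shows "a * b = - (b * a)"
proof (rule grassmann_eqI)
  fix s
  have "gsign t (s - t) * gcoeff a t * gcoeff b (s - t) =
      - ((- 1) ^ (card t * card (s - t)) * gsign t (s - t) * gcoeff a t * gcoeff b (s - t))" for t
    using assms by (cases "gcoeff a t = 0 \<or> gcoeff b (s - t) = 0") (auto simp: godd_def)
  then show "gcoeff (a * b) s = gcoeff (- (b * a)) s"
    unfolding gcoeff_uminus
    by (subst gcoeff_mult_swapped, subst gcoeff_mult, subst sum_negf[symmetric]) (intro sum.cong refl)
qed

lemma godd_square [simp]:
  assumes "godd a"
  shows "a * a = 0"
proof (rule grassmann_eqI)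
  fix s
  have "gcoeff (a * a) s = gcoeff (- (a * a)) s" using godd_anticommute[OF assms assms] by simp
  then show "gcoeff (a * a) s = gcoeff 0 s" by simp
qed

lemma godd_square_left: "godd a \<Longrightarrow> a * (a * b) = 0"
  by (metis godd_square mult.assoc mult_zero_left)

subsection \<open>Inverses and integer powers\<close>

lemma geometric_sum_ring:
  fixes x :: "'a::ring_1"
  shows "(1 - x) * (\<Sum>i<k. x ^ i) = 1 - x ^ k" "(\<Sum>i<k. x ^ i) * (1 - x) = 1 - x ^ k"
proof -
  have "(\<Sum>i<k. x ^ i) * x = x * (\<Sum>i<k. x ^ i)"
    by (simp add: sum_distrib_left sum_distrib_right power_commutes)
  moreover show "(1 - x) * (\<Sum>i<k. x ^ i) = 1 - x ^ k"
  proof (induction k)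
    case (Suc k)
    then show ?case by (simp add: distrib_left left_diff_distrib[of 1 x "x ^ k"])
  qed simp
  ultimately show "(\<Sum>i<k. x ^ i) * (1 - x) = 1 - x ^ k"
    by (simp add: algebra_simps)
qed

lemma grassmann_inverse_exists:
  assumes "body a \<noteq> 0"
  obtains b where "a * b = 1" "b * a = 1" "\<And>N. a \<in> galg N \<Longrightarrow> b \<in> galg N" "geven a \<Longrightarrow> geven b"
proof -
  define n where "n = - (gconst (1 / body a) * soul a)"
  obtain k where k: "soul a ^ k = 0" using soul_nilpotent by blast
  have pw: "(gconst c * u) ^ j = gconst (c ^ j) * u ^ j" for c u j
  proof (induction j)
    case (Suc j)
    have "(gconst c * u) ^ Suc j = gconst c * (u * (gconst (c ^ j) * u ^ j))"
      by (simp add: Suc mult.assoc)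
    also have "\<dots> = gconst (c ^ Suc j) * u ^ Suc j"
      by (simp add: gconst_mult gconst_left_commute[of u] mult.assoc)
    finally show ?case .
  qed simp
  have "n ^ k = gconst ((- 1 / body a) ^ k) * soul a ^ k"
    unfolding n_def pw[symmetric] by (simp add: gconst_uminus)
  then have nk: "n ^ k = 0" using k by simp
  have a: "a = gconst (body a) * (1 - n)"
    using assms body_plus_soul[of a]
    by (simp add: n_def algebra_simps mult.assoc[symmetric] gconst_mult[symmetric])
  have inv: "gconst (body a) * gconst (1 / body a) = 1" "gconst (1 / body a) * gconst (body a) = 1"
    using assms by (simp_all add: gconst_mult[symmetric])
  define b where "b = gconst (1 / body a) * (\<Sum>i<k. n ^ i)"
  have "a * b = (gconst (body a) * gconst (1 / body a)) * ((1 - n) * (\<Sum>i<k. n ^ i))"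
    unfolding b_def by (subst a) (simp only: mult.assoc gconst_left_commute[of "1 - n"])
  then have "a * b = 1" using inv geometric_sum_ring(1)[where x=n and k=k] nk by simp
  moreover have "b * a = (gconst (1 / body a) * gconst (body a)) * ((\<Sum>i<k. n ^ i) * (1 - n))"
    unfolding b_def by (subst (2) a) (simp only: mult.assoc gconst_left_commute[of "\<Sum>i<k. n ^ i"])
  then have "b * a = 1" using inv geometric_sum_ring(2)[where x=n and k=k] nk by simp
  moreover have "b \<in> galg N" if "a \<in> galg N" for N
    unfolding b_def n_def using that by (intro galg_mult galg_sum galg_power galg_uminus) auto
  moreover have "geven b" if "geven a"
    unfolding b_def n_def using that by (intro geven_mult geven_sum geven_power geven_uminus) auto
  ultimately show ?thesis using that by blast
qed

lemma grassmann_inverse_eqI: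
  fixes a b :: grassmann
  assumes "a * b = 1" "b * a = 1"
  shows "inverse a = b"
proof -
  have "(THE b. a * b = 1 \<and> b * a = 1) = b"
    by (rule the_equality) (use assms in \<open>auto, metis mult.assoc mult.right_neutral mult_1_left\<close>)
  then show ?thesis using assms unfolding inverse_grassmann_def by auto
qed

lemma
  assumes "body a \<noteq> 0"
  shows grassmann_right_inverse [simp]: "a * inverse a = 1"
    and grassmann_left_inverse [simp]: "inverse a * a = 1"
    and galg_inverse [intro, simp]: "a \<in> galg N \<Longrightarrow> inverse a \<in> galg N"
    and geven_inverse [intro, simp]: "geven a \<Longrightarrow> geven (inverse a)"
    and body_inverse [simp]: "body (inverse a) = inverse (body a)"
proof -
  obtain b where b: "a * b = 1" "b * a = 1" "\<And>N. a \<in> galg N \<Longrightarrow> b \<in> galg N" "geven a \<Longrightarrow> geven b"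
    using grassmann_inverse_exists[OF assms] by metis
  have i: "inverse a = b" using grassmann_inverse_eqI b by blast
  show "a * inverse a = 1" "inverse a * a = 1" "a \<in> galg N \<Longrightarrow> inverse a \<in> galg N"
    "geven a \<Longrightarrow> geven (inverse a)" unfolding i using b by auto
  have "body a * body b = 1" using b(1) by (metis body_mult body_1)
  then show "body (inverse a) = inverse (body a)" unfolding i by (simp add: inverse_unique)
qed

lemma inverse_gconst: "c \<noteq> 0 \<Longrightarrow> inverse (gconst c) = gconst (inverse c)"
  by (rule grassmann_inverse_eqI) (auto simp: gconst_mult[symmetric])

lemma grassmann_inverse_1 [simp]: "inverse (1::grassmann) = 1"
  by (rule grassmann_inverse_eqI) auto

lemma powi_succ:
  fixes a :: grassmann
  assumes "body a \<noteq> 0"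
  shows "a powi (k + 1) = a powi k * a"
proof (cases "k \<ge> 0")
  case True
  then show ?thesis by (simp add: power_int_def nat_add_distrib power_commutes)
next
  case False
  define m where "m = nat (- k - 1)"
  have k: "k = - int m - 1" using False by (simp add: m_def)
  have "a powi k = inverse a ^ Suc m" unfolding k by (simp add: power_int_def nat_add_distrib)
  moreover have "a powi (k + 1) = inverse a ^ m"
    unfolding k by (cases m) (simp_all add: power_int_def nat_add_distrib)
  ultimately show ?thesis using assms by (simp add: power_Suc2 mult.assoc del: power_Suc)
qed

lemma powi_unique:
  fixes a :: grassmann
  assumes "body a \<noteq> 0" "f 0 = 1" "\<And>k::int. f (k + 1) = f k * a"
  shows "f k = a powi k"
proof (induction k rule: int_induct[of _ 0])
  case base then show ?case using assms(2) by simp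
next
  case (step1 i) then show ?case using assms powi_succ by simp
next
  case (step2 i)
  have "f (i - 1) * a = a powi (i - 1) * a"
    using assms(3)[of "i - 1"] powi_succ[OF assms(1), of "i - 1"] step2 by simp
  then show ?case by (metis assms(1) grassmann_right_inverse mult.assoc mult.right_neutral)
qed

lemma powi_add:
  fixes a :: grassmann
  assumes "body a \<noteq> 0"
  shows "a powi (j + k) = a powi j * a powi k"
proof (induction k rule: int_induct[of _ 0])
  case (step1 i)
  then show ?case using powi_succ[OF assms, of "j + i"] powi_succ[OF assms, of i]
    by (simp add: algebra_simps)
next
  case (step2 i)
  have "a powi (j + (i - 1)) * a = a powi j * a powi (i - 1) * a"
    using powi_succ[OF assms, of "j + (i - 1)"] powi_succ[OF assms, of "i - 1"] step2
    by (simp add: algebra_simps)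
  then show ?case by (metis assms grassmann_right_inverse mult.assoc mult.right_neutral)
qed simp

lemma
  assumes "body a \<noteq> 0"
  shows geven_powi [intro, simp]: "geven a \<Longrightarrow> geven (a powi k)"
    and galg_powi [intro, simp]: "a \<in> galg N \<Longrightarrow> a powi k \<in> galg N"
    and body_powi [simp]: "body (a powi k) = body a powi k"
  using assms by (auto simp: power_int_def)

lemma powi_mult_distrib:
  assumes "body a \<noteq> 0" "body b \<noteq> 0" "geven a" "geven b"
  shows "(a * b) powi k = a powi k * b powi k"
proof (rule sym, rule powi_unique)
  fix k
  show "a powi (k + 1) * b powi (k + 1) = a powi k * b powi k * (a * b)"
    unfolding powi_succ[OF assms(1)] powi_succ[OF assms(2)]
    by (simp add: mult.assoc geven_commute[OF assms(3), of "b powi k * b"]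
        geven_commute[OF assms(3), of b])
qed (use assms in auto)

lemma powi_inverse:
  assumes "body a \<noteq> 0"
  shows "inverse a powi k = a powi (- k)"
proof (rule sym, rule powi_unique)
  fix k
  have "a powi (- (k + 1)) = a powi (- (k + 1)) * a * inverse a" using assms by (simp add: mult.assoc)
  also have "a powi (- (k + 1)) * a = a powi (- k)" using powi_succ[OF assms, of "- (k + 1)"] by simp
  finally show "a powi (- (k + 1)) = a powi (- k) * inverse a" .
qed (use assms in auto)

lemma powi_gconst: "c \<noteq> 0 \<Longrightarrow> gconst c powi k = gconst (c powi k)"
  by (rule sym, rule powi_unique) (auto simp: power_int_add gconst_mult)

lemma powi_minus_mult:
  fixes a :: grassmann
  shows "body a \<noteq> 0 \<Longrightarrow> a powi (- k) * a powi k = 1"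
  using powi_add[of a "- k" k] by simp

lemma powi_one: "(1::grassmann) powi k = 1"
  by (rule powi_unique[symmetric]) auto

lemma grassmann_inverse_mult:
  assumes "body a \<noteq> 0" "body b \<noteq> 0" "geven a" "geven b"
  shows "inverse (a * b) = inverse a * inverse b"
  using powi_mult_distrib[OF assms, of "- 1"] by (simp add: power_int_def)

section \<open>Calculus of superanalytic functions of an even variable\<close>

lemma soul_power_eq_0: "soul z ^ K = 0 \<Longrightarrow> K \<le> l \<Longrightarrow> soul z ^ l = 0"
  by (metis le_add_diff_inverse mult_zero_left power_add)

lemma gext_eq_sum:
  assumes "soul z ^ K = 0"
  shows "gext f z = (\<Sum>l<K. gconst ((deriv ^^ l) f (body z) / fact l) * soul z ^ l)"
  unfolding gext_def
proof (rule sum.mono_neutral_left)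
  show "{l. soul z ^ l \<noteq> 0} \<subseteq> {..<K}"
    using soul_power_eq_0[OF assms] by (auto simp: not_less[symmetric])
qed auto

definition gfin :: "gfun \<Rightarrow> bool" where
  "gfin f \<longleftrightarrow> finite {s. f s \<noteq> 0} \<and> (\<forall>s. f s \<noteq> 0 \<longrightarrow> finite s)"

definition gder :: "gfun \<Rightarrow> gfun" where
  "gder f = (\<lambda>s. deriv (f s))"

definition gval :: "gfun \<Rightarrow> complex \<Rightarrow> grassmann" where
  "gval f x = (\<Sum>s | f s \<noteq> 0. gconst (f s x) * gmono s)"

lemma gcoeff_monomial_sum:
  assumes "finite S" "\<And>s. s \<in> S \<Longrightarrow> finite s"
  shows "gcoeff (\<Sum>s\<in>S. gconst (c s) * gmono s) t = (if t \<in> S then c t else 0)"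
proof -
  have "gcoeff (\<Sum>s\<in>S. gconst (c s) * gmono s) t = (\<Sum>s\<in>S. if s = t then c t else 0)"
    unfolding gcoeff_sum by (rule sum.cong) (auto simp: gcoeff_gmono assms)
  then show ?thesis using assms(1) by simp
qed

lemma gcoeff_gval: "gfin f \<Longrightarrow> gcoeff (gval f x) s = f s x"
  unfolding gval_def by (subst gcoeff_monomial_sum) (auto simp: gfin_def)

lemma gder_funpow: "(gder ^^ l) f s = (deriv ^^ l) (f s)"
  by (induction l) (auto simp: gder_def)

lemma higher_deriv_0: "(deriv ^^ l) (0 :: complex \<Rightarrow> complex) = 0"
  unfolding zero_fun_def by (subst higher_deriv_const) auto

lemma gfin_gder_funpow: "gfin f \<Longrightarrow> gfin ((gder ^^ l) f)"
  unfolding gfin_def gder_funpow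
  by (auto elim!: rev_finite_subset simp: higher_deriv_0) (metis higher_deriv_0)+

lemma gfin_gder: "gfin f \<Longrightarrow> gfin (gder f)"
  using gfin_gder_funpow[of f 1] by simp

text \<open>The Taylor expansion in the soul, with the sum over the monomials carried out first. It makes
  evaluation a statement about jets at the body of the argument.\<close>

lemma gfun_eval_eq:
  assumes "gfin f" "soul z ^ K = 0"
  shows "gfun_eval f z = (\<Sum>l<K. gconst (1 / fact l) * soul z ^ l * gval ((gder ^^ l) f) (body z))"
proof -
  have fin: "finite {s. f s \<noteq> 0}" using assms by (simp add: gfin_def)
  have *: "(\<Sum>s | f s \<noteq> 0. gconst ((deriv ^^ l) (f s) (body z)) * gmono s) = gval ((gder ^^ l) f) (body z)" for l
  proof (rule grassmann_eqI)
    fix t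
    have "gcoeff (\<Sum>s | f s \<noteq> 0. gconst ((deriv ^^ l) (f s) (body z)) * gmono s) t
        = (if f t \<noteq> 0 then (deriv ^^ l) (f t) (body z) else 0)"
      by (subst gcoeff_monomial_sum) (use assms in \<open>auto simp: gfin_def\<close>)
    also have "\<dots> = gcoeff (gval ((gder ^^ l) f) (body z)) t"
      by (simp add: gcoeff_gval gfin_gder_funpow assms gder_funpow higher_deriv_0)
    finally show "gcoeff (\<Sum>s | f s \<noteq> 0. gconst ((deriv ^^ l) (f s) (body z)) * gmono s) t
        = gcoeff (gval ((gder ^^ l) f) (body z)) t" .
  qed
  have **: "gconst (d / fact l) * S * m = gconst (1 / fact l) * S * (gconst d * m)" for d l S m
  proof -
    have "gconst (d / fact l) = gconst (1 / fact l) * gconst d" by (simp add: gconst_mult[symmetric])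
    then show ?thesis by (simp only: mult.assoc gconst_left_commute[of S])
  qed
  have "gfun_eval f z = (\<Sum>s | f s \<noteq> 0. \<Sum>l<K.
      gconst (1 / fact l) * soul z ^ l * (gconst ((deriv ^^ l) (f s) (body z)) * gmono s))"
    unfolding gfun_eval_def gext_eq_sum[OF assms(2)] sum_distrib_right
    by (intro sum.cong refl) (rule **)
  also have "\<dots> = (\<Sum>l<K. gconst (1 / fact l) * soul z ^ l * gval ((gder ^^ l) f) (body z))"
    by (subst sum.swap) (simp only: sum_distrib_left[symmetric] *)
  finally show ?thesis .
qed

lemma gfun_eval_cong:
  assumes "gfin f" "gfin g" "open U" "body z \<in> U" "\<And>s x. x \<in> U \<Longrightarrow> f s x = g s x"
  shows "gfun_eval f z = gfun_eval g z"
proof -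
  obtain K where K: "soul z ^ K = 0" using soul_nilpotent by blast
  have "(deriv ^^ l) (f s) (body z) = (deriv ^^ l) (g s) (body z)" for l s
    by (rule higher_deriv_cong_ev)
      (use eventually_nhds_in_open[OF assms(3,4)] assms(5) in \<open>auto elim!: eventually_mono\<close>)
  then have "gval ((gder ^^ l) f) (body z) = gval ((gder ^^ l) g) (body z)" for l
    by (intro grassmann_eqI) (simp add: gcoeff_gval gfin_gder_funpow assms(1,2) gder_funpow)
  then show ?thesis using gfun_eval_eq[OF _ K] assms(1,2) by simp
qed

lemma gfin_add: "gfin f \<Longrightarrow> gfin g \<Longrightarrow> gfin (\<lambda>s x. f s x + g s x)"
proof -
  assume fg: "gfin f" "gfin g"
  have "f s \<noteq> 0 \<or> g s \<noteq> 0" if "(\<lambda>x. f s x + g s x) \<noteq> 0" for s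
    using that by (auto simp: fun_eq_iff)
  then have sup: "{s. (\<lambda>x. f s x + g s x) \<noteq> 0} \<subseteq> {s. f s \<noteq> 0} \<union> {s. g s \<noteq> 0}" by auto
  show ?thesis unfolding gfin_def
  proof (intro conjI allI impI)
    show "finite {s. (\<lambda>x. f s x + g s x) \<noteq> 0}"
      by (rule finite_subset[OF sup]) (use fg in \<open>simp add: gfin_def\<close>)
    fix s assume "(\<lambda>x. f s x + g s x) \<noteq> 0"
    then have "f s \<noteq> 0 \<or> g s \<noteq> 0" using sup by blast
    then show "finite s" using fg by (auto simp: gfin_def)
  qed
qed

lemma gfun_eval_add:
  assumes "gfin f" "gfin g" "\<And>s. f s holomorphic_on U" "\<And>s. g s holomorphic_on U" "open U"
    "body z \<in> U"
  shows "gfun_eval (\<lambda>s x. f s x + g s x) z = gfun_eval f z + gfun_eval g z"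
proof -
  obtain K where K: "soul z ^ K = 0" using soul_nilpotent by blast
  have "gval ((gder ^^ l) (\<lambda>s x. f s x + g s x)) (body z)
      = gval ((gder ^^ l) f) (body z) + gval ((gder ^^ l) g) (body z)" for l
    by (rule grassmann_eqI)
      (simp add: gcoeff_gval gfin_gder_funpow gfin_add assms gder_funpow higher_deriv_add[OF assms(3-6)])
  then show ?thesis
    by (simp add: gfun_eval_eq[OF _ K] gfin_add assms distrib_left sum.distrib)
qed

subsection \<open>Products\<close>

definition gtimes :: "gfun \<Rightarrow> gfun \<Rightarrow> gfun" where
  "gtimes f g s x = (\<Sum>t\<in>Pow s. gsign t (s - t) * f t x * g (s - t) x)"

lemma gtimes_nonzero:
  assumes "gtimes f g s \<noteq> 0"
  obtains t where "t \<subseteq> s" "finite s" "f t \<noteq> 0" "g (s - t) \<noteq> 0"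
proof -
  obtain x where x: "(\<Sum>t\<in>Pow s. gsign t (s - t) * f t x * g (s - t) x) \<noteq> 0"
    using assms by (auto simp: gtimes_def fun_eq_iff)
  then have "finite s" by (rule contrapos_np) simp
  moreover obtain t where "t \<in> Pow s" "gsign t (s - t) * f t x * g (s - t) x \<noteq> 0"
    using x by (rule sum.not_neutral_contains_not_neutral)
  then have "t \<subseteq> s" "f t x \<noteq> 0" "g (s - t) x \<noteq> 0" by auto
  ultimately show ?thesis using that[of t] by (metis zero_fun_apply)
qed

lemma gfin_gtimes:
  assumes "gfin f" "gfin g"
  shows "gfin (gtimes f g)"
proof -
  have "{s. gtimes f g s \<noteq> 0} \<subseteq> (\<lambda>(t, u). t \<union> u) ` ({s. f s \<noteq> 0} \<times> {s. g s \<noteq> 0})"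
  proof
    fix s assume "s \<in> {s. gtimes f g s \<noteq> 0}"
    then obtain t where "t \<subseteq> s" "f t \<noteq> 0" "g (s - t) \<noteq> 0" by (auto elim: gtimes_nonzero)
    then show "s \<in> (\<lambda>(t, u). t \<union> u) ` ({s. f s \<noteq> 0} \<times> {s. g s \<noteq> 0})"
      by (intro rev_image_eqI[of "(t, s - t)"]) auto
  qed
  moreover have "finite ((\<lambda>(t, u). t \<union> u) ` ({s. f s \<noteq> 0} \<times> {s. g s \<noteq> 0}))"
    using assms by (auto simp: gfin_def)
  ultimately show ?thesis unfolding gfin_def using finite_subset by (blast elim: gtimes_nonzero)
qed

lemma gval_gtimes: "gfin f \<Longrightarrow> gfin g \<Longrightarrow> gval (gtimes f g) x = gval f x * gval g x"
  by (rule grassmann_eqI) (simp add: gcoeff_gval gfin_gtimes gcoeff_mult gtimes_def)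

lemma higher_deriv_sum:
  fixes z :: complex
  assumes "\<And>i. i \<in> A \<Longrightarrow> h i holomorphic_on U" "open U" "z \<in> U"
  shows "(deriv ^^ l) (\<lambda>x. \<Sum>i\<in>A. h i x) z = (\<Sum>i\<in>A. (deriv ^^ l) (h i) z)"
  using assms(1)
proof (induction A rule: infinite_finite_induct)
  case (insert a A)
  then have "(deriv ^^ l) (\<lambda>x. h a x + (\<Sum>i\<in>A. h i x)) z
      = (deriv ^^ l) (h a) z + (deriv ^^ l) (\<lambda>x. \<Sum>i\<in>A. h i x) z"
    by (intro higher_deriv_add[OF _ _ assms(2,3)] holomorphic_on_sum) auto
  then show ?case using insert by simp
qed auto

lemma gval_gder_gtimes:
  assumes "gfin f" "gfin g" "\<And>s. f s holomorphic_on U" "\<And>s. g s holomorphic_on U" "open U" "x \<in> U"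
  shows "gval ((gder ^^ l) (gtimes f g)) x
    = (\<Sum>i\<le>l. gconst (of_nat (l choose i)) * (gval ((gder ^^ i) f) x * gval ((gder ^^ (l - i)) g) x))"
proof (rule grassmann_eqI)
  fix s
  have "(deriv ^^ l) (gtimes f g s) x
      = (\<Sum>t\<in>Pow s. (deriv ^^ l) (\<lambda>x. gsign t (s - t) * f t x * g (s - t) x) x)"
    unfolding gtimes_def
    by (rule higher_deriv_sum[OF _ assms(5,6)]) (intro holomorphic_intros assms)
  also have "\<dots> = (\<Sum>t\<in>Pow s. \<Sum>i\<le>l. of_nat (l choose i) *
      (gsign t (s - t) * (deriv ^^ i) (f t) x * (deriv ^^ (l - i)) (g (s - t)) x))"
  proof (rule sum.cong[OF refl])
    fix t
    have "(deriv ^^ l) (\<lambda>x. gsign t (s - t) * f t x * g (s - t) x) x =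
        (deriv ^^ l) (\<lambda>x. gsign t (s - t) * (f t x * g (s - t) x)) x" by (simp add: mult.assoc)
    also have "\<dots> = gsign t (s - t) * (deriv ^^ l) (\<lambda>x. f t x * g (s - t) x) x"
      by (rule higher_deriv_cmult[OF _ assms(6,5)]) (intro holomorphic_intros assms)
    finally show "(deriv ^^ l) (\<lambda>x. gsign t (s - t) * f t x * g (s - t) x) x = (\<Sum>i\<le>l. of_nat (l choose i) *
      (gsign t (s - t) * (deriv ^^ i) (f t) x * (deriv ^^ (l - i)) (g (s - t)) x))"
      by (simp add: higher_deriv_mult[OF assms(3,4,5,6)] sum_distrib_left atMost_atLeast0 mult_ac)
  qed
  also have "\<dots> = (\<Sum>i\<le>l. of_nat (l choose i) *
      gcoeff (gval ((gder ^^ i) f) x * gval ((gder ^^ (l - i)) g) x) s)"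
    by (subst sum.swap) (simp add: gcoeff_mult gcoeff_gval gfin_gder_funpow assms gder_funpow sum_distrib_left)
  finally show "gcoeff (gval ((gder ^^ l) (gtimes f g)) x) s = gcoeff (\<Sum>i\<le>l. gconst (of_nat (l choose i)) *
      (gval ((gder ^^ i) f) x * gval ((gder ^^ (l - i)) g) x)) s"
    by (simp add: gcoeff_gval gfin_gder_funpow gfin_gtimes assms gder_funpow)
qed

lemma gfun_eval_gtimes:
  assumes "gfin f" "gfin g" "\<And>s. f s holomorphic_on U" "\<And>s. g s holomorphic_on U" "open U"
    "body z \<in> U" "geven z"
  shows "gfun_eval (gtimes f g) z = gfun_eval f z * gfun_eval g z"
proof -
  obtain K where K: "soul z ^ K = 0" using soul_nilpotent by blast
  have K2: "soul z ^ (2 * K) = 0" using soul_power_eq_0[OF K] by simp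
  define F where "F i = gval ((gder ^^ i) f) (body z)" for i
  define G where "G i = gval ((gder ^^ i) g) (body z)" for i
  define A where "A i j = (gconst (1 / fact i) * soul z ^ i * F i) * (gconst (1 / fact j) * soul z ^ j * G j)" for i j
  have comm: "soul z ^ j * a = a * soul z ^ j" for j a using assms(7) by (intro geven_commute) auto
  have A: "A i j = gconst (1 / (fact i * fact j)) * (soul z ^ (i + j) * (F i * G j))" for i j
  proof -
    have "A i j = (gconst (1 / fact i) * gconst (1 / fact j)) * (soul z ^ i * ((F i * soul z ^ j) * G j))"
      unfolding A_def by (simp only: mult.assoc gconst_left_commute[of "F i"] gconst_left_commute[of "soul z ^ i"])
    also have "F i * soul z ^ j = soul z ^ j * F i" by (rule comm[symmetric])
    finally show ?thesis by (simp add: gconst_mult[symmetric] power_add mult.assoc)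
  qed
  have "gfun_eval (gtimes f g) z = (\<Sum>l<2*K. \<Sum>i\<le>l. A i (l - i))"
    unfolding gfun_eval_eq[OF gfin_gtimes[OF assms(1,2)] K2]
  proof (rule sum.cong[OF refl])
    fix l
    have "gconst (1 / fact l) * soul z ^ l * (gconst (of_nat (l choose i)) * (F i * G (l - i))) = A i (l - i)"
      if "i \<le> l" for i
    proof -
      have "gconst (1 / fact l) * soul z ^ l * (gconst (of_nat (l choose i)) * (F i * G (l - i)))
        = (gconst (1 / fact l) * gconst (of_nat (l choose i))) * (soul z ^ l * (F i * G (l - i)))"
        by (simp only: mult.assoc gconst_left_commute[of "soul z ^ l"])
      also have "gconst (1 / fact l) * gconst (of_nat (l choose i)) = gconst (1 / (fact i * fact (l - i)))"
        using that by (simp add: gconst_mult[symmetric] binomial_fact)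
      finally show ?thesis using that by (simp add: A)
    qed
    then show "gconst (1 / fact l) * soul z ^ l * gval ((gder ^^ l) (gtimes f g)) (body z) = (\<Sum>i\<le>l. A i (l - i))"
      unfolding gval_gder_gtimes[OF assms(1-6)] F_def[symmetric] G_def[symmetric]
      by (simp add: sum_distrib_left)
  qed
  also have "\<dots> = (\<Sum>(i, j)\<in>{(i, j). i + j < 2 * K}. A i j)"
    by (rule sum.triangle_reindex[symmetric])
  also have "\<dots> = (\<Sum>(i, j)\<in>{..<K} \<times> {..<K}. A i j)"
  proof (rule sum.mono_neutral_right)
    show "finite {(i, j). i + j < 2 * K}"
      by (rule finite_subset[of _ "{..<2*K} \<times> {..<2*K}"]) auto
    have z0: "A i j = 0" if "(i, j) \<notin> {..<K} \<times> {..<K}" for i j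
    proof -
      have "K \<le> i + j" using that by auto
      then have "soul z ^ (i + j) = 0" by (rule soul_power_eq_0[OF K])
      then show ?thesis by (simp add: A)
    qed
    show "\<forall>p\<in>{(i, j). i + j < 2 * K} - {..<K} \<times> {..<K}. (case p of (i, j) \<Rightarrow> A i j) = 0"
    proof
      fix p assume "p \<in> {(i, j). i + j < 2 * K} - {..<K} \<times> {..<K}"
      then show "(case p of (i, j) \<Rightarrow> A i j) = 0" using z0[of "fst p" "snd p"] by (simp add: case_prod_beta)
    qed
  qed auto
  also have "\<dots> = gfun_eval f z * gfun_eval g z"
    unfolding gfun_eval_eq[OF assms(1) K] gfun_eval_eq[OF assms(2) K] F_def[symmetric] G_def[symmetric]
    by (simp add: sum_product sum.cartesian_product A_def)
  finally show ?thesis .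
qed

subsection \<open>Complex functions at even arguments\<close>

definition gscalar :: "(complex \<Rightarrow> complex) \<Rightarrow> gfun" where
  "gscalar f = (\<lambda>s. if s = {} then f else 0)"

lemma gfin_gscalar: "gfin (gscalar f)"
  unfolding gfin_def gscalar_def by (auto intro: finite_subset[of _ "{{}}"])

lemma gext_0 [simp]: "gext 0 z = 0"
  by (simp add: gext_def higher_deriv_0)

lemma gfun_eval_gscalar: "gfun_eval (gscalar f) z = gext f z"
proof (cases "f = 0")
  case False
  then have "{s. gscalar f s \<noteq> 0} = {{}}" by (auto simp: gscalar_def)
  moreover have "gmono {} = 1" by (rule grassmann_eqI) (auto simp: gcoeff_gmono gcoeff_1)
  ultimately show ?thesis by (simp add: gfun_eval_def gscalar_def)
qed (auto simp: gfun_eval_def gscalar_def)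

lemma gder_gscalar: "gder (gscalar f) = gscalar (deriv f)"
  using higher_deriv_0[of 1] by (auto simp: gder_def gscalar_def)

lemma gtimes_gscalar: "gtimes (gscalar f) (gscalar g) = gscalar (\<lambda>x. f x * g x)"
proof (intro ext)
  fix s x
  show "gtimes (gscalar f) (gscalar g) s x = gscalar (\<lambda>x. f x * g x) s x"
  proof (cases "s = {}")
    case False
    then have "gtimes (gscalar f) (gscalar g) s x = 0"
      unfolding gtimes_def gscalar_def by (intro sum.neutral) auto
    then show ?thesis using False by (simp add: gscalar_def)
  qed (simp add: gtimes_def gscalar_def)
qed

lemma gext_cong:
  assumes "open U" "body z \<in> U" "\<And>x. x \<in> U \<Longrightarrow> f x = g x"
  shows "gext f z = gext g z"
  unfolding gfun_eval_gscalar[symmetric]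
  by (rule gfun_eval_cong[OF gfin_gscalar gfin_gscalar assms(1,2)]) (simp add: gscalar_def assms(3))

lemma gext_mult:
  assumes "f holomorphic_on U" "g holomorphic_on U" "open U" "body z \<in> U" "geven z"
  shows "gext (\<lambda>x. f x * g x) z = gext f z * gext g z"
  unfolding gfun_eval_gscalar[symmetric] gtimes_gscalar[symmetric]
  by (rule gfun_eval_gtimes[OF gfin_gscalar gfin_gscalar _ _ assms(3-5)])
    (auto simp: gscalar_def zero_fun_def intro!: assms holomorphic_intros)

lemma gext_add:
  assumes "f holomorphic_on U" "g holomorphic_on U" "open U" "body z \<in> U"
  shows "gext (\<lambda>x. f x + g x) z = gext f z + gext g z"
proof -
  obtain K where K: "soul z ^ K = 0" using soul_nilpotent by blast
  show ?thesis unfolding gext_eq_sum[OF K]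
    by (simp add: higher_deriv_add[OF assms] add_divide_distrib gconst_add algebra_simps sum.distrib)
qed

lemma gext_const [simp]: "gext (\<lambda>x. c) z = gconst c"
proof -
  obtain K where "soul z ^ K = 0" using soul_nilpotent by blast
  then have K: "soul z ^ Suc K = 0" by simp
  have "(\<Sum>l<Suc K. gconst ((deriv ^^ l) (\<lambda>x. c) (body z) / fact l) * soul z ^ l)
      = (\<Sum>l<Suc K. if l = 0 then gconst c else 0)"
    by (rule sum.cong) auto
  then show ?thesis unfolding gext_eq_sum[OF K] by simp
qed

lemma gext_ident [simp]: "gext (\<lambda>x. x) z = z"
proof -
  obtain K where "soul z ^ K = 0" using soul_nilpotent by blast
  then have K: "soul z ^ (K + 2) = 0" using soul_power_eq_0 le_add1 by blast
  have "gext (\<lambda>x. x) z = (\<Sum>l\<in>{0, 1}. gconst ((deriv ^^ l) (\<lambda>x. x) (body z) / fact l) * soul z ^ l)"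
    unfolding gext_eq_sum[OF K] by (rule sum.mono_neutral_right) (auto split: if_splits)
  then show ?thesis by (simp add: body_plus_soul)
qed

lemma gext_cmult:
  assumes "f holomorphic_on U" "open U" "body z \<in> U" "geven z"
  shows "gext (\<lambda>x. c * f x) z = gconst c * gext f z"
  using gext_mult[of "\<lambda>_. c" U f z] assms by simp

lemma gext_uminus:
  assumes "f holomorphic_on U" "open U" "body z \<in> U" "geven z"
  shows "gext (\<lambda>x. - f x) z = - gext f z"
  using gext_cmult[OF assms, of "- 1"] by (simp add: gconst_uminus)

lemma gext_gconst [simp]: "gext f (gconst c) = gconst (f c)"
proof -
  have "soul (gconst c) ^ 1 = 0" by (simp add: soul_def)
  then show ?thesis using gext_eq_sum[of "gconst c" 1 f] by simp
qed

lemma body_gext [simp]: "body (gext f z) = f (body z)"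
proof -
  obtain K where "soul z ^ K = 0" using soul_nilpotent by blast
  then have K: "soul z ^ Suc K = 0" by simp
  have "body (gext f z) = (\<Sum>l<Suc K. if l = 0 then f (body z) else 0)"
    unfolding gext_eq_sum[OF K] body_sum by (rule sum.cong) auto
  then show ?thesis by simp
qed

lemma galg_gext [intro, simp]: "z \<in> galg N \<Longrightarrow> gext f z \<in> galg N"
  unfolding gext_def by auto

lemma geven_gext [intro, simp]: "geven z \<Longrightarrow> geven (gext f z)"
  unfolding gext_def by auto

lemma gext_inverse:
  assumes "f holomorphic_on U" "open U" "body z \<in> U" "geven z" "\<And>x. x \<in> U \<Longrightarrow> f x \<noteq> 0"
  shows "gext (\<lambda>x. inverse (f x)) z = inverse (gext f z)"
proof -
  have "gext f z * gext (\<lambda>x. inverse (f x)) z = gext (\<lambda>x. f x * inverse (f x)) z"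
    by (rule gext_mult[symmetric, where U = U]) (use assms in \<open>auto intro!: holomorphic_intros\<close>)
  also have "\<dots> = gext (\<lambda>x. 1) z" by (rule gext_cong[where U = U]) (use assms in auto)
  finally have "gext f z * gext (\<lambda>x. inverse (f x)) z = 1" by simp
  then show ?thesis
    using grassmann_inverse_eqI assms(4) geven_commute geven_gext by metis
qed

lemma gext_powi:
  assumes "body z \<noteq> 0" "geven z"
  shows "gext (\<lambda>x. x powi k) z = z powi k"
proof (rule powi_unique[OF assms(1)])
  fix k
  have "gext (\<lambda>x. x powi (k + 1)) z = gext (\<lambda>x. x powi k * x) z"
    by (rule gext_cong[where U = "- {0}"]) (use assms in \<open>auto simp: power_int_add\<close>)
  also have "\<dots> = gext (\<lambda>x. x powi k) z * gext (\<lambda>x. x) z"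
    by (rule gext_mult[where U = "- {0}"]) (use assms in \<open>auto intro!: holomorphic_intros\<close>)
  finally show "gext (\<lambda>x. x powi (k + 1)) z = gext (\<lambda>x. x powi k) z * z" by simp
qed simp

subsection \<open>Superanalytic functions and their derivatives\<close>

text \<open>A superanalytic function is handled through its values together with those of its derivative,
  so that the coefficient functions do not have to be carried along.\<close>

definition superdiff :: "enat \<Rightarrow> complex set \<Rightarrow> (grassmann \<Rightarrow> grassmann) \<Rightarrow> (grassmann \<Rightarrow> grassmann) \<Rightarrow> bool" where
  "superdiff N U \<Phi> \<Phi>' \<longleftrightarrow> (\<exists>f. gfun_on N U f \<and>
     (\<forall>z. geven z \<and> body z \<in> U \<longrightarrow> \<Phi> z = gfun_eval f z \<and> \<Phi>' z = gfun_eval (gder f) z))"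

lemma gfun_on_gfin: "gfun_on N U f \<Longrightarrow> gfin f"
  by (simp add: gfun_on_def gfin_def)

lemma gfun_on_holomorphic: "gfun_on N U f \<Longrightarrow> f s holomorphic_on U"
  by (simp add: gfun_on_def)

lemma gfun_on_gder:
  assumes "gfun_on N U f" "open U"
  shows "gfun_on N U (gder f)"
proof -
  have "gfin (gder f)" using gfin_gder gfun_on_gfin[OF assms(1)] by blast
  moreover have "gder f s \<noteq> 0 \<Longrightarrow> f s \<noteq> 0" for s
    using higher_deriv_0[of 1] by (auto simp: gder_def)
  ultimately show ?thesis using assms
    unfolding gfun_on_def gfin_def by (auto simp: gder_def intro!: holomorphic_deriv)
qed

lemma superdiffE:
  assumes "superdiff N U \<Phi> \<Phi>'"
  obtains f where "gfun_on N U f" "gfin f" "\<And>s. f s holomorphic_on U"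
    "\<And>z. geven z \<Longrightarrow> body z \<in> U \<Longrightarrow> \<Phi> z = gfun_eval f z"
    "\<And>z. geven z \<Longrightarrow> body z \<in> U \<Longrightarrow> \<Phi>' z = gfun_eval (gder f) z"
  using assms unfolding superdiff_def by (metis gfun_on_gfin gfun_on_def)

lemma superdiff_deriv:
  assumes "superdiff N U \<Phi> \<Phi>'" "open U"
  obtains \<Phi>'' where "superdiff N U \<Phi>' \<Phi>''"
  using assms gfun_on_gder unfolding superdiff_def by metis

lemma superdiff_cong:
  assumes "superdiff N U \<Phi> \<Phi>'"
    "\<And>z. geven z \<Longrightarrow> body z \<in> U \<Longrightarrow> \<Psi> z = \<Phi> z" "\<And>z. geven z \<Longrightarrow> body z \<in> U \<Longrightarrow> \<Psi>' z = \<Phi>' z"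
  shows "superdiff N U \<Psi> \<Psi>'"
  using assms unfolding superdiff_def by metis

lemma superdiff_gext:
  assumes "f holomorphic_on U"
  shows "superdiff N U (gext f) (gext (deriv f))"
  unfolding superdiff_def
proof (intro exI conjI allI impI)
  show "gfun_on N U (gscalar f)"
    using assms gfin_gscalar[of f] unfolding gfun_on_def gfin_def
    by (auto simp: gscalar_def zero_fun_def split: if_splits)
qed (simp_all add: gfun_eval_gscalar gder_gscalar)

lemma superdiff_ident: "superdiff N U (\<lambda>z. z) (\<lambda>z. 1)"
proof -
  have "deriv (\<lambda>x. x) = (\<lambda>x. 1::complex)" by auto
  moreover have "gext (\<lambda>x. x) = (\<lambda>z. z)" "gext (\<lambda>x. 1) = (\<lambda>z. 1)" by (simp_all add: fun_eq_iff)
  ultimately show ?thesis using superdiff_gext[of "\<lambda>x. x" U N] by (simp add: holomorphic_intros)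
qed

lemma superdiff_const:
  assumes "a \<in> galg N"
  shows "superdiff N U (\<lambda>z. a) (\<lambda>z. 0)"
  unfolding superdiff_def
proof (intro exI conjI allI impI)
  let ?f = "\<lambda>s x. gcoeff a s"
  have nz: "?f s \<noteq> 0 \<longleftrightarrow> gcoeff a s \<noteq> 0" for s by (auto simp: fun_eq_iff)
  have fin: "finite {s. ?f s \<noteq> 0}" unfolding nz by (rule finite_gcoeff)
  have fs: "gcoeff a s \<noteq> 0 \<Longrightarrow> finite s" for s using gcoeff_infinite by blast
  show "gfun_on N U ?f" using assms fin unfolding gfun_on_def nz galg_def by (auto simp: fs)
  fix z
  show "0 = gfun_eval (gder ?f) z" by (simp add: gfun_eval_def gder_def zero_fun_def)
  show "a = gfun_eval ?f z"
  proof (rule grassmann_eqI)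
    fix t
    show "gcoeff a t = gcoeff (gfun_eval ?f z) t"
      unfolding gfun_eval_def gext_const
      by (subst gcoeff_monomial_sum[OF fin]) (auto simp: nz fs)
  qed
qed

lemma superdiff_mult:
  assumes "superdiff N U \<Phi> \<Phi>'" "superdiff N U \<Psi> \<Psi>'" "open U"
  shows "superdiff N U (\<lambda>z. \<Phi> z * \<Psi> z) (\<lambda>z. \<Phi>' z * \<Psi> z + \<Phi> z * \<Psi>' z)"
proof -
  obtain f where f: "gfun_on N U f" "gfin f" "\<And>s. f s holomorphic_on U"
    "\<And>z. geven z \<Longrightarrow> body z \<in> U \<Longrightarrow> \<Phi> z = gfun_eval f z"
    "\<And>z. geven z \<Longrightarrow> body z \<in> U \<Longrightarrow> \<Phi>' z = gfun_eval (gder f) z"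
    by (rule superdiffE[OF assms(1)]) metis
  obtain g where g: "gfun_on N U g" "gfin g" "\<And>s. g s holomorphic_on U"
    "\<And>z. geven z \<Longrightarrow> body z \<in> U \<Longrightarrow> \<Psi> z = gfun_eval g z"
    "\<And>z. geven z \<Longrightarrow> body z \<in> U \<Longrightarrow> \<Psi>' z = gfun_eval (gder g) z"
    by (rule superdiffE[OF assms(2)]) metis
  have hol: "gder f s holomorphic_on U" "gder g s holomorphic_on U" for s
    by (rule gfun_on_holomorphic[OF gfun_on_gder[OF f(1) assms(3)]]
        gfun_on_holomorphic[OF gfun_on_gder[OF g(1) assms(3)]])+
  have "gfun_on N U (gtimes f g)"
    unfolding gfun_on_def
  proof (intro conjI allI impI ballI)
    show "finite {s. gtimes f g s \<noteq> 0}" "gtimes f g s \<noteq> 0 \<Longrightarrow> finite s" for s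
      using gfin_gtimes[OF f(2) g(2)] by (auto simp: gfin_def)
    show "gtimes f g s holomorphic_on U" for s
      unfolding gtimes_def by (intro holomorphic_intros f g)
    fix s i assume "gtimes f g s \<noteq> 0" "i \<in> s"
    then show "enat i < N" using f(1) g(1) unfolding gfun_on_def by (elim gtimes_nonzero) blast
  qed
  moreover have "gfun_eval (gtimes f g) z = \<Phi> z * \<Psi> z" if "geven z" "body z \<in> U" for z
    using gfun_eval_gtimes[OF f(2) g(2) f(3) g(3) assms(3)] that f(4) g(4) by simp
  moreover have "gfun_eval (gder (gtimes f g)) z = \<Phi>' z * \<Psi> z + \<Phi> z * \<Psi>' z" if z: "geven z" "body z \<in> U" for z
  proof -
    define h where "h = (\<lambda>s x. gtimes (gder f) g s x + gtimes f (gder g) s x)"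
    note fin = gfin_gtimes[OF gfin_gder[OF f(2)] g(2)] gfin_gtimes[OF f(2) gfin_gder[OF g(2)]]
    have hol2: "gtimes (gder f) g s holomorphic_on U" "gtimes f (gder g) s holomorphic_on U" for s
      unfolding gtimes_def by (intro holomorphic_intros f(3) g(3) hol)+
    have hfin: "gfin h" unfolding h_def by (rule gfin_add[OF fin])
    have "gfun_eval (gder (gtimes f g)) z = gfun_eval h z"
    proof (rule gfun_eval_cong[OF _ hfin assms(3) z(2)])
      show "gfin (gder (gtimes f g))" using gfin_gder gfin_gtimes f g by blast
      fix s x assume x: "x \<in> U"
      have "gcoeff (gval ((gder ^^ 1) (gtimes f g)) x) s = gcoeff (gval f x * gval (gder g) x + gval (gder f) x * gval g x) s"
        using gval_gder_gtimes[OF f(2) g(2) f(3) g(3) assms(3) x, of 1] by (simp add: atMost_Suc)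
      then show "gder (gtimes f g) s x = h s x"
        using f(2) g(2) by (simp add: gcoeff_gval gval_gtimes[symmetric] gfin_gtimes gfin_gder h_def)
    qed
    also have "\<dots> = gfun_eval (gtimes (gder f) g) z + gfun_eval (gtimes f (gder g)) z"
      unfolding h_def
      by (rule gfun_eval_add[OF fin hol2 assms(3) z(2)])
    finally show ?thesis
      using gfun_eval_gtimes[OF gfin_gder[OF f(2)] g(2) hol(1) g(3) assms(3) z(2,1)]
        gfun_eval_gtimes[OF f(2) gfin_gder[OF g(2)] f(3) hol(2) assms(3) z(2,1)] z f g by simp
  qed
  ultimately show ?thesis unfolding superdiff_def by (intro exI[of _ "gtimes f g"]) auto
qed

lemma superdiff_add:
  assumes "superdiff N U \<Phi> \<Phi>'" "superdiff N U \<Psi> \<Psi>'" "open U"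
  shows "superdiff N U (\<lambda>z. \<Phi> z + \<Psi> z) (\<lambda>z. \<Phi>' z + \<Psi>' z)"
proof -
  obtain f where f: "gfun_on N U f" "gfin f" "\<And>s. f s holomorphic_on U"
    "\<And>z. geven z \<Longrightarrow> body z \<in> U \<Longrightarrow> \<Phi> z = gfun_eval f z"
    "\<And>z. geven z \<Longrightarrow> body z \<in> U \<Longrightarrow> \<Phi>' z = gfun_eval (gder f) z"
    by (rule superdiffE[OF assms(1)]) metis
  obtain g where g: "gfun_on N U g" "gfin g" "\<And>s. g s holomorphic_on U"
    "\<And>z. geven z \<Longrightarrow> body z \<in> U \<Longrightarrow> \<Psi> z = gfun_eval g z"
    "\<And>z. geven z \<Longrightarrow> body z \<in> U \<Longrightarrow> \<Psi>' z = gfun_eval (gder g) z"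
    by (rule superdiffE[OF assms(2)]) metis
  let ?h = "\<lambda>s x. f s x + g s x"
  have hol: "gder f s holomorphic_on U" "gder g s holomorphic_on U" for s
    by (rule gfun_on_holomorphic[OF gfun_on_gder[OF f(1) assms(3)]]
        gfun_on_holomorphic[OF gfun_on_gder[OF g(1) assms(3)]])+
  have nz: "f s \<noteq> 0 \<or> g s \<noteq> 0" if "?h s \<noteq> 0" for s
    using that by (auto simp: fun_eq_iff)
  have "gfun_on N U ?h"
    unfolding gfun_on_def
  proof (intro conjI allI impI ballI)
    show "finite {s. ?h s \<noteq> 0}" "?h s \<noteq> 0 \<Longrightarrow> finite s" for s
      using gfin_add[OF f(2) g(2)] by (auto simp: gfin_def)
    show "?h s holomorphic_on U" for s by (intro holomorphic_intros f g)
    fix s i assume "?h s \<noteq> 0" "i \<in> s"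
    then show "enat i < N" using f(1) g(1) nz[of s] unfolding gfun_on_def by blast
  qed
  moreover have "gfun_eval ?h z = \<Phi> z + \<Psi> z" if "geven z" "body z \<in> U" for z
    using gfun_eval_add[OF f(2) g(2) f(3) g(3) assms(3)] that f(4) g(4) by simp
  moreover have "gfun_eval (gder ?h) z = \<Phi>' z + \<Psi>' z" if z: "geven z" "body z \<in> U" for z
  proof -
    have "gfun_eval (gder ?h) z = gfun_eval (\<lambda>s x. gder f s x + gder g s x) z"
    proof (rule gfun_eval_cong[OF _ _ assms(3) z(2)])
      fix s x assume "x \<in> U"
      then show "gder ?h s x = gder f s x + gder g s x"
        unfolding gder_def
        by (intro deriv_add holomorphic_on_imp_differentiable_at[OF f(3) assms(3)]
          holomorphic_on_imp_differentiable_at[OF g(3) assms(3)])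
    qed (use f g in \<open>auto intro!: gfin_gder gfin_add\<close>)
    then show ?thesis
      using gfun_eval_add[OF gfin_gder[OF f(2)] gfin_gder[OF g(2)] hol assms(3) z(2)] f g z by simp
  qed
  ultimately show ?thesis unfolding superdiff_def by (intro exI[of _ ?h]) auto
qed

lemma superdiff_cmult:
  assumes "superdiff N U \<Phi> \<Phi>'" "open U" "a \<in> galg N"
  shows "superdiff N U (\<lambda>z. a * \<Phi> z) (\<lambda>z. a * \<Phi>' z)"
  using superdiff_mult[OF superdiff_const[OF assms(3)] assms(1,2)] by simp

text \<open>The values at complex points determine the coefficient functions, hence the derivative.\<close>

lemma superdiff_unique:
  assumes "superdiff N U \<Phi> \<Phi>'" "superdiff N U \<Psi> \<Psi>'" "open U"
    "\<And>z. geven z \<Longrightarrow> body z \<in> U \<Longrightarrow> \<Phi> z = \<Psi> z" "geven z" "body z \<in> U"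
  shows "\<Phi>' z = \<Psi>' z"
proof -
  obtain f where f: "gfun_on N U f" "gfin f" "\<And>s. f s holomorphic_on U"
    "\<And>z. geven z \<Longrightarrow> body z \<in> U \<Longrightarrow> \<Phi> z = gfun_eval f z"
    "\<And>z. geven z \<Longrightarrow> body z \<in> U \<Longrightarrow> \<Phi>' z = gfun_eval (gder f) z"
    by (rule superdiffE[OF assms(1)]) metis
  obtain g where g: "gfun_on N U g" "gfin g" "\<And>s. g s holomorphic_on U"
    "\<And>z. geven z \<Longrightarrow> body z \<in> U \<Longrightarrow> \<Psi> z = gfun_eval g z"
    "\<And>z. geven z \<Longrightarrow> body z \<in> U \<Longrightarrow> \<Psi>' z = gfun_eval (gder g) z"
    by (rule superdiffE[OF assms(2)]) metis
  have ev: "gfun_eval h (gconst x) = gval h x" if "gfin h" for h x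
    using gfun_eval_eq[OF that, of "gconst x" 1] by (simp add: soul_def)
  have eq: "f s x = g s x" if "x \<in> U" for s x
    using ev[OF f(2)] ev[OF g(2)] f(4)[of "gconst x"] g(4)[of "gconst x"] assms(4)[of "gconst x"] that
      gcoeff_gval[OF f(2), of x s] gcoeff_gval[OF g(2), of x s] by simp
  have "gfun_eval (gder f) z = gfun_eval (gder g) z"
  proof (rule gfun_eval_cong[OF gfin_gder[OF f(2)] gfin_gder[OF g(2)] assms(3,6)])
    fix s x assume "x \<in> U"
    then show "gder f s x = gder g s x" unfolding gder_def
      by (intro deriv_cong_ev eventually_mono[OF eventually_nhds_in_open[OF assms(3) \<open>x \<in> U\<close>]] eq) auto
  qed
  then show ?thesis using f(5) g(5) assms(5,6) by simp
qed

subsection \<open>Inverses and powers\<close>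

lemma gval_in_galg:
  assumes "gfun_on N U f"
  shows "gval f x \<in> galg N"
proof -
  have "gcoeff (gval f x) s \<noteq> 0 \<Longrightarrow> f s \<noteq> 0" for s
    using gcoeff_gval[OF gfun_on_gfin[OF assms], of x s] by (metis zero_fun_apply)
  then show ?thesis using assms unfolding galg_def gfun_on_def by blast
qed

lemma gfin_bound:
  assumes "gfin f"
  obtains m where "\<And>x. gval f x \<in> galg (enat m)"
proof -
  have "finite (\<Union>{s. f s \<noteq> 0})" using assms unfolding gfin_def by (intro finite_Union) auto
  then obtain m where m: "\<forall>i\<in>\<Union>{s. f s \<noteq> 0}. i < m" using finite_nat_set_iff_bounded by blast
  have "gval f x \<in> galg (enat m)" for x
    unfolding galg_def
  proof (clarify)
    fix s i assume "gcoeff (gval f x) s \<noteq> 0" "i \<in> s"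
    then have "f s \<noteq> 0" using gcoeff_gval[OF assms, of x s] by (metis zero_fun_apply)
    then show "enat i < enat m" using m \<open>i \<in> s\<close> by auto
  qed
  then show ?thesis using that by blast
qed

text \<open>The coefficients of an inverse are rational functions of those of the given function, by
  recursion on the size of the monomial; in particular they are holomorphic where the body of the
  function does not vanish.\<close>

lemma inverse_coefficients_holomorphic:
  assumes "gfin f" "\<And>s. f s holomorphic_on U" "\<And>x. x \<in> U \<Longrightarrow> f {} x \<noteq> 0"
  shows "(\<lambda>x. gcoeff (inverse (gval f x)) s) holomorphic_on U"
proof (induction "card s" arbitrary: s rule: less_induct)
  case less
  let ?b = "\<lambda>s x. gcoeff (inverse (gval f x)) s"
  show ?case
  proof (cases "finite s")
    case True
    have body: "body (gval f x) = f {} x" for x using gcoeff_gval[OF assms(1)] by (simp add: body_def)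
    have hol: "(\<lambda>x. ((if s = {} then 1 else 0)
        - (\<Sum>t\<in>Pow s - {{}}. gsign t (s - t) * f t x * ?b (s - t) x)) / f {} x) holomorphic_on U"
    proof (intro holomorphic_intros assms)
      fix t assume "t \<in> Pow s - {{}}"
      then show "?b (s - t) holomorphic_on U" using True by (intro less) (auto intro: psubset_card_mono)
    qed (use assms(3) in auto)
    show ?thesis
    proof (rule holomorphic_transform[OF hol])
      fix x assume x: "x \<in> U"
      have "gcoeff (gval f x * inverse (gval f x)) s = (if s = {} then 1 else 0)"
        using assms(3)[OF x] body[of x] by (simp add: gcoeff_1)
      moreover have "gcoeff (gval f x * inverse (gval f x)) s
          = f {} x * ?b s x + (\<Sum>t\<in>Pow s - {{}}. gsign t (s - t) * f t x * ?b (s - t) x)"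
        unfolding gcoeff_mult gcoeff_gval[OF assms(1)] using True
        by (subst sum.remove[of _ "{}"]) auto
      ultimately show "((if s = {} then 1 else 0)
        - (\<Sum>t\<in>Pow s - {{}}. gsign t (s - t) * f t x * ?b (s - t) x)) / f {} x = ?b s x"
        using assms(3)[OF x] by (simp add: field_simps)
    qed
  qed (simp add: gcoeff_infinite)
qed

lemma superdiff_inverse:
  assumes "superdiff N U \<Phi> \<Phi>'" "open U"
    "\<And>z. geven z \<Longrightarrow> body z \<in> U \<Longrightarrow> geven (\<Phi> z) \<and> body (\<Phi> z) \<noteq> 0"
  shows "superdiff N U (\<lambda>z. inverse (\<Phi> z)) (\<lambda>z. - (inverse (\<Phi> z) * inverse (\<Phi> z) * \<Phi>' z))"
proof -
  obtain f where f: "gfun_on N U f" "gfin f" "\<And>s. f s holomorphic_on U"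
    "\<And>z. geven z \<Longrightarrow> body z \<in> U \<Longrightarrow> \<Phi> z = gfun_eval f z"
    "\<And>z. geven z \<Longrightarrow> body z \<in> U \<Longrightarrow> \<Phi>' z = gfun_eval (gder f) z"
    by (rule superdiffE[OF assms(1)]) metis
  have ev: "gfun_eval h (gconst x) = gval h x" if "gfin h" for h x
    using gfun_eval_eq[OF that, of "gconst x" 1] by (simp add: soul_def)
  have body: "body (gval f x) = f {} x" for x using gcoeff_gval[OF f(2)] by (simp add: body_def)
  have nz: "f {} x \<noteq> 0" if "x \<in> U" for x
    using assms(3)[of "gconst x"] f(4)[of "gconst x"] that ev[OF f(2), of x] body by simp
  obtain m where m: "\<And>x. gval f x \<in> galg (enat m)" using gfin_bound[OF f(2)] by blast
  define g where "g = (\<lambda>s x. if x \<in> U then gcoeff (inverse (gval f x)) s else 0)"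
  have gnz: "finite s \<and> (\<forall>i\<in>s. enat i < N \<and> enat i < enat m)" if "g s \<noteq> 0" for s
  proof -
    have "\<exists>x. g s x \<noteq> 0" using that by (auto simp: fun_eq_iff)
    then obtain x where x: "x \<in> U" "gcoeff (inverse (gval f x)) s \<noteq> 0"
      by (auto simp: g_def split: if_splits)
    have "inverse (gval f x) \<in> galg N" "inverse (gval f x) \<in> galg (enat m)"
      using nz[OF x(1)] body gval_in_galg[OF f(1)] m by (auto intro!: galg_inverse)
    then show ?thesis using x(2) gcoeff_infinite unfolding galg_def by blast
  qed
  have "{s. g s \<noteq> 0} \<subseteq> Pow {..<m}" using gnz by fastforce
  then have gfing: "gfin g" unfolding gfin_def using gnz finite_subset by blast
  have ghol: "g s holomorphic_on U" for s
    by (rule holomorphic_transform[OF inverse_coefficients_holomorphic[OF f(2,3) nz, of s]])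
      (auto simp: g_def)
  have gon: "gfun_on N U g" using gfing gnz ghol unfolding gfun_on_def gfin_def by blast
  have ginv: "gfun_eval g z = inverse (\<Phi> z)" if z: "geven z" "body z \<in> U" for z
  proof -
    have "\<Phi> z * gfun_eval g z = gfun_eval (gtimes f g) z"
      using gfun_eval_gtimes[OF f(2) gfing f(3) ghol assms(2) z(2,1)] f(4)[OF z] by simp
    also have "\<dots> = gfun_eval (gscalar (\<lambda>_. 1)) z"
    proof (rule gfun_eval_cong[OF gfin_gtimes[OF f(2) gfing] gfin_gscalar assms(2) z(2)])
      fix s x assume x: "x \<in> U"
      have "gtimes f g s x = gcoeff (gval f x * inverse (gval f x)) s"
        unfolding gtimes_def gcoeff_mult gcoeff_gval[OF f(2)] using x by (simp add: g_def)
      then show "gtimes f g s x = gscalar (\<lambda>_. 1) s x"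
        using nz[OF x] body by (simp add: gcoeff_1 gscalar_def)
    qed
    finally have "\<Phi> z * gfun_eval g z = 1" by (simp add: gfun_eval_gscalar)
    then show ?thesis using grassmann_inverse_eqI assms(3)[OF z] geven_commute by metis
  qed
  have sg: "superdiff N U (\<lambda>z. inverse (\<Phi> z)) (gfun_eval (gder g))"
    unfolding superdiff_def using gon ginv by auto
  have "gfun_eval (gder g) z = - (inverse (\<Phi> z) * inverse (\<Phi> z) * \<Phi>' z)" if z: "geven z" "body z \<in> U" for z
  proof -
    have "\<Phi>' z * inverse (\<Phi> z) + \<Phi> z * gfun_eval (gder g) z = 0"
      by (rule superdiff_unique[OF superdiff_mult[OF assms(1) sg assms(2)] superdiff_const[of 1] assms(2) _ z])
        (use assms(3) in auto)
    then have "\<Phi> z * gfun_eval (gder g) z = - (\<Phi>' z * inverse (\<Phi> z))"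
      by (metis add.commute eq_neg_iff_add_eq_0)
    then have "inverse (\<Phi> z) * (\<Phi> z * gfun_eval (gder g) z) = - (inverse (\<Phi> z) * (\<Phi>' z * inverse (\<Phi> z)))"
      by simp
    moreover have "inverse (\<Phi> z) * (\<Phi> z * gfun_eval (gder g) z) = gfun_eval (gder g) z"
      using assms(3)[OF z] by (simp add: mult.assoc[symmetric])
    moreover have "\<Phi>' z * inverse (\<Phi> z) = inverse (\<Phi> z) * \<Phi>' z"
      using assms(3)[OF z] geven_commute[of "inverse (\<Phi> z)"] by simp
    ultimately show ?thesis by (simp add: mult.assoc)
  qed
  then show ?thesis by (intro superdiff_cong[OF sg]) simp_all
qed

lemma superdiff_power:
  assumes "superdiff N U \<Phi> \<Phi>'" "open U" "\<And>z. geven z \<Longrightarrow> body z \<in> U \<Longrightarrow> geven (\<Phi> z)"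
  shows "superdiff N U (\<lambda>z. \<Phi> z ^ k) (\<lambda>z. gconst (of_nat k) * \<Phi> z ^ (k - 1) * \<Phi>' z)"
proof (induction k)
  case 0
  show ?case using superdiff_const[of 1 N U] by simp
next
  case (Suc k)
  have "\<Phi> z * (gconst (of_nat k) * \<Phi> z ^ (k - 1) * \<Phi>' z) = gconst (of_nat k) * \<Phi> z ^ k * \<Phi>' z" for z
    by (cases k) (simp_all add: mult.assoc gconst_left_commute[of "\<Phi> z"])
  moreover have "\<Phi>' z * \<Phi> z ^ k = \<Phi> z ^ k * \<Phi>' z" if "geven z" "body z \<in> U" for z
    using assms(3)[OF that] geven_commute[of "\<Phi> z ^ k" "\<Phi>' z"] by simp
  ultimately show ?case
    by (intro superdiff_cong[OF superdiff_mult[OF assms(1) Suc assms(2)]])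
      (simp_all add: gconst_add algebra_simps)
qed

lemma superdiff_powi:
  assumes "superdiff N U \<Phi> \<Phi>'" "open U"
    "\<And>z. geven z \<Longrightarrow> body z \<in> U \<Longrightarrow> geven (\<Phi> z) \<and> body (\<Phi> z) \<noteq> 0"
  shows "superdiff N U (\<lambda>z. \<Phi> z powi k) (\<lambda>z. gconst (of_int k) * \<Phi> z powi (k - 1) * \<Phi>' z)"
proof (cases "k \<ge> 0")
  case True
  then obtain m where k: "k = int m" using nonneg_int_cases by blast
  have "gconst (of_int k) * \<Phi> z powi (k - 1) * \<Phi>' z = gconst (of_nat m) * \<Phi> z ^ (m - 1) * \<Phi>' z" for z
    by (cases m) (simp_all add: k power_int_def)
  then show ?thesis
    by (intro superdiff_cong[OF superdiff_power[OF assms(1,2), of m]]) (use assms(3) in \<open>simp_all add: k\<close>)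
next
  case False
  define m where "m = nat (- k)"
  have k: "k = - int m" "m > 0" using False by (auto simp: m_def)
  have inv: "superdiff N U (\<lambda>z. inverse (\<Phi> z) ^ m)
    (\<lambda>z. gconst (of_nat m) * inverse (\<Phi> z) ^ (m - 1) * - (inverse (\<Phi> z) * inverse (\<Phi> z) * \<Phi>' z))"
    by (rule superdiff_power[OF superdiff_inverse[OF assms] assms(2)]) (use assms(3) in auto)
  show ?thesis
  proof (rule superdiff_cong[OF inv])
    fix z assume z: "geven z" "body z \<in> U"
    show "\<Phi> z powi k = inverse (\<Phi> z) ^ m" using k by (simp add: power_int_def)
    have pc: "a ^ i * (a * a) = a * (a * a ^ i)" for a :: grassmann and i
      by (metis mult.assoc power_commutes)
    have "\<Phi> z powi (k - 1) = inverse (\<Phi> z) ^ (m - 1) * (inverse (\<Phi> z) * inverse (\<Phi> z))"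
      using k by (cases m) (simp_all add: power_int_def nat_add_distrib mult.assoc pc)
    then show "gconst (of_int k) * \<Phi> z powi (k - 1) * \<Phi>' z =
      gconst (of_nat m) * inverse (\<Phi> z) ^ (m - 1) * - (inverse (\<Phi> z) * inverse (\<Phi> z) * \<Phi>' z)"
      by (simp add: k gconst_uminus mult.assoc)
  qed
qed

section \<open>Superconformal maps\<close>

lemma gfun_eval_0 [simp]: "gfun_eval 0 z = 0"
  and gder_0 [simp]: "gder 0 = 0"
  using higher_deriv_0[of 1] by (simp_all add: gfun_eval_def gder_def fun_eq_iff)

lemma gfun_on_0 [simp]: "gfun_on N U 0"
  by (auto simp: gfun_on_def zero_fun_def)

lemma gfun_on_uminus:
  assumes "gfun_on N U f"
  shows "gfun_on N U (- f)"
proof -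
  have "(\<lambda>x. - f s x) \<noteq> 0 \<longleftrightarrow> f s \<noteq> 0" for s by (auto simp: fun_eq_iff)
  then show ?thesis using assms unfolding gfun_on_def
    by (auto simp: fun_Compl_def intro!: holomorphic_on_minus)
qed

lemma gfun_eval_uminus:
  assumes "gfun_on N U f" "open U" "geven z" "body z \<in> U"
  shows "gfun_eval (- f) z = - gfun_eval f z"
proof -
  have "gext (- f s) z = - gext (f s) z" for s
    using gext_uminus[OF gfun_on_holomorphic[OF assms(1)] assms(2,4,3), of s]
    by (simp add: fun_Compl_def)
  then show ?thesis by (simp add: gfun_eval_def sum_negf)
qed

lemma body_gfun_eval:
  assumes "gfin f"
  shows "body (gfun_eval f z) = f {} (body z)"
proof -
  obtain K where "soul z ^ K = 0" using soul_nilpotent by blast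
  then have K: "soul z ^ Suc K = 0" by simp
  have "body (gfun_eval f z) = (\<Sum>l<Suc K. if l = 0 then f {} (body z) else 0)"
    unfolding gfun_eval_eq[OF assms K] body_sum
    by (rule sum.cong) (auto simp: body_def[of "gval _ _"] gcoeff_gval[OF assms])
  then show ?thesis by simp
qed

lemma galg_gfun_eval:
  assumes "gfun_on N U f" "N \<le> M" "z \<in> galg M"
  shows "gfun_eval f z \<in> galg M"
  unfolding gfun_eval_def
proof (intro galg_sum galg_mult galg_gext assms)
  fix s assume "s \<in> {s. f s \<noteq> 0}"
  then show "gmono s \<in> galg M" using assms unfolding gfun_on_def galg_gmono by (auto intro: less_le_trans)
qed

lemma superdiff_galg:
  assumes "superdiff N U \<Phi> \<Phi>'" "N \<le> M" "z \<in> galg M" "geven z" "body z \<in> U"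
  shows "\<Phi> z \<in> galg M"
  using assms galg_gfun_eval unfolding superdiff_def by metis

lemma superspace_iff:
  "(z, p, m) \<in> superspace M \<longleftrightarrow> geven z \<and> z \<in> galg M \<and> godd p \<and> p \<in> galg M \<and> godd m \<and> m \<in> galg M"
  by (auto simp: superspace_def galg_even_iff galg_odd_iff)

lemma godd_left_anticommute: "godd a \<Longrightarrow> godd b \<Longrightarrow> a * (b * x) = - (b * (a * x))"
  by (metis godd_anticommute minus_mult_left mult.assoc)

lemma geven_left_commute: "geven a \<Longrightarrow> b * (a * x) = a * (b * x)"
  by (metis geven_commute mult.assoc)

lemma sf_dz_SF: "sf_dz (SF a b c d) = SF (gder a) (gder b) (gder c) (gder d)"
  by (simp add: sf_dz_def gder_def)

text \<open>The general N=2 superconformal map has \<open>\<theta>\<^sup>+\<close>-component \<open>\<gamma> + \<theta>\<^sup>+ A + \<theta>\<^sup>+\<theta>\<^sup>- \<gamma>'\<close>: the equation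
  \<open>D\<^sup>- \<theta>\<^sup>+ = 0\<close> leaves only \<open>\<gamma>\<close> and \<open>A\<close> free. The remaining equations determine the even component from
  \<open>h' = A B\<close>; terms quadratic in the odd functions \<open>\<gamma>\<close>, \<open>\<delta>\<close> are assumed to vanish, as they do for
  maps depending on a single odd parameter.\<close>

definition sconf :: "(grassmann \<Rightarrow> grassmann) \<Rightarrow> (grassmann \<Rightarrow> grassmann) \<Rightarrow> (grassmann \<Rightarrow> grassmann) \<Rightarrow>
    (grassmann \<Rightarrow> grassmann) \<Rightarrow> (grassmann \<Rightarrow> grassmann) \<Rightarrow> (grassmann \<Rightarrow> grassmann) \<Rightarrow>
    (grassmann \<Rightarrow> grassmann) \<Rightarrow> superpoint \<Rightarrow> superpoint" where
  "sconf h A B \<gamma> \<gamma>' \<delta> \<delta>' = (\<lambda>(z, p, m).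
     (h z + p * (\<delta> z * A z) + m * (\<gamma> z * B z),
      \<gamma> z + p * A z + p * m * \<gamma>' z, \<delta> z + m * B z - p * m * \<delta>' z))"

lemma superconformal_on_sconf:
  assumes U: "open U" "U \<noteq> {}" and M: "N \<le> M" "M - 2 = N"
    and diff: "superdiff N U h h'" "superdiff N U A A'" "superdiff N U B B'"
      "superdiff N U \<gamma> \<gamma>'" "superdiff N U \<delta> \<delta>'"
    and par: "\<And>z. geven z \<Longrightarrow> body z \<in> U \<Longrightarrow> geven (h z) \<and> geven (A z) \<and> geven (B z) \<and>
        godd (\<gamma> z) \<and> godd (\<delta> z) \<and> godd (\<gamma>' z) \<and> godd (\<delta>' z)"
    and conf: "\<And>z. geven z \<Longrightarrow> body z \<in> U \<Longrightarrow> h' z = A z * B z"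
    and odd0: "\<And>z. geven z \<Longrightarrow> body z \<in> U \<Longrightarrow> \<gamma> z * \<delta>' z = 0 \<and> \<delta> z * \<gamma>' z = 0"
    and nz: "\<And>z. geven z \<Longrightarrow> body z \<in> U \<Longrightarrow> body (A z) \<noteq> 0 \<and> body (B z) \<noteq> 0"
  shows "superconformal_on M {q \<in> superspace M. body (fst q) \<in> U} (sconf h A B \<gamma> \<gamma>' \<delta> \<delta>')"
proof -
  obtain fh where h: "gfun_on N U fh"
    "\<And>z. geven z \<Longrightarrow> body z \<in> U \<Longrightarrow> h z = gfun_eval fh z"
    "\<And>z. geven z \<Longrightarrow> body z \<in> U \<Longrightarrow> h' z = gfun_eval (gder fh) z"
    by (rule superdiffE[OF diff(1)]) metis
  obtain fA where A: "gfun_on N U fA" "\<And>z. geven z \<Longrightarrow> body z \<in> U \<Longrightarrow> A z = gfun_eval fA z"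
    by (rule superdiffE[OF diff(2)]) metis
  obtain fB where B: "gfun_on N U fB" "\<And>z. geven z \<Longrightarrow> body z \<in> U \<Longrightarrow> B z = gfun_eval fB z"
    by (rule superdiffE[OF diff(3)]) metis
  obtain fg where g: "gfun_on N U fg"
    "\<And>z. geven z \<Longrightarrow> body z \<in> U \<Longrightarrow> \<gamma> z = gfun_eval fg z"
    "\<And>z. geven z \<Longrightarrow> body z \<in> U \<Longrightarrow> \<gamma>' z = gfun_eval (gder fg) z"
    by (rule superdiffE[OF diff(4)]) metis
  obtain fd where d: "gfun_on N U fd"
    "\<And>z. geven z \<Longrightarrow> body z \<in> U \<Longrightarrow> \<delta> z = gfun_eval fd z"
    "\<And>z. geven z \<Longrightarrow> body z \<in> U \<Longrightarrow> \<delta>' z = gfun_eval (gder fd) z"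
    by (rule superdiffE[OF diff(5)]) metis
  have dA: "superdiff N U (\<lambda>z. \<delta> z * A z) (\<lambda>z. \<delta>' z * A z + \<delta> z * A' z)"
    by (rule superdiff_mult[OF diff(5,2) U(1)])
  have gB: "superdiff N U (\<lambda>z. \<gamma> z * B z) (\<lambda>z. \<gamma>' z * B z + \<gamma> z * B' z)"
    by (rule superdiff_mult[OF diff(4,3) U(1)])
  obtain fdA where fdA: "gfun_on N U fdA"
    "\<And>z. geven z \<Longrightarrow> body z \<in> U \<Longrightarrow> \<delta> z * A z = gfun_eval fdA z"
    "\<And>z. geven z \<Longrightarrow> body z \<in> U \<Longrightarrow> \<delta>' z * A z + \<delta> z * A' z = gfun_eval (gder fdA) z"
    by (rule superdiffE[OF dA]) metis
  obtain fgB where fgB: "gfun_on N U fgB"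
    "\<And>z. geven z \<Longrightarrow> body z \<in> U \<Longrightarrow> \<gamma> z * B z = gfun_eval fgB z"
    "\<And>z. geven z \<Longrightarrow> body z \<in> U \<Longrightarrow> \<gamma>' z * B z + \<gamma> z * B' z = gfun_eval (gder fgB) z"
    by (rule superdiffE[OF gB]) metis
  obtain A'' where A': "A'' = gfun_eval (gder fA)" by simp
  define Z where "Z = SF fh fdA fgB 0"
  define P where "P = SF fg fA 0 (gder fg)"
  define Q where "Q = SF fd 0 fB (- gder fd)"
  note hd = gfun_on_gder[OF d(1) U(1)] and hg = gfun_on_gder[OF g(1) U(1)]
  have an: "superanalytic N U Z" "superanalytic N U P" "superanalytic N U Q"
    using h(1) A(1) B(1) g(1) d(1) fdA(1) fgB(1) hd hg gfun_on_uminus[OF hd]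
    unfolding superanalytic_def Z_def P_def Q_def by auto
  have main: "sconf h A B \<gamma> \<gamma>' \<delta> \<delta>' (z, p, m) = (sf_eval Z (z, p, m), sf_eval P (z, p, m), sf_eval Q (z, p, m))"
      "sconf h A B \<gamma> \<gamma>' \<delta> \<delta>' (z, p, m) \<in> superspace M"
      "Dp Q (z, p, m) = 0" "Dm P (z, p, m) = 0"
      "Dp Z (z, p, m) - sf_eval Q (z, p, m) * Dp P (z, p, m) = 0"
      "Dm Z (z, p, m) - sf_eval P (z, p, m) * Dm Q (z, p, m) = 0"
      "body (Dp P (z, p, m)) \<noteq> 0" "body (Dm Q (z, p, m)) \<noteq> 0"
    if q: "(z, p, m) \<in> superspace M" "body z \<in> U" for z p m
  proof -
    have z: "geven z" "z \<in> galg M" and pm: "godd p" "p \<in> galg M" "godd m" "m \<in> galg M"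
      using q(1) by (auto simp: superspace_iff)
    note zu = z(1) q(2)
    have ev: "gfun_eval fh z = h z" "gfun_eval fA z = A z" "gfun_eval fB z = B z" "gfun_eval fg z = \<gamma> z"
      "gfun_eval fd z = \<delta> z" "gfun_eval fdA z = \<delta> z * A z" "gfun_eval fgB z = \<gamma> z * B z"
      "gfun_eval (gder fh) z = A z * B z" "gfun_eval (gder fg) z = \<gamma>' z" "gfun_eval (gder fd) z = \<delta>' z"
      "gfun_eval (- gder fd) z = - \<delta>' z"
      "gfun_eval (gder fdA) z = \<delta>' z * A z + \<delta> z * A' z" "gfun_eval (gder fgB) z = \<gamma>' z * B z + \<gamma> z * B' z"
      using h A B g d fdA fgB zu conf gfun_eval_uminus[OF hd U(1)] by simp_all
    have A'z: "gfun_eval (gder fA) z = A' z"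
      by (rule superdiff_unique[OF _ diff(2) U(1) _ zu, where \<Phi> = "gfun_eval fA" and \<Phi>' = "gfun_eval (gder fA)"])
        (use A in \<open>auto simp: superdiff_def\<close>)
    have B'z: "gfun_eval (gder fB) z = B' z"
      by (rule superdiff_unique[OF _ diff(3) U(1) _ zu, where \<Phi> = "gfun_eval fB" and \<Phi>' = "gfun_eval (gder fB)"])
        (use B in \<open>auto simp: superdiff_def\<close>)
    obtain a b g d g' d' a' b' where abb: "a = A z" "b = B z" "g = \<gamma> z" "d = \<delta> z" "g' = \<gamma>' z" "d' = \<delta>' z"
      "a' = A' z" "b' = B' z" by simp
    have abpar: "geven a" "geven b" "godd g" "godd d" "godd g'" "godd d'" "g * d' = 0" "d * g' = 0"
      using par[OF zu] odd0[OF zu] abb by auto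
    show "sconf h A B \<gamma> \<gamma>' \<delta> \<delta>' (z, p, m) = (sf_eval Z (z, p, m), sf_eval P (z, p, m), sf_eval Q (z, p, m))"
      by (simp add: sconf_def Z_def P_def Q_def ev)
    have "h z \<in> galg M" "a \<in> galg M" "b \<in> galg M" "g \<in> galg M" "d \<in> galg M" "g' \<in> galg M" "d' \<in> galg M"
      unfolding abb using superdiff_galg[OF _ M(1) z(2) zu] diff superdiff_deriv[OF diff(4) U(1)]
        superdiff_deriv[OF diff(5) U(1)] by metis+
    then show "sconf h A B \<gamma> \<gamma>' \<delta> \<delta>' (z, p, m) \<in> superspace M"
      using pm par[OF zu] abb by (auto simp: sconf_def superspace_iff mult.assoc)
    note pp = godd_square[OF pm(1)] godd_square[OF pm(3)] godd_square_left[OF pm(1)] godd_square_left[OF pm(3)]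
    note mp = godd_anticommute[OF pm(3,1)] godd_left_anticommute[OF pm(3,1)]
    have dq: "dtp Q = SF 0 0 (- gder fd) 0" "dtm P = SF 0 (- gder fg) 0 0" "dtp P = SF fA 0 (gder fg) 0"
      "dtm Q = SF fB (gder fd) 0 0" "dtp Z = SF fdA 0 0 0" "dtm Z = SF fgB 0 0 0"
      by (simp_all add: dtp_def dtm_def P_def Q_def Z_def)
    have dz: "sf_dz Q = SF (gder fd) 0 (gder fB) (gder (- gder fd))"
      "sf_dz P = SF (gder fg) (gder fA) 0 (gder (gder fg))"
      "sf_dz Z = SF (gder fh) (gder fdA) (gder fgB) 0"
      by (simp_all add: sf_dz_SF P_def Q_def Z_def)
    have ev2: "gfun_eval (- gder fg) z = - \<gamma>' z" using gfun_eval_uminus[OF hg U(1) zu] ev by simp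
    show "Dp Q (z, p, m) = 0" "Dm P (z, p, m) = 0"
      by (simp_all add: dq dz ev ev2 A'z B'z distrib_left right_diff_distrib mult.assoc pp mp)
    have DpP: "Dp P (z, p, m) = a + m * g' + m * g' + m * (p * a')"
      and DmQ: "Dm Q (z, p, m) = b + p * d' + p * d' + p * (m * b')"
      and DpZ: "Dp Z (z, p, m) = d * a + m * (a * b) + m * (p * (d' * a + d * a'))"
      and DmZ: "Dm Z (z, p, m) = g * b + p * (a * b) + p * (m * (g' * b + g * b'))"
      by (simp_all add: dq dz ev ev2 A'z B'z distrib_left right_diff_distrib mult.assoc pp mp abb)
    have eQ: "sf_eval Q (z, p, m) = d + m * b - p * (m * d')"
      and eP: "sf_eval P (z, p, m) = g + p * a + p * (m * g')"
      by (simp_all add: P_def Q_def ev abb mult.assoc)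
    have sw: "d * (m * x) = - (m * (d * x))" "d * (p * x) = - (p * (d * x))"
       "g * (m * x) = - (m * (g * x))" "g * (p * x) = - (p * (g * x))"
       "d' * (m * x) = - (m * (d' * x))" "d' * (p * x) = - (p * (d' * x))"
       "g' * (m * x) = - (m * (g' * x))" "g' * (p * x) = - (p * (g' * x))"
       "a * (m * x) = m * (a * x)" "a * (p * x) = p * (a * x)"
       "b * (m * x) = m * (b * x)" "b * (p * x) = p * (b * x)"
       "d * g' = 0" "g * d' = 0" "b * a = a * b" "b * (a * x) = a * (b * x)"
       for x
      using godd_left_anticommute abpar pm geven_left_commute geven_commute by metis+
    show "Dp Z (z, p, m) - sf_eval Q (z, p, m) * Dp P (z, p, m) = 0"
      unfolding DpZ DpP eQ by (simp add: distrib_left distrib_right right_diff_distrib left_diff_distrib mult.assoc sw pp mp)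
    show "Dm Z (z, p, m) - sf_eval P (z, p, m) * Dm Q (z, p, m) = 0"
      unfolding DmZ DmQ eP by (simp add: distrib_left distrib_right right_diff_distrib left_diff_distrib mult.assoc sw pp mp)
    show "body (Dp P (z, p, m)) \<noteq> 0" "body (Dm Q (z, p, m)) \<noteq> 0"
      unfolding DpP DmQ using nz[OF zu] pm by (simp_all add: abb)
  qed
  obtain x where x: "x \<in> U" using U(2) by blast
  have x0: "(gconst x, 0, 0) \<in> superspace M" "body (gconst x) \<in> U"
    using x by (auto simp: superspace_iff)
  show ?thesis unfolding superconformal_on_def
  proof (rule exI[of _ U], rule exI[of _ Z], rule exI[of _ P], rule exI[of _ Q], intro conjI ballI)
    show "superanalytic (M - 2) U Z" "superanalytic (M - 2) U P" "superanalytic (M - 2) U Q"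
      using an M by simp_all
    show "\<exists>q\<in>{q \<in> superspace M. body (fst q) \<in> U}. Dp P q \<noteq> 0"
      using main(7)[OF x0] x0 by (intro bexI[of _ "(gconst x, 0, 0)"]) auto
    show "\<exists>q\<in>{q \<in> superspace M. body (fst q) \<in> U}. Dm Q q \<noteq> 0"
      using main(8)[OF x0] x0 by (intro bexI[of _ "(gconst x, 0, 0)"]) auto
    fix q assume "q \<in> {q \<in> superspace M. body (fst q) \<in> U}"
    then obtain z p m where q: "q = (z, p, m)" "(z, p, m) \<in> superspace M" "body z \<in> U"
      by (cases q) auto
    note mm = main[OF q(2,3), folded q(1)]
    show "sconf h A B \<gamma> \<gamma>' \<delta> \<delta>' q = (sf_eval Z q, sf_eval P q, sf_eval Q q)"
      "sconf h A B \<gamma> \<gamma>' \<delta> \<delta>' q \<in> superspace M" "Dp Q q = 0" "Dm P q = 0"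
      "Dp Z q - sf_eval Q q * Dp P q = 0" "Dm Z q - sf_eval P q * Dm Q q = 0"
      by (fact mm)+
  qed (use U in auto)
qed

lemma superconformal_on_cong:
  assumes "superconformal_on M D H" "D' = D" "\<And>q. q \<in> D \<Longrightarrow> H' q = H q"
  shows "superconformal_on M D' H'"
proof -
  obtain U Z P Q where *: "open U" "D = {q \<in> superspace M. body (fst q) \<in> U}"
    "superanalytic (M - 2) U Z" "superanalytic (M - 2) U P" "superanalytic (M - 2) U Q"
    "\<forall>q\<in>D. H q = (sf_eval Z q, sf_eval P q, sf_eval Q q) \<and> H q \<in> superspace M \<and>
           Dp Q q = 0 \<and> Dm P q = 0 \<and>
           Dp Z q - sf_eval Q q * Dp P q = 0 \<and> Dm Z q - sf_eval P q * Dm Q q = 0"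
    "\<exists>q\<in>D. Dp P q \<noteq> 0" "\<exists>q\<in>D. Dm Q q \<noteq> 0"
    using assms(1) unfolding superconformal_on_def by (elim exE conjE)
  have "\<forall>q\<in>D. H' q = (sf_eval Z q, sf_eval P q, sf_eval Q q) \<and> H' q \<in> superspace M \<and>
           Dp Q q = 0 \<and> Dm P q = 0 \<and>
           Dp Z q - sf_eval Q q * Dp P q = 0 \<and> Dm Z q - sf_eval P q * Dm Q q = 0"
  proof
    fix q assume q: "q \<in> D"
    show "H' q = (sf_eval Z q, sf_eval P q, sf_eval Q q) \<and> H' q \<in> superspace M \<and>
           Dp Q q = 0 \<and> Dm P q = 0 \<and>
           Dp Z q - sf_eval Q q * Dp P q = 0 \<and> Dm Z q - sf_eval P q * Dm Q q = 0"
      unfolding assms(3)[OF q] by (rule bspec[OF *(6) q])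
  qed
  then show ?thesis unfolding superconformal_on_def assms(2) using *(1-5,7,8) by (intro exI conjI)
qed

text \<open>All that continuity in the DeWitt topology requires is the body of a superconformal map.\<close>

lemma superconformal_on_body:
  assumes "superconformal_on M D H"
  obtains U f where "open U" "D = {q \<in> superspace M. body (fst q) \<in> U}" "f holomorphic_on U"
    "\<And>q. q \<in> D \<Longrightarrow> H q \<in> superspace M \<and> body (fst (H q)) = f (body (fst q))"
proof -
  obtain U Z P Q where *: "open U" "D = {q \<in> superspace M. body (fst q) \<in> U}" "superanalytic (M - 2) U Z"
    "\<forall>q\<in>D. H q = (sf_eval Z q, sf_eval P q, sf_eval Q q) \<and> H q \<in> superspace M"
    using assms unfolding superconformal_on_def by blast
  have Z: "gfun_on (M - 2) U (sf0 Z)"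
    using *(3) unfolding superanalytic_def by (cases Z) auto
  show ?thesis
  proof (rule that[of U "sf0 Z {}"])
    show "sf0 Z {} holomorphic_on U" by (rule gfun_on_holomorphic[OF Z])
    fix q assume q: "q \<in> D"
    obtain z p m where qq: "q = (z, p, m)" by (cases q)
    have "body p = 0" "body m = 0" using q * qq by (auto simp: superspace_iff)
    then show "H q \<in> superspace M \<and> body (fst (H q)) = sf0 Z {} (body (fst q))"
      using bspec[OF *(4) q] qq by (auto simp: body_gfun_eval[OF gfun_on_gfin[OF Z]])
  qed (use * in auto)
qed

section \<open>The spheres\<close>

text \<open>The two charts are treated uniformly: they are labelled by a truth value, true for \<open>\<Delta>\<^sub>n\<close> and
  false for \<open>\<Upsilon>\<^sub>n\<close>.\<close>

declare split_paired_Ex [simp del] split_paired_All [simp del]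

definition pt :: "bool \<Rightarrow> enat \<Rightarrow> int \<Rightarrow> superpoint \<Rightarrow> sphere_point" where
  "pt c M n q = glue M n `` {if c then Inl q else Inr q}"

definition chart_dom :: "bool \<Rightarrow> enat \<Rightarrow> int \<Rightarrow> sphere_point set" where
  "chart_dom c M n = (if c then Delta_dom M n else Upsilon_dom M n)"

definition coord :: "bool \<Rightarrow> sphere_point \<Rightarrow> superpoint" where
  "coord c = (if c then Delta else Upsilon)"

definition chart_unit :: "bool \<Rightarrow> complex" where
  "chart_unit c = (if c then - \<i> else \<i>)"

fun change_chart :: "bool \<Rightarrow> int \<Rightarrow> superpoint \<Rightarrow> superpoint" where
  "change_chart c n (z, p, m) = (inverse z, gconst (chart_unit c) * (p * z powi (n - 1)),
     gconst (chart_unit c) * (m * z powi (- n - 1)))"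

lemma transition_eq:
  assumes "body (fst q) \<noteq> 0"
  shows "transition n q = change_chart False n q"
proof -
  obtain z p m where q: "q = (z, p, m)" by (cases q)
  have "z powi k * inverse z = z powi (k - 1)" for k
    using powi_add[of z k "- 1"] assms by (simp add: q power_int_minus1_right)
  then show ?thesis
    by (simp add: q divide_grassmann_def chart_unit_def mult.assoc)
qed

lemma change_chart_in:
  assumes "q \<in> superspace M" "body (fst q) \<noteq> 0"
  shows "change_chart c n q \<in> superspace M" "body (fst (change_chart c n q)) = inverse (body (fst q))"
  using assms by (cases q; auto simp: superspace_iff)+

lemma change_chart_inverse:
  assumes "q \<in> superspace M" "body (fst q) \<noteq> 0"
  shows "change_chart (\<not> c) n (change_chart c n q) = q"
proof -
  obtain z p m where q: "q = (z, p, m)" by (cases q)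
  have z: "body z \<noteq> 0" "geven z" using assms by (auto simp: q superspace_iff)
  have *: "gconst (chart_unit (\<not> c)) * ((gconst (chart_unit c) * (a * z powi k)) * inverse z powi k) = a" for a k
  proof -
    have "gconst (chart_unit (\<not> c)) * ((gconst (chart_unit c) * (a * z powi k)) * inverse z powi k)
        = (gconst (chart_unit (\<not> c)) * gconst (chart_unit c)) * (a * (z powi k * z powi (- k)))"
      using powi_inverse[OF z(1)] by (simp only: mult.assoc)
    also have "z powi k * z powi (- k) = 1" using powi_minus_mult[OF z(1), of "- k"] by simp
    also have "gconst (chart_unit (\<not> c)) * gconst (chart_unit c) = 1"
      by (simp add: gconst_mult[symmetric] chart_unit_def)
    finally show ?thesis by simp
  qed
  have "inverse (inverse z) = z" using z by (intro grassmann_inverse_eqI) auto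
  then show ?thesis unfolding q by (simp add: *)
qed

lemma glue_image_Inl:
  assumes "q \<in> superspace M"
  shows "glue M n `` {Inl q} = {Inl q} \<union> (if body (fst q) = 0 then {} else {Inr (change_chart True n q)})"
proof (intro equalityI subsetI)
  fix y assume "y \<in> glue M n `` {Inl q}"
  then consider "y = Inl q" | q' where "q = transition n q'" "y = Inr q'" "q' \<in> superspace M" "body (fst q') \<noteq> 0"
    by (auto simp: glue_def)
  then show "y \<in> {Inl q} \<union> (if body (fst q) = 0 then {} else {Inr (change_chart True n q)})"
  proof cases
    case 2
    have q: "q = change_chart False n q'" using transition_eq 2 by simp
    then have "body (fst q) \<noteq> 0" using change_chart_in[OF 2(3,4), of False n] 2(4) by simp
    moreover have "change_chart True n q = q'" using change_chart_inverse[OF 2(3,4), of False n] q by simp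
    ultimately show ?thesis using 2 by simp
  qed simp
next
  fix y assume y: "y \<in> {Inl q} \<union> (if body (fst q) = 0 then {} else {Inr (change_chart True n q)})"
  show "y \<in> glue M n `` {Inl q}"
  proof (cases "y = Inl q")
    case False
    then have y: "y = Inr (change_chart True n q)" "body (fst q) \<noteq> 0" using y by (auto split: if_splits)
    let ?q' = "change_chart True n q"
    have q': "?q' \<in> superspace M" "body (fst ?q') \<noteq> 0" using change_chart_in[OF assms y(2)] y(2) by auto
    then have "transition n ?q' = q" using transition_eq change_chart_inverse[OF assms y(2), of True n] by simp
    then show ?thesis unfolding y(1) glue_def using q' by force
  qed (use assms in \<open>auto simp: glue_def\<close>)
qed

lemma glue_image_Inr:
  assumes "q \<in> superspace M"
  shows "glue M n `` {Inr q} = {Inr q} \<union> (if body (fst q) = 0 then {} else {Inl (change_chart False n q)})"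
proof -
  have "glue M n `` {Inr q} = {Inr q} \<union> (if body (fst q) = 0 then {} else {Inl (transition n q)})"
    using assms by (auto simp: glue_def)
  then show ?thesis using transition_eq[of q n] by auto
qed

lemma pt_change_chart:
  assumes "q \<in> superspace M" "body (fst q) \<noteq> 0"
  shows "pt (\<not> c) M n (change_chart c n q) = pt c M n q"
  unfolding pt_def
  using change_chart_in[OF assms, of c n] change_chart_inverse[OF assms, of c n] assms
  by (cases c) (auto simp: glue_image_Inl glue_image_Inr)

lemma sphere_eq: "sphere M n = {pt c M n q | c q. q \<in> superspace M}"
proof -
  have "sphere M n = (\<lambda>q. pt True M n q) ` superspace M \<union> (\<lambda>q. pt False M n q) ` superspace M"
    unfolding sphere_def quotient_def pt_def by (auto simp: Plus_def)
  then show ?thesis by (auto simp: image_iff) (metis (full_types))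
qed

lemma pt_in_sphere [simp]: "q \<in> superspace M \<Longrightarrow> pt c M n q \<in> sphere M n"
  by (auto simp: sphere_eq)

lemma pt_in_chart_dom:
  assumes "q \<in> superspace M"
  shows "pt c M n q \<in> chart_dom d M n \<longleftrightarrow> c = d \<or> body (fst q) \<noteq> 0"
  using assms pt_in_sphere[OF assms, of c n]
  unfolding chart_dom_def Delta_dom_def Upsilon_dom_def
  by (cases c; cases d) (auto simp: pt_def glue_image_Inl glue_image_Inr)

lemma coord_pt: "q \<in> superspace M \<Longrightarrow> coord c (pt c M n q) = q"
  by (cases c) (auto simp: coord_def Delta_def Upsilon_def pt_def glue_image_Inl glue_image_Inr)

lemma chart_domE:
  assumes "P \<in> chart_dom c M n"
  obtains q where "q \<in> superspace M" "P = pt c M n q" "coord c P = q"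
proof -
  have "P \<in> sphere M n" using assms by (auto simp: chart_dom_def Delta_dom_def Upsilon_dom_def split: if_splits)
  then obtain d q where q: "P = pt d M n q" "q \<in> superspace M" by (auto simp: sphere_eq)
  show ?thesis
  proof (cases "d = c")
    case False
    then have d: "d = (\<not> c)" "body (fst q) \<noteq> 0" using pt_in_chart_dom[OF q(2)] assms q(1) by auto
    show ?thesis
      using that[of "change_chart d n q"] change_chart_in[OF q(2) d(2)] pt_change_chart[OF q(2) d(2), of d n]
      by (simp add: coord_pt q d)
  qed (use that q coord_pt in auto)
qed

lemma pt_coord: "P \<in> chart_dom c M n \<Longrightarrow> pt c M n (coord c P) = P"
  and coord_in: "P \<in> chart_dom c M n \<Longrightarrow> coord c P \<in> superspace M"
  by (metis chart_domE)+

lemma sphere_chart_cases: "P \<in> sphere M n \<Longrightarrow> \<exists>c. P \<in> chart_dom c M n"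
  by (auto simp: sphere_eq pt_in_chart_dom)

lemma inj_on_coord: "inj_on (coord c) (chart_dom c M n)"
  by (rule inj_onI) (metis pt_coord)

lemma inv_into_coord: "q \<in> superspace M \<Longrightarrow> inv_into (chart_dom c M n) (coord c) q = pt c M n q"
  by (rule inv_into_f_eq[OF inj_on_coord]) (auto simp: pt_in_chart_dom coord_pt)

lemma sphere_atlas_eq: "sphere_atlas M n = {(chart_dom c M n, coord c) | c. True}"
  unfolding sphere_atlas_def chart_dom_def coord_def by (auto split: if_splits)

lemma superconformal_map_sphere_iff:
  "superconformal_map M (sphere_atlas M n) T \<longleftrightarrow>
    (\<forall>c d. {q \<in> superspace M. T (pt c M n q) \<in> chart_dom d M n} \<noteq> {} \<longrightarrow>
      superconformal_on M {q \<in> superspace M. T (pt c M n q) \<in> chart_dom d M n} (\<lambda>q. coord d (T (pt c M n q))))"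
proof -
  have dom: "coord c ` {P \<in> chart_dom c M n. T P \<in> V} = {q \<in> superspace M. T (pt c M n q) \<in> V}" for c V
  proof (intro equalityI subsetI)
    fix q assume "q \<in> {q \<in> superspace M. T (pt c M n q) \<in> V}"
    then show "q \<in> coord c ` {P \<in> chart_dom c M n. T P \<in> V}"
      by (intro rev_image_eqI[of "pt c M n q"]) (auto simp: coord_pt pt_in_chart_dom)
  qed (auto simp: coord_in pt_coord)
  have empty: "{P \<in> chart_dom c M n. T P \<in> V} = {} \<longleftrightarrow> {q \<in> superspace M. T (pt c M n q) \<in> V} = {}" for c V
    unfolding dom[symmetric] by simp
  have iff: "superconformal_on M (coord c ` {P \<in> chart_dom c M n. T P \<in> chart_dom d M n})
        (coord d \<circ> T \<circ> inv_into (chart_dom c M n) (coord c)) \<longleftrightarrow>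
      superconformal_on M {q \<in> superspace M. T (pt c M n q) \<in> chart_dom d M n} (\<lambda>q. coord d (T (pt c M n q)))" for c d
    unfolding dom by (auto simp: inv_into_coord intro: superconformal_on_cong elim!: superconformal_on_cong)
  have "superconformal_map M (sphere_atlas M n) T \<longleftrightarrow>
    (\<forall>c d. {P \<in> chart_dom c M n. T P \<in> chart_dom d M n} \<noteq> {} \<longrightarrow>
      superconformal_on M (coord c ` {P \<in> chart_dom c M n. T P \<in> chart_dom d M n})
        (coord d \<circ> T \<circ> inv_into (chart_dom c M n) (coord c)))"
    unfolding superconformal_map_def sphere_atlas_eq by blast
  then show ?thesis by (simp only: empty iff)
qed

lemma openin_dewitt: "openin (dewitt M) S \<longleftrightarrow> (\<exists>U. open U \<and> S = {q \<in> superspace M. body (fst q) \<in> U})"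
proof -
  have "(\<lambda>q. body (fst q)) -` U \<inter> superspace M = {q \<in> superspace M. body (fst q) \<in> U}" for U by auto
  then show ?thesis unfolding dewitt_def openin_pullback_topology by simp
qed

lemma openin_sphere_iff: "openin (sphere_top M n) W \<longleftrightarrow>
  W \<subseteq> sphere M n \<and> (\<forall>c. openin (dewitt M) {q \<in> superspace M. pt c M n q \<in> W})"
  unfolding openin_sphere_top pt_def by (auto simp: all_bool_eq)

lemma topspace_sphere [simp]: "topspace (sphere_top M n) = sphere M n"
proof -
  have "openin (sphere_top M n) (sphere M n)"
    unfolding openin_sphere_iff openin_dewitt by (auto intro!: exI[of _ UNIV])
  then have "sphere M n \<subseteq> topspace (sphere_top M n)" by (rule openin_subset)
  moreover have "topspace (sphere_top M n) \<subseteq> sphere M n"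
    using openin_topspace[of "sphere_top M n"] unfolding openin_sphere_iff by blast
  ultimately show ?thesis by blast
qed

text \<open>A map that is superconformal in all charts is automatically continuous.\<close>

lemma superconformal_map_continuous:
  assumes "superconformal_map M (sphere_atlas M n) T" "\<And>P. P \<in> sphere M n \<Longrightarrow> T P \<in> sphere M n"
  shows "continuous_map (sphere_top M n) (sphere_top M n) T"
  unfolding continuous_map topspace_sphere
proof (intro conjI allI impI)
  fix W assume W: "openin (sphere_top M n) W"
  show "openin (sphere_top M n) {P \<in> sphere M n. T P \<in> W}"
    unfolding openin_sphere_iff
  proof (intro conjI allI)
    fix c
    let ?S = "\<lambda>d. {q \<in> superspace M. T (pt c M n q) \<in> chart_dom d M n \<and> T (pt c M n q) \<in> W}"
    have "openin (dewitt M) (?S d)" for d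
    proof (cases "{q \<in> superspace M. T (pt c M n q) \<in> chart_dom d M n} = {}")
      case True
      then have "?S d = {}" by auto
      then show ?thesis by (simp only: openin_empty)
    next
      case False
      let ?D = "{q \<in> superspace M. T (pt c M n q) \<in> chart_dom d M n}"
      have "superconformal_on M ?D (\<lambda>q. coord d (T (pt c M n q)))"
        using assms(1) False unfolding superconformal_map_sphere_iff by blast
      then obtain U f where f: "open U" "?D = {q \<in> superspace M. body (fst q) \<in> U}" "f holomorphic_on U"
        "\<And>q. q \<in> ?D \<Longrightarrow> coord d (T (pt c M n q)) \<in> superspace M \<and>
          body (fst (coord d (T (pt c M n q)))) = f (body (fst q))"
        by (rule superconformal_on_body) blast
      obtain V where V: "open V" "{q \<in> superspace M. pt d M n q \<in> W} = {q \<in> superspace M. body (fst q) \<in> V}"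
        using W unfolding openin_sphere_iff openin_dewitt by metis
      have Vm: "pt d M n r \<in> W \<longleftrightarrow> body (fst r) \<in> V" if "r \<in> superspace M" for r
        using V(2) that by blast
      have "open (U \<inter> f -` V)"
        using continuous_open_preimage[OF holomorphic_on_imp_continuous_on[OF f(3)] f(1) V(1)] by simp
      moreover have "?S d = {q \<in> superspace M. body (fst q) \<in> U \<inter> f -` V}"
      proof -
        have "T (pt c M n q) \<in> W \<longleftrightarrow> f (body (fst q)) \<in> V" if q: "q \<in> ?D" for q
        proof -
          have "pt d M n (coord d (T (pt c M n q))) = T (pt c M n q)" using q by (simp add: pt_coord)
          then have "T (pt c M n q) \<in> W \<longleftrightarrow> pt d M n (coord d (T (pt c M n q))) \<in> W"
            
by simp
          then show ?thesis using Vm f(4)[OF q] by simp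
        qed
        moreover have "q \<in> ?D \<longleftrightarrow> q \<in> superspace M \<and> body (fst q) \<in> U" for q
          by (subst f(2)) simp
        ultimately show ?thesis by (intro set_eqI) (simp, metis)
      qed
      ultimately show ?thesis unfolding openin_dewitt by blast
    qed
    then have "openin (dewitt M) (?S True \<union> ?S False)" by blast
    moreover have "?S True \<union> ?S False = {q \<in> superspace M. pt c M n q \<in> {P \<in> sphere M n. T P \<in> W}}"
    proof (intro equalityI subsetI)
      fix q assume q: "q \<in> {q \<in> superspace M. pt c M n q \<in> {P \<in> sphere M n. T P \<in> W}}"
      then obtain d where "T (pt c M n q) \<in> chart_dom d M n" using sphere_chart_cases assms(2) by blast
      then show "q \<in> ?S True \<union> ?S False" using q by (cases d) auto
    qed auto
    ultimately show "openin (dewitt M) {q \<in> superspace M. pt c M n q \<in> {P \<in> sphere M n. T P \<in> W}}"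
      by simp
  qed auto
qed (use assms(2) in auto)

lemma sphere_autsI:
  assumes "superconformal_map M (sphere_atlas M n) T" "superconformal_map M (sphere_atlas M n) T'"
    "\<And>P. P \<in> sphere M n \<Longrightarrow> T P \<in> sphere M n \<and> T' (T P) = P"
    "\<And>P. P \<in> sphere M n \<Longrightarrow> T' P \<in> sphere M n \<and> T (T' P) = P"
  shows "T \<in> sphere_auts M n"
  unfolding sphere_auts_def superconformal_auts_def homeomorphic_maps_def
  using assms superconformal_map_continuous by (auto intro!: exI[of _ T'])

lemma in_Delta_coordinates_iff:
  assumes "q \<in> superspace M"
  shows "in_Delta_coordinates M n T q q' \<longleftrightarrow>
    T (pt True M n q) \<in> chart_dom True M n \<and> coord True (T (pt True M n q)) = q'"
  using inv_into_coord[OF assms, of True n]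
  unfolding in_Delta_coordinates_def Let_def by (simp add: chart_dom_def coord_def)

text \<open>A map of the sphere is given by its values on the two copies of the superspace, provided they
  respect the gluing.\<close>

definition sphere_map :: "(bool \<Rightarrow> superpoint \<Rightarrow> sphere_point) \<Rightarrow> enat \<Rightarrow> int \<Rightarrow> sphere_point \<Rightarrow> sphere_point" where
  "sphere_map \<Phi> M n P = (if P \<in> chart_dom True M n then \<Phi> True (coord True P) else \<Phi> False (coord False P))"

lemma sphere_map_pt:
  assumes "\<And>q. q \<in> superspace M \<Longrightarrow> body (fst q) \<noteq> 0 \<Longrightarrow> \<Phi> True (change_chart False n q) = \<Phi> False q"
    "q \<in> superspace M"
  shows "sphere_map \<Phi> M n (pt c M n q) = \<Phi> c q"
proof (cases c)
  case True
  then show ?thesis using assms(2) by (simp add: sphere_map_def pt_in_chart_dom coord_pt)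
next
  case False
  show ?thesis
  proof (cases "body (fst q) = 0")
    case True
    then show ?thesis using False assms(2) by (simp add: sphere_map_def pt_in_chart_dom coord_pt)
  next
    case nz: False
    have "pt c M n q = pt True M n (change_chart False n q)"
      using pt_change_chart[OF assms(2) nz, of False n] False by simp
    then show ?thesis
      using assms(1)[OF assms(2) nz] change_chart_in[OF assms(2) nz] False
      by (simp add: sphere_map_def pt_in_chart_dom coord_pt)
  qed
qed

section \<open>Moebius automorphisms of the spheres\<close>

lemma geven_commute2: "geven b \<Longrightarrow> a * b = b * a"
  and geven_left_commute2: "geven b \<Longrightarrow> b * (a * x) = a * (b * x)"
  by (metis geven_commute, metis geven_commute mult.assoc)

lemmas geven_ac = mult.assoc geven_commute geven_commute2 geven_left_commute geven_left_commute2

text \<open>A matrix in \<open>SL\<^sub>2\<close> with entries \<open>ma\<close>, \<open>mb\<close>, \<open>mc\<close>, \<open>md\<close>, and a multiplier \<open>me\<close>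
  rotating \<open>\<theta>\<^sup>+\<close> and \<open>\<theta>\<^sup>-\<close> oppositely.\<close>

datatype mob = Mob (ma: grassmann) (mb: grassmann) (mc: grassmann) (md: grassmann) (me: grassmann)

definition mob_over :: "enat \<Rightarrow> mob \<Rightarrow> bool" where
  "mob_over N g \<longleftrightarrow> (\<forall>x\<in>{ma g, mb g, mc g, md g, me g}. x \<in> galg N \<and> geven x) \<and>
     ma g * md g - mb g * mc g = 1 \<and> body (me g) \<noteq> 0"

definition mden :: "mob \<Rightarrow> grassmann \<Rightarrow> grassmann" where
  "mden g z = mc g * z + md g"

definition mnum :: "mob \<Rightarrow> grassmann \<Rightarrow> grassmann" where
  "mnum g z = ma g * z + mb g"

text \<open>The odd coordinates transform with those powers of the automorphy factor \<open>mden g z\<close> that the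
  transition function of the sphere prescribes.\<close>

fun mob_map :: "int \<Rightarrow> mob \<Rightarrow> superpoint \<Rightarrow> superpoint" where
  "mob_map n g (z, p, m) = (mnum g z * inverse (mden g z), me g * (p * mden g z powi (n - 1)),
     inverse (me g) * (m * mden g z powi (- n - 1)))"

definition mob_one :: mob where
  "mob_one = Mob 1 0 0 1 1"

definition mob_mult :: "mob \<Rightarrow> mob \<Rightarrow> mob" where
  "mob_mult g h = Mob (ma g * ma h + mb g * mc h) (ma g * mb h + mb g * md h)
     (mc g * ma h + md g * mc h) (mc g * mb h + md g * md h) (me g * me h)"

definition mob_inv :: "mob \<Rightarrow> mob" where
  "mob_inv g = Mob (md g) (- mb g) (- mc g) (ma g) (inverse (me g))"

text \<open>The change of charts is itself of this form; its matrix has determinant 1 because of the factor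
  \<open>\<i>\<close> in the transition function.\<close>

definition mob_swap :: "bool \<Rightarrow> int \<Rightarrow> mob" where
  "mob_swap c n = (let s = chart_unit c in Mob 0 (gconst s) (gconst s) 0 (gconst (s powi (2 - n))))"

lemma mob_overD:
  assumes "mob_over N g"
  shows "geven (ma g)" "geven (mb g)" "geven (mc g)" "geven (md g)" "geven (me g)"
    "ma g \<in> galg N" "mb g \<in> galg N" "mc g \<in> galg N" "md g \<in> galg N" "me g \<in> galg N"
    "ma g * md g - mb g * mc g = 1" "body (me g) \<noteq> 0"
  using assms by (auto simp: mob_over_def)

lemma mob_mult_assoc: "mob_mult (mob_mult f g) h = mob_mult f (mob_mult g h)"
  by (simp add: mob_mult_def algebra_simps)

lemma mob_mult_one [simp]: "mob_mult mob_one g = g" "mob_mult g mob_one = g"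
  by (simp_all add: mob_mult_def mob_one_def)

lemma mob_over_one: "mob_over N mob_one"
  by (auto simp: mob_over_def mob_one_def)

lemma mob_over_mult:
  assumes "mob_over N g" "mob_over N h"
  shows "mob_over N (mob_mult g h)"
proof -
  note e = mob_overD[OF assms(1)] mob_overD[OF assms(2)]
  have "ma (mob_mult g h) * md (mob_mult g h) - mb (mob_mult g h) * mc (mob_mult g h)
      = (ma g * md g - mb g * mc g) * (ma h * md h - mb h * mc h)"
    using e(1-5) e(13-17) by (simp add: mob_mult_def algebra_simps geven_ac)
  then show ?thesis using e by (auto simp: mob_over_def mob_mult_def)
qed

lemma mob_over_inv:
  assumes "mob_over N g"
  shows "mob_over N (mob_inv g)" "mob_mult (mob_inv g) g = mob_one" "mob_mult g (mob_inv g) = mob_one"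
proof -
  note e = mob_overD[OF assms]
  have *: "md g * ma g = ma g * md g" "mc g * mb g = mb g * mc g" "md g * mb g = mb g * md g"
      "mc g * ma g = ma g * mc g" "mc g * md g = md g * mc g" "ma g * mb g = mb g * ma g"
    using e geven_commute by metis+
  then show "mob_over N (mob_inv g)" using e by (auto simp: mob_over_def mob_inv_def)
  show "mob_mult (mob_inv g) g = mob_one" "mob_mult g (mob_inv g) = mob_one"
    using e * by (auto simp: mob_mult_def mob_inv_def mob_one_def)
qed

lemma chart_unit_props [simp]: "chart_unit c \<noteq> 0" "chart_unit c * chart_unit c = - 1"
  "chart_unit c * chart_unit (\<not> c) = 1" "inverse (chart_unit c) = chart_unit (\<not> c)"
  by (auto simp: chart_unit_def)

lemma mob_over_swap: "mob_over N (mob_swap c n)"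
  by (auto simp: mob_over_def mob_swap_def Let_def gconst_mult[symmetric] gconst_uminus)

lemma mob_swap_swap: "mob_mult (mob_swap c n) (mob_swap (\<not> c) n) = mob_one"
  by (auto simp: mob_mult_def mob_swap_def mob_one_def Let_def gconst_mult[symmetric]
      power_int_mult_distrib[symmetric] simp del: chart_unit_props(4))

lemma mob_den_num:
  assumes "mob_over N g" "mob_over N h" "geven z" "body (mden h z) \<noteq> 0"
  shows "mden g (mnum h z * inverse (mden h z)) = mden (mob_mult g h) z * inverse (mden h z)"
    "mnum g (mnum h z * inverse (mden h z)) = mnum (mob_mult g h) z * inverse (mden h z)"
proof -
  note e = mob_overD[OF assms(1)] mob_overD[OF assms(2)]
  have 1: "x = x * mden h z * inverse (mden h z)" for x using assms(4) by (simp add: mult.assoc)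
  have 2: "mc g * mnum h z + md g * mden h z = mden (mob_mult g h) z"
    "ma g * mnum h z + mb g * mden h z = mnum (mob_mult g h) z"
    by (simp_all add: mnum_def mden_def mob_mult_def algebra_simps)
  show "mden g (mnum h z * inverse (mden h z)) = mden (mob_mult g h) z * inverse (mden h z)"
    unfolding 2[symmetric] mden_def[of g] by (subst (2) 1) (simp add: algebra_simps)
  show "mnum g (mnum h z * inverse (mden h z)) = mnum (mob_mult g h) z * inverse (mden h z)"
    unfolding 2[symmetric] mnum_def[of g] by (subst (2) 1) (simp add: algebra_simps)
qed

lemma mob_even:
  assumes "mob_over N g" "geven z"
  shows "geven (mden g z)" "geven (mnum g z)"
  using mob_overD[OF assms(1)] assms(2) by (auto simp: mden_def mnum_def)

lemma mob_galg:
  assumes "mob_over N g" "N \<le> M" "z \<in> galg M"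
  shows "mden g z \<in> galg M" "mnum g z \<in> galg M"
  using mob_overD[OF assms(1)] assms(2,3) galg_mono[OF _ assms(2)] by (auto simp: mden_def mnum_def)

lemma mob_den_or_num:
  assumes "mob_over N g" "body (mden g z) = 0"
  shows "body (mnum g z) \<noteq> 0"
proof
  assume "body (mnum g z) = 0"
  then have "body (ma g) * body z + body (mb g) = 0" "body (mc g) * body z + body (md g) = 0"
    using assms(2) by (auto simp: mnum_def mden_def)
  then have "body (mb g) = - (body (ma g) * body z)" "body (md g) = - (body (mc g) * body z)"
    by (auto simp: eq_neg_iff_add_eq_0 add.commute)
  then have "body (ma g * md g - mb g * mc g) = 0" by simp
  then show False using mob_overD(11)[OF assms(1)] by simp
qed

lemma mob_map_mult:
  assumes "mob_over N g" "mob_over N h" "geven (fst q)" "body (mden h (fst q)) \<noteq> 0"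
    "body (mden (mob_mult g h) (fst q)) \<noteq> 0"
  shows "mob_map n g (mob_map n h q) = mob_map n (mob_mult g h) q"
proof -
  obtain z p m where q: "q = (z, p, m)" by (cases q)
  have z: "geven z" using assms(3) q by simp
  define v where "v = mden h z"
  define w where "w = mden (mob_mult g h) z"
  have v: "body v \<noteq> 0" "geven v" and w: "body w \<noteq> 0" "geven w"
    using assms mob_even(1)[OF assms(2) z] mob_even(1)[OF mob_over_mult[OF assms(1,2)] z] by (auto simp: v_def w_def q)
  note e = mob_overD[OF assms(1)] mob_overD[OF assms(2)]
  note dn = mob_den_num[OF assms(1,2) z, folded v_def, OF v(1), folded w_def]
  have nu: "geven (mnum (mob_mult g h) z)" using mob_even(2)[OF mob_over_mult[OF assms(1,2)] z] .
  have iv: "inverse (w * inverse v) = v * inverse w"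
    by (rule grassmann_inverse_eqI)
      (use v(1) w(1) in \<open>metis mult.assoc grassmann_left_inverse grassmann_right_inverse mult_1_left\<close>)+
  have ve: "geven (v powi k)" "geven (w powi k)" for k using v w by auto
  have pw: "(w * inverse v) powi k = w powi k * v powi (- k)" for k
    using powi_mult_distrib[of w "inverse v" k] v w powi_inverse[OF v(1)] by simp
  have vv: "v powi k * v powi (- k) = 1" for k using powi_minus_mult[OF v(1), of "- k"] by simp
  have t: "x * v powi k * (w * inverse v) powi k = x * w powi k" for x k
  proof -
    have "x * v powi k * (w * inverse v) powi k = x * (v powi k * v powi (- k)) * w powi k"
      unfolding pw using ve by (simp add: geven_ac)
    then show ?thesis using vv by simp
  qed
  have "mnum (mob_mult g h) z * inverse v * (v * inverse w) = mnum (mob_mult g h) z * inverse w"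
    using v(1) by (metis grassmann_left_inverse mult.assoc mult_1_left)
  moreover have "me g * (me h * (p * v powi k) * (w * inverse v) powi k) = me g * me h * (p * w powi k)" for k
    using t[of "me h * p" k] by (simp add: mult.assoc)
  moreover have "inverse (me g) * (inverse (me h) * (m * v powi k) * (w * inverse v) powi k) =
      inverse (me g * me h) * (m * w powi k)" for k
    using t[of "inverse (me h) * m" k] e grassmann_inverse_mult[of "me g" "me h"] by (simp add: mult.assoc)
  ultimately show ?thesis
    unfolding q mob_map.simps v_def[symmetric] w_def[symmetric] dn iv
    by (simp add: mob_mult_def)
qed

lemma mob_map_one: "mob_map n mob_one q = q"
  by (cases q) (simp add: mob_one_def mnum_def mden_def powi_one)

lemma mob_map_in:
  assumes "mob_over N g" "N \<le> M" "q \<in> superspace M" "body (mden g (fst q)) \<noteq> 0"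
  shows "mob_map n g q \<in> superspace M"
    "body (fst (mob_map n g q)) = body (mnum g (fst q)) / body (mden g (fst q))"
proof -
  obtain z p m where q: "q = (z, p, m)" by (cases q)
  note e = mob_overD[OF assms(1)] galg_mono[OF mob_overD(10)[OF assms(1)] assms(2)]
  show "mob_map n g q \<in> superspace M"
    using assms(3,4) e mob_even[OF assms(1)] mob_galg[OF assms(1,2)] by (auto simp: q superspace_iff)
  show "body (fst (mob_map n g q)) = body (mnum g (fst q)) / body (mden g (fst q))"
    using assms(4) by (simp add: q divide_inverse)
qed

lemma body_mden_swap [simp]: "body (mden (mob_swap c n) z) = 0 \<longleftrightarrow> body z = 0"
  by (simp add: mden_def mob_swap_def Let_def)

lemma mob_map_swap:
  assumes "geven (fst q)" "body (fst q) \<noteq> 0"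
  shows "mob_map n (mob_swap c n) q = change_chart c n q"
proof -
  obtain z p m where q: "q = (z, p, m)" by (cases q)
  define s where "s = chart_unit c"
  have s: "s \<noteq> 0" "s * s = - 1" by (simp_all add: s_def)
  have z: "body z \<noteq> 0" "geven z" using assms by (auto simp: q)
  have pw: "(gconst s * z) powi k = gconst (s powi k) * z powi k" for k
    using powi_mult_distrib[of "gconst s" z k] z s powi_gconst by simp
  have iv: "gconst s * inverse (gconst s * z) = inverse z"
    using grassmann_inverse_mult[of "gconst s" z] z s
    by (simp add: mult.assoc[symmetric] inverse_gconst gconst_mult[symmetric])
  have c1: "gconst (s powi (2 - n)) * (p * (gconst s * z) powi (n - 1)) = gconst s * (p * z powi (n - 1))"
  proof -
    have "gconst (s powi (2 - n)) * (p * (gconst (s powi (n - 1)) * z powi (n - 1)))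
        = (gconst (s powi (2 - n)) * gconst (s powi (n - 1))) * (p * z powi (n - 1))"
      by (simp only: mult.assoc gconst_left_commute[of p])
    also have "s powi (2 - n) * s powi (n - 1) = s" using s by (simp add: power_int_add[symmetric])
    then have "gconst (s powi (2 - n)) * gconst (s powi (n - 1)) = gconst s" by (simp add: gconst_mult[symmetric])
    finally show ?thesis by (simp add: pw)
  qed
  have c2: "inverse (gconst (s powi (2 - n))) * (m * (gconst s * z) powi (- n - 1)) = gconst s * (m * z powi (- n - 1))"
  proof -
    have "gconst (s powi (n - 2)) * (m * (gconst (s powi (- n - 1)) * z powi (- n - 1)))
        = (gconst (s powi (n - 2)) * gconst (s powi (- n - 1))) * (m * z powi (- n - 1))"
      by (simp only: mult.assoc gconst_left_commute[of m])
    also have "s powi (n - 2) * s powi (- n - 1) = s powi (- 3)" using s by (simp add: power_int_add[symmetric])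
    then have "s powi (n - 2) * s powi (- n - 1) = s"
      by (auto simp: s_def chart_unit_def power_int_def power3_eq_cube)
    then have "gconst (s powi (n - 2)) * gconst (s powi (- n - 1)) = gconst s" by (simp add: gconst_mult[symmetric])
    finally show ?thesis using s by (simp add: pw inverse_gconst power_int_minus[symmetric])
  qed
  show ?thesis
    using iv c1 c2 by (simp add: q mob_swap_def Let_def mnum_def mden_def s_def)
qed

subsection \<open>Superconformality\<close>

lemma mob_map_superconformal:
  assumes "mob_over (M - 2) g" "\<exists>x. body (mc g) * x + body (md g) \<noteq> 0"
  shows "superconformal_on M {q \<in> superspace M. body (mden g (fst q)) \<noteq> 0} (mob_map n g)"
proof -
  define U where "U = {x. body (mc g) * x + body (md g) \<noteq> 0}"
  have "open U" unfolding U_def by (intro open_Collect_neq continuous_intros)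
  note e = mob_overD[OF assms(1)]
  have U: "body z \<in> U \<longleftrightarrow> body (mden g z) \<noteq> 0" for z by (simp add: U_def mden_def)
  have M: "M - 2 \<le> M" by (cases M) (auto simp: numeral_eq_enat)
  note lin = superdiff_add[OF superdiff_cmult[OF superdiff_ident \<open>open U\<close>] superdiff_const \<open>open U\<close>, simplified]
  have dden: "superdiff (M - 2) U (mden g) (\<lambda>z. mc g)"
    using lin[of "mc g" "M - 2" "md g"] e by (simp add: mden_def[abs_def])
  have dnum: "superdiff (M - 2) U (mnum g) (\<lambda>z. ma g)"
    using lin[of "ma g" "M - 2" "mb g"] e by (simp add: mnum_def[abs_def])
  have den: "geven z \<Longrightarrow> body z \<in> U \<Longrightarrow> geven (mden g z) \<and> body (mden g z) \<noteq> 0" for z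
    using mob_even[OF assms(1)] U by auto
  let ?h = "\<lambda>z. mnum g z * inverse (mden g z)"
  let ?A = "\<lambda>z. me g * mden g z powi (n - 1)"
  let ?B = "\<lambda>z. inverse (me g) * mden g z powi (- n - 1)"
  have dh: "superdiff (M - 2) U ?h (\<lambda>z. ?A z * ?B z)"
  proof (rule superdiff_cong[OF superdiff_mult[OF dnum superdiff_inverse[OF dden \<open>open U\<close> den] \<open>open U\<close>]])
    fix z assume z: "geven z" "body z \<in> U"
    define v where "v = mden g z"
    have v: "geven v" "body v \<noteq> 0" using den[OF z] by (auto simp: v_def)
    have ve: "geven (v powi k)" for k using v by simp
    have "?A z * ?B z = (me g * inverse (me g)) * (v powi (n - 1) * v powi (- n - 1))"
      unfolding v_def[symmetric] using e ve by (simp add: geven_ac del: grassmann_right_inverse grassmann_left_inverse)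
    also have "\<dots> = v powi (- 2)" using e powi_add[OF v(2), of "n - 1" "- n - 1"] by simp
    also have "v powi (- 2) = inverse v * inverse v" by (simp add: power_int_def power2_eq_square)
    finally have AB: "?A z * ?B z = inverse v * inverse v" .
    have det: "ma g * v - mnum g z * mc g = 1"
    proof -
      have "ma g * v - mnum g z * mc g = ma g * md g - mb g * mc g"
        using e z by (simp add: v_def mden_def mnum_def algebra_simps geven_ac)
      then show ?thesis using e by simp
    qed
    have "ma g * inverse v + mnum g z * - (inverse v * inverse v * mc g)
        = (ma g * v - mnum g z * mc g) * (inverse v * inverse v)"
    proof -
      have "ma g * inverse v = ma g * v * (inverse v * inverse v)" using v by (simp add: mult.assoc[symmetric]) (simp add: mult.assoc)
      moreover have "mnum g z * - (inverse v * inverse v * mc g) = - (mnum g z * mc g * (inverse v * inverse v))"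
        using e v by (simp add: geven_ac)
      ultimately show ?thesis by (simp add: algebra_simps)
    qed
    then have "ma g * inverse v + mnum g z * - (inverse v * inverse v * mc g) = inverse v * inverse v"
      unfolding det by simp
    then show "?A z * ?B z = ma g * inverse (mden g z) +
        mnum g z * - (inverse (mden g z) * inverse (mden g z) * mc g)"
      unfolding v_def[symmetric] AB[unfolded v_def[symmetric]] by (rule sym)
  qed simp_all
  have "superconformal_on M {q \<in> superspace M. body (fst q) \<in> U} (sconf ?h ?A ?B (\<lambda>_. 0) (\<lambda>_. 0) (\<lambda>_. 0) (\<lambda>_. 0))"
  proof (rule superconformal_on_sconf[OF \<open>open U\<close> _ M refl dh
        superdiff_cmult[OF superdiff_powi[OF dden \<open>open U\<close> den] \<open>open U\<close>]
        superdiff_cmult[OF superdiff_powi[OF dden \<open>open U\<close> den] \<open>open U\<close>] superdiff_const superdiff_const])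
    show "U \<noteq> {}" using assms(2) by (auto simp: U_def)
  qed (use e den mob_even[OF assms(1)] in auto)
  then show ?thesis
  proof (rule superconformal_on_cong)
    show "{q \<in> superspace M. body (mden g (fst q)) \<noteq> 0} = {q \<in> superspace M. body (fst q) \<in> U}" by (simp add: U)
    fix q assume q: "q \<in> {q \<in> superspace M. body (fst q) \<in> U}"
    obtain z p m where qq: "q = (z, p, m)" by (cases q)
    show "mob_map n g q = sconf ?h ?A ?B (\<lambda>_. 0) (\<lambda>_. 0) (\<lambda>_. 0) (\<lambda>_. 0) q"
      using e by (simp add: qq sconf_def geven_left_commute2)
  qed
qed

subsection \<open>Action on the sphere\<close>

text \<open>The point with homogeneous coordinates \<open>g \<cdot> q\<close>, where \<open>g \<cdot> q\<close> may lie at infinity.\<close>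

definition mob_pt :: "enat \<Rightarrow> int \<Rightarrow> mob \<Rightarrow> superpoint \<Rightarrow> sphere_point" where
  "mob_pt M n g q = (if body (mden g (fst q)) \<noteq> 0 then pt True M n (mob_map n g q)
     else pt False M n (mob_map n (mob_mult (mob_swap True n) g) q))"

text \<open>The matrix of the passage from \<open>\<Delta>\<^sub>n\<close> to the chart \<open>c\<close>.\<close>

definition mob_chart :: "bool \<Rightarrow> int \<Rightarrow> mob" where
  "mob_chart c n = (if c then mob_one else mob_swap True n)"

lemma body_mden_swap_mult: "body (mden (mob_mult (mob_swap c n) g) z) = chart_unit c * body (mnum g z)"
  by (simp add: mden_def mnum_def mob_mult_def mob_swap_def Let_def algebra_simps)

lemma mob_over_chart: "mob_over N (mob_chart c n)"
  by (simp add: mob_chart_def mob_over_one mob_over_swap)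

lemma mob_pt_chart:
  fixes c :: bool and n :: int
  assumes "mob_over N g" "N \<le> M" "q \<in> superspace M"
  defines "h \<equiv> mob_mult (mob_chart c n) g"
  shows "mob_pt M n g q \<in> sphere M n"
    "mob_pt M n g q \<in> chart_dom c M n \<longleftrightarrow> body (mden h (fst q)) \<noteq> 0"
    "body (mden h (fst q)) \<noteq> 0 \<Longrightarrow> coord c (mob_pt M n g q) = mob_map n h q"
proof -
  have z: "geven (fst q)" using assms(3) by (cases q) (auto simp: superspace_iff)
  let ?J = "mob_mult (mob_swap True n) g"
  have Jo: "mob_over N ?J" by (rule mob_over_mult[OF mob_over_swap assms(1)])
  have Jden: "body (mden ?J (fst q)) = 0 \<longleftrightarrow> body (mnum g (fst q)) = 0"
    by (simp add: body_mden_swap_mult)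
  have "mob_pt M n g q \<in> sphere M n \<and>
    (mob_pt M n g q \<in> chart_dom c M n \<longleftrightarrow> body (mden h (fst q)) \<noteq> 0) \<and>
    (body (mden h (fst q)) \<noteq> 0 \<longrightarrow> coord c (mob_pt M n g q) = mob_map n h q)"
  proof (cases "body (mden g (fst q)) = 0")
    case False
    note i = mob_map_in[OF assms(1-3) False, of n]
    have eq: "mob_pt M n g q = pt True M n (mob_map n g q)" using False by (simp add: mob_pt_def)
    show ?thesis
    proof (cases c)
      case True
      then show ?thesis using False i by (simp add: eq h_def mob_chart_def pt_in_chart_dom coord_pt)
    next
      case c: False
      have dom: "mob_pt M n g q \<in> chart_dom False M n \<longleftrightarrow> body (mden ?J (fst q)) \<noteq> 0"
        using i False by (simp add: eq pt_in_chart_dom Jden)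
      moreover have "coord False (mob_pt M n g q) = mob_map n ?J q" if "body (mden ?J (fst q)) \<noteq> 0"
      proof -
        have nz: "body (fst (mob_map n g q)) \<noteq> 0" using that i False by (simp add: Jden)
        have "mob_map n ?J q = mob_map n (mob_swap True n) (mob_map n g q)"
          by (rule mob_map_mult[symmetric, OF mob_over_swap assms(1) z False that])
        also have "\<dots> = change_chart True n (mob_map n g q)"
          using nz i(1) by (intro mob_map_swap) (cases "mob_map n g q", auto simp: superspace_iff)
        finally have J: "mob_map n ?J q = change_chart True n (mob_map n g q)" .
        have "mob_pt M n g q = pt False M n (mob_map n ?J q)"
          unfolding eq J using pt_change_chart[OF i(1) nz, of True n] by simp
        then show ?thesis using change_chart_in[OF i(1) nz] by (simp add: coord_pt J)
      qed
      ultimately show ?thesis using c i by (simp add: h_def mob_chart_def) (simp add: eq)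
    qed
  next
    case True
    have nJ: "body (mden ?J (fst q)) \<noteq> 0" using mob_den_or_num[OF assms(1) True] Jden by simp
    note i = mob_map_in[OF Jo assms(2,3) nJ, of n]
    have "body (mnum ?J (fst q)) = chart_unit True * body (mden g (fst q))"
      by (simp add: mden_def mnum_def mob_mult_def mob_swap_def Let_def algebra_simps)
    then have b0: "body (fst (mob_map n ?J q)) = 0" using i True by simp
    have eq: "mob_pt M n g q = pt False M n (mob_map n ?J q)" using True by (simp add: mob_pt_def)
    show ?thesis
      using i b0 True nJ by (cases c) (simp_all add: eq h_def mob_chart_def pt_in_chart_dom coord_pt)
  qed
  then show "mob_pt M n g q \<in> sphere M n"
    "mob_pt M n g q \<in> chart_dom c M n \<longleftrightarrow> body (mden h (fst q)) \<noteq> 0"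
    "body (mden h (fst q)) \<noteq> 0 \<Longrightarrow> coord c (mob_pt M n g q) = mob_map n h q" by auto
qed

lemma mob_pt_mult:
  assumes "mob_over N g" "mob_over N h" "geven (fst q)" "body (mden h (fst q)) \<noteq> 0"
  shows "mob_pt M n g (mob_map n h q) = mob_pt M n (mob_mult g h) q"
proof -
  obtain z p m where q: "q = (z, p, m)" by (cases q)
  have z: "geven z" "body (mden h z) \<noteq> 0" using assms q by auto
  have zz: "fst (mob_map n h q) = mnum h z * inverse (mden h z)" by (simp add: q)
  have b: "body (mden g (fst (mob_map n h q))) = 0 \<longleftrightarrow> body (mden (mob_mult g h) z) = 0"
    unfolding zz mob_den_num[OF assms(1,2) z] using z(2) by simp
  let ?J = "mob_mult (mob_swap True n)"
  show ?thesis
  proof (cases "body (mden (mob_mult g h) z) = 0")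
    case False
    then show ?thesis using b mob_map_mult[OF assms] by (simp add: mob_pt_def q)
  next
    case True
    have "body (mden (mob_mult (?J g) h) z) \<noteq> 0"
      using mob_den_or_num[OF mob_over_mult[OF assms(1,2)] True]
      by (simp add: mob_mult_assoc body_mden_swap_mult)
    then have "mob_map n (?J g) (mob_map n h q) = mob_map n (?J (mob_mult g h)) q"
      using mob_map_mult[OF mob_over_mult[OF mob_over_swap assms(1)] assms(2-4), of True n n] by (simp add: q mob_mult_assoc)
    then show ?thesis using b True by (simp add: mob_pt_def q)
  qed
qed

text \<open>The matrix of the passage from the chart \<open>c\<close> to \<open>\<Delta>\<^sub>n\<close>.\<close>

definition mob_base :: "bool \<Rightarrow> int \<Rightarrow> mob" where
  "mob_base c n = (if c then mob_one else mob_swap False n)"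

lemma mob_over_base: "mob_over N (mob_base c n)"
  by (simp add: mob_base_def mob_over_one mob_over_swap)

lemma mob_pt_base:
  assumes "q \<in> superspace M"
  shows "mob_pt M n (mob_base c n) q = pt c M n q"
proof (cases c)
  case True
  then show ?thesis by (simp add: mob_base_def mob_pt_def mden_def mob_one_def mob_map_one[unfolded mob_one_def])
next
  case False
  have z: "geven (fst q)" using assms by (cases q) (auto simp: superspace_iff)
  show ?thesis
  proof (cases "body (fst q) = 0")
    case True
    then show ?thesis using False mob_swap_swap[of True n] by (simp add: mob_base_def mob_pt_def mob_map_one)
  next
    case nz: False
    then show ?thesis using False pt_change_chart[OF assms nz, of False n] mob_map_swap[OF z nz, of n False]
      by (simp add: mob_base_def mob_pt_def)
  qed
qed

definition mob_aut :: "enat \<Rightarrow> int \<Rightarrow> mob \<Rightarrow> sphere_point \<Rightarrow> sphere_point" where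
  "mob_aut M n g = sphere_map (\<lambda>c. mob_pt M n (mob_mult g (mob_base c n))) M n"

lemma mob_aut_pt:
  assumes "mob_over N g" "q \<in> superspace M"
  shows "mob_aut M n g (pt c M n q) = mob_pt M n (mob_mult g (mob_base c n)) q"
  unfolding mob_aut_def
proof (rule sphere_map_pt[OF _ assms(2)])
  fix q assume q: "q \<in> superspace M" "body (fst q) \<noteq> 0"
  have z: "geven (fst q)" using q by (cases q) (auto simp: superspace_iff)
  show "mob_pt M n (mob_mult g (mob_base True n)) (change_chart False n q) = mob_pt M n (mob_mult g (mob_base False n)) q"
    using mob_pt_mult[OF assms(1) mob_over_swap z, of False n M n] q mob_map_swap[OF z q(2), of n False]
    by (simp add: mob_base_def)
qed

lemma mob_aut_mob_pt:
  assumes "mob_over N g" "mob_over N h" "N \<le> M" "q \<in> superspace M"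
  shows "mob_aut M n g (mob_pt M n h q) = mob_pt M n (mob_mult g h) q"
proof -
  have z: "geven (fst q)" using assms(4) by (cases q) (auto simp: superspace_iff)
  let ?J = "mob_mult (mob_swap True n) h"
  have Jo: "mob_over N ?J" by (rule mob_over_mult[OF mob_over_swap assms(2)])
  show ?thesis
  proof (cases "body (mden h (fst q)) = 0")
    case False
    then have "mob_aut M n g (mob_pt M n h q) = mob_aut M n g (pt True M n (mob_map n h q))"
      by (simp add: mob_pt_def)
    also have "\<dots> = mob_pt M n g (mob_map n h q)"
      using mob_aut_pt[OF assms(1) mob_map_in(1)[OF assms(2-4) False, of n], where n = n and c = True] by (simp add: mob_base_def)
    finally show ?thesis using mob_pt_mult[OF assms(1,2) z False] by simp
  next
    case True
    have nJ: "body (mden ?J (fst q)) \<noteq> 0"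
      using mob_den_or_num[OF assms(2) True] by (simp add: body_mden_swap_mult)
    have "mob_aut M n g (mob_pt M n h q) = mob_aut M n g (pt False M n (mob_map n ?J q))"
      using True by (simp add: mob_pt_def)
    also have "\<dots> = mob_pt M n (mob_mult g (mob_swap False n)) (mob_map n ?J q)"
      using mob_aut_pt[OF assms(1) mob_map_in(1)[OF Jo assms(3,4) nJ, of n], where n = n and c = False] by (simp add: mob_base_def)
    also have "\<dots> = mob_pt M n (mob_mult (mob_mult g (mob_swap False n)) ?J) q"
      by (rule mob_pt_mult[OF mob_over_mult[OF assms(1) mob_over_swap] Jo z nJ])
    also have "mob_mult (mob_mult g (mob_swap False n)) ?J = mob_mult g (mob_mult (mob_mult (mob_swap False n) (mob_swap True n)) h)"
      by (simp add: mob_mult_assoc)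
    finally show ?thesis using mob_swap_swap[of False n] by simp
  qed
qed

lemma mob_aut_superconformal:
  assumes "mob_over (M - 2) g"
  shows "superconformal_map M (sphere_atlas M n) (mob_aut M n g)"
  unfolding superconformal_map_sphere_iff
proof (intro allI impI)
  fix c d
  have M: "M - 2 \<le> M" by (cases M) (auto simp: numeral_eq_enat)
  let ?g = "mob_mult g (mob_base c n)"
  let ?h = "mob_mult (mob_chart d n) ?g"
  let ?D = "{q \<in> superspace M. mob_aut M n g (pt c M n q) \<in> chart_dom d M n}"
  assume ne: "?D \<noteq> {}"
  have g: "mob_over (M - 2) ?g" by (rule mob_over_mult[OF assms mob_over_base])
  have h: "mob_over (M - 2) ?h" by (rule mob_over_mult[OF mob_over_chart g])
  have D: "?D = {q \<in> superspace M. body (mden ?h (fst q)) \<noteq> 0}"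
    using mob_aut_pt[OF assms] mob_pt_chart(2)[OF g M] by auto
  have "superconformal_on M {q \<in> superspace M. body (mden ?h (fst q)) \<noteq> 0} (mob_map n ?h)"
    by (rule mob_map_superconformal[OF h]) (use ne in \<open>auto simp: D mden_def[of ?h]\<close>)
  then show "superconformal_on M ?D (\<lambda>q. coord d (mob_aut M n g (pt c M n q)))"
    by (rule superconformal_on_cong[OF _ D]) (use mob_aut_pt[OF assms] mob_pt_chart(3)[OF g M] in auto)
qed

lemma sphere_mob_pt: "P \<in> sphere M n \<Longrightarrow> \<exists>c q. q \<in> superspace M \<and> P = mob_pt M n (mob_base c n) q"
  by (auto simp: sphere_eq) (metis mob_pt_base)

text \<open>In every pair of charts the map is \<open>mob_map\<close> of a product of matrices, which is superconformal;
  the inverse is given by the inverse matrix and multiplier.\<close>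

lemma mob_aut_in_auts:
  assumes "mob_over (M - 2) g"
  shows "mob_aut M n g \<in> sphere_auts M n"
proof (rule sphere_autsI)
  have M: "M - 2 \<le> M" by (cases M) (auto simp: numeral_eq_enat)
  note inv = mob_over_inv[OF assms]
  show "superconformal_map M (sphere_atlas M n) (mob_aut M n g)"
    "superconformal_map M (sphere_atlas M n) (mob_aut M n (mob_inv g))"
    by (rule mob_aut_superconformal, fact)+
  have *: "mob_aut M n f P \<in> sphere M n \<and> mob_aut M n f' (mob_aut M n f P) = P"
    if f: "mob_over (M - 2) f" "mob_over (M - 2) f'" "mob_mult f' f = mob_one" and P: "P \<in> sphere M n" for f f' P
  proof -
    obtain c q where q: "q \<in> superspace M" "P = mob_pt M n (mob_base c n) q" using sphere_mob_pt[OF P] by blast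
    have b: "mob_over (M - 2) (mob_mult f (mob_base c n))" by (rule mob_over_mult[OF f(1) mob_over_base])
    have "mob_aut M n f P = mob_pt M n (mob_mult f (mob_base c n)) q"
      unfolding q(2) by (rule mob_aut_mob_pt[OF f(1) mob_over_base M q(1)])
    moreover have "mob_aut M n f' (mob_pt M n (mob_mult f (mob_base c n)) q) = P"
      using mob_aut_mob_pt[OF f(2) b M q(1)] f(3) q(2) by (simp add: mob_mult_assoc[symmetric])
    ultimately show ?thesis using mob_pt_chart(1)[OF b M q(1)] by simp
  qed
  show "mob_aut M n g P \<in> sphere M n \<and> mob_aut M n (mob_inv g) (mob_aut M n g P) = P"
    "mob_aut M n (mob_inv g) P \<in> sphere M n \<and> mob_aut M n g (mob_aut M n (mob_inv g) P) = P"
    if "P \<in> sphere M n" for P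
    using *[OF assms inv(1,2) that] *[OF inv(1) assms inv(3) that] by blast+
qed

lemma mob_aut_Delta:
  assumes "mob_over (M - 2) g" "q \<in> superspace M" "body (mden g (fst q)) \<noteq> 0"
  shows "in_Delta_coordinates M n (mob_aut M n g) q (mob_map n g q)"
proof -
  have M: "M - 2 \<le> M" by (cases M) (auto simp: numeral_eq_enat)
  have eq: "mob_aut M n g (pt True M n q) = mob_pt M n g q"
    using mob_aut_pt[OF assms(1,2), where n = n and c = True] by (simp add: mob_base_def)
  show ?thesis
    unfolding in_Delta_coordinates_iff[OF assms(2)] eq
    using mob_pt_chart(2,3)[OF assms(1) M assms(2), where c = True and n = n] assms(3) by (simp add: mob_chart_def)
qed

section \<open>Flows of even superderivations\<close>

subsection \<open>Curves in the Grassmann algebra\<close>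

definition has_gderiv :: "(complex \<Rightarrow> grassmann) \<Rightarrow> grassmann \<Rightarrow> complex \<Rightarrow> bool" where
  "has_gderiv Q Q' t \<longleftrightarrow> (\<forall>s. ((\<lambda>t. gcoeff (Q t) s) has_field_derivative gcoeff Q' s) (at t))"

lemma has_gderiv_const: "has_gderiv (\<lambda>t. a) 0 t"
  by (simp add: has_gderiv_def)

lemma has_gderiv_gconst:
  "(f has_field_derivative f') (at t) \<Longrightarrow> has_gderiv (\<lambda>t. gconst (f t)) (gconst f') t"
  by (auto simp: has_gderiv_def gcoeff_gconst)

lemma has_gderiv_add:
  "has_gderiv P P' t \<Longrightarrow> has_gderiv Q Q' t \<Longrightarrow> has_gderiv (\<lambda>t. P t + Q t) (P' + Q') t"
  by (auto simp: has_gderiv_def intro!: derivative_intros)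

lemma has_gderiv_sum:
  "(\<And>i. i \<in> A \<Longrightarrow> has_gderiv (Q i) (Q' i) t) \<Longrightarrow> has_gderiv (\<lambda>t. \<Sum>i\<in>A. Q i t) (\<Sum>i\<in>A. Q' i) t"
  by (auto simp: has_gderiv_def intro!: derivative_intros)

lemma has_gderiv_mult:
  assumes "has_gderiv P P' t" "has_gderiv Q Q' t"
  shows "has_gderiv (\<lambda>t. P t * Q t) (P' * Q t + P t * Q') t"
  unfolding has_gderiv_def
proof
  fix s
  have "((\<lambda>t. \<Sum>u\<in>Pow s. gsign u (s - u) * gcoeff (P t) u * gcoeff (Q t) (s - u)) has_field_derivative
     (\<Sum>u\<in>Pow s. gsign u (s - u) * gcoeff P' u * gcoeff (Q t) (s - u)
        + gsign u (s - u) * gcoeff (P t) u * gcoeff Q' (s - u))) (at t)"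
    using assms unfolding has_gderiv_def
    by (intro DERIV_sum) (auto intro!: derivative_eq_intros simp: algebra_simps)
  then show "((\<lambda>t. gcoeff (P t * Q t) s) has_field_derivative gcoeff (P' * Q t + P t * Q') s) (at t)"
    by (simp add: gcoeff_mult sum.distrib)
qed

lemma has_gderiv_power:
  assumes "has_gderiv Q Q' t" "geven (Q t)"
  shows "has_gderiv (\<lambda>t. Q t ^ k) (gconst (of_nat k) * Q t ^ (k - 1) * Q') t"
proof (induction k)
  case 0
  show ?case using has_gderiv_const[of 1] by simp
next
  case (Suc k)
  have "Q t * (gconst (of_nat k) * Q t ^ (k - 1) * Q') = gconst (of_nat k) * Q t ^ k * Q'"
    by (cases k) (simp_all add: mult.assoc gconst_left_commute[of "Q t"])
  moreover have "Q' * Q t ^ k = Q t ^ k * Q'" using assms(2) geven_commute[of "Q t ^ k" Q'] by simp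
  ultimately show ?case using has_gderiv_mult[OF assms(1) Suc] by (simp add: gconst_add algebra_simps)
qed

lemma has_gderiv_cmult: "has_gderiv Q Q' t \<Longrightarrow> has_gderiv (\<lambda>t. a * Q t) (a * Q') t"
  using has_gderiv_mult[OF has_gderiv_const[of a]] by simp

lemma has_gderiv_uminus: "has_gderiv Q Q' t \<Longrightarrow> has_gderiv (\<lambda>t. - Q t) (- Q') t"
  using has_gderiv_cmult[of Q Q' t "- 1"] by simp

lemma has_gderiv_cong:
  assumes "has_gderiv Q P t" "\<And>t. R t = Q t" "P' = P"
  shows "has_gderiv R P' t"
  using assms by (simp add: has_gderiv_def)

text \<open>The monomials of a product of \<open>k\<close> souls have size at least \<open>k\<close>, so each coefficient of an
  analytic function involves only finitely many of its derivatives, uniformly in the argument.\<close>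

lemma gcoeff_soul_power: "card s < k \<Longrightarrow> gcoeff (soul a ^ k) s = 0"
proof (induction k arbitrary: s)
  case (Suc k)
  show ?case
  proof (rule ccontr)
    assume "gcoeff (soul a ^ Suc k) s \<noteq> 0"
    then have "gcoeff (soul a * soul a ^ k) s \<noteq> 0" by simp
    then obtain t where t: "t \<subseteq> s" "finite s" "gcoeff (soul a) t \<noteq> 0" "gcoeff (soul a ^ k) (s - t) \<noteq> 0"
      by (rule gcoeff_mult_nonzero)
    have "t \<noteq> {}" using t(3) by (auto simp: gcoeff_soul)
    then have "card t > 0" using t finite_subset by (simp add: card_gt_0_iff) blast
    then have "card (s - t) < k" using card_split[OF t(1,2)] Suc.prems by simp
    then show False using Suc.IH t(4) by blast
  qed
qed simp

definition gext_upto :: "nat \<Rightarrow> (complex \<Rightarrow> complex) \<Rightarrow> grassmann \<Rightarrow> grassmann" where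
  "gext_upto K f z = (\<Sum>l<K. gconst ((deriv ^^ l) f (body z) / fact l) * soul z ^ l)"

lemma gcoeff_gext:
  assumes "card s < K"
  shows "gcoeff (gext f z) s = gcoeff (gext_upto K f z) s"
proof -
  obtain K' where K': "soul z ^ K' = 0" using soul_nilpotent by blast
  have "soul z ^ max K K' = 0" by (rule soul_power_eq_0[OF K']) simp
  then have "gcoeff (gext f z) s = (\<Sum>l<max K K'. (deriv ^^ l) f (body z) / fact l * gcoeff (soul z ^ l) s)"
    by (simp add: gext_eq_sum)
  also have "\<dots> = (\<Sum>l<K. (deriv ^^ l) f (body z) / fact l * gcoeff (soul z ^ l) s)"
    by (rule sum.mono_neutral_right) (use assms in \<open>auto intro!: gcoeff_soul_power\<close>)
  finally show ?thesis by (simp add: gext_upto_def)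
qed

lemma has_gderiv_gext:
  assumes Q: "has_gderiv Q Q' t" "geven (Q t)" and f: "f holomorphic_on U" "open U" "body (Q t) \<in> U"
  shows "has_gderiv (\<lambda>t. gext f (Q t)) (gext (deriv f) (Q t) * Q') t"
  unfolding has_gderiv_def
proof
  fix s :: "nat set"
  obtain K0 where K0: "soul (Q t) ^ K0 = 0" using soul_nilpotent by blast
  define K where "K = Suc (max (Suc (card s)) K0)"
  have SK: "soul (Q t) ^ (K - 1) = 0" by (rule soul_power_eq_0[OF K0]) (simp add: K_def)
  have bd: "((\<lambda>t. body (Q t)) has_field_derivative body Q') (at t)"
    using Q(1) by (simp add: has_gderiv_def body_def)
  have sd: "has_gderiv (\<lambda>t. soul (Q t)) (soul Q') t"
    unfolding soul_def diff_conv_add_uminus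
    by (intro has_gderiv_add has_gderiv_uminus has_gderiv_gconst Q bd)
  define F where "F l = (deriv ^^ l) f (body (Q t))" for l
  have Fd: "((\<lambda>t. (deriv ^^ l) f (body (Q t)) / fact l) has_field_derivative F (Suc l) * body Q' / fact l) (at t)" for l
  proof -
    have "((deriv ^^ l) f has_field_derivative F (Suc l)) (at (body (Q t)))"
      unfolding F_def funpow.simps o_def
      by (rule holomorphic_derivI[OF holomorphic_higher_deriv[OF f(1,2)] f(2,3)])
    then show ?thesis using DERIV_chain2[OF _ bd] by (intro DERIV_cdivide) auto
  qed
  let ?S = "soul (Q t)"
  have "has_gderiv (\<lambda>t. gext_upto K f (Q t)) (\<Sum>l<K. gconst (F (Suc l) * body Q' / fact l) * ?S ^ l
      + gconst (F l / fact l) * (gconst (of_nat l) * ?S ^ (l - 1) * soul Q')) t"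
    unfolding gext_upto_def
    by (intro has_gderiv_sum) (use has_gderiv_mult[OF has_gderiv_gconst[OF Fd] has_gderiv_power[OF sd]] Q in \<open>simp add: F_def\<close>)
  moreover have "(\<Sum>l<K. gconst (F (Suc l) * body Q' / fact l) * ?S ^ l
      + gconst (F l / fact l) * (gconst (of_nat l) * ?S ^ (l - 1) * soul Q')) = gext (deriv f) (Q t) * Q'"
  proof -
    have K1: "K = Suc (K - 1)" by (simp add: K_def)
    have SK': "?S ^ K = 0" using soul_power_eq_0[OF SK] by simp
    have term1: "gconst (F (Suc l) * body Q' / fact l) * ?S ^ l = gconst (F (Suc l) / fact l) * ?S ^ l * gconst (body Q')" for l
    proof -
      have "gconst (F (Suc l) * body Q' / fact l) = gconst (F (Suc l) / fact l) * gconst (body Q')"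
        by (simp add: gconst_mult[symmetric])
      then show ?thesis by (simp add: mult.assoc gconst_commute[of "?S ^ l"])
    qed
    have term2: "gconst (F (Suc l) / fact (Suc l)) * (gconst (of_nat (Suc l)) * ?S ^ l * soul Q')
        = gconst (F (Suc l) / fact l) * ?S ^ l * soul Q'" for l
    proof -
      have "F (Suc l) / fact (Suc l) * of_nat (Suc l) = F (Suc l) / fact l"
        by (simp add: divide_simps del: of_nat_Suc)
      then have "gconst (F (Suc l) / fact (Suc l)) * gconst (of_nat (Suc l)) = gconst (F (Suc l) / fact l)"
        by (metis gconst_mult)
      then show ?thesis by (simp add: mult.assoc[symmetric] del: of_nat_Suc fact_Suc)
    qed
    have "(\<Sum>l<K. gconst (F l / fact l) * (gconst (of_nat l) * ?S ^ (l - 1) * soul Q'))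
        = (\<Sum>l<K - 1. gconst (F (Suc l) / fact l) * ?S ^ l * soul Q')"
      by (subst K1, subst sum.lessThan_Suc_shift) (simp add: term2 del: of_nat_Suc fact_Suc)
    also have "\<dots> = (\<Sum>l<K. gconst (F (Suc l) / fact l) * ?S ^ l * soul Q')"
      by (subst (2) K1) (simp add: SK[unfolded One_nat_def])
    finally have "(\<Sum>l<K. gconst (F (Suc l) * body Q' / fact l) * ?S ^ l
      + gconst (F l / fact l) * (gconst (of_nat l) * ?S ^ (l - 1) * soul Q'))
      = (\<Sum>l<K. gconst (F (Suc l) / fact l) * ?S ^ l * gconst (body Q')) + (\<Sum>l<K. gconst (F (Suc l) / fact l) * ?S ^ l * soul Q')"
      unfolding sum.distrib term1 by simp
    also have "\<dots> = (\<Sum>l<K. gconst (F (Suc l) / fact l) * ?S ^ l) * (gconst (body Q') + soul Q')"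
      by (simp add: sum_distrib_right distrib_left)
    also have "\<dots> = gext (deriv f) (Q t) * Q'"
      unfolding gext_eq_sum[OF SK'] body_plus_soul F_def by (simp add: funpow_swap1)
    finally show ?thesis .
  qed
  ultimately have "has_gderiv (\<lambda>t. gext_upto K f (Q t)) (gext (deriv f) (Q t) * Q') t" by simp
  then have "((\<lambda>t. gcoeff (gext_upto K f (Q t)) s) has_field_derivative gcoeff (gext (deriv f) (Q t) * Q') s) (at t)"
    unfolding has_gderiv_def by blast
  moreover have "gcoeff (gext f (Q t)) s = gcoeff (gext_upto K f (Q t)) s" for t
    by (rule gcoeff_gext) (simp add: K_def)
  ultimately show "((\<lambda>t. gcoeff (gext f (Q t)) s) has_field_derivative gcoeff (gext (deriv f) (Q t) * Q') s) (at t)"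
    by simp
qed

subsection \<open>Evaluation of complex superfunctions\<close>

lemma psf_eval_eq: "psf_eval F (z, p, m) = gext (papp (sf0 F)) z + p * gext (papp (sfp F)) z
    + m * gext (papp (sfm F)) z + p * m * gext (papp (sfpm F)) z"
proof -
  have "(\<lambda>f s. if s = {} then papp f else 0) = (\<lambda>f. gscalar (papp f))"
    by (simp add: gscalar_def fun_eq_iff)
  then show ?thesis by (cases F) (simp add: psf_eval_def gfun_eval_gscalar)
qed

lemma papp_holomorphic: "papp f holomorphic_on (- {0})"
  using papp[of f] by auto

lemma papp_simps [simp]:
  "papp 0 = (\<lambda>_. 0)" "papp (f + g) = (\<lambda>x. papp f x + papp g x)" "papp (f - g) = (\<lambda>x. papp f x - papp g x)"
  "papp (- f) = (\<lambda>x. - papp f x)" "papp (f * g) = (\<lambda>x. papp f x * papp g x)"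
  by (simp_all add: zero_pfun.rep_eq plus_pfun.rep_eq minus_pfun.rep_eq uminus_pfun.rep_eq times_pfun.rep_eq fun_eq_iff)

lemma gext_papp:
  assumes "geven z" "body z \<noteq> 0"
  shows "gext (papp 1) z = 1" "gext (papp (f + g)) z = gext (papp f) z + gext (papp g) z"
    "gext (papp (- f)) z = - gext (papp f) z" "gext (papp (f * g)) z = gext (papp f) z * gext (papp g) z"
    "gext (papp (f - g)) z = gext (papp f) z - gext (papp g) z"
    "gext (papp (pmonom c k)) z = gconst c * z powi k"
    "gext (papp (pderivative f)) z = gext (deriv (papp f)) z"
    "gext (papp 0) z = 0"
proof -
  have U: "open (- {0::complex})" "body z \<in> - {0}" using assms by auto
  show "gext (papp 1) z = 1"
    using gext_cong[OF U, of "papp 1" "\<lambda>_. 1"] by (simp add: one_pfun.rep_eq)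
  show a: "gext (papp (f + g)) z = gext (papp f) z + gext (papp g) z" for f g
    using gext_add[OF papp_holomorphic papp_holomorphic U] by simp
  show u: "gext (papp (- f)) z = - gext (papp f) z" for f
    using gext_uminus[OF papp_holomorphic U assms(1)] by simp
  show "gext (papp (f - g)) z = gext (papp f) z - gext (papp g) z"
    using a[of f "- g"] u[of g] by (simp del: papp_simps)
  show "gext (papp (f * g)) z = gext (papp f) z * gext (papp g) z"
    using gext_mult[OF papp_holomorphic papp_holomorphic U assms(1)] by simp
  have "gext (papp (pmonom c k)) z = gext (\<lambda>x. c * x powi k) z"
    by (rule gext_cong[OF U]) (simp add: pmonom.rep_eq)
  also have "\<dots> = gconst c * z powi k"
    using gext_cmult[OF _ U assms(1), of "\<lambda>x. x powi k" c] gext_powi[OF assms(2,1)] by (simp add: holomorphic_intros)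
  finally show "gext (papp (pmonom c k)) z = gconst c * z powi k" .
  show "gext (papp (pderivative f)) z = gext (deriv (papp f)) z"
    by (rule gext_cong[OF U]) (simp add: pderivative.rep_eq)
  show "gext (papp 0) z = 0" by (simp add: gext_const[of 0, simplified])
qed

lemma psf_eval_mult:
  assumes "q \<in> superspace M" "body (fst q) \<noteq> 0"
  shows "psf_eval (F * G) q = psf_eval F q * psf_eval G q"
proof -
  obtain z p m where q: "q = (z, p, m)" by (cases q)
  have z: "geven z" "body z \<noteq> 0" and pm: "godd p" "godd m" using assms by (auto simp: q superspace_iff)
  note c = godd_anticommute[OF pm(2,1)] godd_left_anticommute[OF pm(2,1)] godd_square[OF pm(1)] godd_square[OF pm(2)]
    godd_square_left[OF pm(1)] godd_square_left[OF pm(2)]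
  have e: "geven (gext f z)" for f using z by simp
  have l: "gext f z * (p * x) = p * (gext f z * x)" "gext f z * (m * x) = m * (gext f z * x)" for f x
    by (rule geven_left_commute2[OF e])+
  show ?thesis
    unfolding q psf_eval_eq times_superfun_def superfun.sel gext_papp[OF z]
    by (simp add: algebra_simps c l mult.assoc)
qed

lemma psf_eval_add:
  assumes "q \<in> superspace M" "body (fst q) \<noteq> 0"
  shows "psf_eval (F + G) q = psf_eval F q + psf_eval G q"
proof -
  obtain z p m where q: "q = (z, p, m)" by (cases q)
  have z: "geven z" "body z \<noteq> 0" using assms by (auto simp: q superspace_iff)
  show ?thesis unfolding q psf_eval_eq plus_superfun_def superfun.sel gext_papp[OF z]
    by (simp add: algebra_simps)
qed

lemma psf_eval_chain:
  assumes Z: "has_gderiv Z Z' t" "geven (Z t)" "body (Z t) \<noteq> 0" "geven Z'"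
    and P: "has_gderiv P P' t" "godd (P t)" and Q: "has_gderiv Q Q' t" "godd Q'"
  shows "has_gderiv (\<lambda>t. psf_eval F (Z t, P t, Q t))
    (Z' * psf_eval (dx F) (Z t, P t, Q t) + P' * psf_eval (dtp F) (Z t, P t, Q t)
      + Q' * psf_eval (dtm F) (Z t, P t, Q t)) t"
proof -
  have g: "has_gderiv (\<lambda>t. gext (papp f) (Z t)) (gext (papp (pderivative f)) (Z t) * Z') t" for f
  proof -
    have "open (- {0::complex})" by auto
    then show ?thesis
      using has_gderiv_gext[OF Z(1,2) papp_holomorphic] Z(3) gext_papp(7)[OF Z(2,3)] by simp
  qed
  have dxF: "sf0 (dx F) = pderivative (sf0 F)" "sfp (dx F) = pderivative (sfp F)"
    "sfm (dx F) = pderivative (sfm F)" "sfpm (dx F) = pderivative (sfpm F)"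
    by (cases F; simp add: dx_def)+
  note D = has_gderiv_add[OF has_gderiv_add[OF has_gderiv_add[OF g[of "sf0 F"]
      has_gderiv_mult[OF P(1) g[of "sfp F"]]] has_gderiv_mult[OF Q(1) g[of "sfm F"]]]
      has_gderiv_mult[OF has_gderiv_mult[OF P(1) Q(1)] g[of "sfpm F"]]]
  have sw: "P t * (Q' * x) = - (Q' * (P t * x))" for x using godd_left_anticommute[OF P(2) Q(2)] .
  have zc: "Z' * (x * y) = x * (y * Z')" "Z' * x = x * Z'" for x y
    using Z(4) by (metis geven_commute mult.assoc)+
  show ?thesis
    by (rule has_gderiv_cong[OF D])
      (simp_all add: psf_eval_eq dtp_def dtm_def dxF gext_papp[OF Z(2,3)] algebra_simps sw del: papp_simps, simp add: zc mult.assoc)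
qed

subsection \<open>Integral curves and the exponential series\<close>

lemma psf_eval_coordinates:
  assumes "q \<in> superspace M" "body (fst q) \<noteq> 0"
  shows "psf_eval (xmonom 1 1) q = fst q" "psf_eval phip q = fst (snd q)" "psf_eval phim q = snd (snd q)"
proof -
  obtain z p m where q: "q = (z, p, m)" by (cases q)
  have z: "geven z" "body z \<noteq> 0" using assms by (auto simp: q superspace_iff)
  show "psf_eval (xmonom 1 1) q = fst q" "psf_eval phip q = fst (snd q)" "psf_eval phim q = snd (snd q)"
    unfolding q psf_eval_eq xmonom_def phip_def phim_def superfun.sel gext_papp[OF z] by simp_all
qed

text \<open>Along an integral curve the coefficients of every superfunction are holomorphic in the curve
  parameter, with the iterated derivatives prescribed by the superderivation; the exponential series
  is their Taylor series at 0, evaluated at 1.\<close>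

lemma even_flow_integral_curve:
  assumes r: "r > 1" and y: "geven y"
    and Q: "\<And>t. t \<in> ball 0 r \<Longrightarrow> (Z t, P t, R t) \<in> superspace M \<and> body (Z t) \<noteq> 0"
    and der: "\<And>t. t \<in> ball 0 r \<Longrightarrow> has_gderiv Z (- y * psf_eval a (Z t, P t, R t)) t"
      "\<And>t. t \<in> ball 0 r \<Longrightarrow> has_gderiv P (- y * psf_eval b (Z t, P t, R t)) t"
      "\<And>t. t \<in> ball 0 r \<Longrightarrow> has_gderiv R (- y * psf_eval c (Z t, P t, R t)) t"
    and par: "\<And>t. t \<in> ball 0 r \<Longrightarrow> geven (psf_eval a (Z t, P t, R t)) \<and> godd (psf_eval c (Z t, P t, R t))"
  shows "even_flow (a, b, c) y (Z 0, P 0, R 0) (Z 1, P 1, R 1)"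
proof -
  let ?X = "(a, b, c)"
  let ?Q = "\<lambda>t. (Z t, P t, R t)"
  have in01: "0 \<in> ball (0::complex) r" "1 \<in> ball (0::complex) r" using r by auto
  have D: "has_gderiv (\<lambda>t. psf_eval F (?Q t)) (- y * psf_eval (sder_app ?X F) (?Q t)) t"
    if t: "t \<in> ball 0 r" for F t
  proof -
    have q: "?Q t \<in> superspace M" "body (fst (?Q t)) \<noteq> 0" using Q[OF t] by auto
    have pr: "geven (Z t)" "godd (P t)" using q(1) by (auto simp: superspace_iff)
    have "has_gderiv (\<lambda>t. psf_eval F (?Q t))
      (- y * psf_eval a (?Q t) * psf_eval (dx F) (?Q t) + - y * psf_eval b (?Q t) * psf_eval (dtp F) (?Q t)
        + - y * psf_eval c (?Q t) * psf_eval (dtm F) (?Q t)) t"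
      by (rule psf_eval_chain[OF der(1)[OF t] pr(1) _ _ der(2)[OF t] pr(2) der(3)[OF t]])
        (use Q[OF t] par[OF t] y in auto)
    then show ?thesis
      by (simp add: psf_eval_add[OF q] psf_eval_mult[OF q] distrib_left mult.assoc del: mult_minus_left)
  qed
  have nth: "(deriv ^^ k) (\<lambda>t. gcoeff (psf_eval F (?Q t)) s) t
      = gcoeff ((- y) ^ k * psf_eval ((sder_app ?X ^^ k) F) (?Q t)) s" if "t \<in> ball 0 r" for F s k t
    using that
  proof (induction k arbitrary: t)
    case (Suc k)
    have "(deriv ^^ Suc k) (\<lambda>t. gcoeff (psf_eval F (?Q t)) s) t
        = deriv (\<lambda>t. gcoeff ((- y) ^ k * psf_eval ((sder_app ?X ^^ k) F) (?Q t)) s) t"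
      unfolding funpow.simps o_def
      by (intro deriv_cong_ev eventually_mono[OF eventually_nhds_in_open[OF open_ball Suc.prems] Suc.IH]) auto
    also have "\<dots> = gcoeff ((- y) ^ k * (- y * psf_eval (sder_app ?X ((sder_app ?X ^^ k) F)) (?Q t))) s"
      using has_gderiv_cmult[OF D[OF Suc.prems, of "(sder_app ?X ^^ k) F"], of "(- y) ^ k"]
      unfolding has_gderiv_def by (blast intro: DERIV_imp_deriv)
    also have "(- y) ^ k * (- y * w) = (- y) ^ Suc k * w" for w
      by (metis mult.assoc power_Suc2)
    finally show ?case by (simp del: power_Suc sder_app.simps)
  qed simp
  have "gsums (\<lambda>k. gconst (1 / fact k) * (- y) ^ k * psf_eval ((sder_app ?X ^^ k) F) (?Q 0)) (psf_eval F (?Q 1))" for F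
    unfolding gsums_def
  proof
    fix s
    let ?f = "\<lambda>t. gcoeff (psf_eval F (?Q t)) s"
    have "?f holomorphic_on ball 0 r"
      using D[of _ F] unfolding has_gderiv_def by (subst holomorphic_on_open) (simp, blast)
    then have "(\<lambda>k. (deriv ^^ k) ?f 0 / fact k * (1 - 0) ^ k) sums ?f 1"
      by (rule holomorphic_power_series) (use in01 in auto)
    then show "(\<lambda>k. gcoeff (gconst (1 / fact k) * (- y) ^ k * psf_eval ((sder_app ?X ^^ k) F) (?Q 0)) s) sums ?f 1"
      by (simp add: nth[OF in01(1)] mult.assoc)
  qed
  note * = this
  have "psf_eval (xmonom 1 1) (?Q 1) = Z 1" "psf_eval phip (?Q 1) = P 1" "psf_eval phim (?Q 1) = R 1"
    using psf_eval_coordinates[of "?Q 1" M] Q[OF in01(2)] by simp_all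
  then show ?thesis
    unfolding even_flow_def
    using *[of "xmonom 1 1"] *[of phip] *[of phim] by (simp del: sder_app.simps)
qed

subsection \<open>Quadratic vector fields\<close>

lemma exp_matrix_functions:
  fixes \<Delta> :: complex
  obtains C S where "\<And>x. (C has_field_derivative \<Delta> * S x) (at x)" "\<And>x. (S has_field_derivative C x) (at x)"
    "C 0 = 1" "S 0 = 0" "\<And>x. C x * C x - \<Delta> * (S x * S x) = (1::complex)"
proof (cases "\<Delta> = 0")
  case True
  show ?thesis by (rule that[of "\<lambda>_. 1" "\<lambda>x. x"]) (auto simp: True intro!: derivative_eq_intros)
next
  case False
  define s where "s = csqrt \<Delta>"
  have s: "s * s = \<Delta>" "s \<noteq> 0" using False by (auto simp: s_def power2_eq_square[symmetric])
  show ?thesis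
  proof (rule that[of "\<lambda>x. cosh (s * x)" "\<lambda>x. sinh (s * x) / s"])
    fix x
    show "((\<lambda>x. cosh (s * x)) has_field_derivative \<Delta> * (sinh (s * x) / s)) (at x)"
      using s by (auto intro!: derivative_eq_intros simp: s(1)[symmetric])
    show "((\<lambda>x. sinh (s * x) / s) has_field_derivative cosh (s * x)) (at x)"
      using s by (auto intro!: derivative_eq_intros)
    have "\<Delta> * (sinh (s * x) / s * (sinh (s * x) / s)) = (sinh (s * x))\<^sup>2"
      using s by (simp add: s(1)[symmetric] power2_eq_square field_simps)
    then show "cosh (s * x) * cosh (s * x) - \<Delta> * (sinh (s * x) / s * (sinh (s * x) / s)) = 1"
      by (simp add: power2_eq_square[symmetric] cosh_square_eq)
  qed auto
qed

lemma has_gderiv_transform: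
  assumes "has_gderiv Q P t" "open S" "t \<in> S" "\<And>t. t \<in> S \<Longrightarrow> R t = Q t"
  shows "has_gderiv R P t"
  unfolding has_gderiv_def
proof
  fix s
  show "((\<lambda>t. gcoeff (R t) s) has_field_derivative gcoeff P s) (at t)"
    by (rule has_field_derivative_transform_within_open[of "\<lambda>t. gcoeff (Q t) s" _ _ S])
      (use assms in \<open>auto simp: has_gderiv_def\<close>)
qed

lemma has_gderiv_powi:
  assumes "has_gderiv v v' t" "open S" "t \<in> S" "\<And>t. t \<in> S \<Longrightarrow> geven (v t) \<and> body (v t) \<noteq> 0"
  shows "has_gderiv (\<lambda>t. v t powi k) (gconst (of_int k) * v t powi (k - 1) * v') t"
proof (rule has_gderiv_transform[OF _ assms(2,3)])
  have U: "open (- {0::complex})" "body (v t) \<in> - {0}" using assms by auto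
  have hol: "(\<lambda>x. x powi j) holomorphic_on (- {0::complex})" for j
    by (intro holomorphic_intros) auto
  have "gext (deriv (\<lambda>x. x powi k)) (v t) = gext (\<lambda>x. of_int k * x powi (k - 1)) (v t)"
    by (rule gext_cong[OF U]) (auto intro!: DERIV_imp_deriv derivative_eq_intros)
  also have "\<dots> = gconst (of_int k) * v t powi (k - 1)"
    using gext_cmult[OF hol U, of "of_int k" "k - 1"] assms(3,4) gext_powi by simp
  finally show "has_gderiv (\<lambda>t. gext (\<lambda>x. x powi k) (v t)) (gconst (of_int k) * v t powi (k - 1) * v') t"
    using has_gderiv_gext[OF assms(1) _ hol U(1), of k] assms(3,4) U by simp
qed (use assms(4) gext_powi in auto)

text \<open>The combination \<open>\<alpha> L\<^bsub>-1\<^esub> + \<beta> (L\<^sub>0 - n/2 J\<^sub>0) + \<gamma> (L\<^sub>1 - n J\<^sub>1) + \<delta> J\<^sub>0\<close>.\<close>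

definition quadratic_sder :: "int \<Rightarrow> complex \<Rightarrow> complex \<Rightarrow> complex \<Rightarrow> complex \<Rightarrow> sder" where
  "quadratic_sder n \<alpha> \<beta> \<gamma> \<delta> =
    (SF (- (pmonom \<alpha> 0 + pmonom \<beta> 1 + pmonom \<gamma> 2)) 0 0 0,
     SF 0 (- (pmonom (\<delta> + (1 - of_int n) * (\<beta> / 2)) 0 + pmonom ((1 - of_int n) * \<gamma>) 1)) 0 0,
     SF 0 0 (- (pmonom ((1 + of_int n) * (\<beta> / 2) - \<delta>) 0 + pmonom ((1 + of_int n) * \<gamma>) 1)) 0)"

lemma psf_eval_quadratic:
  assumes "(z, p, m) \<in> superspace M" "body z \<noteq> 0"
  shows "psf_eval (fst (quadratic_sder n \<alpha> \<beta> \<gamma> \<delta>)) (z, p, m) = - (gconst \<alpha> + gconst \<beta> * z + gconst \<gamma> * (z * z))"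
    "psf_eval (fst (snd (quadratic_sder n \<alpha> \<beta> \<gamma> \<delta>))) (z, p, m)
      = - (p * (gconst (\<delta> + (1 - of_int n) * (\<beta> / 2)) + gconst ((1 - of_int n) * \<gamma>) * z))"
    "psf_eval (snd (snd (quadratic_sder n \<alpha> \<beta> \<gamma> \<delta>))) (z, p, m)
      = - (m * (gconst ((1 + of_int n) * (\<beta> / 2) - \<delta>) + gconst ((1 + of_int n) * \<gamma>) * z))"
proof -
  have z: "geven z" using assms by (auto simp: superspace_iff)
  have z2: "z powi 2 = z * z" by (simp add: power2_eq_square)
  show "psf_eval (fst (quadratic_sder n \<alpha> \<beta> \<gamma> \<delta>)) (z, p, m) = - (gconst \<alpha> + gconst \<beta> * z + gconst \<gamma> * (z * z))"
    "psf_eval (fst (snd (quadratic_sder n \<alpha> \<beta> \<gamma> \<delta>))) (z, p, m)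
      = - (p * (gconst (\<delta> + (1 - of_int n) * (\<beta> / 2)) + gconst ((1 - of_int n) * \<gamma>) * z))"
    "psf_eval (snd (snd (quadratic_sder n \<alpha> \<beta> \<gamma> \<delta>))) (z, p, m)
      = - (m * (gconst ((1 + of_int n) * (\<beta> / 2) - \<delta>) + gconst ((1 + of_int n) * \<gamma>) * z))"
    unfolding quadratic_sder_def fst_conv snd_conv psf_eval_eq superfun.sel gext_papp[OF z assms(2)] z2
    by (simp_all add: distrib_left right_diff_distrib)
qed

lemma entire_linear_bound:
  assumes "f holomorphic_on UNIV" "f 0 = (0::complex)"
  obtains K where "K \<ge> 0" "\<And>x. norm x \<le> 1 \<Longrightarrow> norm (f x) \<le> K * norm x"
proof -
  have "continuous_on (cball 0 1) (deriv f)"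
    using assms(1) by (intro holomorphic_on_imp_continuous_on holomorphic_on_subset[OF holomorphic_deriv]) auto
  then have "bounded (deriv f ` cball 0 1)"
    by (intro compact_imp_bounded compact_continuous_image) auto
  then obtain K where K: "\<And>x. x \<in> cball 0 1 \<Longrightarrow> norm (deriv f x) \<le> K"
    unfolding bounded_iff by blast
  have "norm (f x) \<le> K * norm x" if "norm x \<le> 1" for x
  proof -
    have "norm (f x - f 0) \<le> K * norm (x - 0)"
    proof (rule field_differentiable_bound[of "cball 0 1"])
      fix z :: complex assume "z \<in> cball 0 1"
      show "(f has_field_derivative deriv f z) (at z within cball 0 1)"
        by (rule has_field_derivative_at_within, rule holomorphic_derivI[OF assms(1)]) auto
    qed (use K that in auto)
    then show ?thesis using assms(2) by simp
  qed
  moreover have "K \<ge> 0" by (rule order_trans[OF norm_ge_zero K[of 0]]) simp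
  ultimately show ?thesis using that by blast
qed

lemma riccati_identity:
  assumes "geven a" "geven b" "geven g" "geven u" "geven v" "geven w" "geven y" "v * w = 1"
  shows "(y * (a * v + b * u)) * w + u * (- (w * w * - (y * (g * u + b * v)))) = y * (a + (b + b) * (u * w) + g * (u * w * (u * w)))"
proof -
  have vw: "v * (w * x) = x" for x using assms(8) by (metis mult.assoc mult_1_left)
  show ?thesis using assms(1-7) by (simp add: algebra_simps geven_ac vw assms(8))
qed

lemma multiplier_identity:
  assumes "geven b" "geven d" "geven e" "geven g" "geven k" "geven t" "geven u" "geven v" "geven w" "geven y"
    "v * w = 1"
  shows "(d * e * y) * (p * (t * v)) + e * (p * (- k * t * - (y * (g * u + b * v))))
    = y * (e * (p * (t * v)) * (d + k * b + k * g * (u * w)))"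
proof -
  have vw: "v * (w * x) = x" for x using assms(11) by (metis mult.assoc mult_1_left)
  show ?thesis using assms(1-10) by (simp add: algebra_simps geven_ac vw assms(11))
qed

text \<open>The one-parameter group generated by the matrix \<open>((\<beta>/2, \<alpha>), (-\<gamma>, -\<beta>/2))\<close>, which acts on \<open>z\<close> through
  the vector field \<open>\<alpha> + \<beta> z + \<gamma> z\<^sup>2\<close>.\<close>

definition quadratic_flow :: "(complex \<Rightarrow> complex) \<Rightarrow> (complex \<Rightarrow> complex) \<Rightarrow>
    complex \<Rightarrow> complex \<Rightarrow> complex \<Rightarrow> complex \<Rightarrow> grassmann \<Rightarrow> mob" where
  "quadratic_flow C S \<alpha> \<beta> \<gamma> \<delta> y = Mob (gext C y + gconst (\<beta> / 2) * gext S y) (gconst \<alpha> * gext S y)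
     (- (gconst \<gamma> * gext S y)) (gext C y - gconst (\<beta> / 2) * gext S y) (gext (\<lambda>x. exp (\<delta> * x)) y)"

lemma mob_over_quadratic_flow:
  assumes "y \<in> galg N" "geven y" "C holomorphic_on UNIV" "S holomorphic_on UNIV"
    "\<And>x. C x * C x - (\<beta> * \<beta> / 4 - \<alpha> * \<gamma>) * (S x * S x) = 1"
  shows "mob_over N (quadratic_flow C S \<alpha> \<beta> \<gamma> \<delta> y)"
proof -
  let ?c = "gext C y" and ?s = "gext S y"
  have U: "open (UNIV :: complex set)" "body y \<in> UNIV" by auto
  have "gext (\<lambda>x. C x * C x + - (\<beta> * \<beta> / 4 - \<alpha> * \<gamma>) * (S x * S x)) y = ?c * ?c + gconst (- (\<beta> * \<beta> / 4 - \<alpha> * \<gamma>)) * (?s * ?s)"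
    using gext_add[of "\<lambda>x. C x * C x" UNIV "\<lambda>x. - (\<beta> * \<beta> / 4 - \<alpha> * \<gamma>) * (S x * S x)" y]
      gext_mult[OF assms(3,3) U assms(2)] gext_mult[OF assms(4,4) U assms(2)]
      gext_cmult[OF _ U assms(2), of "\<lambda>x. S x * S x" "- (\<beta> * \<beta> / 4 - \<alpha> * \<gamma>)"] assms(3,4)
    by (simp add: holomorphic_intros)
  moreover have "(\<lambda>x. C x * C x + - (\<beta> * \<beta> / 4 - \<alpha> * \<gamma>) * (S x * S x)) = (\<lambda>x. 1)"
    using assms(5) by (auto simp: fun_eq_iff algebra_simps)
  ultimately have det: "?c * ?c + gconst (- (\<beta> * \<beta> / 4 - \<alpha> * \<gamma>)) * (?s * ?s) = 1" by simp
  have g: "gconst (- (\<beta> * \<beta> / 4 - \<alpha> * \<gamma>)) = gconst \<alpha> * gconst \<gamma> - gconst (\<beta> / 2) * gconst (\<beta> / 2)"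
    by (simp add: gconst_mult[symmetric] gconst_diff[symmetric])
  have "(?c + gconst (\<beta> / 2) * ?s) * (?c - gconst (\<beta> / 2) * ?s) - gconst \<alpha> * ?s * - (gconst \<gamma> * ?s) = 1"
    using assms(2) unfolding det[unfolded g, symmetric] by (simp add: algebra_simps geven_ac)
  then show ?thesis using assms(1,2) by (auto simp: mob_over_def quadratic_flow_def)
qed

lemma quadratic_sder_flow:
  assumes CS: "\<And>x. (C has_field_derivative (\<beta> * \<beta> / 4 - \<alpha> * \<gamma>) * S x) (at x)" "\<And>x. (S has_field_derivative C x) (at x)"
      "C 0 = 1" "S 0 = 0" "\<And>x. C x * C x - (\<beta> * \<beta> / 4 - \<alpha> * \<gamma>) * (S x * S x) = 1"
    and y: "y \<in> galg_even (M - 2)" and q: "q \<in> superspace M" and r: "r > 1"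
    and nz: "\<And>t. t \<in> ball 0 r \<Longrightarrow> body (mnum (quadratic_flow C S \<alpha> \<beta> \<gamma> \<delta> (gconst t * y)) (fst q)) \<noteq> 0"
      "\<And>t. t \<in> ball 0 r \<Longrightarrow> body (mden (quadratic_flow C S \<alpha> \<beta> \<gamma> \<delta> (gconst t * y)) (fst q)) \<noteq> 0"
  shows "even_flow (quadratic_sder n \<alpha> \<beta> \<gamma> \<delta>) y q (mob_map n (quadratic_flow C S \<alpha> \<beta> \<gamma> \<delta> y) q)"
proof -
  obtain z p m where qq: "q = (z, p, m)" by (cases q)
  have zpm: "geven z" "godd p" "godd m" "z \<in> galg M" using q by (auto simp: qq superspace_iff)
  have ye: "geven y" "y \<in> galg (M - 2)" using y by (auto simp: galg_even_iff)
  have M: "M - 2 \<le> M" by (cases M) (auto simp: numeral_eq_enat)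
  let ?G = "\<lambda>t. quadratic_flow C S \<alpha> \<beta> \<gamma> \<delta> (gconst t * y)"
  have hol: "C holomorphic_on UNIV" "S holomorphic_on UNIV"
    using CS(1,2) by (auto simp: holomorphic_on_open)
  have Go: "mob_over (M - 2) (?G t)" for t
    by (rule mob_over_quadratic_flow[OF _ _ hol CS(5)]) (use ye in auto)
  define s where "s t = gext S (gconst t * y)" for t
  define c where "c t = gext C (gconst t * y)" for t
  define e where "e t = gext (\<lambda>x. exp (\<delta> * x)) (gconst t * y)" for t
  define e' where "e' t = gext (\<lambda>x. exp (- \<delta> * x)) (gconst t * y)" for t
  define b where "b = gconst (\<beta> / 2)"
  define u where "u t = mnum (?G t) z" for t
  define v where "v t = mden (?G t) z" for t
  have ev: "geven (s t)" "geven (c t)" "geven (e t)" "geven (e' t)" "geven b" "geven (u t)" "geven (v t)" for t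
    using ye mob_even[OF Go zpm(1)] by (auto simp: s_def c_def e_def e'_def b_def u_def v_def)
  have ueq: "u t = (c t + b * s t) * z + gconst \<alpha> * s t" and veq: "v t = - (gconst \<gamma> * s t) * z + (c t - b * s t)" for t
    by (simp_all add: u_def v_def mnum_def mden_def quadratic_flow_def s_def c_def b_def)
  have ie: "inverse (e t) = e' t" for t
  proof -
    have "e' t = gext (\<lambda>x. inverse (exp (\<delta> * x))) (gconst t * y)" by (simp add: e'_def exp_minus)
    then show ?thesis unfolding e_def
      using gext_inverse[of "\<lambda>x. exp (\<delta> * x)" UNIV "gconst t * y"] ye by (simp add: holomorphic_intros)
  qed
  have Y: "has_gderiv (\<lambda>t. gconst t * y) y t" for t
    using has_gderiv_mult[OF has_gderiv_gconst[of "\<lambda>t. t" 1 t] has_gderiv_const[of y]] by simp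
  have gy: "geven (gconst t * y)" for t using ye by simp
  have UU: "open (UNIV :: complex set)" by simp
  have ds: "has_gderiv s (c t * y) t" for t
  proof -
    have "deriv S = C" using CS(2) by (auto intro: DERIV_imp_deriv)
    then show ?thesis using has_gderiv_gext[OF Y gy hol(2) UU] by (simp add: s_def[abs_def] c_def)
  qed
  have dc: "has_gderiv c (gconst (\<beta> * \<beta> / 4 - \<alpha> * \<gamma>) * s t * y) t" for t
  proof -
    have "deriv C = (\<lambda>x. (\<beta> * \<beta> / 4 - \<alpha> * \<gamma>) * S x)" using CS(1) by (auto intro: DERIV_imp_deriv)
    then show ?thesis using has_gderiv_gext[OF Y gy hol(1) UU, of t] gext_cmult[OF hol(2) UU _ gy, of t]
      by (simp add: s_def c_def[abs_def])
  qed
  have dexp: "has_gderiv (\<lambda>t. gext (\<lambda>x. exp (k * x)) (gconst t * y)) (gconst k * gext (\<lambda>x. exp (k * x)) (gconst t * y) * y) t" for k t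
  proof -
    have "deriv (\<lambda>x. exp (k * x)) = (\<lambda>x. k * exp (k * x))"
      by (rule ext, rule DERIV_imp_deriv) (auto intro!: derivative_eq_intros)
    then show ?thesis
      using has_gderiv_gext[OF Y gy _ UU, of "\<lambda>x. exp (k * x)" t] gext_cmult[OF _ UU _ gy, of "\<lambda>x. exp (k * x)" t k]
      by (simp add: holomorphic_intros)
  qed
  have bb: "gconst (\<beta> * \<beta> / 4 - \<alpha> * \<gamma>) = b * b - gconst \<alpha> * gconst \<gamma>"
    by (simp add: b_def gconst_mult[symmetric] gconst_diff[symmetric])
  have b2: "gconst \<beta> = b + b" by (simp add: b_def gconst_add[symmetric])
  have du: "has_gderiv u (y * (gconst \<alpha> * v t + b * u t)) t" for t
  proof (rule has_gderiv_cong[OF has_gderiv_add[OF has_gderiv_mult[OF has_gderiv_add[OF dc has_gderiv_cmult[OF ds]] has_gderiv_const] has_gderiv_cmult[OF ds]] ueq])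
    show "y * (gconst \<alpha> * v t + b * u t) = (gconst (\<beta> * \<beta> / 4 - \<alpha> * \<gamma>) * s t * y + b * (c t * y)) * z +
      (c t + b * s t) * 0 + gconst \<alpha> * (c t * y)"
      unfolding ueq veq bb using ev ye zpm by (simp add: algebra_simps geven_ac)
  qed
  have dv: "has_gderiv v (- (y * (gconst \<gamma> * u t + b * v t))) t" for t
  proof (rule has_gderiv_cong[OF has_gderiv_add[OF has_gderiv_mult[OF has_gderiv_uminus[OF has_gderiv_cmult[OF ds]] has_gderiv_const] has_gderiv_add[OF dc has_gderiv_uminus[OF has_gderiv_cmult[OF ds]]]]])
    show "v t = - (gconst \<gamma> * s t) * z + (c t + - (b * s t))" for t by (simp add: veq)
    show "- (y * (gconst \<gamma> * u t + b * v t)) = - (gconst \<gamma> * (c t * y)) * z + - (gconst \<gamma> * s t) * 0 +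
      (gconst (\<beta> * \<beta> / 4 - \<alpha> * \<gamma>) * s t * y + - (b * (c t * y)))"
      unfolding ueq veq bb using ev ye zpm by (simp add: algebra_simps geven_ac)
  qed
  define Z where "Z t = u t * v t powi (- 1)" for t
  define P where "P t = e t * (p * v t powi (n - 1))" for t
  define R where "R t = e' t * (m * v t powi (- n - 1))" for t
  have Q: "(Z t, P t, R t) = mob_map n (?G t) q" for t
    by (simp add: qq Z_def P_def R_def u_def v_def ie[symmetric])
      (simp add: quadratic_flow_def e_def power_int_def)
  have vnz: "geven (v t) \<and> body (v t) \<noteq> 0" if "t \<in> ball 0 r" for t
    using ev nz(2)[OF that] by (simp add: v_def qq)
  have in_space: "(Z t, P t, R t) \<in> superspace M \<and> body (Z t) \<noteq> 0" if t: "t \<in> ball 0 r" for t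
  proof -
    have "body (mden (?G t) (fst q)) \<noteq> 0" "body (mnum (?G t) (fst q)) \<noteq> 0" using nz t by auto
    then have "mob_map n (?G t) q \<in> superspace M" "body (fst (mob_map n (?G t) q)) \<noteq> 0"
      using mob_map_in[OF Go M q] by auto
    then show ?thesis unfolding Q[symmetric] by simp
  qed
  note dpow = has_gderiv_powi[OF dv open_ball _ vnz]
  note ps = psf_eval_quadratic[OF conjunct1[OF in_space] conjunct2[OF in_space]]
  have vw: "v t * v t powi (- 1) = 1" "v t powi k = v t powi (k - 1) * v t" if "t \<in> ball 0 r" for t :: complex and k
    using powi_add[of "v t" 1 "- 1"] powi_succ[of "v t" "k - 1"] vnz[OF that] by auto
  have "even_flow (fst (quadratic_sder n \<alpha> \<beta> \<gamma> \<delta>), fst (snd (quadratic_sder n \<alpha> \<beta> \<gamma> \<delta>)), snd (snd (quadratic_sder n \<alpha> \<beta> \<gamma> \<delta>))) y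
      (Z 0, P 0, R 0) (Z 1, P 1, R 1)"
  proof (rule even_flow_integral_curve[OF r ye(1) in_space])
    fix t :: complex assume t: "t \<in> ball 0 r"
    have w: "geven (v t powi k)" for k using vnz[OF t] by simp
    show "has_gderiv Z (- y * psf_eval (fst (quadratic_sder n \<alpha> \<beta> \<gamma> \<delta>)) (Z t, P t, R t)) t"
    proof (rule has_gderiv_cong[OF has_gderiv_mult[OF du dpow[OF t, of "- 1"]] Z_def])
      let ?w = "v t powi (- 1)"
      have psZ: "psf_eval (fst (quadratic_sder n \<alpha> \<beta> \<gamma> \<delta>)) (Z t, P t, R t)
          = - (gconst \<alpha> + (b + b) * Z t + gconst \<gamma> * (Z t * Z t))"
        by (simp only: ps[OF t t] b2)
      have "v t powi (- 1 - 1) = ?w * ?w" using powi_add[of "v t" "- 1" "- 1"] vnz[OF t] by simp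
      then have c: "gconst (of_int (- 1)) * v t powi (- 1 - 1) * x = - (?w * ?w * x)" for x
        by (simp add: gconst_uminus)
      have id: "(y * (gconst \<alpha> * v t + b * u t)) * ?w + u t * (- (?w * ?w * - (y * (gconst \<gamma> * u t + b * v t))))
          = y * (gconst \<alpha> + (b + b) * (u t * ?w) + gconst \<gamma> * (u t * ?w * (u t * ?w)))"
        by (rule riccati_identity[OF geven_gconst ev(5) geven_gconst ev(6,7) w ye(1) vw(1)[OF t]])
      show "- y * psf_eval (fst (quadratic_sder n \<alpha> \<beta> \<gamma> \<delta>)) (Z t, P t, R t) =
        y * (gconst \<alpha> * v t + b * u t) * v t powi - 1 +
          u t * (gconst (of_int (- 1)) * v t powi (- 1 - 1) * - (y * (gconst \<gamma> * u t + b * v t)))"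
        unfolding psZ by (simp only: Z_def c minus_mult_minus id)
    qed
    have gg: "gconst (\<delta> + (1 - of_int n) * (\<beta> / 2)) = gconst \<delta> + gconst (1 - of_int n) * b"
      "gconst ((1 - of_int n) * \<gamma>) = gconst (1 - of_int n) * gconst \<gamma>"
      "gconst (of_int (n - 1)) = - gconst (1 - of_int n)"
      "gconst ((1 + of_int n) * (\<beta> / 2) - \<delta>) = gconst (- \<delta>) + gconst (1 + of_int n) * b"
      "gconst ((1 + of_int n) * \<gamma>) = gconst (1 + of_int n) * gconst \<gamma>"
      "gconst (of_int (- n - 1)) = - gconst (1 + of_int n)"
      by (simp_all add: b_def gconst_mult[symmetric] gconst_add[symmetric] gconst_uminus[symmetric])
    show "has_gderiv P (- y * psf_eval (fst (snd (quadratic_sder n \<alpha> \<beta> \<gamma> \<delta>))) (Z t, P t, R t)) t"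
    proof (rule has_gderiv_cong[OF has_gderiv_mult[OF dexp[of \<delta>, folded e_def] has_gderiv_cmult[OF dpow[OF t, of "n - 1"]]]])
      show "P t = e t * (p * v t powi (n - 1))" for t by (rule P_def)
      show "- y * psf_eval (fst (snd (quadratic_sder n \<alpha> \<beta> \<gamma> \<delta>))) (Z t, P t, R t) =
        gconst \<delta> * e t * y * (p * v t powi (n - 1)) +
        e t * (p * (gconst (of_int (n - 1)) * v t powi (n - 1 - 1) * - (y * (gconst \<gamma> * u t + b * v t))))"
        unfolding ps[OF t t]
        unfolding gg P_def Z_def minus_mult_minus vw(2)[OF t, of "n - 1"]
        by (rule multiplier_identity[symmetric, OF ev(5) geven_gconst ev(3) geven_gconst geven_gconst w ev(6,7) w ye(1) vw(1)[OF t]])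
    qed
    show "has_gderiv R (- y * psf_eval (snd (snd (quadratic_sder n \<alpha> \<beta> \<gamma> \<delta>))) (Z t, P t, R t)) t"
    proof (rule has_gderiv_cong[OF has_gderiv_mult[OF dexp[of "- \<delta>", folded e'_def] has_gderiv_cmult[OF dpow[OF t, of "- n - 1"]]]])
      show "R t = e' t * (m * v t powi (- n - 1))" for t by (rule R_def)
      show "- y * psf_eval (snd (snd (quadratic_sder n \<alpha> \<beta> \<gamma> \<delta>))) (Z t, P t, R t) =
        gconst (- \<delta>) * e' t * y * (m * v t powi (- n - 1)) +
        e' t * (m * (gconst (of_int (- n - 1)) * v t powi (- n - 1 - 1) * - (y * (gconst \<gamma> * u t + b * v t))))"
        unfolding ps[OF t t]
        unfolding gg R_def Z_def minus_mult_minus vw(2)[OF t, of "- n - 1"]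
        by (rule multiplier_identity[symmetric, OF ev(5) geven_gconst ev(4) geven_gconst geven_gconst w ev(6,7) w ye(1) vw(1)[OF t]])
    qed
    have "geven (Z t)" "godd (R t)" using in_space[OF t] by (auto simp: superspace_iff)
    then show "geven (psf_eval (fst (quadratic_sder n \<alpha> \<beta> \<gamma> \<delta>)) (Z t, P t, R t)) \<and>
        godd (psf_eval (snd (snd (quadratic_sder n \<alpha> \<beta> \<gamma> \<delta>))) (Z t, P t, R t))"
      unfolding ps[OF t t] by auto
  qed
  moreover have "?G 0 = mob_one" using CS(3,4) by (simp add: quadratic_flow_def mob_one_def gext_gconst[of _ 0, simplified])
  then have "(Z 0, P 0, R 0) = q" using Q[of 0] by (simp add: mob_map_one)
  ultimately show ?thesis using Q[of 1] by simp
qed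

text \<open>The matrices and multipliers are entire in the parameter and give automorphisms for all its values.
  The neighbourhood \<open>W\<close> is only there to keep the integral curve inside the punctured plane, where
  the exponential series represents it.\<close>

lemma quadratic_sder_flows:
  "\<exists>T W. (\<forall>y\<in>galg_even (M - 2). T y \<in> sphere_auts M n) \<and> open W \<and> {0} \<times> (- {0}) \<subseteq> W \<and>
     (\<forall>y\<in>galg_even (M - 2). \<forall>q\<in>superspace M. body (fst q) \<noteq> 0 \<and> (body y, body (fst q)) \<in> W \<longrightarrow>
        (\<exists>q'. even_flow (quadratic_sder n \<alpha> \<beta> \<gamma> \<delta>) y q q' \<and> in_Delta_coordinates M n (T y) q q'))"
proof -
  obtain C S where CS: "\<And>x. (C has_field_derivative (\<beta> * \<beta> / 4 - \<alpha> * \<gamma>) * S x) (at x)"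
    "\<And>x. (S has_field_derivative C x) (at x)"
      "C 0 = 1" "S 0 = 0" "\<And>x. C x * C x - (\<beta> * \<beta> / 4 - \<alpha> * \<gamma>) * (S x * S x) = (1::complex)"
    by (rule exp_matrix_functions[of "\<beta> * \<beta> / 4 - \<alpha> * \<gamma>"]) metis
  have hol: "C holomorphic_on UNIV" "S holomorphic_on UNIV"
    using CS(1,2) by (auto simp: holomorphic_on_open)
  let ?G = "quadratic_flow C S \<alpha> \<beta> \<gamma> \<delta>"
  define A where "A x = C x + \<beta> / 2 * S x" for x
  define D where "D x = C x - \<beta> / 2 * S x" for x
  have bound: "\<exists>K\<ge>0. \<forall>x. norm x \<le> 1 \<longrightarrow> norm (f x) \<le> K * norm x"
    if "f holomorphic_on UNIV" "f 0 = 0" for f :: "complex \<Rightarrow> complex"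
    using entire_linear_bound[OF that] by metis
  have h: "(\<lambda>x. A x - 1) holomorphic_on UNIV" "(\<lambda>x. D x - 1) holomorphic_on UNIV"
    "(\<lambda>x. \<alpha> * S x) holomorphic_on UNIV" "(\<lambda>x. \<gamma> * S x) holomorphic_on UNIV"
    unfolding A_def D_def by (intro holomorphic_intros hol; simp)+
  have v0: "A 0 - 1 = 0" "D 0 - 1 = 0" "\<alpha> * S 0 = 0" "\<gamma> * S 0 = 0"
    using CS(3,4) by (simp_all add: A_def D_def)
  obtain KA where KA: "KA \<ge> 0" "\<And>x. norm x \<le> 1 \<Longrightarrow> norm (A x - 1) \<le> KA * norm x"
    using bound[OF h(1) v0(1)] by blast
  obtain KD where KD: "KD \<ge> 0" "\<And>x. norm x \<le> 1 \<Longrightarrow> norm (D x - 1) \<le> KD * norm x"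
    using bound[OF h(2) v0(2)] by blast
  obtain KB where KB: "KB \<ge> 0" "\<And>x. norm x \<le> 1 \<Longrightarrow> norm (\<alpha> * S x) \<le> KB * norm x"
    using bound[OF h(3) v0(3)] by blast
  obtain KC where KC: "KC \<ge> 0" "\<And>x. norm x \<le> 1 \<Longrightarrow> norm (\<gamma> * S x) \<le> KC * norm x"
    using bound[OF h(4) v0(4)] by blast
  define K where "K = KA + KB + KC + KD"
  \<comment> \<open>Within \<open>W\<close> the flow reaches time 1 without passing through 0 or infinity.\<close>
  define W :: "(complex \<times> complex) set" where "W = {(y, x). norm y < 1 \<and> norm y * (K * (norm x + 1)) < 1 \<and> norm y * (K * (norm x + 1)) < norm (x::complex)}"
  have "open W"
    unfolding W_def case_prod_beta by (intro open_Collect_conj open_Collect_less continuous_intros)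
  moreover have "{0} \<times> (- {0}) \<subseteq> W" by (auto simp: W_def)
  moreover have "mob_aut M n (?G y) \<in> sphere_auts M n" if "y \<in> galg_even (M - 2)" for y
    by (rule mob_aut_in_auts, rule mob_over_quadratic_flow[OF _ _ hol CS(5)]) (use that in \<open>auto simp: galg_even_iff\<close>)
  moreover have "even_flow (quadratic_sder n \<alpha> \<beta> \<gamma> \<delta>) y q (mob_map n (?G y) q) \<and>
      in_Delta_coordinates M n (mob_aut M n (?G y)) q (mob_map n (?G y) q)"
    if y: "y \<in> galg_even (M - 2)" and q: "q \<in> superspace M" "body (fst q) \<noteq> 0" "(body y, body (fst q)) \<in> W" for y q
  proof -
    define x where "x = body (fst q)"
    define k where "k = max (norm (body y)) (max (norm (body y) * (K * (norm x + 1))) (norm (body y) * (K * (norm x + 1)) / norm x))"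
    have x0: "norm x > 0" using q(2) by (simp add: x_def)
    have k: "k < 1" "k \<ge> 0" using q(3) x0 by (auto simp: k_def W_def x_def divide_simps le_max_iff_disj)
    define r where "r = 2 / (1 + k)"
    have r: "r > 1" "r * k < 1" using k by (auto simp: r_def divide_simps)
    have nz: "body (mnum (?G (gconst t * y)) (fst q)) \<noteq> 0 \<and> body (mden (?G (gconst t * y)) (fst q)) \<noteq> 0"
      if t: "t \<in> ball 0 r" for t
    proof -
      define s where "s = t * body y"
      have tr: "norm t \<le> r" using t by (simp add: less_imp_le)
      have small: "norm t * a < 1" if "a \<le> k" "a \<ge> 0" for a
      proof -
        have "norm t * a \<le> r * k" using that tr r by (intro mult_mono) auto
        then show ?thesis using r by simp
      qed
      have K0: "K \<ge> 0" using KA KB KC KD by (simp add: K_def)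
      have s1: "norm s < 1" using small[of "norm (body y)"] by (simp add: s_def norm_mult k_def)
      have s2: "norm s * (K * (norm x + 1)) < 1"
        using small[of "norm (body y) * (K * (norm x + 1))"] K0 by (simp add: s_def norm_mult k_def mult.assoc)
      have "norm t * (norm (body y) * (K * (norm x + 1)) / norm x) < 1"
        using small[of "norm (body y) * (K * (norm x + 1)) / norm x"] K0 by (simp add: k_def)
      then have s3: "norm s * (K * (norm x + 1)) < norm x"
        using x0 by (simp add: s_def norm_mult mult.assoc divide_simps)
      note bd = KA(2)[OF less_imp_le[OF s1]] KB(2)[OF less_imp_le[OF s1]] KC(2)[OF less_imp_le[OF s1]] KD(2)[OF less_imp_le[OF s1]]
      have Kle: "KA * norm s \<le> K * norm s" "KB * norm s \<le> K * norm s" "KC * norm s \<le> K * norm s" "KD * norm s \<le> K * norm s"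
        using KA(1) KB(1) KC(1) KD(1) by (auto simp: K_def intro!: mult_right_mono)
      have num: "body (mnum (?G (gconst t * y)) (fst q)) = x + ((A s - 1) * x + \<alpha> * S s)"
        by (simp add: mnum_def quadratic_flow_def A_def x_def s_def algebra_simps)
      have den: "body (mden (?G (gconst t * y)) (fst q)) = 1 + (- (\<gamma> * S s) * x + (D s - 1))"
        by (simp add: mden_def quadratic_flow_def D_def x_def s_def algebra_simps)
      have "norm ((A s - 1) * x + \<alpha> * S s) \<le> (K * norm s) * norm x + K * norm s"
        by (rule norm_triangle_le, rule add_mono)
          (use bd Kle in \<open>auto simp: norm_mult intro!: mult_right_mono\<close>)
      also have "\<dots> = norm s * (K * (norm x + 1))" by (simp add: algebra_simps)
      finally have "norm ((A s - 1) * x + \<alpha> * S s) < norm x" using s3 by simp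
      then have 1: "x + ((A s - 1) * x + \<alpha> * S s) \<noteq> 0" by (metis add_eq_0_iff less_irrefl norm_minus_cancel)
      have "norm (- (\<gamma> * S s) * x + (D s - 1)) \<le> (K * norm s) * norm x + K * norm s"
        by (rule norm_triangle_le, rule add_mono)
          (use bd Kle in \<open>auto simp: norm_mult intro!: mult_right_mono\<close>)
      also have "\<dots> = norm s * (K * (norm x + 1))" by (simp add: algebra_simps)
      finally have "norm (- (\<gamma> * S s) * x + (D s - 1)) < norm (1::complex)" using s2 by simp
      then have 2: "1 + (- (\<gamma> * S s) * x + (D s - 1)) \<noteq> 0" by (metis add_eq_0_iff less_irrefl norm_minus_cancel)
      show ?thesis unfolding num den using 1 2 by simp
    qed
    have Go: "mob_over (M - 2) (?G y)"
      by (rule mob_over_quadratic_flow[OF _ _ hol CS(5)]) (use y in \<open>auto simp: galg_even_iff\<close>)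
    have den1: "body (mden (?G y) (fst q)) \<noteq> 0" using nz[of 1] r by simp
    show ?thesis
      using quadratic_sder_flow[OF CS y q(1) r(1)] nz mob_aut_Delta[OF Go q(1) den1] by blast
  qed
  ultimately show ?thesis
    by (intro exI[of _ "\<lambda>y. mob_aut M n (?G y)"] exI[of _ W]) blast
qed

section \<open>Odd automorphisms\<close>

text \<open>Polynomials with a degree bound that may be negative, in which case they vanish.\<close>

definition gpoly :: "int \<Rightarrow> (nat \<Rightarrow> complex) \<Rightarrow> grassmann \<Rightarrow> grassmann" where
  "gpoly k c z = (\<Sum>j | int j \<le> k. gconst (c j) * z ^ j)"

definition gpoly' :: "int \<Rightarrow> (nat \<Rightarrow> complex) \<Rightarrow> grassmann \<Rightarrow> grassmann" where
  "gpoly' k c z = (\<Sum>j | int j \<le> k. gconst (c j) * (gconst (of_nat j) * z ^ (j - 1)))"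

lemma finite_degrees: "finite {j. int j \<le> k}"
  by (rule finite_subset[of _ "{..nat k}"]) auto

lemma gpoly_closure:
  "geven z \<Longrightarrow> geven (gpoly k c z)" "geven z \<Longrightarrow> geven (gpoly' k c z)"
  by (auto simp: gpoly_def gpoly'_def)

lemma superdiff_gpoly:
  assumes "open U"
  shows "superdiff N U (gpoly k c) (gpoly' k c)"
proof -
  have "superdiff N U (\<lambda>z. \<Sum>j\<in>A. gconst (c j) * z ^ j) (\<lambda>z. \<Sum>j\<in>A. gconst (c j) * (gconst (of_nat j) * z ^ (j - 1)))"
    if "finite A" for A
    using that
  proof (induction A rule: finite_induct)
    case empty
    show ?case using superdiff_const[of 0] by simp
  next
    case (insert i A)
    have "superdiff N U (\<lambda>z. z ^ i) (\<lambda>z. gconst (of_nat i) * z ^ (i - 1))"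
      using superdiff_power[OF superdiff_ident assms, of N i] by simp
    from superdiff_add[OF superdiff_cmult[OF this assms galg_gconst] insert.IH assms] insert
    show ?case by simp
  qed
  from this[OF finite_degrees] show ?thesis by (simp add: gpoly_def[abs_def] gpoly'_def[abs_def])
qed

definition rev_coeffs :: "int \<Rightarrow> (nat \<Rightarrow> complex) \<Rightarrow> nat \<Rightarrow> complex" where
  "rev_coeffs k c j = chart_unit True * c (nat (k - int j))"

text \<open>The coordinate change at infinity reverses the coefficients; this is where the degree bound
  comes from.\<close>

lemma gpoly_rev:
  assumes "body z \<noteq> 0" "geven z"
  shows "gpoly k (rev_coeffs k c) z = gconst (chart_unit True) * (z powi k * gpoly k c (inverse z))"
proof -
  have "gpoly k (rev_coeffs k c) z = (\<Sum>j | int j \<le> k. gconst (chart_unit True * c j) * z ^ nat (k - int j))"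
    unfolding gpoly_def rev_coeffs_def
    by (rule sum.reindex_bij_witness[of _ "\<lambda>j. nat (k - int j)" "\<lambda>j. nat (k - int j)"]) auto
  also have "\<dots> = (\<Sum>j | int j \<le> k. gconst (chart_unit True) * (z powi k * (gconst (c j) * inverse z ^ j)))"
  proof (rule sum.cong)
    fix j assume j: "j \<in> {j. int j \<le> k}"
    have "z ^ nat (k - int j) = z powi (k - int j)" using j by (simp add: power_int_def)
    also have "\<dots> = z powi k * inverse z ^ j"
      using powi_add[OF assms(1), of k "- int j"] by (simp add: power_int_def)
    finally show "gconst (chart_unit True * c j) * z ^ nat (k - int j) = gconst (chart_unit True) * (z powi k * (gconst (c j) * inverse z ^ j))"
      by (simp add: gconst_mult mult.assoc gconst_left_commute[of "z powi k"])
  qed simp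
  also have "\<dots> = gconst (chart_unit True) * (z powi k * gpoly k c (inverse z))"
    by (simp add: gpoly_def sum_distrib_left)
  finally show ?thesis .
qed

lemma gpoly'_rev:
  assumes "body z \<noteq> 0" "geven z"
  shows "gpoly' k (rev_coeffs k c) z = gconst (chart_unit True) * (gconst (of_int k) * z powi (k - 1) * gpoly k c (inverse z)
    - z powi (k - 2) * gpoly' k c (inverse z))"
proof -
  have U: "open (- {0::complex})" by auto
  have dinv: "superdiff 0 (- {0}) (\<lambda>z. inverse z) (\<lambda>z. - (inverse z * inverse z * 1))"
    by (rule superdiff_inverse[OF superdiff_ident U]) auto
  have dpow: "superdiff 0 (- {0}) (\<lambda>z. z powi k) (\<lambda>z. gconst (of_int k) * z powi (k - 1) * 1)"
    by (rule superdiff_powi[OF superdiff_ident U]) auto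
  have dp: "superdiff 0 (- {0}) (\<lambda>z. gpoly k c (inverse z)) (\<lambda>z. gpoly' k c (inverse z) * - (inverse z * inverse z))"
  proof -
    have "superdiff 0 (- {0}) (\<lambda>z. \<Sum>j\<in>A. gconst (c j) * inverse z ^ j)
       (\<lambda>z. (\<Sum>j\<in>A. gconst (c j) * (gconst (of_nat j) * inverse z ^ (j - 1))) * - (inverse z * inverse z))"
      if "finite A" for A
      using that
    proof (induction A rule: finite_induct)
      case empty
      show ?case using superdiff_const[of 0] by simp
    next
      case (insert i A)
      have "superdiff 0 (- {0}) (\<lambda>z. inverse z ^ i) (\<lambda>z. gconst (of_nat i) * inverse z ^ (i - 1) * - (inverse z * inverse z * 1))"
        by (rule superdiff_power[OF dinv U]) auto
      from superdiff_add[OF superdiff_cmult[OF this U galg_gconst] insert.IH U] insert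
      show ?case by (simp add: algebra_simps)
    qed
    from this[OF finite_degrees] show ?thesis by (simp add: gpoly_def gpoly'_def)
  qed
  note D = superdiff_cmult[OF superdiff_mult[OF dpow dp U] U galg_gconst[of "chart_unit True"]]
  have "gpoly' k (rev_coeffs k c) z = gconst (chart_unit True) * (gconst (of_int k) * z powi (k - 1) * 1 * gpoly k c (inverse z)
      + z powi k * (gpoly' k c (inverse z) * - (inverse z * inverse z)))"
    by (rule superdiff_unique[OF superdiff_gpoly[OF U, of 0 k "rev_coeffs k c"] D U _ assms(2)])
      (use assms gpoly_rev in auto)
  moreover have "z powi k * (g * - (inverse z * inverse z)) = - (z powi (k - 2) * g)" for g
  proof -
    have "z powi (k - 2) = z powi k * (inverse z * inverse z)"
      using powi_add[OF assms(1), of k "- 2"] by (simp add: power_int_def power2_eq_square)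
    then show ?thesis using assms by (simp add: geven_ac)
  qed
  ultimately show ?thesis by simp
qed

text \<open>The flow \<open>1 - \<xi>X\<close> of the odd derivation \<open>X\<close> with coefficient functions \<open>u\<close>, \<open>w\<close>, with \<open>\<xi>\<close> moved
  next to the functions.\<close>

fun odd_map :: "grassmann \<Rightarrow> (grassmann \<Rightarrow> grassmann) \<Rightarrow> (grassmann \<Rightarrow> grassmann) \<Rightarrow>
    (grassmann \<Rightarrow> grassmann) \<Rightarrow> (grassmann \<Rightarrow> grassmann) \<Rightarrow> superpoint \<Rightarrow> superpoint" where
  "odd_map \<xi> u u' w w' (z, p, m) = (z + p * (\<xi> * w z) + m * (\<xi> * u z),
     \<xi> * u z + p + p * (m * (\<xi> * u' z)), \<xi> * w z + m - p * (m * (\<xi> * w' z)))"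

lemma powi_nilpotent:
  assumes "body z \<noteq> 0" "geven z" "geven \<epsilon>" "body \<epsilon> = 0" "\<epsilon> * \<epsilon> = 0"
  shows "(z + \<epsilon>) powi k = z powi k + gconst (of_int k) * (z powi (k - 1) * \<epsilon>)"
proof (rule sym, rule powi_unique)
  fix k
  have e: "z powi (k - 1) * z = z powi k" "z powi (k + 1) = z powi k * z"
    using powi_succ[OF assms(1), of "k - 1"] powi_succ[OF assms(1), of k] by simp_all
  have ev: "geven (z powi j)" for j using assms by simp
  have "gconst (of_int k) * (z powi (k - 1) * \<epsilon>) * z = gconst (of_int k) * ((z powi (k - 1) * z) * \<epsilon>)"
    using assms ev by (simp add: geven_ac)
  moreover have "gconst (of_int k) * (z powi (k - 1) * \<epsilon>) * \<epsilon> = 0"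
    using assms(5) by (simp add: mult.assoc)
  ultimately show "z powi (k + 1) + gconst (of_int (k + 1)) * (z powi (k + 1 - 1) * \<epsilon>) =
    (z powi k + gconst (of_int k) * (z powi (k - 1) * \<epsilon>)) * (z + \<epsilon>)"
    using e(2) by (simp add: e(1) gconst_add algebra_simps)
qed (use assms in auto)

lemma change_chart_odd_map:
  fixes c :: bool
  assumes xi: "godd \<xi>" and q: "geven z" "godd p" "godd m" "body z \<noteq> 0"
    and uw: "geven (u z)" "geven (u' z)" "geven (w z)" "geven (w' z)"
  defines "s \<equiv> gconst (chart_unit c)"
  shows "change_chart c n (odd_map \<xi> u u' w w' (z, p, m)) =
    sconf (\<lambda>z. inverse z) (\<lambda>z. s * z powi (n - 1)) (\<lambda>z. s * z powi (- n - 1))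
      (\<lambda>z. s * \<xi> * (u z * z powi (n - 1)))
      (\<lambda>z. s * \<xi> * (u' z * z powi (n - 1) + u z * (gconst (of_int (n - 1)) * z powi (n - 1 - 1))))
      (\<lambda>z. s * \<xi> * (w z * z powi (- n - 1)))
      (\<lambda>z. s * \<xi> * (w' z * z powi (- n - 1) + w z * (gconst (of_int (- n - 1)) * z powi (- n - 1 - 1)))) (z, p, m)"
proof -
  define \<epsilon> where "\<epsilon> = p * (\<xi> * w z) + m * (\<xi> * u z)"
  have sq: "\<xi> * \<xi> = 0" "p * p = 0" "m * m = 0" "\<xi> * (\<xi> * x) = 0" "p * (p * x) = 0" "m * (m * x) = 0" for x
    using xi q by (simp_all add: godd_square_left)
  have ac: "\<xi> * p = - (p * \<xi>)" "\<xi> * m = - (m * \<xi>)" "m * p = - (p * m)"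
    "\<xi> * (p * x) = - (p * (\<xi> * x))" "\<xi> * (m * x) = - (m * (\<xi> * x))" "m * (p * x) = - (p * (m * x))" for x
    using godd_anticommute godd_left_anticommute xi q by blast+
  have comm: "u z * (p * x) = p * (u z * x)" "u z * (m * x) = m * (u z * x)" "u z * (\<xi> * x) = \<xi> * (u z * x)"
     "w z * (p * x) = p * (w z * x)" "w z * (m * x) = m * (w z * x)" "w z * (\<xi> * x) = \<xi> * (w z * x)" for x
    using uw by (metis geven_left_commute2)+
  have ee: "\<epsilon> * \<epsilon> = 0" unfolding \<epsilon>_def by (simp add: algebra_simps comm ac sq)
  have ge: "geven \<epsilon>" "body \<epsilon> = 0" using xi q uw by (auto simp: \<epsilon>_def)
  have zz: "z + p * (\<xi> * w z) + m * (\<xi> * u z) = z + \<epsilon>" by (simp add: \<epsilon>_def add.assoc)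
  note pw = powi_nilpotent[OF q(4,1) ge ee]
  have zev: "geven (z powi j)" for j using q by simp
  have zc: "z powi j * (p * x) = p * (z powi j * x)" "z powi j * (m * x) = m * (z powi j * x)"
      "z powi j * (\<xi> * x) = \<xi> * (z powi j * x)" "z powi j * u z = u z * z powi j" "z powi j * w z = w z * z powi j"
      "z powi j * (u z * x) = u z * (z powi j * x)" "z powi j * (w z * x) = w z * (z powi j * x)" for j x
    using geven_left_commute2[OF zev] geven_commute[OF zev] by blast+
  have inv: "inverse (z + \<epsilon>) = inverse z - z powi (- 2) * \<epsilon>"
    using pw[of "- 1"] by (simp add: power_int_def gconst_uminus)
  have s2: "chart_unit c * chart_unit c = - 1" by simp
  have ss: "s * s = - 1" "s * (s * x) = - x" for x
    using s2 by (simp_all add: s_def gconst_mult[symmetric] mult.assoc[symmetric] gconst_uminus)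
  have sev: "x * s = s * x" "x * (s * y) = s * (x * y)" for x y
    by (simp_all add: s_def gconst_commute gconst_left_commute)
  have c1: "inverse z - z powi (- 2) * \<epsilon> = inverse z + p * (s * \<xi> * (w z * z powi (- n - 1)) * (s * z powi (n - 1)))
      + m * (s * \<xi> * (u z * z powi (n - 1)) * (s * z powi (- n - 1)))"
  proof -
    have "z powi (- n - 1) * z powi (n - 1) = z powi (- 2)" "z powi (n - 1) * z powi (- n - 1) = z powi (- 2)"
      using powi_add[OF q(4), of "- n - 1" "n - 1"] powi_add[OF q(4), of "n - 1" "- n - 1"] by simp_all
    then have "s * \<xi> * (w z * z powi (- n - 1)) * (s * z powi (n - 1)) = - (\<xi> * (w z * z powi (- 2)))"
      "s * \<xi> * (u z * z powi (n - 1)) * (s * z powi (- n - 1)) = - (\<xi> * (u z * z powi (- 2)))"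
      by (simp_all only: mult.assoc sev(2)[of "z powi _"] sev(2)[of "w z"] sev(2)[of "u z"] sev(2)[of \<xi>] ss)
    then show ?thesis by (simp add: \<epsilon>_def algebra_simps zc)
  qed
  have c2: "s * ((\<xi> * a + p + p * (m * (\<xi> * a'))) * (z powi k + gconst (of_int k) * (z powi (k - 1) * \<epsilon>)))
      = s * \<xi> * (a * z powi k) + p * (s * z powi k) + p * m * (s * \<xi> * (a' * z powi k + a * (gconst (of_int k) * z powi (k - 1))))"
    if "a = u z" "geven a'" for a a' k
  proof -
    have "\<xi> * (a * (z powi (k - 1) * \<epsilon>)) = 0" "\<xi> * (a' * (z powi (k - 1) * \<epsilon>)) = 0"
        "p * (z powi (k - 1) * \<epsilon>) = p * (m * (\<xi> * (a * z powi (k - 1))))"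
      using geven_left_commute2[OF that(2)] by (simp_all add: \<epsilon>_def algebra_simps zc comm ac sq that(1))
    then show ?thesis
      by (simp add: algebra_simps sev gconst_left_commute[of \<xi>] gconst_left_commute[of p] gconst_left_commute[of m]
        gconst_left_commute[of a] gconst_left_commute[of a'])
  qed
  have c3: "s * ((\<xi> * a + m - p * (m * (\<xi> * a'))) * (z powi k + gconst (of_int k) * (z powi (k - 1) * \<epsilon>)))
      = s * \<xi> * (a * z powi k) + m * (s * z powi k) - p * m * (s * \<xi> * (a' * z powi k + a * (gconst (of_int k) * z powi (k - 1))))"
    if "a = w z" "geven a'" for a a' k
  proof -
    have "\<xi> * (a * (z powi (k - 1) * \<epsilon>)) = 0" "\<xi> * (a' * (z powi (k - 1) * \<epsilon>)) = 0"
        "m * (z powi (k - 1) * \<epsilon>) = - (p * (m * (\<xi> * (a * z powi (k - 1)))))"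
      using geven_left_commute2[OF that(2)] by (simp_all add: \<epsilon>_def algebra_simps zc comm ac sq that(1))
    then show ?thesis
      by (simp add: algebra_simps sev gconst_left_commute[of \<xi>] gconst_left_commute[of p] gconst_left_commute[of m]
        gconst_left_commute[of a] gconst_left_commute[of a'])
  qed
  show ?thesis
    unfolding odd_map.simps change_chart.simps zz pw inv sconf_def prod.case s_def[symmetric]
    using c1 c2[OF refl uw(2), of "n - 1"] c3[OF refl uw(4), of "- n - 1"] by simp
qed

lemma gpoly_rev_glue:
  assumes "body z \<noteq> 0" "geven z"
  defines "s \<equiv> gconst (chart_unit False)"
  shows "s * \<xi> * (gpoly k (rev_coeffs k c) z * z powi (- k)) = \<xi> * gpoly k c (inverse z)"
    "s * \<xi> * (gpoly' k (rev_coeffs k c) z * z powi (- k) + gpoly k (rev_coeffs k c) z * (gconst (of_int (- k)) * z powi (- k - 1)))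
      = - (\<xi> * (z powi (- 2) * gpoly' k c (inverse z)))"
proof -
  define t where "t = gconst (chart_unit True)"
  have st: "s * t = 1" by (simp add: s_def t_def gconst_mult[symmetric] chart_unit_def)
  have st': "s * \<xi> * (t * x) = \<xi> * x" for x
    using st by (metis gconst_left_commute mult.assoc mult_1_left t_def)
  have ev: "geven (gpoly k c (inverse z))" "geven (gpoly' k c (inverse z))" "geven (z powi j)" for j
    using assms gpoly_closure by auto
  have pp: "z powi i * (z powi j * x) = z powi (i + j) * x" "z powi i * z powi j = z powi (i + j)" for i j x
    using powi_add[OF assms(1), of i j] by (simp_all add: mult.assoc)
  have "gpoly k (rev_coeffs k c) z * z powi (- k) = t * (gpoly k c (inverse z) * (z powi k * z powi (- k)))"
    unfolding gpoly_rev[OF assms(1,2)] t_def[symmetric] using ev by (simp add: geven_ac)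
  then show "s * \<xi> * (gpoly k (rev_coeffs k c) z * z powi (- k)) = \<xi> * gpoly k c (inverse z)"
    by (simp add: st' pp)
  have 1: "gpoly' k (rev_coeffs k c) z * z powi (- k) = t * (gconst (of_int k) * (gpoly k c (inverse z) * (z powi (k - 1) * z powi (- k)))
      - gpoly' k c (inverse z) * (z powi (k - 2) * z powi (- k)))"
    unfolding gpoly'_rev[OF assms(1,2)] t_def[symmetric] using ev by (simp add: algebra_simps geven_ac)
  have 2: "gpoly k (rev_coeffs k c) z * (gconst (of_int (- k)) * z powi (- k - 1))
     = t * - (gconst (of_int k) * (gpoly k c (inverse z) * (z powi k * z powi (- k - 1))))"
    unfolding gpoly_rev[OF assms(1,2)] t_def[symmetric] using ev by (simp add: geven_ac gconst_uminus)
  have "gpoly' k (rev_coeffs k c) z * z powi (- k) + gpoly k (rev_coeffs k c) z * (gconst (of_int (- k)) * z powi (- k - 1))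
      = t * - (gpoly' k c (inverse z) * z powi (- 2))"
    unfolding 1 2 distrib_left[symmetric] by (simp add: pp)
  then show "s * \<xi> * (gpoly' k (rev_coeffs k c) z * z powi (- k) + gpoly k (rev_coeffs k c) z * (gconst (of_int (- k)) * z powi (- k - 1)))
      = - (\<xi> * (z powi (- 2) * gpoly' k c (inverse z)))"
    using ev geven_commute by (metis mult_minus_right st')
qed

definition chart_coeffs :: "bool \<Rightarrow> int \<Rightarrow> (nat \<Rightarrow> complex) \<Rightarrow> nat \<Rightarrow> complex" where
  "chart_coeffs c k a = (if c then a else rev_coeffs k a)"

definition odd_chart_map :: "bool \<Rightarrow> int \<Rightarrow> grassmann \<Rightarrow> (nat \<Rightarrow> complex) \<Rightarrow> (nat \<Rightarrow> complex) \<Rightarrow> superpoint \<Rightarrow> superpoint" where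
  "odd_chart_map c n \<xi> a b = odd_map \<xi> (gpoly (1 - n) (chart_coeffs c (1 - n) a)) (gpoly' (1 - n) (chart_coeffs c (1 - n) a))
     (gpoly (1 + n) (chart_coeffs c (1 + n) b)) (gpoly' (1 + n) (chart_coeffs c (1 + n) b))"

definition odd_aut :: "enat \<Rightarrow> int \<Rightarrow> grassmann \<Rightarrow> (nat \<Rightarrow> complex) \<Rightarrow> (nat \<Rightarrow> complex) \<Rightarrow> sphere_point \<Rightarrow> sphere_point" where
  "odd_aut M n \<xi> a b = sphere_map (\<lambda>c q. pt c M n (odd_chart_map c n \<xi> a b q)) M n"

lemma enat_minus_2_le: "M - 2 \<le> (M::enat)"
  by (cases M) (auto simp: numeral_eq_enat)

lemma gpoly_galg:
  assumes "z \<in> galg M"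
  shows "gpoly k c z \<in> galg M" "gpoly' k c z \<in> galg M"
  using assms by (auto simp: gpoly_def gpoly'_def)

lemma odd_chart_map_in:
  assumes "\<xi> \<in> galg_odd (M - 2)" "q \<in> superspace M"
  shows "odd_chart_map c n \<xi> a b q \<in> superspace M"
    "body (fst (odd_chart_map c n \<xi> a b q)) = body (fst q)"
proof -
  obtain z p m where q: "q = (z, p, m)" by (cases q)
  have "godd \<xi>" "\<xi> \<in> galg M" using assms(1) galg_mono[OF _ enat_minus_2_le] by (auto simp: galg_odd_iff)
  then show "odd_chart_map c n \<xi> a b q \<in> superspace M"
    "body (fst (odd_chart_map c n \<xi> a b q)) = body (fst q)"
    using assms(2) gpoly_closure gpoly_galg by (auto simp: q superspace_iff odd_chart_map_def)
qed

lemma odd_chart_map_glue: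
  assumes "\<xi> \<in> galg_odd (M - 2)" "q \<in> superspace M" "body (fst q) \<noteq> 0"
  shows "odd_chart_map True n \<xi> a b (change_chart False n q) = change_chart False n (odd_chart_map False n \<xi> a b q)"
proof -
  obtain z p m where q: "q = (z, p, m)" by (cases q)
  have z: "geven z" "body z \<noteq> 0" and pm: "godd p" "godd m" and xi: "godd \<xi>"
    using assms by (auto simp: q superspace_iff galg_odd_iff)
  define s where "s = gconst (chart_unit False)"
  have ss: "s * s = - 1" "s * (s * x) = - x" for x
    by (simp_all add: s_def gconst_mult[symmetric] mult.assoc[symmetric] gconst_uminus)
  have sev: "p * s = s * p" "m * s = s * m" "\<xi> * s = s * \<xi>" "z powi j * s = s * z powi j"
    "p * (s * y) = s * (p * y)" "m * (s * y) = s * (m * y)" "\<xi> * (s * y) = s * (\<xi> * y)"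
    "z powi j * (s * y) = s * (z powi j * y)" for y j
    unfolding s_def by (rule gconst_commute gconst_left_commute)+
  have sev': "gpoly i c x * (s * y) = s * (gpoly i c x * y)" for i c x y
    unfolding s_def by (rule gconst_left_commute)
  define U where "U = gpoly (1 - n) a (inverse z)"
  define W where "W = gpoly (1 + n) b (inverse z)"
  define U' where "U' = gpoly' (1 - n) a (inverse z)"
  define W' where "W' = gpoly' (1 + n) b (inverse z)"
  have ev: "geven U" "geven W" "geven U'" "geven W'"
    using z gpoly_closure by (auto simp: U_def W_def U'_def W'_def)
  have gl: "s * \<xi> * (gpoly (1 - n) (rev_coeffs (1 - n) a) z * z powi (n - 1)) = \<xi> * U"
    "s * \<xi> * (gpoly' (1 - n) (rev_coeffs (1 - n) a) z * z powi (n - 1)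
      + gpoly (1 - n) (rev_coeffs (1 - n) a) z * (gconst (of_int (n - 1)) * z powi (n - 1 - 1))) = - (\<xi> * (z powi (- 2) * U'))"
    "s * \<xi> * (gpoly (1 + n) (rev_coeffs (1 + n) b) z * z powi (- n - 1)) = \<xi> * W"
    "s * \<xi> * (gpoly' (1 + n) (rev_coeffs (1 + n) b) z * z powi (- n - 1)
      + gpoly (1 + n) (rev_coeffs (1 + n) b) z * (gconst (of_int (- n - 1)) * z powi (- n - 1 - 1))) = - (\<xi> * (z powi (- 2) * W'))"
  proof -
    have n: "- (1 - n) = n - 1" "- (1 + n) = - n - 1" by auto
    note g1 = gpoly_rev_glue[OF z(2,1), of \<xi> "1 - n" a, unfolded n] and g2 = gpoly_rev_glue[OF z(2,1), of \<xi> "1 + n" b, unfolded n]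
    show "s * \<xi> * (gpoly (1 - n) (rev_coeffs (1 - n) a) z * z powi (n - 1)) = \<xi> * U"
      "s * \<xi> * (gpoly' (1 - n) (rev_coeffs (1 - n) a) z * z powi (n - 1)
      + gpoly (1 - n) (rev_coeffs (1 - n) a) z * (gconst (of_int (n - 1)) * z powi (n - 1 - 1))) = - (\<xi> * (z powi (- 2) * U'))"
      unfolding s_def U_def U'_def by (fact g1)+
    show "s * \<xi> * (gpoly (1 + n) (rev_coeffs (1 + n) b) z * z powi (- n - 1)) = \<xi> * W"
      "s * \<xi> * (gpoly' (1 + n) (rev_coeffs (1 + n) b) z * z powi (- n - 1)
      + gpoly (1 + n) (rev_coeffs (1 + n) b) z * (gconst (of_int (- n - 1)) * z powi (- n - 1 - 1))) = - (\<xi> * (z powi (- 2) * W'))"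
      unfolding s_def W_def W'_def by (fact g2)+
  qed
  have R: "change_chart False n (odd_chart_map False n \<xi> a b q) =
     (inverse z + p * (\<xi> * W * (s * z powi (n - 1))) + m * (\<xi> * U * (s * z powi (- n - 1))),
      \<xi> * U + p * (s * z powi (n - 1)) + p * m * - (\<xi> * (z powi (- 2) * U')),
      \<xi> * W + m * (s * z powi (- n - 1)) - p * m * - (\<xi> * (z powi (- 2) * W')))"
    unfolding q odd_chart_map_def chart_coeffs_def if_False
    by (subst change_chart_odd_map[OF xi z(1) pm z(2)])
      (use z gpoly_closure in \<open>simp_all only: sconf_def prod.case s_def[symmetric] gl\<close>)
  have zev: "geven (z powi j)" for j using z by simp
  have p2: "z powi (n - 1) * (z powi (- n - 1) * x) = z powi (- 2) * x" for x
    using powi_add[OF z(2), of "n - 1" "- n - 1"] by (simp add: mult.assoc[symmetric])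
  have zc: "z powi j * (p * x) = p * (z powi j * x)" "z powi j * (m * x) = m * (z powi j * x)"
      "z powi j * (\<xi> * x) = \<xi> * (z powi j * x)" "z powi j * U = U * z powi j" "z powi j * W = W * z powi j" for j x
    using geven_left_commute2[OF zev] geven_commute[OF zev] by blast+
  show ?thesis
    unfolding R unfolding q odd_chart_map_def chart_coeffs_def if_True change_chart.simps odd_map.simps
      s_def[symmetric] U_def[symmetric] W_def[symmetric] U'_def[symmetric] W'_def[symmetric]
    by (simp add: mult.assoc sev sev'[of "1 - n" a "inverse z", folded U_def]
      sev'[of "1 + n" b "inverse z", folded W_def] ss zc p2)
qed

lemma odd_aut_pt:
  assumes "\<xi> \<in> galg_odd (M - 2)" "q \<in> superspace M"
  shows "odd_aut M n \<xi> a b (pt c M n q) = pt c M n (odd_chart_map c n \<xi> a b q)"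
  unfolding odd_aut_def
proof (rule sphere_map_pt[OF _ assms(2)])
  fix q assume q: "q \<in> superspace M" "body (fst q) \<noteq> 0"
  show "pt True M n (odd_chart_map True n \<xi> a b (change_chart False n q)) = pt False M n (odd_chart_map False n \<xi> a b q)"
    unfolding odd_chart_map_glue[OF assms(1) q]
    using pt_change_chart[of "odd_chart_map False n \<xi> a b q" M False n] odd_chart_map_in[OF assms(1) q(1)] q by simp
qed

lemma superdiff_odd:
  assumes "\<xi> \<in> galg N" "superdiff N U \<Phi> \<Phi>'" "open U" "\<And>z. geven z \<Longrightarrow> body z \<in> U \<Longrightarrow> body z \<noteq> 0"
  shows "superdiff N U (\<lambda>z. gconst s * \<xi> * (\<Phi> z * z powi k))
    (\<lambda>z. gconst s * \<xi> * (\<Phi>' z * z powi k + \<Phi> z * (gconst (of_int k) * z powi (k - 1))))"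
proof -
  have "superdiff N U (\<lambda>z. z powi k) (\<lambda>z. gconst (of_int k) * z powi (k - 1) * 1)"
    by (rule superdiff_powi[OF superdiff_ident assms(3)]) (use assms(4) in auto)
  from superdiff_cmult[OF superdiff_mult[OF assms(2) this assms(3)] assms(3), of "gconst s * \<xi>"] assms(1)
  show ?thesis by simp
qed

lemma odd_products_vanish:
  assumes "godd \<xi>" "geven x"
  shows "(\<xi> * x) * (\<xi> * y) = 0" "(gconst s * \<xi> * x) * (gconst s * \<xi> * y) = 0"
proof -
  show *: "(\<xi> * x) * (\<xi> * y) = 0"
    using geven_left_commute2[OF assms(2), of \<xi> y] assms(1) by (simp add: mult.assoc godd_square_left)
  have "(gconst s * \<xi> * x) * (gconst s * \<xi> * y) = gconst s * (gconst s * ((\<xi> * x) * (\<xi> * y)))"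
    by (simp only: mult.assoc gconst_left_commute[of x] gconst_left_commute[of \<xi>])
  then show "(gconst s * \<xi> * x) * (gconst s * \<xi> * y) = 0" using * by simp
qed

lemma odd_aut_superconformal:
  assumes "\<xi> \<in> galg_odd (M - 2)"
  shows "superconformal_map M (sphere_atlas M n) (odd_aut M n \<xi> a b)"
  unfolding superconformal_map_sphere_iff
proof (intro allI impI)
  fix c d
  let ?D = "{q \<in> superspace M. odd_aut M n \<xi> a b (pt c M n q) \<in> chart_dom d M n}"
  let ?m = "odd_chart_map c n \<xi> a b"
  have xi: "godd \<xi>" "\<xi> \<in> galg (M - 2)" using assms by (auto simp: galg_odd_iff)
  define u where "u = gpoly (1 - n) (chart_coeffs c (1 - n) a)"
  define u' where "u' = gpoly' (1 - n) (chart_coeffs c (1 - n) a)"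
  define w where "w = gpoly (1 + n) (chart_coeffs c (1 + n) b)"
  define w' where "w' = gpoly' (1 + n) (chart_coeffs c (1 + n) b)"
  have m: "?m = odd_map \<xi> u u' w w'" by (simp add: odd_chart_map_def u_def u'_def w_def w'_def)
  have ev: "geven z \<Longrightarrow> geven (u z) \<and> geven (u' z) \<and> geven (w z) \<and> geven (w' z)" for z
    using gpoly_closure by (auto simp: u_def u'_def w_def w'_def)
  have dd: "superdiff (M - 2) U u u'" "superdiff (M - 2) U w w'" if "open U" for U
    unfolding u_def u'_def w_def w'_def by (rule superdiff_gpoly[OF that])+
  have T: "odd_aut M n \<xi> a b (pt c M n q) = pt c M n (?m q)" "?m q \<in> superspace M" "body (fst (?m q)) = body (fst q)"
    if "q \<in> superspace M" for q
    using odd_aut_pt[OF assms that] odd_chart_map_in[OF assms that] by auto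
  show "superconformal_on M ?D (\<lambda>q. coord d (odd_aut M n \<xi> a b (pt c M n q)))"
  proof (cases "c = d")
    case True
    have "superconformal_on M {q \<in> superspace M. body (fst q) \<in> UNIV}
        (sconf (\<lambda>z. z) (\<lambda>_. 1) (\<lambda>_. 1) (\<lambda>z. \<xi> * u z) (\<lambda>z. \<xi> * u' z) (\<lambda>z. \<xi> * w z) (\<lambda>z. \<xi> * w' z))"
      by (rule superconformal_on_sconf[OF open_UNIV _ enat_minus_2_le refl superdiff_ident superdiff_const superdiff_const
          superdiff_cmult[OF dd(1)] superdiff_cmult[OF dd(2)]])
        (use xi ev odd_products_vanish in auto)
    then show ?thesis
    proof (rule superconformal_on_cong)
      show "?D = {q \<in> superspace M. body (fst q) \<in> UNIV}" using T True by (auto simp: pt_in_chart_dom)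
      fix q assume "q \<in> {q \<in> superspace M. body (fst q) \<in> UNIV}"
      then have q: "q \<in> superspace M" by simp
      obtain z p r where qq: "q = (z, p, r)" by (cases q)
      show "coord d (odd_aut M n \<xi> a b (pt c M n q)) =
          sconf (\<lambda>z. z) (\<lambda>_. 1) (\<lambda>_. 1) (\<lambda>z. \<xi> * u z) (\<lambda>z. \<xi> * u' z) (\<lambda>z. \<xi> * w z) (\<lambda>z. \<xi> * w' z) q"
        using T[OF q] True m by (simp add: coord_pt qq sconf_def mult.assoc)
    qed
  next
    case False
    then have d: "d = (\<not> c)" by auto
    have U: "open (- {0::complex})" by auto
    let ?s = "gconst (chart_unit c)"
    have bnz: "geven z \<Longrightarrow> body z \<in> - {0} \<Longrightarrow> body z \<noteq> 0" for z by simp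
    have dinv: "superdiff (M - 2) (- {0}) (\<lambda>z. inverse z) (\<lambda>z. (?s * z powi (n - 1)) * (?s * z powi (- n - 1)))"
    proof (rule superdiff_cong[OF superdiff_inverse[OF superdiff_ident U]])
      fix z assume z: "geven z" "body z \<in> - {0}"
      have "z powi (n - 1) * z powi (- n - 1) = inverse z * inverse z"
        using powi_add[of z "n - 1" "- n - 1"] z by (simp add: power_int_def power2_eq_square)
      moreover have "?s * ?s = - 1" by (simp add: gconst_mult[symmetric] gconst_uminus)
      ultimately show "?s * z powi (n - 1) * (?s * z powi (- n - 1)) = - (inverse z * inverse z * 1)"
        by (metis gconst_left_commute mult.assoc mult.right_neutral mult_minus1)
    qed auto
    have dpow: "superdiff (M - 2) (- {0}) (\<lambda>z. ?s * z powi k) (\<lambda>z. ?s * (gconst (of_int k) * z powi (k - 1) * 1))" for k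
      by (rule superdiff_cmult[OF superdiff_powi[OF superdiff_ident U] U]) auto
    have "superconformal_on M {q \<in> superspace M. body (fst q) \<in> - {0}}
        (sconf (\<lambda>z. inverse z) (\<lambda>z. ?s * z powi (n - 1)) (\<lambda>z. ?s * z powi (- n - 1))
      (\<lambda>z. ?s * \<xi> * (u z * z powi (n - 1)))
      (\<lambda>z. ?s * \<xi> * (u' z * z powi (n - 1) + u z * (gconst (of_int (n - 1)) * z powi (n - 1 - 1))))
      (\<lambda>z. ?s * \<xi> * (w z * z powi (- n - 1)))
      (\<lambda>z. ?s * \<xi> * (w' z * z powi (- n - 1) + w z * (gconst (of_int (- n - 1)) * z powi (- n - 1 - 1)))))"
    proof (rule superconformal_on_sconf[OF U _ enat_minus_2_le refl dinv dpow dpow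
          superdiff_odd[OF xi(2) dd(1)[OF U] U bnz] superdiff_odd[OF xi(2) dd(2)[OF U] U bnz]])
      fix z assume z: "geven z" "body z \<in> - {0}"
      then have "geven (u z * z powi (n - 1))" "geven (w z * z powi (- n - 1))" using ev by auto
      from odd_products_vanish(2)[OF xi(1) this(1)] odd_products_vanish(2)[OF xi(1) this(2)]
      show "?s * \<xi> * (u z * z powi (n - 1)) * (?s * \<xi> * (w' z * z powi (- n - 1) + w z * (gconst (of_int (- n - 1)) * z powi (- n - 1 - 1)))) = 0 \<and>
        ?s * \<xi> * (w z * z powi (- n - 1)) * (?s * \<xi> * (u' z * z powi (n - 1) + u z * (gconst (of_int (n - 1)) * z powi (n - 1 - 1)))) = 0"
        by blast
    qed (use xi ev in auto)
    then show ?thesis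
    proof (rule superconformal_on_cong)
      show "?D = {q \<in> superspace M. body (fst q) \<in> - {0}}" using T d by (auto simp: pt_in_chart_dom)
      fix q assume "q \<in> {q \<in> superspace M. body (fst q) \<in> - {0}}"
      then have q: "q \<in> superspace M" "body (fst q) \<noteq> 0" by auto
      obtain z p r where qq: "q = (z, p, r)" by (cases q)
      have zp: "geven z" "godd p" "godd r" "body z \<noteq> 0" using q by (auto simp: qq superspace_iff)
      have b: "body (fst (?m q)) \<noteq> 0" using T[OF q(1)] q(2) by simp
      have "odd_aut M n \<xi> a b (pt c M n q) = pt d M n (change_chart c n (?m q))"
        using T[OF q(1)] pt_change_chart[OF T(2)[OF q(1)] b, of c n] d by simp
      then have "coord d (odd_aut M n \<xi> a b (pt c M n q)) = change_chart c n (?m q)"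
        using change_chart_in[OF T(2)[OF q(1)] b] by (simp add: coord_pt)
      then show "coord d (odd_aut M n \<xi> a b (pt c M n q)) = (sconf (\<lambda>z. inverse z) (\<lambda>z. ?s * z powi (n - 1)) (\<lambda>z. ?s * z powi (- n - 1))
      (\<lambda>z. ?s * \<xi> * (u z * z powi (n - 1)))
      (\<lambda>z. ?s * \<xi> * (u' z * z powi (n - 1) + u z * (gconst (of_int (n - 1)) * z powi (n - 1 - 1))))
      (\<lambda>z. ?s * \<xi> * (w z * z powi (- n - 1)))
      (\<lambda>z. ?s * \<xi> * (w' z * z powi (- n - 1) + w z * (gconst (of_int (- n - 1)) * z powi (- n - 1 - 1))))) q"
        unfolding m qq using change_chart_odd_map[OF xi(1) zp(1-4), of u u' w w' c n] ev[OF zp(1)] by simp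
    qed
  qed
qed

lemma odd_map_inverse:
  assumes xi: "godd \<xi>" and q: "geven z" "godd p" "godd m"
  shows "odd_map (- \<xi>) (gpoly k a) (gpoly' k a) (gpoly l b) (gpoly' l b)
    (odd_map \<xi> (gpoly k a) (gpoly' k a) (gpoly l b) (gpoly' l b) (z, p, m)) = (z, p, m)"
proof -
  have ac: "\<xi> * (p * x) = - (p * (\<xi> * x))" "\<xi> * (m * x) = - (m * (\<xi> * x))"
      "\<xi> * (\<xi> * x) = 0" "\<xi> * p = - (p * \<xi>)" "\<xi> * m = - (m * \<xi>)" "\<xi> * \<xi> = 0" for x
    by (rule godd_left_anticommute[OF xi q(2)] godd_left_anticommute[OF xi q(3)] godd_square_left[OF xi]
        godd_anticommute[OF xi q(2)] godd_anticommute[OF xi q(3)] godd_square[OF xi])+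
  define z' where "z' = z + p * (\<xi> * gpoly l b z) + m * (\<xi> * gpoly k a z)"
  have "\<xi> * (z' * x) = \<xi> * (z * x)" for x by (simp add: z'_def algebra_simps ac)
  then have pw: "\<xi> * z' ^ j = \<xi> * z ^ j" for j
  proof (induction j)
    case (Suc j)
    have "\<xi> * (z' * z' ^ j) = z * (\<xi> * z' ^ j)"
      using Suc.prems geven_left_commute[OF q(1)] by simp
    then show ?case using Suc geven_left_commute[OF q(1), of \<xi> "z ^ j"] by simp
  qed simp
  have po: "\<xi> * gpoly i c z' = \<xi> * gpoly i c z" "\<xi> * gpoly' i c z' = \<xi> * gpoly' i c z" for i c
    by (simp_all add: gpoly_def gpoly'_def sum_distrib_left gconst_left_commute[of \<xi>] pw)
  have pe: "gpoly i c z * (y * x) = y * (gpoly i c z * x)" "gpoly' i c z * (y * x) = y * (gpoly' i c z * x)" for i c x y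
    by (rule geven_left_commute2[OF gpoly_closure(1)[OF q(1)]] geven_left_commute2[OF gpoly_closure(2)[OF q(1)]])+
  show ?thesis
    unfolding odd_map.simps z'_def[symmetric]
    by (simp add: po algebra_simps pe[of _ _ \<xi>] pe[of _ _ m] ac) (simp add: z'_def algebra_simps)
qed

text \<open>The inverse belongs to the parameter \<open>- \<xi>\<close> because all terms quadratic in \<open>\<xi>\<close> vanish.\<close>

lemma odd_aut_in_auts:
  assumes "\<xi> \<in> galg_odd (M - 2)"
  shows "odd_aut M n \<xi> a b \<in> sphere_auts M n"
proof (rule sphere_autsI)
  have xi: "- \<xi> \<in> galg_odd (M - 2)" using assms by (auto simp: galg_odd_iff)
  show "superconformal_map M (sphere_atlas M n) (odd_aut M n \<xi> a b)"
    "superconformal_map M (sphere_atlas M n) (odd_aut M n (- \<xi>) a b)"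
    by (rule odd_aut_superconformal, fact)+
  have *: "odd_aut M n \<eta> a b P \<in> sphere M n \<and> odd_aut M n (- \<eta>) a b (odd_aut M n \<eta> a b P) = P"
    if e: "\<eta> \<in> galg_odd (M - 2)" and P: "P \<in> sphere M n" for \<eta> P
  proof -
    obtain c q where q: "q \<in> superspace M" "P = pt c M n q" using P by (auto simp: sphere_eq)
    have e': "- \<eta> \<in> galg_odd (M - 2)" using e by (auto simp: galg_odd_iff)
    obtain z p m where qq: "q = (z, p, m)" by (cases q)
    have "odd_chart_map c n (- \<eta>) a b (odd_chart_map c n \<eta> a b q) = q"
      unfolding odd_chart_map_def qq
      by (rule odd_map_inverse) (use e q in \<open>auto simp: galg_odd_iff qq superspace_iff\<close>)
    then show ?thesis
      using odd_aut_pt[OF e q(1)] odd_aut_pt[OF e' odd_chart_map_in(1)[OF e q(1)]] odd_chart_map_in(1)[OF e q(1)] q(2)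
      by simp
  qed
  show "odd_aut M n \<xi> a b P \<in> sphere M n \<and> odd_aut M n (- \<xi>) a b (odd_aut M n \<xi> a b P) = P"
    "odd_aut M n (- \<xi>) a b P \<in> sphere M n \<and> odd_aut M n \<xi> a b (odd_aut M n (- \<xi>) a b P) = P"
    if "P \<in> sphere M n" for P
    using *[OF assms that] *[OF xi that] by simp_all
qed

definition ppoly :: "int \<Rightarrow> (nat \<Rightarrow> complex) \<Rightarrow> pfun" where
  "ppoly k c = (\<Sum>j | int j \<le> k. pmonom (c j) (int j))"

text \<open>The odd derivation with coefficient functions \<open>u\<close> (multiplying the \<open>G\<^sup>+\<close>) and \<open>w\<close>
  (multiplying the \<open>G\<^sup>-\<close>).\<close>

definition odd_sder :: "pfun \<Rightarrow> pfun \<Rightarrow> sder" where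
  "odd_sder u w = (SF 0 w u 0, SF (- u) 0 0 (- pderivative u), SF (- w) 0 0 (pderivative w))"

lemma gext_ppoly:
  assumes "geven z" "body z \<noteq> 0"
  shows "gext (papp (ppoly k c)) z = gpoly k c z" "gext (papp (pderivative (ppoly k c))) z = gpoly' k c z"
proof -
  have "gext (papp (\<Sum>j\<in>A. pmonom (c j) (int j))) z = (\<Sum>j\<in>A. gconst (c j) * z ^ j)"
    if "geven z" "body z \<noteq> 0" for A :: "nat set" and z
    by (induction A rule: infinite_finite_induct) (use gext_papp[OF that] in \<open>simp_all del: papp_simps\<close>)
  then have e: "gext (papp (ppoly k c)) z = gpoly k c z" if "geven z" "body z \<noteq> 0" for z
    using that by (simp add: ppoly_def gpoly_def)
  then show "gext (papp (ppoly k c)) z = gpoly k c z" using assms .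
  have U: "open (- {0::complex})" by auto
  have "gext (deriv (papp (ppoly k c))) z = gpoly' k c z"
    by (rule superdiff_unique[OF superdiff_gext[OF papp_holomorphic] superdiff_gpoly[OF U] U])
      (use e assms in auto)
  then show "gext (papp (pderivative (ppoly k c))) z = gpoly' k c z"
    using gext_papp(7)[OF assms] by simp
qed

lemma pderivative_simps [simp]: "pderivative 0 = 0" "pderivative 1 = 0"
  and pderivative_pmonom: "pderivative (pmonom c k) = pmonom (of_int k * c) (k - 1)"
  and pderivative_add: "pderivative (f + g) = pderivative f + pderivative g"
  and pderivative_uminus: "pderivative (- f) = - pderivative f"
  and pderivative_diff: "pderivative (f - g) = pderivative f - pderivative g"
  and pderivative_mult: "pderivative (f * g) = pderivative f * g + f * pderivative g"
proof -
  have cong: "deriv f x = deriv g x" if "x \<noteq> 0" "\<And>y. y \<noteq> 0 \<Longrightarrow> f y = g y" for f g :: "complex \<Rightarrow> complex" and x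
    using that by (intro deriv_cong_ev eventually_mono[OF eventually_nhds_in_open[of "- {0}"]]) auto
  have d: "papp f field_differentiable at x" if "x \<noteq> 0" for f x
    by (rule holomorphic_on_imp_differentiable_at[OF papp_holomorphic]) (use that in auto)
  show "pderivative 0 = 0" by (rule papp_eqI) (simp add: pderivative.rep_eq)
  show "pderivative 1 = 0"
    by (rule papp_eqI) (simp add: pderivative.rep_eq one_pfun.rep_eq cong[of _ _ "\<lambda>_. 1"])
  show "pderivative (pmonom c k) = pmonom (of_int k * c) (k - 1)"
  proof (rule papp_eqI)
    fix x :: complex
    have "deriv (papp (pmonom c k)) x = of_int k * c * x powi (k - 1)" if "x \<noteq> 0"
    proof -
      have "deriv (papp (pmonom c k)) x = deriv (\<lambda>x. c * x powi k) x"
        by (rule cong[OF that]) (simp add: pmonom.rep_eq)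
      then show ?thesis using that by (auto intro!: DERIV_imp_deriv derivative_eq_intros)
    qed
    then show "papp (pderivative (pmonom c k)) x = papp (pmonom (of_int k * c) (k - 1)) x"
      by (simp add: pderivative.rep_eq pmonom.rep_eq[of _ "k - 1"])
  qed
  show "pderivative (f + g) = pderivative f + pderivative g"
    by (rule papp_eqI) (simp add: pderivative.rep_eq d)
  show "pderivative (- f) = - pderivative f"
    by (rule papp_eqI) (simp add: pderivative.rep_eq d)
  show "pderivative (f - g) = pderivative f - pderivative g"
    by (rule papp_eqI) (simp add: pderivative.rep_eq d)
  show "pderivative (f * g) = pderivative f * g + f * pderivative g"
    by (rule papp_eqI) (simp add: pderivative.rep_eq d)
qed

lemma pmonom_1_0 [simp]: "pmonom 1 0 = 1"
  by (rule papp_eqI) (simp add: pmonom.rep_eq one_pfun.rep_eq)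

lemma sder_app_coordinates: "sder_app (A, B, C) (xmonom 1 1) = A" "sder_app (A, B, C) phip = B" "sder_app (A, B, C) phim = C"
  by (cases A; cases B; cases C; simp add: xmonom_def phip_def phim_def dx_def dtp_def dtm_def pderivative_pmonom
      times_superfun_def plus_superfun_def zero_superfun_def)+

lemma odd_flow_iff:
  assumes "q \<in> superspace M" "body (fst q) \<noteq> 0"
  shows "odd_flow (odd_sder u w) \<xi> q q' \<longleftrightarrow> q' = (fst q - \<xi> * psf_eval (SF 0 w u 0) q,
      fst (snd q) - \<xi> * psf_eval (SF (- u) 0 0 (- pderivative u)) q,
      snd (snd q) - \<xi> * psf_eval (SF (- w) 0 0 (pderivative w)) q)"
  using sder_app_coordinates
  unfolding odd_flow_def odd_sder_def
  by (cases q') (auto simp: psf_eval_coordinates[OF assms] simp del: sder_app.simps)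

lemma odd_sder_flows:
  assumes xi: "\<xi> \<in> galg_odd (M - 2)"
  shows "\<exists>T\<in>sphere_auts M n. \<forall>q\<in>superspace M. body (fst q) \<noteq> 0 \<longrightarrow>
    (\<exists>q'. odd_flow (odd_sder (ppoly (1 - n) a) (ppoly (1 + n) b)) \<xi> q q' \<and> in_Delta_coordinates M n T q q')"
proof (intro bexI[OF _ odd_aut_in_auts[OF xi, of n a b]] ballI impI exI conjI)
  fix q assume q: "q \<in> superspace M" "body (fst q) \<noteq> 0"
  obtain z p m where qq: "q = (z, p, m)" by (cases q)
  have z: "geven z" "body z \<noteq> 0" "godd p" "godd m" "godd \<xi>" using q xi by (auto simp: qq superspace_iff galg_odd_iff)
  have e: "gext (papp 0) z = 0" using gext_papp(8)[OF z(1,2)] .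
  have sw: "\<xi> * (p * x) = - (p * (\<xi> * x))" "\<xi> * (m * x) = - (m * (\<xi> * x))" for x
    using godd_left_anticommute z by blast+
  show "odd_flow (odd_sder (ppoly (1 - n) a) (ppoly (1 + n) b)) \<xi> q (odd_chart_map True n \<xi> a b q)"
    unfolding odd_flow_iff[OF q]
    by (simp add: qq odd_chart_map_def chart_coeffs_def psf_eval_eq gext_papp(3)[OF z(1,2)] gext_ppoly[OF z(1,2)] e
        algebra_simps sw del: papp_simps)
  show "in_Delta_coordinates M n (odd_aut M n \<xi> a b) q (odd_chart_map True n \<xi> a b q)"
    unfolding in_Delta_coordinates_iff[OF q(1)] odd_aut_pt[OF xi q(1)]
    using odd_chart_map_in[OF xi q(1)] by (simp add: pt_in_chart_dom coord_pt)
qed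

section \<open>Holomorphic automorphisms of the Riemann sphere with a multiplier\<close>

lemma Liouville_sphere:
  assumes "G holomorphic_on - {p}" "(G \<longlongrightarrow> a) (at p)" "((\<lambda>w. G (inverse w)) \<longlongrightarrow> (b::complex)) (at 0)"
  shows "x \<noteq> p \<Longrightarrow> G x = b"
proof -
  assume x: "x \<noteq> p"
  let ?G = "\<lambda>y. if y = p then a else G y"
  have "?G holomorphic_on UNIV"
    by (rule removable_singularity) (use assms in \<open>simp_all add: Compl_eq_Diff_UNIV\<close>)
  moreover have "(?G \<longlongrightarrow> b) at_infinity"
    unfolding lim_at_infinity_0 o_def
  proof (rule Lim_transform_eventually[OF assms(3)])
    have "eventually (\<lambda>w. w \<noteq> inverse p) (at 0)"
    proof (cases "p = 0")
      case False
      then have "eventually (\<lambda>w. w \<in> - {inverse p}) (nhds 0)" by (intro eventually_nhds_in_open) auto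
      then show ?thesis by (auto simp: eventually_at_filter elim: eventually_mono)
    qed (auto simp: eventually_at_filter)
    then show "eventually (\<lambda>w. G (inverse w) = ?G (inverse w)) (at 0)"
      by eventually_elim auto
  qed
  ultimately have "?G x = b" by (rule Liouville_weak)
  then show "G x = b" using x by simp
qed

lemma deriv_quotient_limit:
  assumes "g holomorphic_on V" "open V" "p \<in> V"
  shows "((\<lambda>x. (g x - g p) / (x - p)) \<longlongrightarrow> deriv g p) (at p)"
  using holomorphic_derivI[OF assms] by (simp add: has_field_derivative_iff)

lemma tendsto_at_cong:
  assumes "(f \<longlongrightarrow> L) (at p)" "open V" "p \<in> V" "\<And>x. x \<in> V \<Longrightarrow> x \<noteq> p \<Longrightarrow> f x = g x"
  shows "(g \<longlongrightarrow> L) (at p)"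
proof (rule Lim_transform_eventually[OF assms(1)])
  have "eventually (\<lambda>x. x \<in> V \<and> x \<noteq> p) (at p)"
    using eventually_nhds_in_open[OF assms(2,3)] by (auto simp: eventually_at_filter elim: eventually_mono)
  then show "eventually (\<lambda>x. f x = g x) (at p)" by eventually_elim (use assms(4) in auto)
qed

lemma holomorphic_tendsto: "g holomorphic_on V \<Longrightarrow> open V \<Longrightarrow> p \<in> V \<Longrightarrow> (g \<longlongrightarrow> g p) (at p)"
  by (metis at_within_open continuous_on_def holomorphic_on_imp_continuous_on)

text \<open>In the next two lemmas \<open>h\<close> is the automorphism and \<open>A\<close> the multiplier in the finite chart; the
  other functions are their expressions at infinity. The multiplier is a section of a line bundle,
  and this determines it up to a constant. If infinity is fixed, \<open>(h x - h 0) / x\<close> and \<open>A\<close> extend to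
  the sphere.\<close>

lemma automorphism_fixing_infinity:
  assumes h: "h holomorphic_on UNIV" and A: "A holomorphic_on UNIV"
    and V: "open V" "0 \<in> V" "g holomorphic_on V" "B holomorphic_on V" "g 0 = 0" "deriv g 0 \<noteq> 0"
    and glue: "\<And>w. w \<in> V \<Longrightarrow> w \<noteq> 0 \<Longrightarrow> g w \<noteq> 0 \<and> h (inverse w) = inverse (g w)
      \<and> B w = A (inverse w) * (w * h (inverse w)) powi (k::int)"
  obtains \<alpha> \<beta> C where "\<alpha> \<noteq> 0" "\<And>x. h x = \<alpha> * x + \<beta>" "\<And>x. A x = (C::complex)"
proof -
  define l where "l = inverse (deriv g 0)"
  have l0: "l \<noteq> 0" using V(6) by (simp add: l_def)
  have lim: "((\<lambda>w. w * h (inverse w)) \<longlongrightarrow> l) (at 0)"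
  proof (rule tendsto_at_cong[OF _ V(1,2)])
    show "((\<lambda>w. inverse ((g w - g 0) / (w - 0))) \<longlongrightarrow> l) (at 0)"
      unfolding l_def by (intro tendsto_inverse deriv_quotient_limit[OF V(3,1,2)] V(6))
  qed (use glue V(5) in \<open>auto simp: field_simps\<close>)
  have "(h x - h 0) / x = l" if "x \<noteq> 0" for x
  proof (rule Liouville_sphere[OF _ _ _ that])
    show "(\<lambda>x. (h x - h 0) / x) holomorphic_on - {0}"
      by (intro holomorphic_intros holomorphic_on_subset[OF h]) auto
    show "((\<lambda>x. (h x - h 0) / x) \<longlongrightarrow> deriv h 0) (at 0)"
      using deriv_quotient_limit[OF h, of 0] by simp
    have "((\<lambda>w. w * h (inverse w) - h 0 * w) \<longlongrightarrow> l - h 0 * 0) (at 0)"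
      by (intro tendsto_intros lim)
    then show "((\<lambda>w. (h (inverse w) - h 0) / inverse w) \<longlongrightarrow> l) (at 0)"
      by (simp add: field_simps)
  qed
  then have hh: "h x = l * x + h 0" for x by (cases "x = 0") (auto simp: field_simps)
  have "A x = B 0 * l powi (- k)" if "x \<noteq> 0" for x
  proof (rule Liouville_sphere[OF _ _ _ that])
    show "A holomorphic_on - {0}" by (rule holomorphic_on_subset[OF A]) auto
    show "(A \<longlongrightarrow> A 0) (at 0)" by (rule holomorphic_tendsto[OF A]) auto
    show "((\<lambda>w. A (inverse w)) \<longlongrightarrow> B 0 * l powi (- k)) (at 0)"
    proof (rule tendsto_at_cong[OF _ V(1,2)])
      show "((\<lambda>w. B w * (w * h (inverse w)) powi (- k)) \<longlongrightarrow> B 0 * l powi (- k)) (at 0)"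
        using l0 by (intro tendsto_mult holomorphic_tendsto[OF V(4,1,2)] tendsto_power_int lim)
      fix w assume w: "w \<in> V" "w \<noteq> 0"
      then have "w * h (inverse w) \<noteq> 0" using glue by auto
      then show "B w * (w * h (inverse w)) powi (- k) = A (inverse w)"
        using glue[OF w] by (simp add: power_int_minus)
    qed
  qed
  moreover have "A 0 = B 0 * l powi (- k)"
  proof (rule tendsto_unique[of "at (0::complex)" A])
    show "(A \<longlongrightarrow> A 0) (at 0)" by (rule holomorphic_tendsto[OF A]) auto
    show "(A \<longlongrightarrow> B 0 * l powi (- k)) (at 0)"
      by (rule tendsto_at_cong[of "\<lambda>_. B 0 * l powi (- k)" _ _ UNIV]) (use calculation in auto)
  qed simp
  ultimately have "A x = B 0 * l powi (- k)" for x by (cases "x = 0") auto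
  then show ?thesis using that[OF l0 hh] by blast
qed

text \<open>Otherwise, with \<open>p \<mapsto> \<infinity> \<mapsto> r\<close>, the functions \<open>1 / ((h x - r) (x - p))\<close> and \<open>A x / (x - p)\<^sup>k\<close>
  extend.\<close>

lemma automorphism_moving_infinity:
  assumes h: "h holomorphic_on - {p}" and A: "A holomorphic_on - {p}" and hr: "\<And>x. x \<noteq> p \<Longrightarrow> h x \<noteq> r"
    and V: "open V" "p \<in> V" "g holomorphic_on V" "B holomorphic_on V" "g p = 0"
    and glueV: "\<And>x. x \<in> V \<Longrightarrow> x \<noteq> p \<Longrightarrow> g x \<noteq> 0 \<and> h x = inverse (g x) \<and> B x = s * (A x * h x powi k)"
    and W: "open W" "0 \<in> W" "f holomorphic_on W" "D holomorphic_on W" "f 0 = r" "deriv f 0 \<noteq> 0"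
    and glueW: "\<And>w. w \<in> W \<Longrightarrow> w \<noteq> 0 \<Longrightarrow> inverse w \<noteq> p \<Longrightarrow> h (inverse w) = f w \<and> D w = s' * w powi k * A (inverse w)"
    and s: "s \<noteq> 0" "s' \<noteq> 0"
  obtains \<kappa> C where "\<kappa> \<noteq> 0" "\<And>x. x \<noteq> p \<Longrightarrow> h x = r + \<kappa> / (x - p)"
    "\<And>x. x \<noteq> p \<Longrightarrow> A x = (C::complex) * (x - p) powi (k::int)"
proof -
  define \<kappa> where "\<kappa> = deriv f 0"
  obtain W' where W': "open W'" "0 \<in> W'" "\<And>w. w \<in> W' \<Longrightarrow> w \<noteq> 0 \<Longrightarrow> w \<in> W \<and> inverse w \<noteq> p"
  proof (cases "p = 0")
    case False
    show ?thesis by (rule that[of "W - {inverse p}"]) (use W(1,2) False in auto)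
  qed (use W(1,2) that in auto)
  have "1 / ((h x - r) * (x - p)) = inverse \<kappa>" if "x \<noteq> p" for x
  proof (rule Liouville_sphere[OF _ _ _ that])
    show "(\<lambda>x. 1 / ((h x - r) * (x - p))) holomorphic_on - {p}"
      using hr by (intro holomorphic_intros h) auto
    show "((\<lambda>x. 1 / ((h x - r) * (x - p))) \<longlongrightarrow> deriv g p / (1 - r * g p)) (at p)"
    proof (rule tendsto_at_cong[OF _ V(1,2)])
      show "((\<lambda>x. ((g x - g p) / (x - p)) / (1 - r * g x)) \<longlongrightarrow> deriv g p / (1 - r * g p)) (at p)"
        by (intro tendsto_intros deriv_quotient_limit[OF V(3,1,2)] holomorphic_tendsto[OF V(3,1,2)])
          (simp add: V(5))
      fix x assume x: "x \<in> V" "x \<noteq> p"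
      have "g x \<noteq> 0" "h x = inverse (g x)" using glueV[OF x] by auto
      then have "h x - r = (1 - r * g x) / g x" by (simp add: field_simps)
      then show "((g x - g p) / (x - p)) / (1 - r * g x) = 1 / ((h x - r) * (x - p))"
        using x by (simp add: V(5))
    qed
    show "((\<lambda>w. 1 / ((h (inverse w) - r) * (inverse w - p))) \<longlongrightarrow> inverse \<kappa>) (at 0)"
    proof (rule tendsto_at_cong[OF _ W'(1,2)])
      have "((\<lambda>w. inverse ((f w - f 0) / (w - 0)) / (1 - p * w)) \<longlongrightarrow> inverse \<kappa> / (1 - p * 0)) (at 0)"
        unfolding \<kappa>_def by (intro tendsto_intros deriv_quotient_limit[OF W(3,1,2)]) (use W(6) in auto)
      then show "((\<lambda>w. inverse ((f w - f 0) / (w - 0)) / (1 - p * w)) \<longlongrightarrow> inverse \<kappa>) (at 0)" by simp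
      fix w assume w: "w \<in> W'" "w \<noteq> 0"
      then have "h (inverse w) = f w" "inverse w \<noteq> p" using glueW W'(3) by auto
      moreover have "inverse w - p = (1 - p * w) / w" using w by (simp add: field_simps)
      ultimately show "inverse ((f w - f 0) / (w - 0)) / (1 - p * w) = 1 / ((h (inverse w) - r) * (inverse w - p))"
        by (simp add: W(5))
    qed
  qed
  moreover have k0: "\<kappa> \<noteq> 0" using W(6) by (simp add: \<kappa>_def)
  ultimately have hh: "h x = r + \<kappa> / (x - p)" if "x \<noteq> p" for x
  proof -
    have "(h x - r) * (x - p) = \<kappa>" using \<open>x \<noteq> p \<Longrightarrow> 1 / ((h x - r) * (x - p)) = inverse \<kappa>\<close>[OF that] k0
      by (metis inverse_eq_divide inverse_inverse_eq)
    then show ?thesis using that by (simp add: field_simps)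
  qed
  define C where "C = inverse s' * D 0"
  have "A x * (x - p) powi (- k) = C" if "x \<noteq> p" for x
  proof (rule Liouville_sphere[OF _ _ _ that])
    show "(\<lambda>x. A x * (x - p) powi (- k)) holomorphic_on - {p}"
      by (intro holomorphic_intros A) auto
    show "((\<lambda>x. A x * (x - p) powi (- k)) \<longlongrightarrow> inverse s * (B p * (r * (p - p) + \<kappa>) powi (- k))) (at p)"
    proof (rule tendsto_at_cong[OF _ V(1,2)])
      show "((\<lambda>x. inverse s * (B x * (r * (x - p) + \<kappa>) powi (- k))) \<longlongrightarrow> inverse s * (B p * (r * (p - p) + \<kappa>) powi (- k))) (at p)"
        using k0 by (intro tendsto_intros tendsto_power_int holomorphic_tendsto[OF V(4,1,2)]) auto
      fix x assume x: "x \<in> V" "x \<noteq> p"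
      have "g x \<noteq> 0" "h x = inverse (g x)" and B: "B x = s * (A x * h x powi k)" using glueV[OF x] by auto
      then have h0: "h x \<noteq> 0" by simp
      have e: "r * (x - p) + \<kappa> = h x * (x - p)" using hh[OF x(2)] x by (simp add: field_simps)
      show "inverse s * (B x * (r * (x - p) + \<kappa>) powi (- k)) = A x * (x - p) powi (- k)"
        unfolding e B power_int_mult_distrib using h0 s by (simp add: power_int_minus)
    qed
    show "((\<lambda>w. A (inverse w) * (inverse w - p) powi (- k)) \<longlongrightarrow> C) (at 0)"
    proof (rule tendsto_at_cong[OF _ W'(1,2)])
      have "((\<lambda>w. inverse s' * (D w * (1 - p * w) powi (- k))) \<longlongrightarrow> inverse s' * (D 0 * (1 - p * 0) powi (- k))) (at 0)"
        by (intro tendsto_intros tendsto_power_int holomorphic_tendsto[OF W(4,1,2)]) auto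
      then show "((\<lambda>w. inverse s' * (D w * (1 - p * w) powi (- k))) \<longlongrightarrow> C) (at 0)" by (simp add: C_def)
      fix w assume w: "w \<in> W'" "w \<noteq> 0"
      have D: "D w = s' * w powi k * A (inverse w)" using glueW W'(3) w by auto
      have e: "1 - p * w = w * (inverse w - p)" using w by (simp add: field_simps)
      show "inverse s' * (D w * (1 - p * w) powi (- k)) = A (inverse w) * (inverse w - p) powi (- k)"
        unfolding e D power_int_mult_distrib using w s by (simp add: power_int_minus)
    qed
  qed
  then have "A x = C * (x - p) powi k" if "x \<noteq> p" for x
    using that by (simp add: power_int_minus field_simps)
  then show ?thesis using that[OF k0 hh] by blast
qed

section \<open>Reduced automorphisms\<close>

lemma gcoeff_mult_singleton: "gcoeff (a * b) {l} = body a * gcoeff b {l} + gcoeff a {l} * body b"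
proof -
  have "Pow {l} = {{}, {l}}" by auto
  then show ?thesis by (simp add: gcoeff_mult body_def)
qed

lemma gcoeff_zeta [simp]: "gcoeff (gmono {k}) {l} = (if k = l then 1 else 0)" "body (gmono {k}) = 0"
  by (auto simp: gcoeff_gmono body_def)

lemma godd_zeta [simp]: "godd (gconst c * gmono {k})" "godd (gmono {k})"
  by (auto simp: godd_gmono)

lemma gfun_eval_gconst:
  assumes "gfun_on N U f"
  shows "gcoeff (gfun_eval f (gconst x)) s = f s x"
proof -
  have "gfun_eval f (gconst x) = gval f x"
    using gfun_eval_eq[OF gfun_on_gfin[OF assms], of "gconst x" 1] by (simp add: soul_def)
  then show ?thesis by (simp add: gcoeff_gval[OF gfun_on_gfin[OF assms]])
qed

lemma gfun_support_finite: "gfun_on N U f \<Longrightarrow> finite {k. f {k} \<noteq> 0}"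
proof -
  assume "gfun_on N U f"
  then have "finite {s. f s \<noteq> 0}" by (simp add: gfun_on_def)
  then have "finite ((\<lambda>k. {k}) -` {s. f s \<noteq> 0})" by (rule finite_vimageI) auto
  then show ?thesis by (simp add: vimage_def)
qed

text \<open>The lowest-order part of a superconformal map is a holomorphic map \<open>h\<close> together with multipliers
  \<open>A\<close>, \<open>B\<close> of \<open>\<theta>\<^sup>+\<close>, \<open>\<theta>\<^sup>-\<close> with \<open>h' = A B\<close>. The multipliers are read off at odd coordinates
  proportional to generators that do not occur in the coefficients of the map.\<close>

lemma superconformal_on_jet:
  assumes "superconformal_on \<infinity> D H"
  obtains U h A B S where "open U" "D = {q \<in> superspace \<infinity>. body (fst q) \<in> U}" "finite S"
    "h holomorphic_on U" "A holomorphic_on U" "B holomorphic_on U" "\<And>x. x \<in> U \<Longrightarrow> deriv h x = A x * B x"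
    "\<And>q. q \<in> D \<Longrightarrow> H q \<in> superspace \<infinity> \<and> body (fst (H q)) = h (body (fst q))"
    "\<And>x a b k l. x \<in> U \<Longrightarrow> k \<notin> S \<Longrightarrow> l \<notin> S \<Longrightarrow> k \<noteq> l \<Longrightarrow>
      gcoeff (fst (snd (H (gconst x, gconst a * gmono {k}, gconst b * gmono {l})))) {k} = a * A x \<and>
      gcoeff (snd (snd (H (gconst x, gconst a * gmono {k}, gconst b * gmono {l})))) {l} = b * B x"
proof -
  obtain U Z P Q where *: "open U" "D = {q \<in> superspace \<infinity>. body (fst q) \<in> U}"
    "superanalytic \<infinity> U Z" "superanalytic \<infinity> U P" "superanalytic \<infinity> U Q"
    "\<forall>q\<in>D. H q = (sf_eval Z q, sf_eval P q, sf_eval Q q) \<and> H q \<in> superspace \<infinity> \<and>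
           Dp Q q = 0 \<and> Dm P q = 0 \<and>
           Dp Z q - sf_eval Q q * Dp P q = 0 \<and> Dm Z q - sf_eval P q * Dm Q q = 0"
    using assms unfolding superconformal_on_def idiff_infinity by blast
  obtain z0 zp zm zpm p0 pp pm ppm q0 qp qm qpm where
    F: "Z = SF z0 zp zm zpm" "P = SF p0 pp pm ppm" "Q = SF q0 qp qm qpm"
    by (cases Z; cases P; cases Q) auto
  have on: "gfun_on \<infinity> U z0" "gfun_on \<infinity> U zp" "gfun_on \<infinity> U zm" "gfun_on \<infinity> U zpm"
    "gfun_on \<infinity> U p0" "gfun_on \<infinity> U pp" "gfun_on \<infinity> U pm" "gfun_on \<infinity> U ppm"
    "gfun_on \<infinity> U q0" "gfun_on \<infinity> U qp" "gfun_on \<infinity> U qm" "gfun_on \<infinity> U qpm"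
    using *(3-5) by (auto simp: superanalytic_def F)
  note ond = on[THEN gfun_on_gder[OF _ *(1)]] gfun_on_uminus[OF on(4)] gfun_on_uminus[OF on(12)]
  define S where "S = {k. zp {k} \<noteq> 0} \<union> {k. zm {k} \<noteq> 0} \<union> {k. p0 {k} \<noteq> 0} \<union> {k. q0 {k} \<noteq> 0}"
  have S: "finite S" using on gfun_support_finite by (auto simp: S_def)
  have S0: "zp {k} = 0" "zm {k} = 0" "p0 {k} = 0" "q0 {k} = 0" if "k \<notin> S" for k
    using that by (auto simp: S_def)
  have ev: "gcoeff (gfun_eval f (gconst x)) s = f s x" "body (gfun_eval f (gconst x)) = f {} x"
    if "gfun_on \<infinity> U f" for f s x
    using gfun_eval_gconst[OF that] by (simp_all add: body_def)
  note evs = on[THEN ev(1)] on[THEN ev(2)] ond[THEN ev(1)] ond[THEN ev(2)]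
  have inD: "(gconst x, gconst a * gmono {k}, gconst b * gmono {l}) \<in> D" if "x \<in> U" for x a b k l
    using that by (simp add: *(2) superspace_iff)
  have body0: "p0 {} x = 0" "q0 {} x = 0" if x: "x \<in> U" for x
  proof -
    have "H (gconst x, 0, 0) \<in> superspace \<infinity>" "H (gconst x, 0, 0) = (sf_eval Z (gconst x, 0, 0), sf_eval P (gconst x, 0, 0), sf_eval Q (gconst x, 0, 0))"
      using *(6) inD[OF x, of 0 0 0 0] by auto
    then have "godd (gfun_eval p0 (gconst x))" "godd (gfun_eval q0 (gconst x))"
      by (simp_all add: F superspace_iff)
    then show "p0 {} x = 0" "q0 {} x = 0" using evs(17,21) godd_body by metis+
  qed
  show ?thesis
  proof (rule that[of U S "z0 {}" "pp {}" "qm {}"])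
    show "z0 {} holomorphic_on U" "pp {} holomorphic_on U" "qm {} holomorphic_on U"
      using on gfun_on_holomorphic by blast+
    show "H q \<in> superspace \<infinity> \<and> body (fst (H q)) = z0 {} (body (fst q))" if "q \<in> D" for q
    proof -
      obtain z p m where q: "q = (z, p, m)" by (cases q)
      have "body p = 0" "body m = 0" using that * q by (auto simp: superspace_iff)
      then show ?thesis using bspec[OF *(6) that] q by (auto simp: F body_gfun_eval[OF gfun_on_gfin[OF on(1)]])
    qed
    fix x assume x: "x \<in> U"
    show "gcoeff (fst (snd (H (gconst x, gconst a * gmono {k}, gconst b * gmono {l})))) {k} = a * pp {} x \<and>
      gcoeff (snd (snd (H (gconst x, gconst a * gmono {k}, gconst b * gmono {l})))) {l} = b * qm {} x"
      if "k \<notin> S" "l \<notin> S" "k \<noteq> l" for a b k l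
      using bspec[OF *(6) inD[OF x, of a k b l]] that
      by (simp add: F gcoeff_mult_singleton evs S0 mult.assoc)
    obtain k where k: "k \<notin> S" using S ex_new_if_finite infinite_UNIV_nat by blast
    let ?q = "(gconst x, gconst 0 * gmono {k}, gconst 1 * gmono {k})" and ?q' = "(gconst x, gconst 1 * gmono {k}, gconst 0 * gmono {k})"
    have d: "dtp Z = SF zp 0 zpm 0" "dtp P = SF pp 0 ppm 0" "dtm Z = SF zm (- zpm) 0 0" "dtm Q = SF qm (- qpm) 0 0"
      "sf_dz Z = SF (gder z0) (gder zp) (gder zm) (gder zpm)" "sf_dz P = SF (gder p0) (gder pp) (gder pm) (gder ppm)"
      "sf_dz Q = SF (gder q0) (gder qp) (gder qm) (gder qpm)"
      by (simp_all add: F dtp_def dtm_def sf_dz_SF)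
    have gdx: "gder z0 {} x = deriv (z0 {}) x" "(- zpm) {} x = - zpm {} x"
      by (simp_all add: gder_def)
    have "gcoeff (Dp Z ?q - sf_eval Q ?q * Dp P ?q) {k} = 0" "gcoeff (Dm Z ?q' - sf_eval P ?q' * Dm Q ?q') {k} = 0"
      using bspec[OF *(6) inD[OF x, of 0 k 1 k]] bspec[OF *(6) inD[OF x, of 1 k 0 k]] by auto
    then have "zpm {} x + deriv (z0 {}) x = qm {} x * pp {} x" "- zpm {} x + deriv (z0 {}) x = pp {} x * qm {} x"
      using body0[OF x] unfolding Dp.simps Dm.simps d
      by (simp_all add: F(2,3) gcoeff_mult_singleton evs S0[OF k] gdx)
    then show "deriv (z0 {}) x = pp {} x * qm {} x" by algebra
  qed (use *(1,2) S in auto)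
qed

text \<open>Superconformal maps respect this relation, whose classes are the points of the underlying
  Riemann sphere; this is how bijectivity of a map passes to its lowest-order part.\<close>

definition same_body :: "int \<Rightarrow> sphere_point \<Rightarrow> sphere_point \<Rightarrow> bool" where
  "same_body n P P' \<longleftrightarrow> (\<forall>c. (P \<in> chart_dom c \<infinity> n \<longleftrightarrow> P' \<in> chart_dom c \<infinity> n) \<and>
     (P \<in> chart_dom c \<infinity> n \<longrightarrow> body (fst (coord c P)) = body (fst (coord c P'))))"

lemma coord_pt_other:
  assumes "q \<in> superspace M" "body (fst q) \<noteq> 0"
  shows "coord (\<not> c) (pt c M n q) = change_chart c n q"
  using coord_pt[OF change_chart_in(1)[OF assms, of c n], of "\<not> c" n] pt_change_chart[OF assms, of c n] by simp

lemma coord_other: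
  assumes "P \<in> chart_dom c M n" "P \<in> chart_dom (\<not> c) M n"
  shows "coord (\<not> c) P = change_chart c n (coord c P)" "body (fst (coord c P)) \<noteq> 0"
proof -
  have P: "pt c M n (coord c P) = P" "coord c P \<in> superspace M" using pt_coord coord_in assms by auto
  then show b: "body (fst (coord c P)) \<noteq> 0" using assms(2) pt_in_chart_dom[OF P(2), of c n "\<not> c"] by simp
  show "coord (\<not> c) P = change_chart c n (coord c P)" using coord_pt_other[OF P(2) b, of c n] P(1) by simp
qed

lemma same_body_pt:
  assumes "q \<in> superspace \<infinity>" "q' \<in> superspace \<infinity>" "body (fst q) = body (fst q')"
  shows "same_body n (pt c \<infinity> n q) (pt c \<infinity> n q')"
  unfolding same_body_def
proof (intro allI conjI impI)
  fix d
  show "pt c \<infinity> n q \<in> chart_dom d \<infinity> n \<longleftrightarrow> pt c \<infinity> n q' \<in> chart_dom d \<infinity> n"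
    using assms by (simp add: pt_in_chart_dom)
  assume d: "pt c \<infinity> n q \<in> chart_dom d \<infinity> n"
  show "body (fst (coord d (pt c \<infinity> n q))) = body (fst (coord d (pt c \<infinity> n q')))"
  proof (cases "c = d")
    case False
    then have "d = (\<not> c)" "body (fst q) \<noteq> 0" using d assms(1) by (auto simp: pt_in_chart_dom)
    moreover from this have "body (fst q') \<noteq> 0" using assms(3) by simp
    ultimately show ?thesis
      using coord_pt_other[OF assms(1), of c n] coord_pt_other[OF assms(2), of c n]
        change_chart_in(2)[OF assms(1), of c n] change_chart_in(2)[OF assms(2), of c n] assms(3) by simp
  qed (use assms coord_pt in simp)
qed

lemma same_body_coord:
  assumes "P \<in> chart_dom c \<infinity> n" "P' \<in> chart_dom c \<infinity> n" "body (fst (coord c P)) = body (fst (coord c P'))"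
  shows "same_body n P P'"
  using same_body_pt[of "coord c P" "coord c P'" n c] assms by (simp add: pt_coord coord_in)

lemma outside_Delta:
  assumes "P \<in> sphere \<infinity> n" "P \<notin> chart_dom True \<infinity> n"
  shows "P \<in> chart_dom False \<infinity> n" "body (fst (coord False P)) = 0"
proof -
  show P: "P \<in> chart_dom False \<infinity> n" using sphere_chart_cases[OF assms(1)] assms(2) by (metis (full_types))
  then have "pt False \<infinity> n (coord False P) = P" "coord False P \<in> superspace \<infinity>" using pt_coord coord_in by auto
  then show "body (fst (coord False P)) = 0"
    using assms(2) pt_in_chart_dom[of "coord False P" \<infinity> False n True] by auto
qed

lemma same_body_outside:
  assumes "P \<in> sphere \<infinity> n" "P \<notin> chart_dom True \<infinity> n" "P' \<in> sphere \<infinity> n" "P' \<notin> chart_dom True \<infinity> n"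
  shows "same_body n P P'"
  using outside_Delta[OF assms(1,2)] outside_Delta[OF assms(3,4)] by (intro same_body_coord) auto

lemma same_body_map:
  assumes T: "superconformal_map \<infinity> (sphere_atlas \<infinity> n) T" "\<And>P. P \<in> sphere \<infinity> n \<Longrightarrow> T P \<in> sphere \<infinity> n"
    and P: "P \<in> sphere \<infinity> n" "P' \<in> sphere \<infinity> n" "same_body n P P'"
  shows "same_body n (T P) (T P')"
proof -
  obtain c where c: "P \<in> chart_dom c \<infinity> n" using sphere_chart_cases[OF P(1)] by blast
  obtain d where d: "T P \<in> chart_dom d \<infinity> n" using sphere_chart_cases[OF T(2)[OF P(1)]] by blast
  have c': "P' \<in> chart_dom c \<infinity> n" "body (fst (coord c P)) = body (fst (coord c P'))"
    using P(3) c by (auto simp: same_body_def)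
  have q: "coord c P \<in> superspace \<infinity>" "pt c \<infinity> n (coord c P) = P" "coord c P' \<in> superspace \<infinity>" "pt c \<infinity> n (coord c P') = P'"
    using c c' pt_coord coord_in by auto
  let ?D = "{q \<in> superspace \<infinity>. T (pt c \<infinity> n q) \<in> chart_dom d \<infinity> n}"
  have in1: "coord c P \<in> ?D" using q d by simp
  then have "superconformal_on \<infinity> ?D (\<lambda>q. coord d (T (pt c \<infinity> n q)))"
    using T(1) unfolding superconformal_map_sphere_iff by blast
  then obtain U f where f: "?D = {q \<in> superspace \<infinity>. body (fst q) \<in> U}"
      "\<And>q. q \<in> ?D \<Longrightarrow> body (fst (coord d (T (pt c \<infinity> n q)))) = f (body (fst q))"
    by (rule superconformal_on_body) blast
  have "coord c P \<in> {q \<in> superspace \<infinity>. body (fst q) \<in> U}" using in1 f(1) by blast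
  then have "coord c P' \<in> {q \<in> superspace \<infinity>. body (fst q) \<in> U}" using q(3) c'(2) by simp
  then have in2: "coord c P' \<in> ?D" using f(1) by blast
  show ?thesis
    by (rule same_body_coord[of _ d]) (use d in2 f(2)[OF in1] f(2)[OF in2] q c'(2) in auto)
qed

definition jets :: "int \<Rightarrow> (sphere_point \<Rightarrow> sphere_point) \<Rightarrow> bool \<Rightarrow> bool \<Rightarrow> complex set \<Rightarrow>
    (complex \<Rightarrow> complex) \<Rightarrow> (complex \<Rightarrow> complex) \<Rightarrow> (complex \<Rightarrow> complex) \<Rightarrow> nat set \<Rightarrow> bool" where
  "jets n T c d U h A B S \<longleftrightarrow> open U \<and> finite S \<and> h holomorphic_on U \<and> A holomorphic_on U \<and> B holomorphic_on U \<and>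
    (\<forall>x\<in>U. deriv h x = A x * B x) \<and>
    (\<forall>q\<in>superspace \<infinity>. (T (pt c \<infinity> n q) \<in> chart_dom d \<infinity> n \<longleftrightarrow> body (fst q) \<in> U) \<and>
      (body (fst q) \<in> U \<longrightarrow> body (fst (coord d (T (pt c \<infinity> n q)))) = h (body (fst q)))) \<and>
    (\<forall>x\<in>U. \<forall>a b k l. k \<notin> S \<and> l \<notin> S \<and> k \<noteq> l \<longrightarrow>
      gcoeff (fst (snd (coord d (T (pt c \<infinity> n (gconst x, gconst a * gmono {k}, gconst b * gmono {l})))))) {k} = a * A x \<and>
      gcoeff (snd (snd (coord d (T (pt c \<infinity> n (gconst x, gconst a * gmono {k}, gconst b * gmono {l})))))) {l} = b * B x)"

lemma jetsD:
  assumes "jets n T c d U h A B S"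
  shows "open U" "finite S" "h holomorphic_on U" "A holomorphic_on U" "B holomorphic_on U"
    "\<And>x. x \<in> U \<Longrightarrow> deriv h x = A x * B x"
    "\<And>q. q \<in> superspace \<infinity> \<Longrightarrow> T (pt c \<infinity> n q) \<in> chart_dom d \<infinity> n \<longleftrightarrow> body (fst q) \<in> U"
    "\<And>q. q \<in> superspace \<infinity> \<Longrightarrow> body (fst q) \<in> U \<Longrightarrow> body (fst (coord d (T (pt c \<infinity> n q)))) = h (body (fst q))"
    "\<And>x a b k l. x \<in> U \<Longrightarrow> k \<notin> S \<Longrightarrow> l \<notin> S \<Longrightarrow> k \<noteq> l \<Longrightarrow>
      gcoeff (fst (snd (coord d (T (pt c \<infinity> n (gconst x, gconst a * gmono {k}, gconst b * gmono {l})))))) {k} = a * A x"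
    "\<And>x a b k l. x \<in> U \<Longrightarrow> k \<notin> S \<Longrightarrow> l \<notin> S \<Longrightarrow> k \<noteq> l \<Longrightarrow>
      gcoeff (snd (snd (coord d (T (pt c \<infinity> n (gconst x, gconst a * gmono {k}, gconst b * gmono {l})))))) {l} = b * B x"
  using assms unfolding jets_def by (elim conjE; simp)+

lemma jets_exist:
  assumes "superconformal_map \<infinity> (sphere_atlas \<infinity> n) T"
  shows "\<exists>U h A B S. jets n T c d U h A B S"
proof (cases "{q \<in> superspace \<infinity>. T (pt c \<infinity> n q) \<in> chart_dom d \<infinity> n} = {}")
  case True
  then have "jets n T c d {} (\<lambda>_. 0) (\<lambda>_. 0) (\<lambda>_. 0) {}" by (auto simp: jets_def)
  then show ?thesis by blast
next
  case False
  let ?D = "{q \<in> superspace \<infinity>. T (pt c \<infinity> n q) \<in> chart_dom d \<infinity> n}"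
  have "superconformal_on \<infinity> ?D (\<lambda>q. coord d (T (pt c \<infinity> n q)))"
    using assms False unfolding superconformal_map_sphere_iff by blast
  then obtain U h A B S where J: "open U" "?D = {q \<in> superspace \<infinity>. body (fst q) \<in> U}" "finite S"
    "h holomorphic_on U" "A holomorphic_on U" "B holomorphic_on U" "\<And>x. x \<in> U \<Longrightarrow> deriv h x = A x * B x"
    "\<And>q. q \<in> ?D \<Longrightarrow> coord d (T (pt c \<infinity> n q)) \<in> superspace \<infinity> \<and> body (fst (coord d (T (pt c \<infinity> n q)))) = h (body (fst q))"
    "\<And>x a b k l. x \<in> U \<Longrightarrow> k \<notin> S \<Longrightarrow> l \<notin> S \<Longrightarrow> k \<noteq> l \<Longrightarrow>
      gcoeff (fst (snd (coord d (T (pt c \<infinity> n (gconst x, gconst a * gmono {k}, gconst b * gmono {l})))))) {k} = a * A x \<and>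
      gcoeff (snd (snd (coord d (T (pt c \<infinity> n (gconst x, gconst a * gmono {k}, gconst b * gmono {l})))))) {l} = b * B x"
    by (rule superconformal_on_jet) blast
  have "T (pt c \<infinity> n q) \<in> chart_dom d \<infinity> n \<longleftrightarrow> body (fst q) \<in> U" if "q \<in> superspace \<infinity>" for q
    using J(2) that by blast
  then have "jets n T c d U h A B S" unfolding jets_def using J(1,3-9) by auto
  then show ?thesis by blast
qed

lemma sphere_autsE:
  assumes "T \<in> sphere_auts M n"
  obtains T' where "superconformal_map M (sphere_atlas M n) T" "superconformal_map M (sphere_atlas M n) T'"
    "\<And>P. P \<in> sphere M n \<Longrightarrow> T P \<in> sphere M n" "\<And>P. P \<in> sphere M n \<Longrightarrow> T' P \<in> sphere M n"
    "\<And>P. P \<in> sphere M n \<Longrightarrow> T' (T P) = P" "\<And>P. P \<in> sphere M n \<Longrightarrow> T (T' P) = P"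
  using assms unfolding sphere_auts_def superconformal_auts_def homeomorphic_maps_def
  by (auto simp: continuous_map_def Pi_iff)

lemma jets_target:
  assumes "coord True P \<in> superspace \<infinity>" "P \<in> chart_dom True \<infinity> n" "P \<in> chart_dom False \<infinity> n"
  shows "body (fst (coord False P)) = inverse (body (fst (coord True P)))" "body (fst (coord True P)) \<noteq> 0"
    "gcoeff (fst (snd (coord False P))) {k} = chart_unit True * (gcoeff (fst (snd (coord True P))) {k} * body (fst (coord True P)) powi (n - 1))"
proof -
  obtain z p m where q: "coord True P = (z, p, m)" by (cases "coord True P")
  note o = coord_other[of P True \<infinity> n, simplified, OF assms(2,3)]
  show "body (fst (coord True P)) \<noteq> 0" by (rule o)
  then show "body (fst (coord False P)) = inverse (body (fst (coord True P)))"
    "gcoeff (fst (snd (coord False P))) {k} = chart_unit True * (gcoeff (fst (snd (coord True P))) {k} * body (fst (coord True P)) powi (n - 1))"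
    using o assms(1) unfolding o(1) q by (simp_all add: gcoeff_mult_singleton superspace_iff)
qed

lemma jets_source:
  assumes "w \<noteq> 0"
  shows "pt False \<infinity> n (gconst w, gconst 1 * gmono {k}, gconst 1 * gmono {l}) =
    pt True \<infinity> n (gconst (inverse w), gconst (chart_unit False * w powi (n - 1)) * gmono {k},
      gconst (chart_unit False * w powi (- n - 1)) * gmono {l})"
proof -
  have "(gconst w, gconst 1 * gmono {k}, gconst 1 * gmono {l}) \<in> superspace \<infinity>" by (simp add: superspace_iff)
  from pt_change_chart[OF this, of False n] assms show ?thesis
    by (simp add: powi_gconst inverse_gconst gconst_commute[of "gmono _"] gconst_mult mult.assoc)
qed

text \<open>The automorphism and its inverse both respect bodies.\<close>

lemma jets_injective:
  assumes J: "jets n T c d U h A B S"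
    and T': "superconformal_map \<infinity> (sphere_atlas \<infinity> n) T'" "\<And>P. P \<in> sphere \<infinity> n \<Longrightarrow> T' P \<in> sphere \<infinity> n"
      "\<And>P. P \<in> sphere \<infinity> n \<Longrightarrow> T P \<in> sphere \<infinity> n" "\<And>P. P \<in> sphere \<infinity> n \<Longrightarrow> T' (T P) = P"
  shows "inj_on h U"
proof (rule inj_onI)
  fix x y assume xy: "x \<in> U" "y \<in> U" "h x = h y"
  have q: "(gconst x, 0, 0) \<in> superspace \<infinity>" "(gconst y, 0, 0) \<in> superspace \<infinity>" by (auto simp: superspace_iff)
  let ?P = "pt c \<infinity> n (gconst x, 0, 0)" and ?Q = "pt c \<infinity> n (gconst y, 0, 0)"
  have "same_body n (T ?P) (T ?Q)"
    using jetsD(7,8)[OF J] xy q by (intro same_body_coord[of _ d]) auto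
  from same_body_map[OF T'(1,2) _ _ this] have "same_body n ?P ?Q" using T'(3,4) q by simp
  then show "x = y" using q by (auto simp: same_body_def pt_in_chart_dom coord_pt dest: spec[of _ c])
qed

lemma body_pt_zero [simp]: "(gconst x, 0, 0) \<in> superspace M"
  by (simp add: superspace_iff)

text \<open>The two classical invariants of an automorphism of the sphere with multipliers: the cross-ratio
  identity of Moebius transformations in its two-point form, and the constancy of
  \<open>A\<^bsup>n+1\<^esup> B\<^bsup>n-1\<^esup>\<close>, written with \<open>A B = h'\<close>.\<close>

lemma automorphism_jet_identities:
  assumes "T \<in> sphere_auts \<infinity> n"
  obtains U h A B S where "jets n T True True U h A B S"
    "\<And>x y. x \<in> U \<Longrightarrow> y \<in> U \<Longrightarrow> (x - y) ^ 2 * (A x * B x) * (A y * B y) = (h x - h y) ^ 2"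
    "\<And>x y. x \<in> U \<Longrightarrow> y \<in> U \<Longrightarrow> A x ^ 2 * (A x * B x) powi (n - 1) = A y ^ 2 * (A y * B y) powi (n - 1)"
proof -
  obtain T' where T': "superconformal_map \<infinity> (sphere_atlas \<infinity> n) T" "superconformal_map \<infinity> (sphere_atlas \<infinity> n) T'"
    "\<And>P. P \<in> sphere \<infinity> n \<Longrightarrow> T P \<in> sphere \<infinity> n" "\<And>P. P \<in> sphere \<infinity> n \<Longrightarrow> T' P \<in> sphere \<infinity> n"
    "\<And>P. P \<in> sphere \<infinity> n \<Longrightarrow> T' (T P) = P" "\<And>P. P \<in> sphere \<infinity> n \<Longrightarrow> T (T' P) = P"
    by (rule sphere_autsE[OF assms]) blast
  obtain U h A B S where J: "jets n T True True U h A B S" using jets_exist[OF T'(1)] by metis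
  obtain V g Ag Bg Sg where JV: "jets n T True False V g Ag Bg Sg" using jets_exist[OF T'(1)] by metis
  obtain W f Af Bf Sf where JW: "jets n T False True W f Af Bf Sf" using jets_exist[OF T'(1)] by metis
  obtain X e Ae Be Se where JX: "jets n T False False X e Ae Be Se" using jets_exist[OF T'(1)] by metis
  have Ud: "T (pt True \<infinity> n q) \<in> chart_dom True \<infinity> n \<longleftrightarrow> body (fst q) \<in> U"
      "body (fst q) \<in> U \<Longrightarrow> body (fst (coord True (T (pt True \<infinity> n q)))) = h (body (fst q))"
    and Vd: "T (pt True \<infinity> n q) \<in> chart_dom False \<infinity> n \<longleftrightarrow> body (fst q) \<in> V"
      "body (fst q) \<in> V \<Longrightarrow> body (fst (coord False (T (pt True \<infinity> n q)))) = g (body (fst q))"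
    and Wd: "T (pt False \<infinity> n q) \<in> chart_dom True \<infinity> n \<longleftrightarrow> body (fst q) \<in> W"
      "body (fst q) \<in> W \<Longrightarrow> body (fst (coord True (T (pt False \<infinity> n q)))) = f (body (fst q))"
    and Xd: "T (pt False \<infinity> n q) \<in> chart_dom False \<infinity> n \<longleftrightarrow> body (fst q) \<in> X"
      "body (fst q) \<in> X \<Longrightarrow> body (fst (coord False (T (pt False \<infinity> n q)))) = e (body (fst q))"
    if "q \<in> superspace \<infinity>" for q
    by (fact jetsD(7)[OF J that], rule jetsD(8)[OF J that], assumption, fact jetsD(7)[OF JV that],
      rule jetsD(8)[OF JV that], assumption, fact jetsD(7)[OF JW that], rule jetsD(8)[OF JW that], assumption,
      fact jetsD(7)[OF JX that], rule jetsD(8)[OF JX that], assumption)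
  note hol = jetsD(1,3,4)[OF J] jetsD(1,3,4)[OF JV] jetsD(1,3,4)[OF JW] jetsD(1,3,4)[OF JX]
  note dh = jetsD(6)[OF J]
  note fin = jetsD(2)[OF J] jetsD(2)[OF JV] jetsD(2)[OF JW] jetsD(2)[OF JX]
  have finS: "finite (S \<union> Sg \<union> Sf \<union> Se)" using fin by simp
  obtain k where k: "k \<notin> S \<union> Sg \<union> Sf \<union> Se" using ex_new_if_finite[OF infinite_UNIV_nat finS] by blast
  obtain l where l: "l \<notin> insert k (S \<union> Sg \<union> Sf \<union> Se)" 
    using ex_new_if_finite[OF infinite_UNIV_nat finite.insertI[OF finS]] by blast
  let ?q = "\<lambda>x a b. (gconst x, gconst a * gmono {k}, gconst b * gmono {l})"
  have q: "?q x a b \<in> superspace \<infinity>" for x a b by (simp add: superspace_iff)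
  have cU: "gcoeff (fst (snd (coord True (T (pt True \<infinity> n (?q x a b)))))) {k} = a * A x" if "x \<in> U" for x a b
    by (rule jetsD(9)[OF J that]) (use k l in auto)
  have cV: "gcoeff (fst (snd (coord False (T (pt True \<infinity> n (?q x a b)))))) {k} = a * Ag x" if "x \<in> V" for x a b
    by (rule jetsD(9)[OF JV that]) (use k l in auto)
  have cW: "gcoeff (fst (snd (coord True (T (pt False \<infinity> n (?q x a b)))))) {k} = a * Af x" if "x \<in> W" for x a b
    by (rule jetsD(9)[OF JW that]) (use k l in auto)
  have cX: "gcoeff (fst (snd (coord False (T (pt False \<infinity> n (?q x a b)))))) {k} = a * Ae x" if "x \<in> X" for x a b
    by (rule jetsD(9)[OF JX that]) (use k l in auto)
  define I where "I = pt False \<infinity> n (gconst 0, 0, 0)"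
  define Y where "Y x = pt True \<infinity> n (gconst x, 0, 0)" for x
  have I: "I \<in> sphere \<infinity> n" "I \<notin> chart_dom True \<infinity> n" "I \<in> chart_dom False \<infinity> n" "body (fst (coord False I)) = 0"
    using body_pt_zero[of 0 \<infinity>] by (simp_all add: I_def pt_in_chart_dom coord_pt del: gconst_0)
  have Y: "Y x \<in> sphere \<infinity> n" "Y x \<in> chart_dom True \<infinity> n" "body (fst (coord True (Y x))) = x" for x
    by (simp_all add: Y_def pt_in_chart_dom coord_pt)
  have pull_back: "same_body n P P'"
    if "same_body n (T P) (T P')" "P \<in> sphere \<infinity> n" "P' \<in> sphere \<infinity> n" for P P'
    using same_body_map[OF T'(2,4) _ _ that(1)] T'(3,5) that by simp
  have YI: "\<not> same_body n (Y x) I" for x using I Y by (auto simp: same_body_def)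
  have Uiff: "x \<in> U \<longleftrightarrow> T (Y x) \<in> chart_dom True \<infinity> n" for x using Ud(1)[of "(gconst x, 0, 0)"] by (simp add: Y_def)
  have inj: "inj_on e X" "inj_on f W"
    using jets_injective[OF JX T'(2,4,3,5)] jets_injective[OF JW T'(2,4,3,5)] by blast+
  show ?thesis
  proof (cases "T I \<in> chart_dom True \<infinity> n")
    case False
    note TI = outside_Delta[OF T'(3)[OF I(1)] False]
    have U: "U = UNIV"
    proof (rule ccontr)
      assume "U \<noteq> UNIV"
      then obtain x where "T (Y x) \<notin> chart_dom True \<infinity> n" using Uiff by blast
      then have "same_body n (T (Y x)) (T I)" using T'(3) I Y False by (intro same_body_outside) auto
      then show False using pull_back YI I Y by blast
    qed
    have X0: "0 \<in> X" "e 0 = 0" using Xd[of "(gconst 0, 0, 0)"] TI by (simp_all add: I_def del: gconst_0)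
    have "deriv e 0 \<noteq> 0" by (rule holomorphic_injective_imp_regular[OF hol(11,10) inj(1) X0(1)])
    moreover have "e w \<noteq> 0 \<and> h (inverse w) = inverse (e w) \<and> Ae w = A (inverse w) * (w * h (inverse w)) powi (n - 1)"
      if w: "w \<in> X" "w \<noteq> 0" for w
    proof -
      let ?P = "T (pt False \<infinity> n (?q w 1 1))"
      let ?r = "?q (inverse w) (chart_unit False * w powi (n - 1)) (chart_unit False * w powi (- n - 1))"
      have P: "?P = T (pt True \<infinity> n ?r)" using jets_source[OF w(2)] by simp
      have P1: "?P \<in> chart_dom False \<infinity> n" using Xd(1)[OF q[of w 1 1]] w by simp
      have P2: "?P \<in> chart_dom True \<infinity> n" unfolding P using Ud(1)[OF q[of "inverse w" "chart_unit False * w powi (n - 1)" "chart_unit False * w powi (- n - 1)"]] U by simp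
      note t = jets_target[OF coord_in[OF P2] P2 P1]
      have b: "body (fst (coord True ?P)) = h (inverse w)" "body (fst (coord False ?P)) = e w"
        using Ud(2)[OF q[of "inverse w" "chart_unit False * w powi (n - 1)" "chart_unit False * w powi (- n - 1)"]] U
          Xd(2)[OF q[of w 1 1]] w unfolding P[symmetric] by simp_all
      have "Ae w = chart_unit True * (chart_unit False * w powi (n - 1) * A (inverse w) * h (inverse w) powi (n - 1))"
        using t(3)[of k] cX[OF w(1), of 1 1] b cU[of "inverse w" "chart_unit False * w powi (n - 1)" "chart_unit False * w powi (- n - 1)"] U
        unfolding P[symmetric] by simp
      then have "Ae w = A (inverse w) * (w * h (inverse w)) powi (n - 1)"
        using chart_unit_props(3)[of True] by (simp add: power_int_mult_distrib)
      then show ?thesis using t(1,2) unfolding b by simp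
    qed
    ultimately obtain \<alpha> \<beta> C where res: "\<alpha> \<noteq> 0" "\<And>x. h x = \<alpha> * x + \<beta>" "\<And>x. A x = C"
      using automorphism_fixing_infinity[OF hol(2)[unfolded U] hol(3)[unfolded U] hol(10) X0(1) hol(11,12) X0(2)] by metis
    have "deriv h x = \<alpha>" for x
    proof -
      have "h = (\<lambda>x. \<alpha> * x + \<beta>)" using res(2) by auto
      then show ?thesis by (auto intro!: DERIV_imp_deriv derivative_eq_intros)
    qed
    then have AB: "A x * B x = \<alpha>" for x using dh[of x] U by simp
    show ?thesis
      by (rule that[OF J]) (simp_all add: AB res(2), simp_all add: res(3) power2_eq_square algebra_simps)
  next
    case True
    define P0 where "P0 = T' I"
    have P0: "P0 \<in> sphere \<infinity> n" "T P0 = I" using T'(4,6) I(1) by (auto simp: P0_def)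
    have P0D: "P0 \<in> chart_dom True \<infinity> n"
    proof (rule ccontr)
      assume "P0 \<notin> chart_dom True \<infinity> n"
      then have "same_body n P0 I" using P0 I by (intro same_body_outside) auto
      from same_body_map[OF T'(1,3) P0(1) I(1) this] show False
        using True I P0(2) by (auto simp: same_body_def)
    qed
    define p where "p = body (fst (coord True P0))"
    define r where "r = body (fst (coord True (T I)))"
    have Yp: "same_body n (Y p) P0" by (rule same_body_coord[OF Y(2) P0D]) (simp add: Y p_def)
    have TYp: "same_body n (T (Y p)) I" using same_body_map[OF T'(1,3) Y(1) P0(1) Yp] P0(2) by simp
    have U: "U = - {p}"
    proof (intro equalityI subsetI)
      fix x assume "x \<in> U"
      then show "x \<in> - {p}" using Uiff[of x] TYp I by (auto simp: same_body_def)
    next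
      fix x assume x: "x \<in> - {p}"
      show "x \<in> U"
      proof (rule ccontr)
        assume "x \<notin> U"
        then have "same_body n (T (Y x)) (T P0)" using Uiff[of x] I P0 T'(3)[OF Y(1)] by (intro same_body_outside) auto
        then have "same_body n (Y x) P0" using pull_back Y P0 by blast
        then show False using x Y[of x] P0D by (auto simp: same_body_def p_def)
      qed
    qed
    have hr: "h x \<noteq> r" if "x \<noteq> p" for x
    proof
      assume "h x = r"
      moreover have "x \<in> U" using that U by simp
      ultimately have "body (fst (coord True (T (Y x)))) = r" "T (Y x) \<in> chart_dom True \<infinity> n"
        using Ud[of "(gconst x, 0, 0)"] by (simp_all add: Y_def)
      then have "same_body n (T (Y x)) (T I)" using True by (intro same_body_coord[of _ True]) (auto simp: r_def)
      then show False using pull_back YI I Y by blast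
    qed
    have TYpF: "T (Y p) \<in> chart_dom False \<infinity> n" "body (fst (coord False (T (Y p)))) = 0"
      using TYp I by (auto simp: same_body_def)
    have V0: "p \<in> V" "g p = 0" using Vd[of "(gconst p, 0, 0)"] TYpF by (simp_all add: Y_def)
    have W0: "0 \<in> W" "f 0 = r" using Wd[of "(gconst 0, 0, 0)"] True by (simp_all add: I_def r_def del: gconst_0)
    have df: "deriv f 0 \<noteq> 0" by (rule holomorphic_injective_imp_regular[OF hol(8,7) inj(2) W0(1)])
    have gV: "g x \<noteq> 0 \<and> h x = inverse (g x) \<and> Ag x = chart_unit True * (A x * h x powi (n - 1))"
      if x: "x \<in> V" "x \<noteq> p" for x
    proof -
      let ?P = "T (pt True \<infinity> n (?q x 1 1))"
      have xU: "x \<in> U" using x U by simp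
      have P: "?P \<in> chart_dom False \<infinity> n" "?P \<in> chart_dom True \<infinity> n"
        using Vd(1)[OF q[of x 1 1]] Ud(1)[OF q[of x 1 1]] x xU by simp_all
      note t = jets_target[OF coord_in[OF P(2)] P(2,1)]
      have b: "body (fst (coord True ?P)) = h x" "body (fst (coord False ?P)) = g x"
        using Ud(2)[OF q[of x 1 1]] xU Vd(2)[OF q[of x 1 1]] x by simp_all
      show ?thesis using t(1,2) t(3)[of k] cV[OF x(1), of 1 1] cU[OF xU, of 1 1] unfolding b by simp
    qed
    have gW: "h (inverse w) = f w \<and> Af w = chart_unit False * w powi (n - 1) * A (inverse w)"
      if w: "w \<in> W" "w \<noteq> 0" "inverse w \<noteq> p" for w
    proof -
      let ?r = "?q (inverse w) (chart_unit False * w powi (n - 1)) (chart_unit False * w powi (- n - 1))"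
      have P: "T (pt False \<infinity> n (?q w 1 1)) = T (pt True \<infinity> n ?r)" using jets_source[OF w(2)] by simp
      have wU: "inverse w \<in> U" using w U by simp
      show ?thesis
        using Wd(2)[OF q[of w 1 1]] Ud(2)[OF q[of "inverse w" "chart_unit False * w powi (n - 1)" "chart_unit False * w powi (- n - 1)"]] cW[OF w(1), of 1 1]
          cU[OF wU, of "chart_unit False * w powi (n - 1)" "chart_unit False * w powi (- n - 1)"] w wU
        unfolding P by simp
    qed
    obtain \<kappa> C where res: "\<kappa> \<noteq> 0" "\<And>x. x \<noteq> p \<Longrightarrow> h x = r + \<kappa> / (x - p)"
      "\<And>x. x \<noteq> p \<Longrightarrow> A x = C * (x - p) powi (n - 1)"
      by (rule automorphism_moving_infinity[OF hol(2)[unfolded U] hol(3)[unfolded U] hr hol(4) V0(1) hol(5,6) V0(2) gV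
          hol(7) W0(1) hol(8,9) W0(2) df gW chart_unit_props(1) chart_unit_props(1)]) (assumption | (rule that; simp))+
    have AB: "A x * B x = - \<kappa> / (x - p) ^ 2" if "x \<noteq> p" for x
    proof -
      have "deriv h x = deriv (\<lambda>x. r + \<kappa> / (x - p)) x"
        using that res(2) by (intro deriv_cong_ev eventually_mono[OF eventually_nhds_in_open[of "- {p}"]]) auto
      also have "\<dots> = - \<kappa> / (x - p) ^ 2"
        using that by (auto intro!: DERIV_imp_deriv derivative_eq_intros simp: power2_eq_square)
      finally show ?thesis using dh[of x] that U by simp
    qed
    show ?thesis
    proof (rule that[OF J])
      fix x y assume "x \<in> U" "y \<in> U"
      then have xy: "x \<noteq> p" "y \<noteq> p" using U by auto
      have "h x - h y = \<kappa> * (y - x) / ((x - p) * (y - p))" using xy by (simp add: res(2) field_simps)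
      then have "(h x - h y) ^ 2 = \<kappa> ^ 2 * (y - x) ^ 2 / ((x - p) ^ 2 * (y - p) ^ 2)"
        by (simp add: power_mult_distrib power_divide)
      then show "(x - y) ^ 2 * (A x * B x) * (A y * B y) = (h x - h y) ^ 2"
        unfolding AB[OF xy(1)] AB[OF xy(2)] by (simp add: power2_commute[of x y] power2_eq_square[of \<kappa>])
      have c: "A x ^ 2 * (A x * B x) powi (n - 1) = C ^ 2 * (- \<kappa>) powi (n - 1)" if "x \<noteq> p" for x
      proof -
        have "((x - p) powi (n - 1)) ^ 2 = ((x - p) ^ 2) powi (n - 1)"
          by (simp add: power2_eq_square power_int_mult_distrib)
        moreover have "((x - p) ^ 2) powi (n - 1) * (- \<kappa> / (x - p) ^ 2) powi (n - 1) = (- \<kappa>) powi (n - 1)"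
          unfolding power_int_mult_distrib[symmetric] using that by simp
        ultimately show ?thesis
          unfolding AB[OF that] unfolding res(3)[OF that] power_mult_distrib mult.assoc by simp
      qed
      show "A x ^ 2 * (A x * B x) powi (n - 1) = A y ^ 2 * (A y * B y) powi (n - 1)"
        using c[OF xy(1)] c[OF xy(2)] by simp
    qed
  qed
qed

section \<open>Infinitesimal superconformal transformations\<close>

lemmas superfun_defs = times_superfun_def plus_superfun_def minus_superfun_def uminus_superfun_def
  zero_superfun_def one_superfun_def

lemma dx_SF [simp]: "dx (SF a b c d) = SF (pderivative a) (pderivative b) (pderivative c) (pderivative d)"
  by (simp add: dx_def)

lemma pfun_double_eq_0: "a + a = (0::pfun) \<Longrightarrow> a = 0"
proof (rule papp_eqI)
  fix x assume a: "a + a = 0"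
  have "papp a x + papp a x = papp (a + a) x" by (simp only: papp_simps)
  then show "papp a x = papp 0 x" by (simp add: a)
qed

text \<open>Twice the coefficient \<open>g\<close> is the difference of the two conditions, which is why it has to vanish.\<close>

lemma even_infinitesimal_superconformal_iff:
  "infinitesimal_superconformal (SF f 0 0 g, SF 0 b b' 0, SF 0 c' c 0) \<longleftrightarrow>
    g = 0 \<and> b' = 0 \<and> c' = 0 \<and> b + c = pderivative f"
proof -
  let ?X = "(SF f 0 0 g, SF 0 b b' 0, SF 0 c' c 0)"
  have p: "sder_bracket ?X sder_Dp = (SF 0 c' (c - (g + pderivative f)) 0, SF (- b) 0 0 (pderivative b), SF (- c') 0 0 (pderivative c'))"
    and m: "sder_bracket ?X sder_Dm = (SF 0 (b - (pderivative f - g)) b' 0, SF (- b') 0 0 (- pderivative b'), SF (- c) 0 0 (- pderivative c))"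
    by (simp_all add: sder_bracket_def sder_bracket_app_def sder_Dp_def sder_Dm_def superfun_defs sf_even_def sf_odd_def
        phip_def phim_def xmonom_def dtp_def dtm_def pderivative_pmonom)
  show ?thesis
  proof
    assume "infinitesimal_superconformal ?X"
    then obtain F G where F: "sder_bracket ?X sder_Dp = sder_lmult F sder_Dp" and G: "sder_bracket ?X sder_Dm = sder_lmult G sder_Dm"
      by (auto simp: infinitesimal_superconformal_def)
    obtain F0 F1 F2 F3 G0 G1 G2 G3 where FG: "F = SF F0 F1 F2 F3" "G = SF G0 G1 G2 G3" by (cases F; cases G) auto
    have 1: "c' = 0" "c - (g + pderivative f) = - b" "b' = 0" "b - (pderivative f - g) = - c"
      using F G unfolding p m FG by (simp_all add: sder_Dp_def sder_Dm_def phip_def phim_def superfun_defs)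
    have "g + g = (b - (pderivative f - g) + c) - (c - (g + pderivative f) + b)" by (simp add: algebra_simps)
    then have "g + g = 0" unfolding 1(2,4) by simp
    then have g: "g = 0" by (rule pfun_double_eq_0)
    have "b + c - pderivative f = b - (pderivative f - g) + c - g" by (simp add: algebra_simps)
    then have "b + c = pderivative f" unfolding 1(4) unfolding g by simp
    then show "g = 0 \<and> b' = 0 \<and> c' = 0 \<and> b + c = pderivative f" using 1 g by simp
  next
    assume a: "g = 0 \<and> b' = 0 \<and> c' = 0 \<and> b + c = pderivative f"
    have "sder_bracket ?X sder_Dp = sder_lmult (SF (- b) 0 0 (pderivative b)) sder_Dp"
      "sder_bracket ?X sder_Dm = sder_lmult (SF (- c) 0 0 (- pderivative c)) sder_Dm"
      unfolding p m using a by (auto simp: sder_Dp_def sder_Dm_def phip_def phim_def superfun_defs algebra_simps)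
    then show "infinitesimal_superconformal ?X" unfolding infinitesimal_superconformal_def by blast
  qed
qed

text \<open>The components along \<open>\<partial>/\<partial>\<phi>\<^sup>\<plusminus>\<close> of a bracket with \<open>D\<^sup>\<plusminus>\<close> have to be proportional to those of
  \<open>D\<^sup>\<plusminus>\<close>, which leaves only the \<open>\<partial>/\<partial>x\<close> component free.\<close>

lemma odd_infinitesimal_superconformal_iff:
  "infinitesimal_superconformal (SF 0 w u 0, SF b 0 0 b', SF c 0 0 c') \<longleftrightarrow>
    (SF 0 w u 0, SF b 0 0 b', SF c 0 0 c') = odd_sder u w"
proof -
  let ?X = "(SF 0 w u 0, SF b 0 0 b', SF c 0 0 c')"
  have p: "sder_bracket ?X sder_Dp = (SF (c + w) 0 0 (c' - pderivative w), SF 0 0 (b' + pderivative b) 0, SF 0 0 (c' + pderivative c) 0)"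
    and m: "sder_bracket ?X sder_Dm = (SF (b + u) 0 0 (b' + pderivative u), SF 0 (pderivative b - b') 0 0, SF 0 (pderivative c - c') 0 0)"
    by (simp_all add: sder_bracket_def sder_bracket_app_def sder_Dp_def sder_Dm_def superfun_defs sf_even_def sf_odd_def
        phip_def phim_def xmonom_def dtp_def dtm_def pderivative_pmonom)
  show ?thesis
  proof
    assume "infinitesimal_superconformal ?X"
    then obtain F G where F: "sder_bracket ?X sder_Dp = sder_lmult F sder_Dp" and G: "sder_bracket ?X sder_Dm = sder_lmult G sder_Dm"
      by (auto simp: infinitesimal_superconformal_def)
    obtain F0 F1 F2 F3 G0 G1 G2 G3 where FG: "F = SF F0 F1 F2 F3" "G = SF G0 G1 G2 G3" by (cases F; cases G) auto
    have 1: "F1 = 0" "G2 = 0" "c + w = 0" "c' - pderivative w = F1" "b + u = 0" "b' + pderivative u = - G2"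
      using F G unfolding p m FG by (simp_all add: sder_Dp_def sder_Dm_def phip_def phim_def superfun_defs)
    have "c = - w" "b = - u" "b' = - pderivative u" "c' = pderivative w"
      using 1 by (simp_all only: eq_neg_iff_add_eq_0 eq_iff_diff_eq_0[of c'] minus_zero)
    then show "?X = odd_sder u w" by (simp add: odd_sder_def)
  next
    assume "?X = odd_sder u w"
    then have a: "b = - u" "b' = - pderivative u" "c = - w" "c' = pderivative w" by (auto simp: odd_sder_def)
    have "sder_bracket ?X sder_Dp = sder_lmult (SF 0 0 (b' + pderivative b) 0) sder_Dp"
      "sder_bracket ?X sder_Dm = sder_lmult (SF 0 (pderivative c - c') 0 0) sder_Dm"
      unfolding p m using a by (auto simp: sder_Dp_def sder_Dm_def phip_def phim_def superfun_defs pderivative_uminus)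
    then show "infinitesimal_superconformal ?X" unfolding infinitesimal_superconformal_def by blast
  qed
qed

section \<open>The even infinitesimal automorphisms\<close>

text \<open>The function is given only by the sums of the series near 0; a value \<open>H 0\<close> and a derivative are
  all that is extracted from a local flow.\<close>

lemma power_series_DERIV_0:
  fixes a :: "nat \<Rightarrow> complex"
  assumes "\<epsilon> > 0" "\<And>t. norm t < \<epsilon> \<Longrightarrow> (\<lambda>k. a k * t ^ k) sums H t"
  shows "H 0 = a 0" "(H has_field_derivative a 1) (at 0)"
proof -
  show "H 0 = a 0" using sums_unique2[OF assms(2)[of 0] powser_sums_zero[of a]] assms(1) by simp
  have "summable (\<lambda>k. a k * of_real (\<epsilon> / 2) ^ k)" using assms by (intro sums_summable[OF assms(2)]) auto
  then have "((\<lambda>x. suminf (\<lambda>k. a k * x ^ k)) has_field_derivative suminf (\<lambda>k. diffs a k * 0 ^ k)) (at 0)"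
    by (rule termdiffs_strong) (use assms in auto)
  moreover have "suminf (\<lambda>k. diffs a k * 0 ^ k) = a 1"
    using sums_unique[OF powser_sums_zero[of "diffs a"]] by (simp add: diffs_def)
  ultimately have d: "((\<lambda>x. suminf (\<lambda>k. a k * x ^ k)) has_field_derivative a 1) (at 0)" by simp
  show "(H has_field_derivative a 1) (at 0)"
    by (rule has_field_derivative_transform_within_open[OF d, of "ball 0 \<epsilon>"])
      (use assms in \<open>auto dest: assms(2) sums_unique[symmetric]\<close>)
qed

text \<open>With odd coordinates proportional to different generators, the components of a superfunction can be
  read off separately.\<close>

lemma psf_eval_coefficients:
  assumes "x \<noteq> 0" "k \<noteq> l"
  defines "q \<equiv> (gconst x, gconst 1 * gmono {k}, gconst 1 * gmono {l})"
  shows "body (psf_eval F q) = papp (sf0 F) x" "gcoeff (psf_eval F q) {k} = papp (sfp F) x"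
    "gcoeff (psf_eval F q) {l} = papp (sfm F) x"
  using assms(2) by (simp_all add: q_def psf_eval_eq gcoeff_mult_singleton gcoeff_gconst)

text \<open>The two identities for the lowest-order parts of the automorphisms \<open>T t\<close> are differentiated at
  \<open>t = 0\<close>, where \<open>h x = x\<close>, \<open>A = B = 1\<close>; the derivatives in \<open>t\<close> are \<open>- f\<close>, \<open>- b\<close>, \<open>- c\<close>. For each fixed
  argument the exponential series is a power series in \<open>t\<close>, which gives these derivatives.\<close>

lemma even_flow_identities:
  assumes "X = (SF f 0 0 0, SF 0 b 0 0, SF 0 0 c 0)" "X \<in> lie_aut_even N n" "x \<noteq> 0" "y \<noteq> 0"
  shows "(x - y) * (papp b x + papp c x + papp b y + papp c y) = 2 * (papp f x - papp f y)"
    "2 * papp b x + (of_int n - 1) * (papp b x + papp c x) = 2 * papp b y + (of_int n - 1) * (papp b y + papp c y)"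
proof -
  obtain T W where T: "\<And>t. t \<in> galg_even \<infinity> \<Longrightarrow> T t \<in> sphere_auts \<infinity> n" and W: "open W" "{0} \<times> (- {0}) \<subseteq> W"
    and flow: "\<And>t q. t \<in> galg_even \<infinity> \<Longrightarrow> q \<in> superspace \<infinity> \<Longrightarrow> body (fst q) \<noteq> 0 \<Longrightarrow> (body t, body (fst q)) \<in> W \<Longrightarrow>
        \<exists>q'. even_flow X t q q' \<and> in_Delta_coordinates \<infinity> n (T t) q q'"
  proof -
    have "N \<le> \<infinity>" by simp
    then have "\<exists>T W. (\<forall>y\<in>galg_even (\<infinity> - 2). T y \<in> sphere_auts \<infinity> n) \<and> open W \<and> {0} \<times> (- {0}) \<subseteq> W \<and>
        (\<forall>y\<in>galg_even (\<infinity> - 2). \<forall>q\<in>superspace \<infinity>. body (fst q) \<noteq> 0 \<and> (body y, body (fst q)) \<in> W \<longrightarrow>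
           (\<exists>q'. even_flow X y q q' \<and> in_Delta_coordinates \<infinity> n (T y) q q'))"
      using assms(2)[unfolded lie_aut_even_def mem_Collect_eq, THEN conjunct2, THEN conjunct2, rule_format, of \<infinity>] by (simp only:)
    then obtain T W where *: "\<forall>y\<in>galg_even \<infinity>. T y \<in> sphere_auts \<infinity> n" "open W" "{0} \<times> (- {0}) \<subseteq> W"
        "\<forall>y\<in>galg_even \<infinity>. \<forall>q\<in>superspace \<infinity>. body (fst q) \<noteq> 0 \<and> (body y, body (fst q)) \<in> W \<longrightarrow>
           (\<exists>q'. even_flow X y q q' \<and> in_Delta_coordinates \<infinity> n (T y) q q')"
      unfolding idiff_infinity by (elim exE conjE) (rule that)
    show ?thesis
    proof (rule that[of T W])
      show "T t \<in> sphere_auts \<infinity> n" if "t \<in> galg_even \<infinity>" for t by (rule bspec[OF *(1) that])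
      show "open W" "{0} \<times> (- {0}) \<subseteq> W" by (rule *)+
      show "\<exists>q'. even_flow X t q q' \<and> in_Delta_coordinates \<infinity> n (T t) q q'"
        if "t \<in> galg_even \<infinity>" "q \<in> superspace \<infinity>" "body (fst q) \<noteq> 0" "(body t, body (fst q)) \<in> W" for t q
        by (rule *(4)[rule_format, OF that(1,2) conjI[OF that(3,4)]])
    qed
  qed
  have "\<exists>\<epsilon>>0. \<forall>t. norm t < \<epsilon> \<longrightarrow> (t, z) \<in> W" if "z \<noteq> 0" for z
  proof -
    have "(0, z) \<in> W" using W(2) that by auto
    then obtain e where e: "e > 0" "ball (0, z) e \<subseteq> W" using W(1) openE by metis
    have "(t, z) \<in> W" if "norm t < e" for t
      using subsetD[OF e(2), of "(t, z)"] that by (simp add: dist_Pair_Pair)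
    then show ?thesis using e(1) by blast
  qed
  then obtain \<epsilon>x \<epsilon>y where eps: "\<epsilon>x > 0" "\<epsilon>y > 0" "\<And>t. norm t < \<epsilon>x \<Longrightarrow> (t, x) \<in> W" "\<And>t. norm t < \<epsilon>y \<Longrightarrow> (t, y) \<in> W"
    using assms(3,4) by metis
  define \<epsilon> where "\<epsilon> = min \<epsilon>x \<epsilon>y"
  have e: "\<epsilon> > 0" using eps by (simp add: \<epsilon>_def)
  define F0 where "F0 k = sf0 ((sder_app X ^^ k) (xmonom 1 1))" for k
  define F1 where "F1 k = sfp ((sder_app X ^^ k) phip)" for k
  define F2 where "F2 k = sfm ((sder_app X ^^ k) phim)" for k
  define a where "a F z k = 1 / fact k * (- 1) ^ k * papp (F k) z" for F :: "nat \<Rightarrow> pfun" and z k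
  define H where "H F z t = suminf (\<lambda>k. a F z k * t ^ k)" for F z t
  have flows: "\<exists>U h A B. x \<in> U \<and> y \<in> U \<and> (x - y) ^ 2 * (A x * B x) * (A y * B y) = (h x - h y) ^ 2 \<and>
      A x ^ 2 * (A x * B x) powi (n - 1) = A y ^ 2 * (A y * B y) powi (n - 1) \<and>
      (\<forall>z\<in>{x, y}. (\<lambda>k. a F0 z k * t ^ k) sums h z \<and> (\<lambda>k. a F1 z k * t ^ k) sums A z \<and> (\<lambda>k. a F2 z k * t ^ k) sums B z)"
    if t: "norm t < \<epsilon>" for t
  proof -
    have tg: "gconst t \<in> galg_even \<infinity>" by (simp add: galg_even_iff)
    obtain U h A B S where J: "jets n (T (gconst t)) True True U h A B S"
      and id: "\<And>x y. x \<in> U \<Longrightarrow> y \<in> U \<Longrightarrow> (x - y) ^ 2 * (A x * B x) * (A y * B y) = (h x - h y) ^ 2"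
        "\<And>x y. x \<in> U \<Longrightarrow> y \<in> U \<Longrightarrow> A x ^ 2 * (A x * B x) powi (n - 1) = A y ^ 2 * (A y * B y) powi (n - 1)"
      by (rule automorphism_jet_identities[OF T[OF tg]]) blast
    obtain k where k: "k \<notin> S" using ex_new_if_finite[OF infinite_UNIV_nat jetsD(2)[OF J]] by blast
    obtain l where l: "l \<notin> insert k S" using ex_new_if_finite[OF infinite_UNIV_nat finite.insertI[OF jetsD(2)[OF J]]] by blast
    have kl: "k \<noteq> l" using l by auto
    have zz: "z \<in> U \<and> (\<lambda>k. a F0 z k * t ^ k) sums h z \<and> (\<lambda>k. a F1 z k * t ^ k) sums A z \<and> (\<lambda>k. a F2 z k * t ^ k) sums B z"
      if z: "z \<in> {x, y}" for z
    proof -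
      have z0: "z \<noteq> 0" "(t, z) \<in> W" using z assms(3,4) eps t by (auto simp: \<epsilon>_def)
      let ?q = "(gconst z, gconst 1 * gmono {k}, gconst 1 * gmono {l})"
      have q: "?q \<in> superspace \<infinity>" by (simp add: superspace_iff)
      obtain q' where fl: "even_flow X (gconst t) ?q q'" and D: "in_Delta_coordinates \<infinity> n (T (gconst t)) ?q q'"
        using flow[OF tg q] z0 by auto
      have co: "T (gconst t) (pt True \<infinity> n ?q) \<in> chart_dom True \<infinity> n" "coord True (T (gconst t) (pt True \<infinity> n ?q)) = q'"
        using D unfolding in_Delta_coordinates_iff[OF q] by auto
      have zU: "z \<in> U" using jetsD(7)[OF J q] co(1) by simp
      have hAB: "body (fst q') = h z" "gcoeff (fst (snd q')) {k} = A z" "gcoeff (snd (snd q')) {l} = B z"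
        using jetsD(8)[OF J q] jetsD(9,10)[OF J zU, of k l 1 1] zU k l kl unfolding co(2) by auto
      have pw: "(- gconst t) ^ j = gconst ((- t) ^ j)" for j by (metis gconst_power gconst_uminus)
      have "gsums (\<lambda>j. gconst (1 / fact j) * (- gconst t) ^ j * psf_eval ((sder_app X ^^ j) (xmonom 1 1)) ?q) (fst q')"
        "gsums (\<lambda>j. gconst (1 / fact j) * (- gconst t) ^ j * psf_eval ((sder_app X ^^ j) phip) ?q) (fst (snd q'))"
        "gsums (\<lambda>j. gconst (1 / fact j) * (- gconst t) ^ j * psf_eval ((sder_app X ^^ j) phim) ?q) (snd (snd q'))"
        using fl unfolding even_flow_def by auto
      note g = this[unfolded gsums_def pw gconst_mult[symmetric] gcoeff_gconst_mult]
      note ps = psf_eval_coefficients[OF z0(1) kl]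
      have s0: "(\<lambda>j. 1 / fact j * (- t) ^ j * papp (F0 j) z) sums h z"
        using g(1)[rule_format, of "{}"] ps(1) hAB(1) by (simp add: body_def F0_def)
      have s1: "(\<lambda>j. 1 / fact j * (- t) ^ j * papp (F1 j) z) sums A z"
        using g(2)[rule_format, of "{k}"] ps(2) hAB(2) by (simp add: F1_def)
      have s2: "(\<lambda>j. 1 / fact j * (- t) ^ j * papp (F2 j) z) sums B z"
        using g(3)[rule_format, of "{l}"] ps(3) hAB(3) by (simp add: F2_def)
      have "(\<lambda>k. a F z k * t ^ k) = (\<lambda>j. 1 / fact j * (- t) ^ j * papp (F j) z)" for F
        by (simp add: a_def power_minus[of t] fun_eq_iff mult_ac)
      note this[of F0] this[of F1] this[of F2]
      then show ?thesis using zU s0 s1 s2 by presburger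
    qed
    then have U: "x \<in> U" "y \<in> U" by auto
    have *: "\<forall>z\<in>{x, y}. (\<lambda>k. a F0 z k * t ^ k) sums h z \<and> (\<lambda>k. a F1 z k * t ^ k) sums A z \<and> (\<lambda>k. a F2 z k * t ^ k) sums B z"
      by (intro ballI, drule zz, erule conjunct2)
    show ?thesis by (intro exI[of _ U] exI[of _ h] exI[of _ A] exI[of _ B] conjI U id[OF U] *)
  qed
  have H: "(\<lambda>k. a F z k * t ^ k) sums H F z t" if "norm t < \<epsilon>" "z \<in> {x, y}" "F \<in> {F0, F1, F2}" for F z t
    using flows[OF that(1)] that(2,3) unfolding H_def by (auto intro: summable_sums sums_summable)
  have id: "(x - y) ^ 2 * (H F1 x t * H F2 x t) * (H F1 y t * H F2 y t) = (H F0 x t - H F0 y t) ^ 2"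
    "H F1 x t ^ 2 * (H F1 x t * H F2 x t) powi (n - 1) = H F1 y t ^ 2 * (H F1 y t * H F2 y t) powi (n - 1)"
    if t: "norm t < \<epsilon>" for t
  proof -
    obtain h A B where *: "(x - y) ^ 2 * (A x * B x) * (A y * B y) = (h x - h y) ^ 2"
      "A x ^ 2 * (A x * B x) powi (n - 1) = A y ^ 2 * (A y * B y) powi (n - 1)"
      "\<And>z. z \<in> {x, y} \<Longrightarrow> (\<lambda>k. a F0 z k * t ^ k) sums h z \<and> (\<lambda>k. a F1 z k * t ^ k) sums A z \<and> (\<lambda>k. a F2 z k * t ^ k) sums B z"
      using flows[OF t] by blast
    have "H F0 z t = h z" "H F1 z t = A z" "H F2 z t = B z" if "z \<in> {x, y}" for z
      using *(3)[OF that] by (auto simp: H_def sums_iff)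
    then show "(x - y) ^ 2 * (H F1 x t * H F2 x t) * (H F1 y t * H F2 y t) = (H F0 x t - H F0 y t) ^ 2"
      "H F1 x t ^ 2 * (H F1 x t * H F2 x t) powi (n - 1) = H F1 y t ^ 2 * (H F1 y t * H F2 y t) powi (n - 1)"
      using *(1,2) by simp_all
  qed
  have a01: "a F0 z 0 = z" "a F1 z 0 = 1" "a F2 z 0 = 1" "a F0 z 1 = - papp f z" "a F1 z 1 = - papp b z" "a F2 z 1 = - papp c z"
    if "z \<in> {x, y}" for z
    using that assms(3,4) sder_app_coordinates[of "SF f 0 0 0" "SF 0 b 0 0" "SF 0 0 c 0"]
    by (auto simp: a_def F0_def F1_def F2_def assms(1) xmonom_def phip_def phim_def pmonom.rep_eq one_pfun.rep_eq simp del: sder_app.simps)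
  note ser = power_series_DERIV_0[OF e H]
  have v: "H F0 z 0 = z" "H F1 z 0 = 1" "H F2 z 0 = 1"
    and D: "(H F0 z has_field_derivative - papp f z) (at 0)" "(H F1 z has_field_derivative - papp b z) (at 0)"
      "(H F2 z has_field_derivative - papp c z) (at 0)" if "z \<in> {x, y}" for z
    using ser[of z F0] ser[of z F1] ser[of z F2] a01[OF that] that by auto
  have xy: "x \<in> {x, y}" "y \<in> {x, y}" by auto
  note vx = v[OF xy(1)] and vy = v[OF xy(2)] and Dx = D[OF xy(1)] and Dy = D[OF xy(2)]
  have un: "d = d'" if "(f1 has_field_derivative d) (at 0)" "(f2 has_field_derivative d') (at 0)" "\<And>t. norm t < \<epsilon> \<Longrightarrow> f1 t = f2 t"
    for f1 f2 :: "complex \<Rightarrow> complex" and d d'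
    using has_field_derivative_transform_within_open[OF that(1), of "ball 0 \<epsilon>" f2] that(2,3) e
    by (auto intro: DERIV_unique)
  have "(x - y) ^ 2 * (- (papp b x + papp c x + papp b y + papp c y)) = 2 * (x - y) * (- papp f x + papp f y)"
    by (rule un[of "\<lambda>t. (x - y) ^ 2 * (H F1 x t * H F2 x t) * (H F1 y t * H F2 y t)" _ "\<lambda>t. (H F0 x t - H F0 y t) ^ 2"])
      (use id(1) in \<open>auto intro!: derivative_eq_intros Dx Dy simp: vx vy algebra_simps\<close>)
  then have "(x - y) * ((x - y) * (papp b x + papp c x + papp b y + papp c y) - 2 * (papp f x - papp f y)) = 0"
    by algebra
  then show "(x - y) * (papp b x + papp c x + papp b y + papp c y) = 2 * (papp f x - papp f y)" by auto
  have d2: "((\<lambda>t. H F1 z t ^ 2 * (H F1 z t * H F2 z t) powi (n - 1)) has_field_derivative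
      - (2 * papp b z + (of_int n - 1) * (papp b z + papp c z))) (at 0)" if z: "z \<in> {x, y}" for z
    using v[OF z] D[OF z] by (auto intro!: derivative_eq_intros simp: algebra_simps)
  have "- (2 * papp b x + (of_int n - 1) * (papp b x + papp c x)) = - (2 * papp b y + (of_int n - 1) * (papp b y + papp c y))"
    by (rule un[OF d2[OF xy(1)] d2[OF xy(2)] id(2)])
  then show "2 * papp b x + (of_int n - 1) * (papp b x + papp c x) = 2 * papp b y + (of_int n - 1) * (papp b y + papp c y)"
    by (simp only: neg_equal_iff_equal)
qed

text \<open>The first identity, with \<open>y = 1\<close> and \<open>y = 2\<close>, shows that \<open>b + c\<close> is affine and hence \<open>f\<close> quadratic;
  the second one then determines \<open>b\<close> up to the constant \<open>\<delta>\<close>.\<close>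

lemma lie_aut_even_eq:
  "lie_aut_even N n = {quadratic_sder n \<alpha> \<beta> \<gamma> \<delta> | \<alpha> \<beta> \<gamma> \<delta>. True}"
proof (intro equalityI subsetI)
  fix X assume "X \<in> {quadratic_sder n \<alpha> \<beta> \<gamma> \<delta> | \<alpha> \<beta> \<gamma> \<delta>. True}"
  then obtain \<alpha> \<beta> \<gamma> \<delta> where X: "X = quadratic_sder n \<alpha> \<beta> \<gamma> \<delta>" by blast
  have "sder_even X = X" by (simp add: X quadratic_sder_def sf_even_def sf_odd_def)
  moreover have "infinitesimal_superconformal X"
    unfolding X quadratic_sder_def even_infinitesimal_superconformal_iff
    by (auto intro!: papp_eqI simp: pderivative_uminus pderivative_add pderivative_diff pderivative_pmonom pmonom.rep_eq field_simps)
  ultimately show "X \<in> lie_aut_even N n"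
    using quadratic_sder_flows[of _ n \<alpha> \<beta> \<gamma> \<delta>] unfolding lie_aut_even_def X by auto
next
  fix X assume L: "X \<in> lie_aut_even N n"
  obtain a b c where X: "X = (a, b, c)" by (cases X)
  have ev: "sder_even X = X" and inf: "infinitesimal_superconformal X" using L by (auto simp: lie_aut_even_def)
  obtain f g b1 b2 c1 c2 where abc: "a = SF f 0 0 g" "b = SF 0 b1 b2 0" "c = SF 0 c1 c2 0"
    using ev unfolding X by (cases a; cases b; cases c) (auto simp: sf_even_def sf_odd_def)
  have cond: "g = 0" "b2 = 0" "c1 = 0" "b1 + c2 = pderivative f"
    using inf unfolding X abc even_infinitesimal_superconformal_iff by auto
  have Xf: "X = (SF f 0 0 0, SF 0 b1 0 0, SF 0 0 c2 0)" using cond by (simp add: X abc)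
  define F where "F x = papp b1 x + papp c2 x" for x
  have id1: "(x - y) * (F x + F y) = 2 * (papp f x - papp f y)"
    and id2: "2 * papp b1 x + (of_int n - 1) * F x = 2 * papp b1 y + (of_int n - 1) * F y" if "x \<noteq> 0" "y \<noteq> 0" for x y
    using even_flow_identities[OF Xf L that] by (simp_all add: F_def algebra_simps)
  define \<gamma> where "\<gamma> = - (F 2 - F 1) / 2"
  define \<beta> where "\<beta> = - (F 1 - 2 * F 2 + 2 * papp f 2 - 2 * papp f 1 + F 1 - (F 2 - F 1)) / 2"
  have Fx: "F x = x * (F 2 - F 1) + (F 1 - 2 * F 2 + 2 * papp f 2 - 2 * papp f 1)" if "x \<noteq> 0" for x
    using id1[OF that, of 1] id1[OF that, of 2] by (simp add: algebra_simps) algebra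
  define \<alpha> where "\<alpha> = - (papp f 1 + \<beta> + \<gamma>)"
  have fx: "papp f x = - (\<alpha> + \<beta> * x + \<gamma> * (x * x))" if "x \<noteq> 0" for x
  proof -
    have "2 * papp f x = 2 * papp f 1 + (x - 1) * (F x + F 1)" using id1[OF that, of 1] by (simp add: algebra_simps)
    then show ?thesis unfolding Fx[OF that] \<alpha>_def \<beta>_def \<gamma>_def by (simp add: field_simps) algebra
  qed
  have f: "f = - (pmonom \<alpha> 0 + pmonom \<beta> 1 + pmonom \<gamma> 2)"
  proof (rule papp_eqI)
    fix x show "papp f x = papp (- (pmonom \<alpha> 0 + pmonom \<beta> 1 + pmonom \<gamma> 2)) x"
      using fx[of x] papp_0[of f] by (cases "x = 0") (auto simp: pmonom.rep_eq power2_eq_square)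
  qed
  have F': "F x = - (\<beta> + 2 * \<gamma> * x)" if "x \<noteq> 0" for x
  proof -
    have "F x = papp (b1 + c2) x" by (simp add: F_def)
    also have "\<dots> = - (\<beta> + 2 * \<gamma> * x)" unfolding cond(4) f
      using that by (simp add: pderivative_uminus pderivative_add pderivative_diff pderivative_pmonom pmonom.rep_eq)
    finally show ?thesis .
  qed
  define \<delta> where "\<delta> = - (2 * papp b1 1 + (of_int n - 1) * F 1) / 2"
  have bx: "papp b1 x = - (\<delta> + (1 - of_int n) * (\<beta> / 2) + (1 - of_int n) * \<gamma> * x)" if "x \<noteq> 0" for x
  proof -
    have "2 * \<delta> = - (2 * papp b1 1 + (of_int n - 1) * F 1)" by (simp add: \<delta>_def)
    then have "2 * papp b1 x = - 2 * \<delta> - (of_int n - 1) * F x"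
      using id2[OF that, of 1, simplified] by algebra
    then show ?thesis unfolding F'[OF that] by (simp add: field_simps)
  qed
  have cx: "papp c2 x = - ((1 + of_int n) * (\<beta> / 2) - \<delta> + (1 + of_int n) * \<gamma> * x)" if "x \<noteq> 0" for x
  proof -
    have "papp c2 x = F x - papp b1 x" by (simp add: F_def)
    then show ?thesis unfolding F'[OF that] bx[OF that] by (simp add: field_simps)
  qed
  have "b1 = - (pmonom (\<delta> + (1 - of_int n) * (\<beta> / 2)) 0 + pmonom ((1 - of_int n) * \<gamma>) 1)"
  proof (rule papp_eqI)
    fix x show "papp b1 x = papp (- (pmonom (\<delta> + (1 - of_int n) * (\<beta> / 2)) 0 + pmonom ((1 - of_int n) * \<gamma>) 1)) x"
      using bx[of x] papp_0[of b1] by (cases "x = 0") (auto simp: pmonom.rep_eq)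
  qed
  moreover have "c2 = - (pmonom ((1 + of_int n) * (\<beta> / 2) - \<delta>) 0 + pmonom ((1 + of_int n) * \<gamma>) 1)"
  proof (rule papp_eqI)
    fix x show "papp c2 x = papp (- (pmonom ((1 + of_int n) * (\<beta> / 2) - \<delta>) 0 + pmonom ((1 + of_int n) * \<gamma>) 1)) x"
      using cx[of x] papp_0[of c2] by (cases "x = 0") (auto simp: pmonom.rep_eq)
  qed
  ultimately have "X = quadratic_sder n \<alpha> \<beta> \<gamma> \<delta>" unfolding Xf quadratic_sder_def f by simp
  then show "X \<in> {quadratic_sder n \<alpha> \<beta> \<gamma> \<delta> | \<alpha> \<beta> \<gamma> \<delta>. True}" by blast
qed

section \<open>The odd infinitesimal automorphisms\<close>

lemma papp_ppoly:
  assumes "x \<noteq> 0"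
  shows "papp (ppoly k c) x = (\<Sum>j | int j \<le> k. c j * x ^ j)"
proof -
  have "papp (\<Sum>j\<in>A. pmonom (c j) (int j)) x = (\<Sum>j\<in>A. c j * x ^ j)" for A :: "nat set"
    using assms by (induction A rule: infinite_finite_induct) (auto simp: pmonom.rep_eq)
  then show ?thesis by (simp add: ppoly_def)
qed

text \<open>A global section of the line bundle of degree \<open>k\<close> over the sphere is a polynomial of degree at
  most \<open>k\<close>; in particular it vanishes for negative \<open>k\<close>.\<close>

lemma line_bundle_section_polynomial:
  assumes e: "e1 holomorphic_on UNIV" "e2 holomorphic_on UNIV" "s \<noteq> 0"
    and u: "\<And>x. x \<noteq> 0 \<Longrightarrow> e1 x = papp u x" "\<And>w. w \<noteq> 0 \<Longrightarrow> e2 w = s * (papp u (inverse w) * w powi k)"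
  shows "\<exists>c. u = ppoly k c"
proof -
  have "compact (e2 ` cball 0 1)"
    by (intro compact_continuous_image holomorphic_on_imp_continuous_on[OF holomorphic_on_subset[OF e(2)]]) auto
  then obtain B where B: "\<And>w. norm w \<le> 1 \<Longrightarrow> norm (e2 w) \<le> B"
    using compact_imp_bounded bounded_iff by (metis image_eqI mem_cball_0)
  have ux: "papp u x = e2 (inverse x) / s * x powi k" if "x \<noteq> 0" for x
    using u(2)[of "inverse x"] that e(3) by (simp add: power_int_inverse)
  have bound: "norm (e1 x) \<le> B / norm s * norm x powi k" if "1 \<le> norm x" for x
  proof -
    have x: "x \<noteq> 0" using that by auto
    then have "norm (e1 x) = norm (e2 (inverse x)) / norm s * norm x powi k"
      by (simp add: u(1) ux norm_mult norm_divide norm_power_int)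
    also have "\<dots> \<le> B / norm s * norm x powi k"
      using that by (intro mult_right_mono divide_right_mono B) (auto simp: norm_inverse inverse_le_1_iff)
    finally show ?thesis .
  qed
  have B0: "B \<ge> 0" using order_trans[OF norm_ge_zero B[of 0]] by simp
  show ?thesis
  proof (cases "k \<ge> 0")
    case True
    have eq: "e1 x = (\<Sum>j\<le>nat k. (deriv ^^ j) e1 0 / fact j * x ^ j)" for x
      by (rule Liouville_polynomial[OF e(1), of 1 "B / norm s"])
        (use bound True in \<open>auto simp: power_int_def\<close>)
    have *: "{j. int j \<le> k} = {..nat k}" using True by auto
    have "u = ppoly k (\<lambda>j. (deriv ^^ j) e1 0 / fact j)"
    proof (rule papp_eqI)
      fix x show "papp u x = papp (ppoly k (\<lambda>j. (deriv ^^ j) e1 0 / fact j)) x"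
        using u(1)[of x] eq[of x] by (cases "x = 0") (simp_all add: papp_0 papp_ppoly *)
    qed
    then show ?thesis by blast
  next
    case False
    have "norm x powi k \<le> 1" if "1 \<le> norm x" for x :: complex
      unfolding power_int_def if_not_P[OF False] by (rule power_le_one) (use that in \<open>auto simp: inverse_le_1_iff\<close>)
    then have "norm (e1 x) \<le> B / norm s" if "1 \<le> norm x" for x
      using bound[OF that] mult_left_mono[of "norm x powi k" 1 "B / norm s"] B0 that by force
    then have const: "e1 x = e1 0" for x
      using Liouville_polynomial[OF e(1), of 1 "B / norm s" 0 x] by simp
    obtain m where m: "k = - int (Suc m)" using False by (intro that[of "nat (- k - 1)"]) simp
    have e2: "e2 w * w ^ Suc m = s * e1 0" if "w \<noteq> 0" for w
      using u(2)[OF that] u(1)[of "inverse w"] const[of "inverse w"] that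
      unfolding m power_int_minus power_int_of_nat by (simp add: field_simps)
    have "((\<lambda>w. e2 w * w ^ Suc m) \<longlongrightarrow> e2 0 * 0 ^ Suc m) (at 0)"
      by (rule holomorphic_tendsto[of _ UNIV]) (auto intro!: holomorphic_intros e)
    then have "((\<lambda>_. s * e1 0) \<longlongrightarrow> e2 0 * 0 ^ Suc m) (at (0::complex))"
      by (rule tendsto_at_cong[of _ _ _ UNIV]) (use e2 in auto)
    then have "s * e1 0 = 0" by (simp add: tendsto_const_iff)
    then have e0: "e1 x = 0" for x using const[of x] e(3) by simp
    have "u = ppoly k (\<lambda>_. 0)"
    proof (rule papp_eqI)
      fix x show "papp u x = papp (ppoly k (\<lambda>_. 0)) x"
        using u(1)[of x] e0[of x] by (cases "x = 0") (simp_all add: papp_0 papp_ppoly)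
    qed
    then show ?thesis by blast
  qed
qed

text \<open>At points without odd coordinates a superanalytic function is given by its coefficient functions.\<close>

lemma superconformal_on_coefficients_holomorphic:
  assumes "superconformal_on \<infinity> D H"
  shows "\<exists>U. open U \<and> D = {q \<in> superspace \<infinity>. body (fst q) \<in> U} \<and>
    (\<forall>s. (\<lambda>x. gcoeff (fst (H (gconst x, 0, 0))) s) holomorphic_on U \<and>
      (\<lambda>x. gcoeff (fst (snd (H (gconst x, 0, 0)))) s) holomorphic_on U \<and>
      (\<lambda>x. gcoeff (snd (snd (H (gconst x, 0, 0)))) s) holomorphic_on U)"
proof -
  obtain U Z P Q where *: "open U" "D = {q \<in> superspace \<infinity>. body (fst q) \<in> U}"
    "superanalytic \<infinity> U Z" "superanalytic \<infinity> U P" "superanalytic \<infinity> U Q"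
    "\<And>q. q \<in> D \<Longrightarrow> H q = (sf_eval Z q, sf_eval P q, sf_eval Q q)"
    using assms unfolding superconformal_on_def idiff_infinity by blast
  have c: "(\<lambda>x. gcoeff (sf_eval F (gconst x, 0, 0)) s) holomorphic_on U" if F: "superanalytic \<infinity> U F" for F s
  proof -
    have on: "gfun_on \<infinity> U (sf0 F)" using F by (cases F) (simp add: superanalytic_def)
    have "gcoeff (sf_eval F (gconst x, 0, 0)) s = sf0 F s x" for x
      using gfun_eval_gconst[OF on] by (cases F) simp
    then show ?thesis using gfun_on_holomorphic[OF on] by simp
  qed
  have H: "H (gconst x, 0, 0) = (sf_eval Z (gconst x, 0, 0), sf_eval P (gconst x, 0, 0), sf_eval Q (gconst x, 0, 0))" if "x \<in> U" for x
    using *(6)[of "(gconst x, 0, 0)"] that *(2) by simp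
  show ?thesis
    by (intro exI[of _ U] conjI allI *(1,2); rule holomorphic_transform[OF c]) (use * H in auto)
qed

text \<open>The point over \<open>0\<close> is mapped into the same chart as its neighbours: otherwise the other
  coordinate of its image would be \<open>0\<close>, while it is \<open>1 / x\<close> nearby.\<close>

lemma automorphism_coefficients_entire:
  assumes T: "superconformal_map \<infinity> (sphere_atlas \<infinity> n) T" "\<And>P. P \<in> sphere \<infinity> n \<Longrightarrow> T P \<in> sphere \<infinity> n"
    and x: "\<And>x. x \<noteq> 0 \<Longrightarrow> T (pt c \<infinity> n (gconst x, 0, 0)) \<in> chart_dom c \<infinity> n \<and>
      body (fst (coord c (T (pt c \<infinity> n (gconst x, 0, 0))))) = x"
  shows "(\<lambda>x. gcoeff (fst (snd (coord c (T (pt c \<infinity> n (gconst x, 0, 0)))))) s) holomorphic_on UNIV"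
    "(\<lambda>x. gcoeff (snd (snd (coord c (T (pt c \<infinity> n (gconst x, 0, 0)))))) s) holomorphic_on UNIV"
proof -
  let ?P = "\<lambda>x. pt c \<infinity> n (gconst x, 0, 0)"
  let ?D = "\<lambda>d. {q \<in> superspace \<infinity>. T (pt c \<infinity> n q) \<in> chart_dom d \<infinity> n}"
  have dom: "(gconst x, 0, 0) \<in> ?D d \<longleftrightarrow> T (?P x) \<in> chart_dom d \<infinity> n" for x d by simp
  have sc: "superconformal_on \<infinity> (?D d) (\<lambda>q. coord d (T (pt c \<infinity> n q)))" if "T (?P x) \<in> chart_dom d \<infinity> n" for d x
    using T(1) that dom unfolding superconformal_map_sphere_iff by blast
  have "T (?P 1) \<in> chart_dom c \<infinity> n" using x[of 1] by simp
  from superconformal_on_coefficients_holomorphic[OF sc[OF this]]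
  obtain U where U: "open U \<and> ?D c = {q \<in> superspace \<infinity>. body (fst q) \<in> U} \<and>
    (\<forall>s. (\<lambda>x. gcoeff (fst (coord c (T (?P x)))) s) holomorphic_on U \<and>
      (\<lambda>x. gcoeff (fst (snd (coord c (T (?P x))))) s) holomorphic_on U \<and>
      (\<lambda>x. gcoeff (snd (snd (coord c (T (?P x))))) s) holomorphic_on U)" ..
  note U = U[THEN conjunct1] U[THEN conjunct2, THEN conjunct1] U[THEN conjunct2, THEN conjunct2, rule_format]
  have U_iff: "x \<in> U \<longleftrightarrow> T (?P x) \<in> chart_dom c \<infinity> n" for x using dom[of x c] unfolding U(2) by simp
  have "T (?P 0) \<in> chart_dom c \<infinity> n"
  proof (rule ccontr)
    assume n: "T (?P 0) \<notin> chart_dom c \<infinity> n"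
    obtain d where d: "T (?P 0) \<in> chart_dom d \<infinity> n"
      using sphere_chart_cases[OF T(2)[OF pt_in_sphere[OF body_pt_zero]]] by blast
    then have "d = (\<not> c)" using n by (cases c; cases d) auto
    note d = d[unfolded this]
    from superconformal_on_coefficients_holomorphic[OF sc[OF d]]
    obtain V where V: "open V \<and> ?D (\<not> c) = {q \<in> superspace \<infinity>. body (fst q) \<in> V} \<and>
      (\<forall>s. (\<lambda>x. gcoeff (fst (coord (\<not> c) (T (?P x)))) s) holomorphic_on V \<and>
        (\<lambda>x. gcoeff (fst (snd (coord (\<not> c) (T (?P x))))) s) holomorphic_on V \<and>
        (\<lambda>x. gcoeff (snd (snd (coord (\<not> c) (T (?P x))))) s) holomorphic_on V)" ..
    note V = V[THEN conjunct1] V[THEN conjunct2, THEN conjunct1] V[THEN conjunct2, THEN conjunct2, rule_format]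
    have V_iff: "x \<in> V \<longleftrightarrow> T (?P x) \<in> chart_dom (\<not> c) \<infinity> n" for x using dom[of x "\<not> c"] unfolding V(2) by simp
    define g where "g x = gcoeff (fst (coord (\<not> c) (T (?P x)))) {}" for x
    have g: "g holomorphic_on V" unfolding g_def using V(3) by (rule conjunct1)
    have "g 0 = 0"
      using n pt_in_chart_dom[OF coord_in[OF d], of "\<not> c" n c] pt_coord[OF d] by (auto simp: g_def body_def)
    then have "(g \<longlongrightarrow> 0) (at 0)" using holomorphic_tendsto[OF g V(1), of 0] V_iff d by simp
    then have "((\<lambda>x. g x * x) \<longlongrightarrow> 0 * 0) (at 0)" by (intro tendsto_intros)
    moreover have "g y * y = 1" if y: "y \<in> V" "y \<noteq> 0" for y
    proof -
      have c: "T (?P y) \<in> chart_dom c \<infinity> n" "body (fst (coord c (T (?P y)))) = y" using x[OF y(2)] by auto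
      have "T (?P y) \<in> chart_dom (\<not> c) \<infinity> n" using V_iff y(1) by (rule iffD1)
      note o = coord_other[OF c(1) this]
      have "body (fst (coord (\<not> c) (T (?P y)))) = inverse y"
        using change_chart_in(2)[OF coord_in[OF c(1)] o(2), of c n] by (simp only: o(1) c(2))
      then show ?thesis using y(2) by (simp add: g_def body_def)
    qed
    moreover have "0 \<in> V" using V_iff d by (rule iffD2)
    ultimately have "((\<lambda>x. 1) \<longlongrightarrow> 0 * (0::complex)) (at (0::complex))"
      using V(1) by (intro tendsto_at_cong[of "\<lambda>x. g x * x" "0 * 0" 0 V "\<lambda>x. 1"]) simp_all
    then show False by (simp add: tendsto_const_iff)
  qed
  then have "U = UNIV" using x U_iff by (metis UNIV_eq_I)
  then show "(\<lambda>x. gcoeff (fst (snd (coord c (T (?P x))))) s) holomorphic_on UNIV"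
    "(\<lambda>x. gcoeff (snd (snd (coord c (T (?P x))))) s) holomorphic_on UNIV"
    using U(3)[of s] by (auto simp only:)
qed

text \<open>The flow along \<open>\<xi> = \<zeta>\<^sub>0\<close> moves the even coordinates of points without odd coordinates not at
  all, and the odd ones by the functions \<open>u\<close> and \<open>w\<close>, which are therefore global sections of the line
  bundles of degree \<open>1 - n\<close> and \<open>1 + n\<close>.\<close>

lemma lie_aut_odd_polynomial:
  assumes "odd_sder u w \<in> lie_aut_odd N n"
  shows "\<exists>a. u = ppoly (1 - n) a" "\<exists>b. w = ppoly (1 + n) b"
proof -
  let ?\<xi> = "gmono {0}"
  have "?\<xi> \<in> galg_odd (\<infinity> - 2)" by (simp add: galg_odd_iff)
  moreover have "N \<le> \<infinity>" by simp
  ultimately obtain T where T: "T \<in> sphere_auts \<infinity> n" and fl: "\<And>q. q \<in> superspace \<infinity> \<Longrightarrow> body (fst q) \<noteq> 0 \<Longrightarrow>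
      \<exists>q'. odd_flow (odd_sder u w) ?\<xi> q q' \<and> in_Delta_coordinates \<infinity> n T q q'"
    using assms unfolding lie_aut_odd_def by blast
  obtain T' where T': "superconformal_map \<infinity> (sphere_atlas \<infinity> n) T" "\<And>P. P \<in> sphere \<infinity> n \<Longrightarrow> T P \<in> sphere \<infinity> n"
    by (rule sphere_autsE[OF T]) blast
  define q' where "q' x = (gconst x, ?\<xi> * gconst (papp u x), ?\<xi> * gconst (papp w x))" for x
  have q': "q' x \<in> superspace \<infinity>" for x by (simp add: q'_def superspace_iff)
  have q'_proj: "fst (snd (q' x)) = ?\<xi> * gconst (papp u x)" "snd (snd (q' x)) = ?\<xi> * gconst (papp w x)" for x
    by (simp_all add: q'_def)
  have D: "T (pt True \<infinity> n (gconst x, 0, 0)) \<in> chart_dom True \<infinity> n" "coord True (T (pt True \<infinity> n (gconst x, 0, 0))) = q' x"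
    if x: "x \<noteq> 0" for x
  proof -
    have q: "(gconst x, 0, 0) \<in> superspace \<infinity>" "body (fst (gconst x, 0 :: grassmann, 0 :: grassmann)) \<noteq> 0" using x by simp_all
    obtain r where r: "odd_flow (odd_sder u w) ?\<xi> (gconst x, 0, 0) r" "in_Delta_coordinates \<infinity> n T (gconst x, 0, 0) r"
      using fl[OF q] by blast
    have "r = q' x" using r(1) unfolding odd_flow_iff[OF q] by (simp add: q'_def psf_eval_eq gconst_uminus)
    then show "T (pt True \<infinity> n (gconst x, 0, 0)) \<in> chart_dom True \<infinity> n" "coord True (T (pt True \<infinity> n (gconst x, 0, 0))) = q' x"
      using r(2) unfolding in_Delta_coordinates_iff[OF q(1)] by auto
  qed
  have E: "T (pt False \<infinity> n (gconst x, 0, 0)) \<in> chart_dom False \<infinity> n"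
    "coord False (T (pt False \<infinity> n (gconst x, 0, 0))) = change_chart True n (q' (inverse x))" if x: "x \<noteq> 0" for x
  proof -
    let ?P = "T (pt False \<infinity> n (gconst x, 0, 0))"
    have "pt False \<infinity> n (gconst x, 0, 0) = pt True \<infinity> n (gconst (inverse x), 0, 0)"
      using pt_change_chart[of "(gconst x, 0, 0)" \<infinity> False n] x by (simp add: inverse_gconst)
    then have P: "?P \<in> chart_dom True \<infinity> n" "coord True ?P = q' (inverse x)" using D[of "inverse x"] x by auto
    show F: "?P \<in> chart_dom False \<infinity> n"
      using pt_in_chart_dom[OF q', of True n "inverse x" False] x pt_coord[OF P(1)] unfolding P(2) by (simp add: q'_def)
    show "coord False ?P = change_chart True n (q' (inverse x))"
      using coord_other(1)[of ?P True \<infinity> n] P F by simp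
  qed
  have pw: "inverse x powi (n - 1) = x powi (1 - n)" "inverse x powi (- n - 1) = x powi (1 + n)" for x :: complex
    using power_int_minus[of x "n - 1"] power_int_minus[of x "- n - 1"] by (simp_all add: power_int_inverse add.commute)
  have F: "change_chart True n (q' (inverse x)) = (gconst x,
      gconst (chart_unit True) * (?\<xi> * gconst (papp u (inverse x)) * gconst (x powi (1 - n))),
      gconst (chart_unit True) * (?\<xi> * gconst (papp w (inverse x)) * gconst (x powi (1 + n))))" if x: "x \<noteq> 0" for x
    using x by (simp add: q'_def inverse_gconst powi_gconst pw)
  have Dx: "x \<noteq> 0 \<Longrightarrow> T (pt True \<infinity> n (gconst x, 0, 0)) \<in> chart_dom True \<infinity> n \<and>
      body (fst (coord True (T (pt True \<infinity> n (gconst x, 0, 0))))) = x" for x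
    using D by (simp add: q'_def)
  have Ex: "x \<noteq> 0 \<Longrightarrow> T (pt False \<infinity> n (gconst x, 0, 0)) \<in> chart_dom False \<infinity> n \<and>
      body (fst (coord False (T (pt False \<infinity> n (gconst x, 0, 0))))) = x" for x
    using E F by simp
  have Cx: "x \<noteq> 0 \<Longrightarrow> T (pt c \<infinity> n (gconst x, 0, 0)) \<in> chart_dom c \<infinity> n \<and>
      body (fst (coord c (T (pt c \<infinity> n (gconst x, 0, 0))))) = x" for c x
    using Dx Ex by (cases c) simp_all
  have e: "(\<lambda>x. gcoeff (fst (snd (coord c (T (pt c \<infinity> n (gconst x, 0, 0)))))) {0}) holomorphic_on UNIV" for c
    by (rule automorphism_coefficients_entire(1)) (rule T'(1), erule T'(2), erule Cx)
  have e': "(\<lambda>x. gcoeff (snd (snd (coord c (T (pt c \<infinity> n (gconst x, 0, 0)))))) {0}) holomorphic_on UNIV" for c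
    by (rule automorphism_coefficients_entire(2)) (rule T'(1), erule T'(2), erule Cx)
  have cu: "chart_unit True \<noteq> 0" by (simp add: chart_unit_def)
  show "\<exists>a. u = ppoly (1 - n) a"
    by (rule line_bundle_section_polynomial[OF e[of True] e[of False] cu])
      (simp_all add: D E F q'_proj gcoeff_mult_singleton gcoeff_gconst)
  show "\<exists>b. w = ppoly (1 + n) b"
    by (rule line_bundle_section_polynomial[OF e'[of True] e'[of False] cu])
      (simp_all add: D E F q'_proj gcoeff_mult_singleton gcoeff_gconst)
qed

lemma lie_aut_odd_eq:
  "lie_aut_odd N n = {odd_sder (ppoly (1 - n) a) (ppoly (1 + n) b) | a b. True}"
proof (intro equalityI subsetI)
  fix X assume "X \<in> {odd_sder (ppoly (1 - n) a) (ppoly (1 + n) b) | a b. True}"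
  then obtain a b where X: "X = odd_sder (ppoly (1 - n) a) (ppoly (1 + n) b)" by blast
  have "sder_odd X = X" by (simp add: X odd_sder_def sf_even_def sf_odd_def)
  moreover have "infinitesimal_superconformal X"
    using odd_infinitesimal_superconformal_iff unfolding X odd_sder_def by blast
  ultimately show "X \<in> lie_aut_odd N n"
    using odd_sder_flows[of _ _ n a b] unfolding lie_aut_odd_def X by blast
next
  fix X assume L: "X \<in> lie_aut_odd N n"
  obtain a b c where X: "X = (a, b, c)" by (cases X)
  have ev: "sder_odd X = X" and inf: "infinitesimal_superconformal X" using L by (auto simp: lie_aut_odd_def)
  obtain u w b1 b2 c1 c2 where abc: "a = SF 0 w u 0" "b = SF b1 0 0 b2" "c = SF c1 0 0 c2"
    using ev unfolding X by (cases a; cases b; cases c) (auto simp: sf_even_def sf_odd_def)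
  have "X = odd_sder u w" using inf unfolding X abc odd_infinitesimal_superconformal_iff .
  then show "X \<in> {odd_sder (ppoly (1 - n) a) (ppoly (1 + n) b) | a b. True}"
    using lie_aut_odd_polynomial[of u w N n] L by blast
qed

section \<open>The representation by superderivations\<close>

definition sder_scale :: "complex \<Rightarrow> sder \<Rightarrow> sder" where
  "sder_scale c = sder_lmult (xmonom c 0)"

lemma pmonom_0 [simp]: "pmonom 0 k = 0"
  by (rule papp_eqI) (simp add: pmonom.rep_eq)

lemma pmonom_linear: "pmonom (c + d) k = pmonom c k + pmonom d k" "pmonom (c * d) 0 = pmonom c 0 * pmonom d 0"
  "pmonom (- c) k = - pmonom c k"
  by (rule papp_eqI; simp add: pmonom.rep_eq distrib_right)+

lemma xmonom_scalar:
  "G * (xmonom c 0 * F) = xmonom c 0 * (G * F)" "dx (xmonom c 0 * F) = xmonom c 0 * dx F"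
  "dtp (xmonom c 0 * F) = xmonom c 0 * dtp F" "dtm (xmonom c 0 * F) = xmonom c 0 * dtm F"
  "sf_even (xmonom c 0 * F) = xmonom c 0 * sf_even F" "sf_odd (xmonom c 0 * F) = xmonom c 0 * sf_odd F"
  "xmonom (c + d) 0 = xmonom c 0 + xmonom d 0" "xmonom (c * d) 0 = xmonom c 0 * xmonom d 0"
  "xmonom 0 0 = 0" "xmonom 1 0 = 1"
  by (cases F; cases G; simp add: xmonom_def superfun_defs dtp_def dtm_def sf_even_def sf_odd_def
      pderivative_mult pderivative_pmonom pmonom_linear algebra_simps)+

lemma superfun_additive:
  "dx (F + G) = dx F + dx G" "dtp (F + G) = dtp F + dtp G" "dtm (F + G) = dtm F + dtm G"
  "sf_even (F + G) = sf_even F + sf_even G" "sf_odd (F + G) = sf_odd F + sf_odd G"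
  by (cases F; cases G; simp add: superfun_defs dtp_def dtm_def sf_even_def sf_odd_def pderivative_add)+

lemma sder_scale_rules:
  "sder_scale c (X + Y) = sder_scale c X + sder_scale c Y" "sder_scale (c + d) X = sder_scale c X + sder_scale d X"
  "sder_scale c (sder_scale d X) = sder_scale (c * d) X" "sder_scale 0 X = 0" "sder_scale 1 X = X" "sder_scale c 0 = 0"
  by (cases X; cases Y; simp add: sder_scale_def xmonom_scalar(7-) distrib_left distrib_right mult.assoc zero_prod_def)+

lemma sder_app_linear:
  "sder_app (X + Y) F = sder_app X F + sder_app Y F" "sder_app X (F + G) = sder_app X F + sder_app X G"
  "sder_app (sder_scale c X) F = xmonom c 0 * sder_app X F" "sder_app X (xmonom c 0 * F) = xmonom c 0 * sder_app X F"
  by (cases X; cases Y; simp add: sder_scale_def superfun_additive xmonom_scalar distrib_left distrib_right mult.assoc add_ac)+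

lemma sder_parity_linear:
  "sder_even (X + Y) = sder_even X + sder_even Y" "sder_odd (X + Y) = sder_odd X + sder_odd Y"
  "sder_even (sder_scale c X) = sder_scale c (sder_even X)" "sder_odd (sder_scale c X) = sder_scale c (sder_odd X)"
  by (cases X; cases Y; simp add: sder_scale_def superfun_additive xmonom_scalar)+

lemma sder_bracket_bilinear:
  "sder_bracket (X + X') Y = sder_bracket X Y + sder_bracket X' Y"
  "sder_bracket X (Y + Y') = sder_bracket X Y + sder_bracket X Y'"
  "sder_bracket (sder_scale c X) Y = sder_scale c (sder_bracket X Y)"
  "sder_bracket X (sder_scale c Y) = sder_scale c (sder_bracket X Y)"
proof -
  have "sder_bracket_app (X + X') Y F = sder_bracket_app X Y F + sder_bracket_app X' Y F"
    "sder_bracket_app X (Y + Y') F = sder_bracket_app X Y F + sder_bracket_app X Y' F"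
    "sder_bracket_app (sder_scale c X) Y F = xmonom c 0 * sder_bracket_app X Y F"
    "sder_bracket_app X (sder_scale c Y) F = xmonom c 0 * sder_bracket_app X Y F" for F
    unfolding sder_bracket_app_def
    by (simp_all add: sder_app_linear sder_parity_linear distrib_left right_diff_distrib del: sder_app.simps)
  then show "sder_bracket (X + X') Y = sder_bracket X Y + sder_bracket X' Y"
    "sder_bracket X (Y + Y') = sder_bracket X Y + sder_bracket X Y'"
    "sder_bracket (sder_scale c X) Y = sder_scale c (sder_bracket X Y)"
    "sder_bracket X (sder_scale c Y) = sder_scale c (sder_bracket X Y)"
    by (simp_all add: sder_bracket_def sder_scale_def)
qed

lemma sder_scale_sum: "sder_scale c (\<Sum>a\<in>A. f a) = (\<Sum>a\<in>A. sder_scale c (f a))"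
  by (rule additive.sum[OF additive.intro]) (rule sder_scale_rules)

lemma sder_bracket_sum:
  "sder_bracket (\<Sum>a\<in>A. f a) Y = (\<Sum>a\<in>A. sder_bracket (f a) Y)"
  "sder_bracket X (\<Sum>a\<in>A. f a) = (\<Sum>a\<in>A. sder_bracket X (f a))"
  by (rule additive.sum[OF additive.intro], rule sder_bracket_bilinear)+

lemma sder_bracket_0: "sder_bracket 0 Y = 0" "sder_bracket X 0 = 0"
  using sder_bracket_sum(1)[of "\<lambda>_. 0" "{}"] sder_bracket_sum(2)[of _ "\<lambda>_. 0" "{}"] by simp_all

lemma ns_rep_superset:
  assumes "finite A" "Poly_Mapping.keys u \<subseteq> A"
  shows "ns_rep u = (\<Sum>b\<in>A. sder_scale (Poly_Mapping.lookup u b) (ns_basis_rep b))"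
  unfolding ns_rep_def sder_scale_def[symmetric]
  by (rule sum.mono_neutral_left) (use assms in \<open>auto simp: in_keys_iff sder_scale_rules\<close>)

lemma ns_rep_linear:
  "ns_rep (u + v) = ns_rep u + ns_rep v" "ns_rep (ns_scale c u) = sder_scale c (ns_rep u)"
proof -
  let ?A = "Poly_Mapping.keys u \<union> Poly_Mapping.keys v"
  have "Poly_Mapping.keys (u + v) \<subseteq> ?A" by (rule Poly_Mapping.keys_add)
  then show "ns_rep (u + v) = ns_rep u + ns_rep v"
    by (simp add: ns_rep_superset[of ?A] lookup_add sder_scale_rules sum.distrib)
  have "Poly_Mapping.keys (ns_scale c u) \<subseteq> Poly_Mapping.keys u" by (auto simp: in_keys_iff)
  then show "ns_rep (ns_scale c u) = sder_scale c (ns_rep u)"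
    by (simp add: ns_rep_superset[of "Poly_Mapping.keys u"] sder_scale_sum sder_scale_rules)
qed

lemma ns_rep_single: "ns_rep (Poly_Mapping.single b c) = sder_scale c (ns_basis_rep b)"
  by (subst ns_rep_superset[of "{b}"]) auto

lemma ns_rep_sum: "ns_rep (\<Sum>a\<in>A. f a) = (\<Sum>a\<in>A. ns_rep (f a))"
  by (rule additive.sum[OF additive.intro]) (rule ns_rep_linear)

lemma ns_rep_0: "ns_rep 0 = 0"
  by (simp add: ns_rep_def)

lemma ns_uminus_scale: "- u = ns_scale (- 1) u"
  by (rule poly_mapping_eqI) simp

lemma ns_basis_rep_SF:
  "ns_basis_rep (BL m) = (SF (- pmonom 1 (m + 1)) 0 0 0, SF 0 (- pmonom ((of_int m + 1) / 2) m) 0 0,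
     SF 0 0 (- pmonom ((of_int m + 1) / 2) m) 0)"
  "ns_basis_rep (BJ m) = (SF 0 0 0 0, SF 0 (- pmonom 1 m) 0 0, SF 0 0 (pmonom 1 m) 0)"
  "ns_basis_rep (BGp m) = odd_sder (pmonom 1 (m + 1)) 0"
  "ns_basis_rep (BGm m) = odd_sder 0 (pmonom 1 (m + 1))"
  by (simp_all add: odd_sder_def xmonom_def phip_def phim_def superfun_defs pderivative_pmonom Let_def)

text \<open>The central terms are lost since \<open>d\<close> acts by zero; what remains are identities between Laurent
  monomials, which are compared by their values away from 0.\<close>

lemma ns_rep_basis_bracket: "ns_rep (ns_basis_bracket a b) = sder_bracket (ns_basis_rep a) (ns_basis_rep b)"
proof -
  have D: "ns_rep (ns_basis_bracket BD b) = 0" "ns_rep (ns_basis_bracket a BD) = 0" for a b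
    by (cases b; simp add: ns_rep_0) (cases a; simp add: ns_rep_0)
  have uminus: "ns_rep (- u) = sder_scale (- 1) (ns_rep u)" for u
    unfolding ns_uminus_scale[of u] by (rule ns_rep_linear)
  have scale: "sder_scale c (SF a1 a2 a3 a4, SF b1 b2 b3 b4, SF c1 c2 c3 c4) =
    (SF (pmonom c 0 * a1) (pmonom c 0 * a2) (pmonom c 0 * a3) (pmonom c 0 * a4),
     SF (pmonom c 0 * b1) (pmonom c 0 * b2) (pmonom c 0 * b3) (pmonom c 0 * b4),
     SF (pmonom c 0 * c1) (pmonom c 0 * c2) (pmonom c 0 * c3) (pmonom c 0 * c4))" for c a1 a2 a3 a4 b1 b2 b3 b4 c1 c2 c3 c4
    by (simp add: sder_scale_def xmonom_def superfun_defs)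
  note br = sder_bracket_def sder_bracket_app_def superfun_defs sf_even_def sf_odd_def phip_def phim_def
    xmonom_def dtp_def dtm_def pderivative_pmonom odd_sder_def pderivative_uminus pderivative_add pderivative_diff pderivative_mult
  have two: "papp 2 x = 2" if "x \<noteq> 0" for x
    using that by (simp only: numeral_2_eq_2 one_add_one[symmetric] papp_simps one_pfun.rep_eq) simp
  note ev = two pmonom.rep_eq power_int_add power_int_diff power_int_minus field_simps power2_eq_square
  have expand: "ns_rep (ns_basis_bracket a b) = sder_bracket (ns_basis_rep a) (ns_basis_rep b)" if "a \<noteq> BD" "b \<noteq> BD"
    by (insert that) (cases a; cases b; simp add: ns_rep_linear ns_rep_single ns_rep_0 uminus sder_scale_rules ns_basis_rep_SF scale br
        zero_prod_def del: ns_basis_rep.simps(2-);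
        (intro conjI)?; (rule papp_eqI, case_tac "x = 0")?; (simp add: ev; fail)?)
  show ?thesis
  proof (cases "a = BD \<or> b = BD")
    case True
    then show ?thesis by (elim disjE) (simp_all only: D ns_basis_rep.simps(1) sder_bracket_0)
  qed (use expand in blast)
qed

lemma ns_rep_bracket: "ns_rep (ns_bracket u v) = sder_bracket (ns_rep u) (ns_rep v)"
proof -
  let ?u = "Poly_Mapping.keys u" and ?v = "Poly_Mapping.keys v"
  have r: "ns_rep w = (\<Sum>a\<in>Poly_Mapping.keys w. sder_scale (Poly_Mapping.lookup w a) (ns_basis_rep a))" for w
    by (simp add: ns_rep_def sder_scale_def)
  show ?thesis
    unfolding r[of u] r[of v] ns_bracket_def ns_rep_sum ns_rep_linear ns_rep_basis_bracket
    unfolding sder_bracket_sum(1) sder_bracket_bilinear(3)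
    unfolding sder_bracket_sum(2) sder_bracket_bilinear(4)
    by (simp add: sder_scale_rules sder_scale_sum)
qed

lemma lookup_ns_parity:
  "Poly_Mapping.lookup (ns_even u) b = (if b \<in> range BGp \<union> range BGm then 0 else Poly_Mapping.lookup u b)"
  "Poly_Mapping.lookup (ns_odd u) b = (if b \<in> range BGp \<union> range BGm then Poly_Mapping.lookup u b else 0)"
  by (auto simp: ns_even_def ns_odd_def lookup_sum lookup_single when_def in_keys_iff)

lemma ns_rep_parity: "ns_rep (ns_even u) = sder_even (ns_rep u)" "ns_rep (ns_odd u) = sder_odd (ns_rep u)"
proof -
  have even: "sder_even (ns_basis_rep b) = (if b \<in> range BGp \<union> range BGm then 0 else ns_basis_rep b)" for b
    by (cases b) (auto simp: ns_basis_rep_SF odd_sder_def sf_even_def sf_odd_def zero_superfun_def zero_prod_def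
        simp del: ns_basis_rep.simps(2-))
  have odd: "sder_odd (ns_basis_rep b) = (if b \<in> range BGp \<union> range BGm then ns_basis_rep b else 0)" for b
    by (cases b) (auto simp: ns_basis_rep_SF odd_sder_def sf_even_def sf_odd_def zero_superfun_def zero_prod_def
        simp del: ns_basis_rep.simps(2-))
  have sums: "sder_even (\<Sum>a\<in>A. f a) = (\<Sum>a\<in>A. sder_even (f a))" "sder_odd (\<Sum>a\<in>A. f a) = (\<Sum>a\<in>A. sder_odd (f a))"
    for A and f :: "ns_index \<Rightarrow> sder"
    by (rule additive.sum[OF additive.intro], rule sder_parity_linear)+
  have "Poly_Mapping.keys (ns_even u) \<subseteq> Poly_Mapping.keys u" "Poly_Mapping.keys (ns_odd u) \<subseteq> Poly_Mapping.keys u"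
    by (auto simp: in_keys_iff lookup_ns_parity split: if_splits)
  then show "ns_rep (ns_even u) = sder_even (ns_rep u)" "ns_rep (ns_odd u) = sder_odd (ns_rep u)"
    by (auto simp: ns_rep_superset[of "Poly_Mapping.keys u"] sums sder_parity_linear even odd lookup_ns_parity
        sder_scale_rules intro!: sum.cong)
qed

section \<open>The subalgebras\<close>

text \<open>The union of the generators in all five cases of the theorem: the interval of indices of \<open>G\<^sup>+\<close> is empty
  for \<open>n \<ge> 2\<close> and that of \<open>G\<^sup>-\<close> for \<open>n \<le> -2\<close>.\<close>

definition sphere_gens :: "int \<Rightarrow> ns set" where
  "sphere_gens n = {nsL (-1), nsL 0 - ns_scale (of_int n / 2) (nsJ 0), nsL 1 - ns_scale (of_int n) (nsJ 1), nsJ 0}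
     \<union> nsGp ` {-1..-n} \<union> nsGm ` {-1..n}"

text \<open>The sums run over the exponents \<open>j\<close> of the polynomial coefficients, so that \<open>G\<^bsub>j-1/2\<^esub>\<close> has index \<open>j - 1\<close>.\<close>

definition sphere_element ::
    "int \<Rightarrow> complex \<Rightarrow> complex \<Rightarrow> complex \<Rightarrow> complex \<Rightarrow> (nat \<Rightarrow> complex) \<Rightarrow> (nat \<Rightarrow> complex) \<Rightarrow> ns" where
  "sphere_element n \<alpha> \<beta> \<gamma> \<delta> a b = ns_scale \<alpha> (nsL (-1)) + ns_scale \<beta> (nsL 0 - ns_scale (of_int n / 2) (nsJ 0))
     + ns_scale \<gamma> (nsL 1 - ns_scale (of_int n) (nsJ 1)) + ns_scale \<delta> (nsJ 0)
     + (\<Sum>j | int j \<le> 1 - n. ns_scale (a j) (nsGp (int j - 1))) + (\<Sum>j | int j \<le> 1 + n. ns_scale (b j) (nsGm (int j - 1)))"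

lemma span_sphere_gens: "ns.span (sphere_gens n) = {sphere_element n \<alpha> \<beta> \<gamma> \<delta> a b | \<alpha> \<beta> \<gamma> \<delta> a b. True}" (is "_ = ?H")
proof
  have add: "sphere_element n \<alpha> \<beta> \<gamma> \<delta> a b + sphere_element n \<alpha>' \<beta>' \<gamma>' \<delta>' a' b'
      = sphere_element n (\<alpha> + \<alpha>') (\<beta> + \<beta>') (\<gamma> + \<gamma>') (\<delta> + \<delta>') (\<lambda>j. a j + a' j) (\<lambda>j. b j + b' j)" for \<alpha> \<beta> \<gamma> \<delta> a b \<alpha>' \<beta>' \<gamma>' \<delta>' a' b'
    by (simp add: sphere_element_def ns.scale_left_distrib sum.distrib)
  have scale: "ns_scale c (sphere_element n \<alpha> \<beta> \<gamma> \<delta> a b)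
      = sphere_element n (c * \<alpha>) (c * \<beta>) (c * \<gamma>) (c * \<delta>) (\<lambda>j. c * a j) (\<lambda>j. c * b j)" for c \<alpha> \<beta> \<gamma> \<delta> a b
    by (simp add: sphere_element_def ns.scale_right_distrib ns.scale_right_diff_distrib ns.scale_sum_right mult.assoc)
  have zero: "sphere_element n 0 0 0 0 (\<lambda>_. 0) (\<lambda>_. 0) = 0" by (simp add: sphere_element_def)
  have sub: "ns.subspace ?H"
    unfolding ns.subspace_def using add scale zero by (auto; metis)
  have delta: "(\<Sum>j\<in>A. ns_scale (if j = i then 1 else 0) (f j)) = f i" if "finite A" "i \<in> A" for A and i :: nat and f
    using that by (subst sum.mono_neutral_right[of _ "{i}"]) auto
  have "x \<in> ?H" if "x \<in> sphere_gens n" for x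
  proof -
    consider "x = sphere_element n 1 0 0 0 (\<lambda>_. 0) (\<lambda>_. 0)" | "x = sphere_element n 0 1 0 0 (\<lambda>_. 0) (\<lambda>_. 0)"
      | "x = sphere_element n 0 0 1 0 (\<lambda>_. 0) (\<lambda>_. 0)" | "x = sphere_element n 0 0 0 1 (\<lambda>_. 0) (\<lambda>_. 0)"
      | m where "x = nsGp m" "-1 \<le> m" "m \<le> - n" | m where "x = nsGm m" "-1 \<le> m" "m \<le> n"
      using \<open>x \<in> sphere_gens n\<close> unfolding sphere_gens_def by (auto simp: sphere_element_def)
    then show ?thesis
    proof cases
      case 5
      then have "x = sphere_element n 0 0 0 0 (\<lambda>j. if j = nat (m + 1) then 1 else 0) (\<lambda>_. 0)"
        by (simp add: sphere_element_def delta[OF finite_degrees])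
      then show ?thesis by blast
    next
      case 6
      then have "x = sphere_element n 0 0 0 0 (\<lambda>_. 0) (\<lambda>j. if j = nat (m + 1) then 1 else 0)"
        by (simp add: sphere_element_def delta[OF finite_degrees])
      then show ?thesis by blast
    qed blast+
  qed
  then show "ns.span (sphere_gens n) \<subseteq> ?H" using sub by (intro ns.span_minimal) auto
  have "sphere_element n \<alpha> \<beta> \<gamma> \<delta> a b \<in> ns.span (sphere_gens n)" for \<alpha> \<beta> \<gamma> \<delta> a b
    unfolding sphere_element_def
    by (intro ns.span_add ns.span_sum ns.span_scale ns.span_base) (auto simp: sphere_gens_def)
  then show "?H \<subseteq> ns.span (sphere_gens n)" by blast
qed

lemma sder_scale_odd_sder: "sder_scale c (odd_sder u w) = odd_sder (pmonom c 0 * u) (pmonom c 0 * w)"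
  by (simp add: odd_sder_def sder_scale_def xmonom_def superfun_defs pderivative_mult pderivative_pmonom)

text \<open>The parameters of a combination of the generators are those of the corresponding derivation.\<close>

lemma ns_rep_sphere_element:
  "ns_rep (sphere_element n \<alpha> \<beta> \<gamma> \<delta> a b) = quadratic_sder n \<alpha> \<beta> \<gamma> \<delta> + odd_sder (ppoly (1 - n) a) (ppoly (1 + n) b)"
proof -
  have diff: "ns_rep (u - v) = ns_rep u + sder_scale (- 1) (ns_rep v)" for u v
  proof -
    have "u - v = u + ns_scale (- 1) v" by simp
    then show ?thesis by (simp only: ns_rep_linear)
  qed
  have mono: "pmonom c 0 * pmonom 1 k = pmonom c k" for c k
    by (rule papp_eqI) (simp add: pmonom.rep_eq)
  have p: "(\<Sum>j\<in>A. odd_sder (f j) 0) = odd_sder (\<Sum>j\<in>A. f j) 0" "(\<Sum>j\<in>A. odd_sder 0 (f j)) = odd_sder 0 (\<Sum>j\<in>A. f j)"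
    for A and f :: "nat \<Rightarrow> pfun"
    by (rule additive.sum[OF additive.intro, symmetric];
        simp add: odd_sder_def superfun_defs pderivative_add)+
  have o: "odd_sder u 0 + odd_sder 0 w = odd_sder u w" for u w
    by (simp add: odd_sder_def superfun_defs)
  have odd: "ns_rep ((\<Sum>j | int j \<le> 1 - n. ns_scale (a j) (nsGp (int j - 1))) + (\<Sum>j | int j \<le> 1 + n. ns_scale (b j) (nsGm (int j - 1))))
      = odd_sder (ppoly (1 - n) a) (ppoly (1 + n) b)"
    by (simp add: ns_rep_linear ns_rep_sum ns_rep_single ns_basis_rep_SF sder_scale_rules sder_scale_odd_sder mono p o
        flip: ppoly_def del: ns_basis_rep.simps(2-))
  have even: "ns_rep (ns_scale \<alpha> (nsL (-1)) + ns_scale \<beta> (nsL 0 - ns_scale (of_int n / 2) (nsJ 0))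
     + ns_scale \<gamma> (nsL 1 - ns_scale (of_int n) (nsJ 1)) + ns_scale \<delta> (nsJ 0)) = quadratic_sder n \<alpha> \<beta> \<gamma> \<delta>"
    unfolding ns_rep_linear diff ns_rep_single ns_basis_rep_SF quadratic_sder_def
    by (simp add: sder_scale_def xmonom_def superfun_defs; intro conjI; rule papp_eqI; case_tac "x = 0";
        simp add: pmonom.rep_eq one_pfun.rep_eq field_simps)
  show ?thesis
    unfolding even[symmetric] odd[symmetric] ns_rep_linear(1)[symmetric] by (simp add: sphere_element_def add.assoc)
qed

lemma lie_aut_eq: "lie_aut N n = ns_rep ` ns.span (sphere_gens n)"
proof -
  have "ns_rep ` ns.span (sphere_gens n) = {ns_rep (sphere_element n \<alpha> \<beta> \<gamma> \<delta> a b) | \<alpha> \<beta> \<gamma> \<delta> a b. True}"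
    unfolding span_sphere_gens by blast
  then show ?thesis
    unfolding ns_rep_sphere_element lie_aut_def lie_aut_even_eq lie_aut_odd_eq by blast
qed

lemma ppoly_eq_0D:
  assumes "ppoly k c = 0" "int j \<le> k"
  shows "c j = 0"
proof (rule ccontr)
  assume "c j \<noteq> 0"
  have k: "{j. int j \<le> k} = {..nat k}" using assms(2) by auto
  have "(\<Sum>i\<le>nat k. c i * x ^ i) = 0" if "x \<noteq> 0" for x
    using papp_ppoly[OF that, of k c] assms(1) by (simp add: k)
  then have "- {0} \<subseteq> {z. (\<Sum>i\<le>nat k. c i * z ^ i) = 0}" by auto
  moreover have "finite {z. (\<Sum>i\<le>nat k. c i * z ^ i) = 0}"
    using \<open>c j \<noteq> 0\<close> assms(2) by (intro polyfun_roots_finite[of c j]) auto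
  moreover have "infinite (- {0 :: complex})"
    using infinite_UNIV_char_0[where 'a = complex] by (metis Compl_eq_Diff_UNIV finite_Diff2 finite.emptyI finite.insertI)
  ultimately show False using finite_subset by blast
qed

text \<open>Only the kernel matters; on the kernel three values of the quadratic polynomial, one of the
  coefficient of \<open>\<partial>/\<partial>\<phi>\<^sup>+\<close> and infinitely many of the odd coefficients vanish.\<close>

lemma ns_rep_inj: "inj_on ns_rep (ns.span (sphere_gens n))"
proof (rule inj_onI)
  fix u v assume uv: "u \<in> ns.span (sphere_gens n)" "v \<in> ns.span (sphere_gens n)" "ns_rep u = ns_rep v"
  have "u - v \<in> ns.span (sphere_gens n)" using uv by (intro ns.span_diff)
  then obtain \<alpha> \<beta> \<gamma> \<delta> a b where e: "u - v = sphere_element n \<alpha> \<beta> \<gamma> \<delta> a b" unfolding span_sphere_gens by blast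
  have "ns_rep (u - v) = 0"
    using ns_rep_linear(1)[of "u - v" v] uv(3) by simp
  then have z: "quadratic_sder n \<alpha> \<beta> \<gamma> \<delta> + odd_sder (ppoly (1 - n) a) (ppoly (1 + n) b) = 0"
    unfolding e ns_rep_sphere_element .
  have "u = 0 \<and> w = 0 \<and> A = 0 \<and> B = 0"
    if "(SF (- A) 0 0 0, SF 0 (- B) 0 0, SF 0 0 C 0) + odd_sder u w = 0" for A B C u w
    using that by (simp add: odd_sder_def zero_prod_def superfun_defs)
  from this[OF z[unfolded quadratic_sder_def]]
  have *: "ppoly (1 - n) a = 0" "ppoly (1 + n) b = 0"
    "pmonom \<alpha> 0 + pmonom \<beta> 1 + pmonom \<gamma> 2 = 0"
    "pmonom (\<delta> + (1 - of_int n) * (\<beta> / 2)) 0 + pmonom ((1 - of_int n) * \<gamma>) 1 = 0"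
    by blast+
  have ab: "int j \<le> 1 - n \<Longrightarrow> a j = 0" "int j \<le> 1 + n \<Longrightarrow> b j = 0" for j
    using ppoly_eq_0D *(1,2) by blast+
  have q: "\<alpha> + \<beta> * x + \<gamma> * x ^ 2 = 0" "\<delta> + (1 - of_int n) * (\<beta> / 2) + (1 - of_int n) * \<gamma> * x = 0" if "x \<noteq> 0" for x
    using arg_cong[OF *(3), of "\<lambda>f. papp f x"] arg_cong[OF *(4), of "\<lambda>f. papp f x"] that
    by (simp_all add: pmonom.rep_eq)
  have "\<alpha> + \<beta> + \<gamma> = 0" "\<alpha> - \<beta> + \<gamma> = 0" "\<alpha> + \<beta> * 2 + \<gamma> * 4 = 0"
    using q(1)[of 1] q(1)[of "- 1"] q(1)[of 2] by simp_all
  then have abc: "\<alpha> = 0" "\<beta> = 0" "\<gamma> = 0" by algebra+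
  then have "\<delta> = 0" using q(2)[of 1] by simp
  then have "u - v = 0" using ab abc unfolding e sphere_element_def by simp
  then show "u = v" by simp
qed

lemma ns_bracket_superset:
  assumes "finite A" "Poly_Mapping.keys u \<subseteq> A" "finite B" "Poly_Mapping.keys v \<subseteq> B"
  shows "ns_bracket u v = (\<Sum>a\<in>A. \<Sum>b\<in>B. ns_scale (Poly_Mapping.lookup u a * Poly_Mapping.lookup v b) (ns_basis_bracket a b))"
proof -
  have "ns_bracket u v = (\<Sum>a\<in>Poly_Mapping.keys u. \<Sum>b\<in>B. ns_scale (Poly_Mapping.lookup u a * Poly_Mapping.lookup v b) (ns_basis_bracket a b))"
    unfolding ns_bracket_def
    by (intro sum.cong refl sum.mono_neutral_left) (use assms in \<open>auto simp: in_keys_iff\<close>)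
  also have "\<dots> = (\<Sum>a\<in>A. \<Sum>b\<in>B. ns_scale (Poly_Mapping.lookup u a * Poly_Mapping.lookup v b) (ns_basis_bracket a b))"
    by (rule sum.mono_neutral_left) (use assms in \<open>auto simp: in_keys_iff\<close>)
  finally show ?thesis .
qed

lemma ns_bracket_bilinear:
  "ns_bracket (u + u') v = ns_bracket u v + ns_bracket u' v" "ns_bracket v (u + u') = ns_bracket v u + ns_bracket v u'"
  "ns_bracket (ns_scale c u) v = ns_scale c (ns_bracket u v)" "ns_bracket v (ns_scale c u) = ns_scale c (ns_bracket v u)"
proof -
  let ?A = "Poly_Mapping.keys u \<union> Poly_Mapping.keys u'" and ?B = "Poly_Mapping.keys v"
  have A: "finite ?A" "Poly_Mapping.keys (u + u') \<subseteq> ?A" "Poly_Mapping.keys u \<subseteq> ?A" "Poly_Mapping.keys u' \<subseteq> ?A"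
    "Poly_Mapping.keys (ns_scale c u) \<subseteq> ?A" "finite ?B" "?B \<subseteq> ?B"
    by (auto simp: in_keys_iff lookup_add)
  note l = ns_bracket_superset[OF A(1) _ A(6,7)] and r = ns_bracket_superset[OF A(6,7) A(1)]
  show "ns_bracket (u + u') v = ns_bracket u v + ns_bracket u' v" "ns_bracket v (u + u') = ns_bracket v u + ns_bracket v u'"
    by (simp_all add: l[OF A(2)] l[OF A(3)] l[OF A(4)] r[OF A(2)] r[OF A(3)] r[OF A(4)] lookup_add
        distrib_left distrib_right ns.scale_left_distrib sum.distrib)
  show "ns_bracket (ns_scale c u) v = ns_scale c (ns_bracket u v)" "ns_bracket v (ns_scale c u) = ns_scale c (ns_bracket v u)"
    by (simp_all add: l[OF A(3)] l[OF A(5)] r[OF A(3)] r[OF A(5)] ns.scale_sum_right mult_ac)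
qed

lemma ns_bracket_single: "ns_bracket (Poly_Mapping.single a 1) (Poly_Mapping.single b 1) = ns_basis_bracket a b"
  by (simp add: ns_bracket_def)

lemma ns_bracket_diff:
  "ns_bracket (u - u') v = ns_bracket u v - ns_bracket u' v" "ns_bracket v (u - u') = ns_bracket v u - ns_bracket v u'"
  using ns_bracket_bilinear(1)[of "u - u'" u' v] ns_bracket_bilinear(2)[of v "u - u'" u'] by (simp_all add: eq_diff_eq)

text \<open>The exponents stop at the right place because the bracket with \<open>L\<^sub>1 - n J\<^sub>1\<close> annihilates the
  last of the odd generators.\<close>

lemma sphere_gens_bracket:
  assumes "x \<in> sphere_gens n" "y \<in> sphere_gens n"
  shows "ns_bracket x y \<in> ns.span (sphere_gens n)"
proof -
  let ?S = "ns.span (sphere_gens n)"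
  let ?L = "nsL (-1)" and ?E = "nsL 0 - ns_scale (of_int n / 2) (nsJ 0)" and ?F = "nsL 1 - ns_scale (of_int n) (nsJ 1)" and ?J = "nsJ 0"
  have S: "?L \<in> ?S" "?E \<in> ?S" "?F \<in> ?S" "?J \<in> ?S"
    by (rule ns.span_base, simp add: sphere_gens_def)+
  have P: "ns_scale c (nsGp m) \<in> ?S" if "c = 0 \<or> -1 \<le> m \<and> m \<le> - n" for c m
  proof (cases "c = 0")
    case False
    then show ?thesis using that by (intro ns.span_scale ns.span_base) (simp add: sphere_gens_def)
  qed (simp add: ns.span_zero)
  have M: "ns_scale c (nsGm m) \<in> ?S" if "c = 0 \<or> -1 \<le> m \<and> m \<le> n" for c m
  proof (cases "c = 0")
    case False
    then show ?thesis using that by (intro ns.span_scale ns.span_base) (simp add: sphere_gens_def)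
  qed (simp add: ns.span_zero)
  note br = ns_bracket_diff ns_bracket_bilinear ns_bracket_single
  note eq = poly_mapping_eqI
  have ee: "ns_bracket ?L ?L = 0" "ns_bracket ?L ?E = ns_scale (-1) ?L" "ns_bracket ?L ?F = ns_scale (-2) ?E" "ns_bracket ?L ?J = 0"
    "ns_bracket ?E ?L = ns_scale 1 ?L" "ns_bracket ?E ?E = 0" "ns_bracket ?E ?F = ns_scale (-1) ?F" "ns_bracket ?E ?J = 0"
    "ns_bracket ?F ?L = ns_scale 2 ?E" "ns_bracket ?F ?E = ns_scale 1 ?F" "ns_bracket ?F ?F = 0" "ns_bracket ?F ?J = 0"
    "ns_bracket ?J ?L = 0" "ns_bracket ?J ?E = 0" "ns_bracket ?J ?F = 0" "ns_bracket ?J ?J = 0"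
    by (rule eq; simp add: br lookup_add lookup_minus algebra_simps)+
  have ep: "ns_bracket ?L (nsGp m) = ns_scale (- of_int m - 1) (nsGp (m - 1))" "ns_bracket ?E (nsGp m) = ns_scale (- of_int m - 1 / 2 - of_int n / 2) (nsGp m)"
    "ns_bracket ?F (nsGp m) = ns_scale (- of_int m - of_int n) (nsGp (m + 1))" "ns_bracket ?J (nsGp m) = ns_scale 1 (nsGp m)" for m
    by (rule eq; simp add: br lookup_add lookup_minus algebra_simps)+
  have em: "ns_bracket ?L (nsGm m) = ns_scale (- of_int m - 1) (nsGm (m - 1))" "ns_bracket ?E (nsGm m) = ns_scale (- of_int m - 1 / 2 + of_int n / 2) (nsGm m)"
    "ns_bracket ?F (nsGm m) = ns_scale (- of_int m + of_int n) (nsGm (m + 1))" "ns_bracket ?J (nsGm m) = ns_scale (- 1) (nsGm m)" for m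
    by (rule eq; simp add: br lookup_add lookup_minus algebra_simps)+
  have pe: "ns_bracket (nsGp m) ?L = ns_scale (of_int m + 1) (nsGp (m - 1))" "ns_bracket (nsGp m) ?E = ns_scale (of_int m + 1 / 2 + of_int n / 2) (nsGp m)"
    "ns_bracket (nsGp m) ?F = ns_scale (of_int m + of_int n) (nsGp (m + 1))" "ns_bracket (nsGp m) ?J = ns_scale (- 1) (nsGp m)" for m
    by (rule eq; simp add: br lookup_add lookup_minus algebra_simps)+
  have me: "ns_bracket (nsGm m) ?L = ns_scale (of_int m + 1) (nsGm (m - 1))" "ns_bracket (nsGm m) ?E = ns_scale (of_int m + 1 / 2 - of_int n / 2) (nsGm m)"
    "ns_bracket (nsGm m) ?F = ns_scale (of_int m - of_int n) (nsGm (m + 1))" "ns_bracket (nsGm m) ?J = ns_scale 1 (nsGm m)" for m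
    by (rule eq; simp add: br lookup_add lookup_minus algebra_simps)+
  have oo: "ns_bracket (nsGp m) (nsGm k) \<in> ?S \<and> ns_bracket (nsGm k) (nsGp m) \<in> ?S"
    if mk: "-1 \<le> m" "m \<le> - n" "-1 \<le> k" "k \<le> n" for m k
  proof -
    have sym: "ns_bracket (nsGm k) (nsGp m) = ns_bracket (nsGp m) (nsGm k)" by (simp add: br)
    \<comment> \<open>The bounds give \<open>m + k \<le> 0\<close>, so besides the two lowest levels only the top pair occurs; it
      exists for \<open>\<bar>n\<bar> \<le> 1\<close>.\<close>
    have "m = -1 \<and> k = -1 \<or> m = -1 \<and> k = 0 \<or> m = 0 \<and> k = -1 \<or> m = - n \<and> k = n" using mk by presburger
    then consider "m = -1" "k = -1" | "m = -1" "k = 0" | "m = 0" "k = -1" | "m = - n" "k = n" by blast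
    then have "\<exists>c d. ns_bracket (nsGp m) (nsGm k) = ns_scale 2 ?L \<or> ns_bracket (nsGp m) (nsGm k) = ns_scale c ?E + ns_scale d ?J
        \<or> ns_bracket (nsGp m) (nsGm k) = ns_scale 2 ?F"
    proof cases
      case 1
      then have "ns_bracket (nsGp m) (nsGm k) = ns_scale 2 ?L" by (simp add: br)
      then show ?thesis by blast
    next
      case 2
      then have "ns_bracket (nsGp m) (nsGm k) = ns_scale 2 ?E + ns_scale (of_int n - 1) ?J"
        by (intro eq) (simp add: br lookup_add lookup_minus algebra_simps)
      then show ?thesis by blast
    next
      case 3
      then have "ns_bracket (nsGp m) (nsGm k) = ns_scale 2 ?E + ns_scale (of_int n + 1) ?J"
        by (intro eq) (simp add: br lookup_add lookup_minus algebra_simps)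
      then show ?thesis by blast
    next
      case 4
      then have "ns_bracket (nsGp m) (nsGm k) = ns_scale 2 ?F"
        by (intro eq) (simp add: br lookup_add lookup_minus algebra_simps)
      then show ?thesis by blast
    qed
    moreover have "ns_scale 2 ?L \<in> ?S" "ns_scale c ?E + ns_scale d ?J \<in> ?S" "ns_scale 2 ?F \<in> ?S" for c d
      by (intro ns.span_add ns.span_scale S)+
    ultimately have "ns_bracket (nsGp m) (nsGm k) \<in> ?S" by (elim exE disjE) (simp_all only:)
    then show ?thesis unfolding sym by simp
  qed
  have pp: "ns_bracket (nsGp m) (nsGp k) = 0" "ns_bracket (nsGm m) (nsGm k) = 0" for m k by (simp_all add: br)
  note rules = ns.span_zero ns.span_scale S P M
  have gens: "x \<in> {?L, ?E, ?F, ?J} \<or> (\<exists>m. x = nsGp m \<and> -1 \<le> m \<and> m \<le> - n) \<or> (\<exists>m. x = nsGm m \<and> -1 \<le> m \<and> m \<le> n)"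
    if "x \<in> sphere_gens n" for x using that by (auto simp: sphere_gens_def)
  have G: "\<forall>x\<in>{?L, ?E, ?F, ?J}. ns_bracket x (nsGp m) \<in> ?S \<and> ns_bracket (nsGp m) x \<in> ?S" if m: "-1 \<le> m" "m \<le> - n" for m
    by (intro ballI, elim insertE emptyE; hypsubst; unfold ep pe; intro conjI P) (insert m, (cases "m = -1"; cases "m = - n"; force)+)
  have H: "\<forall>x\<in>{?L, ?E, ?F, ?J}. ns_bracket x (nsGm m) \<in> ?S \<and> ns_bracket (nsGm m) x \<in> ?S" if m: "-1 \<le> m" "m \<le> n" for m
    by (intro ballI, elim insertE emptyE; hypsubst; unfold em me; intro conjI M) (insert m, (cases "m = -1"; cases "m = n"; force)+)
  have EE: "\<forall>x\<in>{?L, ?E, ?F, ?J}. \<forall>y\<in>{?L, ?E, ?F, ?J}. ns_bracket x y \<in> ?S"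
    by (intro ballI, elim insertE emptyE; hypsubst; unfold ee; intro ns.span_zero ns.span_scale S)
  consider "x \<in> {?L, ?E, ?F, ?J}" | m where "x = nsGp m" "-1 \<le> m" "m \<le> - n" | m where "x = nsGm m" "-1 \<le> m" "m \<le> n"
    using gens[OF assms(1)] by blast
  moreover consider "y \<in> {?L, ?E, ?F, ?J}" | m where "y = nsGp m" "-1 \<le> m" "m \<le> - n" | m where "y = nsGm m" "-1 \<le> m" "m \<le> n"
    using gens[OF assms(2)] by blast
  ultimately show ?thesis
    using EE G H oo by cases (cases; metis pp ns.span_zero)+
qed

lemma ns_subalgebra_sphere: "ns_subalgebra (ns.span (sphere_gens n))"
  unfolding ns_subalgebra_def
proof (intro conjI ballI)
  let ?S = "ns.span (sphere_gens n)"
  show "ns.subspace ?S" by (rule ns.subspace_span)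
  have lin: "ns_even (u + v) = ns_even u + ns_even v" "ns_even (ns_scale c u) = ns_scale c (ns_even u)" "ns_even 0 = 0"
    "ns_odd (u + v) = ns_odd u + ns_odd v" "ns_odd (ns_scale c u) = ns_scale c (ns_odd u)" "ns_odd 0 = 0" for u v c
    by (rule poly_mapping_eqI, simp add: lookup_ns_parity lookup_add)+
  have gens: "ns_even u = u \<and> ns_odd u = 0 \<or> ns_even u = 0 \<and> ns_odd u = u" if "u \<in> sphere_gens n" for u
    using that unfolding sphere_gens_def
    by (auto intro!: poly_mapping_eqI simp: lookup_ns_parity lookup_add lookup_minus lookup_single when_def split: if_splits)
  fix u assume u: "u \<in> ?S"
  show "ns_even u \<in> ?S"
    using u
  proof (rule ns.span_induct)
    show "ns.subspace {u. ns_even u \<in> ?S}"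
      by (auto simp: ns.subspace_def lin ns.span_zero ns.span_add ns.span_scale)
    show "ns_even x \<in> ?S" if "x \<in> sphere_gens n" for x
      using gens[OF that] that by (auto simp: ns.span_zero ns.span_base)
  qed
  show "ns_odd u \<in> ?S"
    using u
  proof (rule ns.span_induct)
    show "ns.subspace {u. ns_odd u \<in> ?S}"
      by (auto simp: ns.subspace_def lin ns.span_zero ns.span_add ns.span_scale)
    show "ns_odd x \<in> ?S" if "x \<in> sphere_gens n" for x
      using gens[OF that] that by (auto simp: ns.span_zero ns.span_base)
  qed
next
  let ?S = "ns.span (sphere_gens n)"
  fix u v assume u: "u \<in> ?S" and v: "v \<in> ?S"
  have z: "ns_bracket 0 w = 0" "ns_bracket w 0 = 0" for w by (simp_all add: ns_bracket_def)
  have "ns_bracket x v \<in> ?S" if "x \<in> sphere_gens n" for x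
    using v
  proof (rule ns.span_induct)
    show "ns.subspace {v. ns_bracket x v \<in> ?S}"
      by (auto simp: ns.subspace_def z ns_bracket_bilinear ns.span_zero ns.span_add ns.span_scale)
  qed (rule sphere_gens_bracket[OF that])
  then have g: "ns_bracket x v \<in> ?S" if "x \<in> sphere_gens n" for x using that .
  show "ns_bracket u v \<in> ?S"
    using u
  proof (rule ns.span_induct)
    show "ns.subspace {u. ns_bracket u v \<in> ?S}"
      by (auto simp: ns.subspace_def z ns_bracket_bilinear ns.span_zero ns.span_add ns.span_scale)
  qed (rule g)
qed

theorem theorem5p1:
  fixes N :: enat and n :: int
  assumes "2 \<le> N"
  shows "\<exists>h. ns_subalgebra h \<and> ns_identified h (lie_aut N n) \<and>
    (n = 0 \<longrightarrow> h = ns.span {nsL (-1), nsL 0, nsL 1, nsJ 0,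
        nsGp (-1), nsGp 0, nsGm (-1), nsGm 0}) \<and>
    (n = 1 \<longrightarrow> h = ns.span {nsL (-1), nsL 0 - ns_scale (1/2) (nsJ 0), nsL 1 - nsJ 1, nsJ 0,
        nsGp (-1), nsGm (-1), nsGm 0, nsGm 1}) \<and>
    (n = -1 \<longrightarrow> h = ns.span {nsL (-1), nsL 0 + ns_scale (1/2) (nsJ 0), nsL 1 + nsJ 1, nsJ 0,
        nsGp (-1), nsGp 0, nsGp 1, nsGm (-1)}) \<and>
    (n \<ge> 2 \<longrightarrow> h = ns.span ({nsL (-1), nsL 0 - ns_scale (of_int n / 2) (nsJ 0),
        nsL 1 - ns_scale (of_int n) (nsJ 1), nsJ 0} \<union> nsGm ` {-1..n})) \<and>
    (n \<le> -2 \<longrightarrow> h = ns.span ({nsL (-1), nsL 0 - ns_scale (of_int n / 2) (nsJ 0),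
        nsL 1 - ns_scale (of_int n) (nsJ 1), nsJ 0} \<union> nsGp ` {-1..-n}))"
proof (intro exI[of _ "ns.span (sphere_gens n)"] conjI impI)
  show "ns_subalgebra (ns.span (sphere_gens n))" by (rule ns_subalgebra_sphere)
  show "ns_identified (ns.span (sphere_gens n)) (lie_aut N n)"
    by (simp add: ns_identified_def ns_rep_inj lie_aut_eq ns_rep_parity ns_rep_bracket)
  have ivl: "{-1..0::int} = {-1, 0}" "{-1..1::int} = {-1, 0, 1}" "{-1..-1::int} = {-1}" by auto
  show "ns.span (sphere_gens n) = ns.span {nsL (-1), nsL 0, nsL 1, nsJ 0, nsGp (-1), nsGp 0, nsGm (-1), nsGm 0}" if "n = 0"
    by (rule arg_cong[of _ _ ns.span]) (auto simp: sphere_gens_def that ivl)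
  show "ns.span (sphere_gens n) = ns.span {nsL (-1), nsL 0 - ns_scale (1/2) (nsJ 0), nsL 1 - nsJ 1, nsJ 0,
      nsGp (-1), nsGm (-1), nsGm 0, nsGm 1}" if "n = 1"
    by (rule arg_cong[of _ _ ns.span]) (auto simp: sphere_gens_def that ivl)
  show "ns.span (sphere_gens n) = ns.span {nsL (-1), nsL 0 + ns_scale (1/2) (nsJ 0), nsL 1 + nsJ 1, nsJ 0,
      nsGp (-1), nsGp 0, nsGp 1, nsGm (-1)}" if "n = -1"
  proof -
    have "nsL 0 - ns_scale (- 1 / 2) (nsJ 0) = nsL 0 + ns_scale (1 / 2) (nsJ 0)" "nsL 1 - ns_scale (- 1) (nsJ 1) = nsL 1 + nsJ 1"
      by (simp_all add: ns.scale_minus_left)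
    then show ?thesis
      by (intro arg_cong[of _ _ ns.span]) (auto simp: sphere_gens_def that ivl)
  qed
  show "ns.span (sphere_gens n) = ns.span ({nsL (-1), nsL 0 - ns_scale (of_int n / 2) (nsJ 0),
      nsL 1 - ns_scale (of_int n) (nsJ 1), nsJ 0} \<union> nsGm ` {-1..n})" if "n \<ge> 2"
    using that by (simp add: sphere_gens_def)
  show "ns.span (sphere_gens n) = ns.span ({nsL (-1), nsL 0 - ns_scale (of_int n / 2) (nsJ 0),
      nsL 1 - ns_scale (of_int n) (nsJ 1), nsJ 0} \<union> nsGp ` {-1..-n})" if "n \<le> -2"
    using that by (simp add: sphere_gens_def)
qed

end
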